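(* Let $d,T\ge 1$ be integers and $1\le p<\infty$. Let $\xi\in\mathcal P_p((\mathbb R^d)^T)$ be a noise distribution satisfying: (i) $\xi$ has a continuously differentiable density $f:(\mathbb R^d)^T\to\mathbb R$ with $\nabla f\in L^1$; (ii) the set of real zeros of $\widehat f$ has Lebesgue measure zero. Let $\sigma>0$. Then $\mathcal{AW}^{(\sigma)}_p$ is a metric on $\mathcal P_p((\mathbb R^d)^T)$ that induces the same topology as $\mathcal W_p$.
   Context: $|\cdot|$ is the Euclidean norm. $\mathcal P_p(\mathbb R^N)$ is the set of Borel probability measures on $\mathbb R^N$ with finite $p$-th moment. $\mathcal W_p(\mu,\nu)=(\inf_{\pi\in\mathrm{Cpl}(\mu,\nu)}\int|x-y|^p\,d\pi)^{1/p}$, with $\mathrm{Cpl}(\mu,\nu)$ the set of couplings. For $x\in(\mathbb R^d)^T$, $x_{1:t}=(x_1,\dots,x_t)$. A coupling $\pi$ of $\mu,\nu\in\mathcal P((\mathbb R^d)^T)$ is bicausal if for $(X,Y)\sim\pi$ and every $t\in\{1,\dots,T-1\}$: $Y_{1:t}$ and $(X_{t+1},\dots,X_T)$ are conditionally independent given $X_{1:t}$, and $X_{1:t}$ and $(Y_{t+1},\dots,Y_T)$ are conditionally independent given $Y_{1:t}$; $\mathrm{Cpl}_{bc}(\mu,\nu)$ is the set of bicausal couplings. $\mathcal{AW}_p(\mu,\nu)=\left(\inf_{\pi\in\mathrm{Cpl}_{bc}(\mu,\nu)}\int\sum_{t=1}^T|x_t-y_t|^p\,\pi(dx,dy)\right)^{1/p}$.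 $\xi_\sigma$ is the law of $\sigma Z$ with $Z\sim\xi$; $\mathcal{AW}^{(\sigma)}_p(\mu,\nu):=\mathcal{AW}_p(\mu\ast\xi_\sigma,\nu\ast\xi_\sigma)$. $\widehat f(s)=\int e^{-2\pi i s\cdot x}f(x)\,dx$. *)

theory Defs
  imports "HOL-Probability.Probability"
begin

text \<open>
  The path space \<open>(R^d)^T\<close> is rendered as the type \<open>real ^ 'd ^ 't\<close>, where the index type \<open>'t\<close> of
  times is an arbitrary (nonempty) finite linear order with \<open>T = CARD('t)\<close> elements and
  \<open>d = CARD('d)\<close>. A finite linear order with \<open>T\<close> elements is uniquely order isomorphic to
  \<open>{1..T}\<close>. The norm of this type is the Euclidean norm of \<open>R^(d*T)\<close>.
\<close>

subsection \<open>Conditional independence\<close>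

text \<open>
  \<open>cond_indep M U S V S' W S''\<close>: under \<open>M\<close>, the \<open>S\<close>-valued variable \<open>U\<close> and the \<open>S'\<close>-valued
  variable \<open>V\<close> are conditionally independent given the \<open>S''\<close>-valued variable \<open>W\<close>. It is meant for
  probability measures \<open>M\<close> and measurable \<open>U\<close>, \<open>V\<close>, \<open>W\<close>.
\<close>

definition cond_indep ::
  "'a measure \<Rightarrow> ('a \<Rightarrow> 'b) \<Rightarrow> 'b measure \<Rightarrow> ('a \<Rightarrow> 'c) \<Rightarrow> 'c measure
     \<Rightarrow> ('a \<Rightarrow> 'e) \<Rightarrow> 'e measure \<Rightarrow> bool" where
  "cond_indep M U S V S' W S'' \<longleftrightarrow>
     (let G = vimage_algebra (space M) W S'' in
      \<forall>A\<in>sets S. \<forall>B\<in>sets S'. AE \<omega> in M.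
        real_cond_exp M G (indicator (U -` A \<inter> V -` B)) \<omega> =
        real_cond_exp M G (indicator (U -` A)) \<omega> * real_cond_exp M G (indicator (V -` B)) \<omega>)"

subsection \<open>Couplings and Wasserstein distances\<close>

definition prob_finite_moment :: "real \<Rightarrow> 'a::euclidean_space measure set" where
  "prob_finite_moment p =
     {\<mu>. prob_space \<mu> \<and> sets \<mu> = sets borel \<and> integrable \<mu> (\<lambda>x. norm x powr p)}"

definition couplings ::
  "'a::euclidean_space measure \<Rightarrow> 'a measure \<Rightarrow> ('a \<times> 'a) measure set" where
  "couplings \<mu> \<nu> =
     {\<pi>. prob_space \<pi> \<and> sets \<pi> = sets (borel \<Otimes>\<^sub>M borel) \<and>
         distr \<pi> borel fst = \<mu> \<and> distr \<pi> borel snd = \<nu>}"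

text \<open>
  Transport costs are nonnegative Lebesgue integrals, so that a non-integrable cost is infinite
  and not \<open>0\<close>. For arguments in \<open>prob_finite_moment p\<close> the infima below are finite, and
  \<open>enn2real\<close> only changes the type.
\<close>

definition wasserstein ::
  "real \<Rightarrow> 'a::euclidean_space measure \<Rightarrow> 'a measure \<Rightarrow> real" where
  "wasserstein p \<mu> \<nu> =
     enn2real (INF \<pi>\<in>couplings \<mu> \<nu>. \<integral>\<^sup>+(x, y). ennreal (norm (x - y) powr p) \<partial>\<pi>) powr (1 / p)"

definition path_upto ::
  "'t::{finite,linorder} \<Rightarrow> real ^ 'd ^ 't::{finite,linorder}
     \<Rightarrow> 't::{finite,linorder} \<Rightarrow> real ^ 'd" where
  "path_upto t x = (\<lambda>s\<in>{..t}. x $ s)"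

definition path_after ::
  "'t::{finite,linorder} \<Rightarrow> real ^ 'd ^ 't::{finite,linorder}
     \<Rightarrow> 't::{finite,linorder} \<Rightarrow> real ^ 'd" where
  "path_after t x = (\<lambda>s\<in>{t<..}. x $ s)"

text \<open>The range \<open>t < Max UNIV\<close> corresponds to \<open>t \<in> {1..T-1}\<close>.\<close>

definition bicausal ::
  "((real ^ 'd ^ 't::{finite,linorder}) \<times> (real ^ 'd ^ 't::{finite,linorder})) measure \<Rightarrow> bool" where
  "bicausal \<pi> \<longleftrightarrow>
     (\<forall>t < Max UNIV.
        cond_indep \<pi>
          (\<lambda>(x, y). path_upto t y) (Pi\<^sub>M {..t} (\<lambda>_. borel))
          (\<lambda>(x, y). path_after t x) (Pi\<^sub>M {t<..} (\<lambda>_. borel))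
          (\<lambda>(x, y). path_upto t x) (Pi\<^sub>M {..t} (\<lambda>_. borel)) \<and>
        cond_indep \<pi>
          (\<lambda>(x, y). path_upto t x) (Pi\<^sub>M {..t} (\<lambda>_. borel))
          (\<lambda>(x, y). path_after t y) (Pi\<^sub>M {t<..} (\<lambda>_. borel))
          (\<lambda>(x, y). path_upto t y) (Pi\<^sub>M {..t} (\<lambda>_. borel)))"

definition bicausal_couplings ::
  "(real ^ 'd ^ 't::{finite,linorder}) measure \<Rightarrow> (real ^ 'd ^ 't::{finite,linorder}) measure
     \<Rightarrow> ((real ^ 'd ^ 't::{finite,linorder}) \<times> (real ^ 'd ^ 't::{finite,linorder})) measure set" where
  "bicausal_couplings \<mu> \<nu> = {\<pi> \<in> couplings \<mu> \<nu>. bicausal \<pi>}"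

definition adapted_wasserstein ::
  "real \<Rightarrow> (real ^ 'd ^ 't::{finite,linorder}) measure
     \<Rightarrow> (real ^ 'd ^ 't::{finite,linorder}) measure \<Rightarrow> real" where
  "adapted_wasserstein p \<mu> \<nu> =
     enn2real (INF \<pi>\<in>bicausal_couplings \<mu> \<nu>.
       \<integral>\<^sup>+(x, y). ennreal (\<Sum>t\<in>UNIV. norm (x $ t - y $ t) powr p) \<partial>\<pi>) powr (1 / p)"

subsection \<open>Smoothing\<close>

definition scaled_noise :: "real \<Rightarrow> 'a::euclidean_space measure \<Rightarrow> 'a measure" where
  "scaled_noise \<sigma> \<xi> = distr \<xi> borel (\<lambda>z. \<sigma> *\<^sub>R z)"

definition smoothed_adapted_wasserstein ::
  "(real ^ 'd ^ 't::{finite,linorder}) measure \<Rightarrow> real \<Rightarrow> real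
     \<Rightarrow> (real ^ 'd ^ 't::{finite,linorder}) measure \<Rightarrow> (real ^ 'd ^ 't::{finite,linorder}) measure \<Rightarrow> real" where
  "smoothed_adapted_wasserstein \<xi> \<sigma> p \<mu> \<nu> =
     adapted_wasserstein p (\<mu> \<star> scaled_noise \<sigma> \<xi>) (\<nu> \<star> scaled_noise \<sigma> \<xi>)"

definition fourier_transform :: "('a::euclidean_space \<Rightarrow> real) \<Rightarrow> 'a \<Rightarrow> complex" where
  "fourier_transform f s =
     (LINT x|lborel. exp (- 2 * of_real pi * \<i> * of_real (s \<bullet> x)) * of_real (f x))"

end

theory Submission
  imports Defs
begin

text \<open>
  A coupling of \<open>\<mu>\<close> and \<open>\<nu>\<close> is bicausal iff conditioning on either path maps the past of the other
  path, up to time \<open>t\<close>, to a function of the past up to time \<open>t\<close>. In this operator form bicausality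
  is stable under gluing along a common marginal, which gives the triangle inequality.

  If \<open>\<mu>\<close> and \<open>\<nu>\<close> are \<open>\<delta>\<close>-close in total variation, put \<open>\<rho> = (\<mu> + \<nu>) / 2\<close> and let \<open>\<phi>\<^sub>i\<close> be the density of
  \<open>\<mu>\<close> with respect to \<open>\<rho>\<close> on the past up to time \<open>i\<close>. The measures \<open>\<phi>\<^sub>i \<rho>\<close> lead from \<open>\<rho>\<close> to \<open>\<mu>\<close> by changing
  one conditional law at a time, and consecutive ones have an explicit bicausal coupling that is off
  the diagonal with probability at most \<open>2 \<delta>\<close>. Gluing yields a bicausal coupling of \<open>\<mu>\<close> and \<open>\<nu>\<close> that is
  off the diagonal with probability at most \<open>4 T \<delta>\<close>. Hence total variation convergence together with
  uniformly small \<open>p\<close>-th moment tails implies convergence in \<open>AW\<^sub>p\<close>.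

  Since \<open>\<nabla>f\<close> is integrable, translations of the noise are Lipschitz in total variation, so
  \<open>W\<^sub>p\<close>-convergence of measures gives total variation, hence \<open>AW\<^sub>p\<close>, convergence of their smoothings.
  Conversely, convergence of the smoothed measures gives convergence of the characteristic functions of
  the unsmoothed ones wherever that of the noise is nonzero, i.e. almost everywhere. By Fourier inversion and
  Scheffe's lemma the measures converge in total variation after convolution with any small Gaussian,
  hence in \<open>W\<^sub>p\<close>, and the Gaussian costs little in \<open>W\<^sub>p\<close>. The constant sequence yields definiteness.
\<close>

text \<open>The obstacle is that \<open>W_p\<close>-closeness says nothing about conditional laws:
  nearby paths may reveal the future at different times, and a good coupling is then far from
  bicausal. Total variation closeness does control conditional laws on average, and this is what the
  smoothing provides. The average \<rho> enters because neither measure need dominate the other,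
  while \<rho> dominates both. A step of the chain can respect the whole filtration because every
  history is either contained in the one at which the step starts or contains the next one. Its cost
  comes from passing through the constant density 1: the drop from one density to the next splits
  into two parts of mass at most \<delta>, and two chains of T steps meet at \<rho>. Total variation
  does not see large values, so the p-th moment tails are carried along separately. The Gaussian is
  there because characteristic functions are known to converge only almost everywhere. Integrated
  against a Gaussian weight they yield smoothed densities at every point, and the null set of zeros
  of the noise has no influence.\<close>

section \<open>Regular conditional distributions\<close>

text \<open>Testing on the set where \<open>g\<close> is smaller than \<open>f\<close> shows that
  this set is null. Finiteness of the integral of \<open>g\<close> makes the subtraction in
  \<open>ennreal\<close> legitimate.\<close>

lemma AE_le_if_nn_integral_le:
  fixes f g :: "'a \<Rightarrow> ennreal"
  assumes [measurable]: "f \<in> borel_measurable M" "g \<in> borel_measurable M"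
    and fin: "(\<integral>\<^sup>+x. g x \<partial>M) < \<infinity>"
    and le: "\<And>A. A \<in> sets M \<Longrightarrow> (\<integral>\<^sup>+x. f x * indicator A x \<partial>M) \<le> (\<integral>\<^sup>+x. g x * indicator A x \<partial>M)"
  shows "AE x in M. f x \<le> g x"
proof -
  define A where "A = {x \<in> space M. g x < f x}"
  have A[measurable]: "A \<in> sets M" unfolding A_def by measurable
  have gA: "(\<integral>\<^sup>+x. g x * indicator A x \<partial>M) < \<infinity>"
    by (rule le_less_trans[OF _ fin], rule nn_integral_mono) (auto split: split_indicator)
  have "(\<integral>\<^sup>+x. f x * indicator A x - g x * indicator A x \<partial>M)
      = (\<integral>\<^sup>+x. f x * indicator A x \<partial>M) - (\<integral>\<^sup>+x. g x * indicator A x \<partial>M)"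
    using gA by (intro nn_integral_diff) (auto simp: A_def split: split_indicator)
  also have "\<dots> = 0"
    using le[OF A] gA by (simp add: diff_eq_0_iff_ennreal)
  finally have "AE x in M. f x * indicator A x - g x * indicator A x = 0"
    by (subst (asm) nn_integral_0_iff_AE) auto
  moreover have "AE x in M. g x < \<infinity>"
    using fin nn_integral_PInf_AE[of g M] by (auto simp: less_top)
  ultimately show ?thesis
    using AE_space
  proof eventually_elim
    case (elim x)
    then show ?case
      by (cases "x \<in> A") (auto simp: diff_eq_0_iff_ennreal A_def)
  qed
qed

text \<open>The measure with density \<open>a\<close> has an image under \<open>f\<close> that is
  dominated by the image of \<open>M\<close>. Its Radon-Nikodym density is the conditional
  expectation of \<open>a\<close> given \<open>f\<close>, written as a function on
  \<open>B\<close>.\<close>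

lemma cond_version:
  fixes a :: "'a \<Rightarrow> ennreal"
  assumes "prob_space M" and [measurable]: "f \<in> M \<rightarrow>\<^sub>M B" "a \<in> borel_measurable M" and a1: "\<And>x. a x \<le> 1"
  obtains k where "k \<in> borel_measurable B" "\<And>y. k y \<le> (1::ennreal)"
    "\<And>q. q \<in> borel_measurable B \<Longrightarrow> (\<integral>\<^sup>+x. a x * q (f x) \<partial>M) = (\<integral>\<^sup>+x. k (f x) * q (f x) \<partial>M)"
proof -
  interpret M: prob_space M by fact
  define P where "P = distr M B f"
  define N where "N = distr (density M a) B f"
  interpret P: prob_space P unfolding P_def by (rule M.prob_space_distr) simp
  have [measurable_cong, simp]: "sets P = sets B" "sets N = sets B" by (auto simp: P_def N_def)
  have Nle: "emeasure N A \<le> emeasure P A" if "A \<in> sets B" for A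
  proof -
    have [measurable]: "A \<in> sets B" by fact
    have "emeasure N A = (\<integral>\<^sup>+x. a x * indicator (f -` A \<inter> space M) x \<partial>M)"
      unfolding N_def by (subst emeasure_distr) (auto simp: emeasure_density)
    also have "\<dots> \<le> (\<integral>\<^sup>+x. indicator (f -` A \<inter> space M) x \<partial>M)"
      by (intro nn_integral_mono) (auto split: split_indicator intro: a1)
    finally show ?thesis unfolding P_def by (simp add: emeasure_distr)
  qed
  have "absolutely_continuous P N"
    unfolding absolutely_continuous_def using Nle by (auto simp: null_sets_def) (metis le_zero_eq)
  from P.Radon_Nikodym[OF this] obtain k0 where [measurable]: "k0 \<in> borel_measurable P" and k0: "density P k0 = N"
    by auto
  have "AE y in P. k0 y \<le> 1"
  proof (rule AE_le_if_nn_integral_le)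
    fix A assume A[measurable]: "A \<in> sets P"
    have "(\<integral>\<^sup>+x. k0 x * indicator A x \<partial>P) = emeasure N A"
      unfolding k0[symmetric] using A by (subst emeasure_density) auto
    also have "\<dots> \<le> emeasure P A" using Nle A by simp
    finally show "(\<integral>\<^sup>+x. k0 x * indicator A x \<partial>P) \<le> (\<integral>\<^sup>+x. 1 * indicator A x \<partial>P)" using A by simp
  qed (auto simp: P.emeasure_space_1)
  \<comment> \<open>The density is at most 1 only almost everywhere; the cut makes the bound hold at
    every point.\<close>
  define k where "k y = min 1 (k0 y)" for y
  have km[measurable]: "k \<in> borel_measurable B" unfolding k_def by measurable
  have key: "(\<integral>\<^sup>+x. a x * q (f x) \<partial>M) = (\<integral>\<^sup>+x. k (f x) * q (f x) \<partial>M)" if [measurable]: "q \<in> borel_measurable B" for q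
  proof -
    have "(\<integral>\<^sup>+x. a x * q (f x) \<partial>M) = (\<integral>\<^sup>+y. q y \<partial>N)"
      unfolding N_def by (simp add: nn_integral_distr nn_integral_density)
    also have "\<dots> = (\<integral>\<^sup>+y. k0 y * q y \<partial>P)"
      unfolding k0[symmetric] by (simp add: nn_integral_density)
    also have "\<dots> = (\<integral>\<^sup>+y. k y * q y \<partial>P)"
      using \<open>AE y in P. k0 y \<le> 1\<close> by (intro nn_integral_cong_AE) (auto simp: k_def min_def)
    also have "\<dots> = (\<integral>\<^sup>+x. k (f x) * q (f x) \<partial>M)"
      unfolding P_def by (simp add: nn_integral_distr)
    finally show ?thesis .
  qed
  show thesis by (rule that[OF km _ key]) (simp add: k_def)
qed

lemma measure_eqI_rectangles:
  assumes sM: "sets M = sets (A \<Otimes>\<^sub>M B)" and sN: "sets N = sets (A \<Otimes>\<^sub>M B)" and fin: "finite_measure M"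
    and eq: "\<And>a b. a \<in> sets A \<Longrightarrow> b \<in> sets B \<Longrightarrow> emeasure M (a \<times> b) = emeasure N (a \<times> b)"
  shows "M = N"
proof (rule measure_eqI_generator_eq[OF Int_stable_pair_measure_generator[of A B]])
  let ?E = "{a \<times> b |a b. a \<in> sets A \<and> b \<in> sets B}"
  show "?E \<subseteq> Pow (space A \<times> space B)" by (rule pair_measure_closed)
  show "sets M = sigma_sets (space A \<times> space B) ?E" "sets N = sigma_sets (space A \<times> space B) ?E"
    using sM sN by (simp_all add: sets_pair_measure)
  show "emeasure M X = emeasure N X" if "X \<in> ?E" for X using that eq by auto
  show "range (\<lambda>i::nat. space A \<times> space B) \<subseteq> ?E" by auto
  show "(\<Union>i::nat. space A \<times> space B) = space A \<times> space B" by auto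
  show "emeasure M (space A \<times> space B) \<noteq> \<infinity>" for i::nat
    using finite_measure.emeasure_finite[OF fin] by simp
qed

section \<open>Regular conditional distributions of real variables from conditional distribution
  functions\<close>

definition rat_cdf :: "(rat \<Rightarrow> real) \<Rightarrow> real \<Rightarrow> real" where
  "rat_cdf h x = (INF q\<in>{q. x < of_rat q}. h q)"

text \<open>The infimum over larger rationals makes a distribution function on the rationals right-continuous.\<close>

lemma rat_cdf_real_distribution:
  assumes mono: "\<And>q r. q \<le> r \<Longrightarrow> h q \<le> h r" and h0: "\<And>q. 0 \<le> h q" and h1: "\<And>q. h q \<le> 1"
    and top: "\<And>e. e > 0 \<Longrightarrow> \<exists>q. h q > 1 - e" and bot: "\<And>e. e > 0 \<Longrightarrow> \<exists>q. h q < e"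
  shows "real_distribution (interval_measure (rat_cdf h))"
    and "emeasure (interval_measure (rat_cdf h)) {..x} = ennreal (rat_cdf h x)"
proof -
  have ne: "{q. x < of_rat q} \<noteq> {}" for x :: real
    using of_rat_dense[of x "x+1"] by auto
  have bb: "bdd_below (h ` A)" for A by (rule bdd_belowI[of _ 0]) (auto simp: h0)
  have le: "rat_cdf h x \<le> h q" if "x < of_rat q" for x q
    unfolding rat_cdf_def using that bb by (intro cINF_lower) auto
  have ge: "y \<le> rat_cdf h x" if "\<And>q. x < of_rat q \<Longrightarrow> y \<le> h q" for x y
    unfolding rat_cdf_def using that ne by (intro cINF_greatest) auto
  have ex: "\<exists>q. x < of_rat q \<and> h q < y" if "rat_cdf h x < y" for x y
    using ge[of x y] that by force
  have nd: "rat_cdf h x \<le> rat_cdf h y" if "x \<le> y" for x y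
    by (rule ge) (use le that in force)
  have c0: "0 \<le> rat_cdf h x" for x by (rule ge) (rule h0)
  have c1: "rat_cdf h x \<le> 1" for x
    using ne[of x] le[of x] h1 by (force intro: order_trans)
  have rc: "continuous (at_right a) (rat_cdf h)" for a
    unfolding continuous_within
  proof (rule tendstoI)
    fix e :: real assume "e > 0"
    then obtain q where q: "a < of_rat q" "h q < rat_cdf h a + e" using ex[of a "rat_cdf h a + e"] by auto
    show "\<forall>\<^sub>F x in at_right a. dist (rat_cdf h x) (rat_cdf h a) < e"
    proof (rule eventually_at_rightI[OF _ q(1)])
      fix x assume "x \<in> {a<..<real_of_rat q}"
      then show "dist (rat_cdf h x) (rat_cdf h a) < e"
        using nd[of a x] le[of x q] q by (auto simp: dist_real_def)
    qed
  qed
  have lt: "(rat_cdf h \<longlongrightarrow> 1) at_top"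
  proof (rule tendstoI)
    fix e :: real assume "e > 0"
    then obtain q where q: "h q > 1 - e" using top by auto
    show "\<forall>\<^sub>F x in at_top. dist (rat_cdf h x) 1 < e"
      using eventually_ge_at_top[of "of_rat q :: real"]
    proof eventually_elim
      case (elim x)
      have "h q \<le> rat_cdf h x"
        by (rule ge, rule mono) (use elim in \<open>metis le_less_trans less_eq_real_def of_rat_less_eq\<close>)
      with q c1[of x] show ?case by (auto simp: dist_real_def)
    qed
  qed
  have lb: "(rat_cdf h \<longlongrightarrow> 0) at_bot"
  proof (rule tendstoI)
    fix e :: real assume "e > 0"
    then obtain q where q: "h q < e" using bot by auto
    show "\<forall>\<^sub>F x in at_bot. dist (rat_cdf h x) 0 < e"
      using eventually_gt_at_bot[of "of_rat q :: real"]
    proof eventually_elim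
      case (elim x)
      then show ?case using le[of x q] q c0[of x] by (auto simp: dist_real_def)
    qed
  qed
  show "real_distribution (interval_measure (rat_cdf h))"
    by (rule real_distribution_interval_measure[OF nd rc lb lt])
  show "emeasure (interval_measure (rat_cdf h)) {..x} = ennreal (rat_cdf h x)"
    by (rule emeasure_interval_measure_Iic[OF nd rc lb])
qed

lemma ennreal_rat_cdf:
  assumes "\<And>q. 0 \<le> h q"
  shows "ennreal (rat_cdf h x) = (INF q\<in>{q. x < of_rat q}. ennreal (h q))"
proof -
  have ne: "{q. x < of_rat q} \<noteq> {}"
    using of_rat_dense[of x "x+1"] by auto
  have bb: "bdd_below (h ` A)" for A by (rule bdd_belowI[of _ 0]) (auto simp: assms)
  have le: "rat_cdf h x \<le> h q" if "x < of_rat q" for q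
    unfolding rat_cdf_def using that bb by (intro cINF_lower) auto
  have ge: "y \<le> rat_cdf h x" if "\<And>q. x < of_rat q \<Longrightarrow> y \<le> h q" for y
    unfolding rat_cdf_def using that ne by (intro cINF_greatest) auto
  show ?thesis
  proof (rule antisym)
    show "ennreal (rat_cdf h x) \<le> (INF q\<in>{q. x < of_rat q}. ennreal (h q))"
      by (rule INF_greatest) (auto intro!: ennreal_leI le)
    show "(INF q\<in>{q. x < of_rat q}. ennreal (h q)) \<le> ennreal (rat_cdf h x)"
    proof -
      obtain q0 where q0: "x < of_rat q0" using ne by auto
      let ?I = "INF q\<in>{q. x < of_rat q}. ennreal (h q)"
      have I: "?I \<le> ennreal (h q)" if "x < of_rat q" for q using that by (intro INF_lower) auto
      have "?I < \<top>" using I[OF q0] by (simp add: le_less_trans)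
      then have eq: "?I = ennreal (enn2real ?I)" by simp
      have "enn2real ?I \<le> rat_cdf h x"
        by (rule ge) (metis I assms eq ennreal_le_iff)
      then show ?thesis by (subst eq) (rule ennreal_leI)
    qed
  qed
qed

text \<open>For every rational \<open>q\<close> a version of the conditional probability of
  \<open>Z \<le> q\<close> given \<open>f\<close> is chosen. Monotonicity in \<open>q\<close> and
  the limits 0 and 1 are countably many almost sure conditions, so off one null set the versions
  form a distribution function on the rationals. Its right-continuous version defines the
  kernel.\<close>

lemma disintegration_real:
  fixes Z :: "'e \<Rightarrow> real"
  assumes M: "prob_space M" and [measurable]: "f \<in> M \<rightarrow>\<^sub>M B" "Z \<in> borel_measurable M"
  obtains \<kappa> where "\<kappa> \<in> B \<rightarrow>\<^sub>M prob_algebra borel"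
    "\<And>g. g \<in> borel_measurable (B \<Otimes>\<^sub>M borel) \<Longrightarrow>
       (\<integral>\<^sup>+x. g (f x, Z x) \<partial>M) = (\<integral>\<^sup>+x. (\<integral>\<^sup>+z. g (f x, z) \<partial>\<kappa> (f x)) \<partial>M)"
proof -
  interpret M: prob_space M by fact
  define P where "P = distr M B f"
  interpret P: prob_space P unfolding P_def by (rule M.prob_space_distr) simp
  have [measurable_cong, simp]: "sets P = sets B" by (auto simp: P_def)
  have [simp]: "space P = space B" by (auto simp: P_def)
  have "\<exists>k. k \<in> borel_measurable B \<and> (\<forall>y. k y \<le> (1::ennreal)) \<and>
     (\<forall>D\<in>sets B. (\<integral>\<^sup>+y. k y * indicator D y \<partial>P) = emeasure M {x\<in>space M. f x \<in> D \<and> Z x \<le> of_rat q})" for q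
  proof -
    obtain k where [measurable]: "k \<in> borel_measurable B" and k1: "\<And>y. k y \<le> (1::ennreal)"
      and k: "\<And>u. u \<in> borel_measurable B \<Longrightarrow> (\<integral>\<^sup>+x. indicator {x\<in>space M. Z x \<le> of_rat q} x * u (f x) \<partial>M) = (\<integral>\<^sup>+x. k (f x) * u (f x) \<partial>M)"
      by (rule cond_version[OF M, of f B "indicator {x\<in>space M. Z x \<le> of_rat q}"]) (auto split: split_indicator)
    have "(\<integral>\<^sup>+y. k y * indicator D y \<partial>P) = emeasure M {x\<in>space M. f x \<in> D \<and> Z x \<le> of_rat q}" if [measurable]: "D \<in> sets B" for D
    proof -
      have "(\<integral>\<^sup>+y. k y * indicator D y \<partial>P) = (\<integral>\<^sup>+x. k (f x) * indicator D (f x) \<partial>M)"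
        unfolding P_def by (simp add: nn_integral_distr)
      also have "\<dots> = (\<integral>\<^sup>+x. indicator {x\<in>space M. Z x \<le> of_rat q} x * indicator D (f x) \<partial>M)"
        by (rule k[symmetric]) measurable
      also have "\<dots> = (\<integral>\<^sup>+x. indicator {x\<in>space M. f x \<in> D \<and> Z x \<le> of_rat q} x \<partial>M)"
        by (intro nn_integral_cong) (auto split: split_indicator)
      finally show ?thesis by simp
    qed
    with k1 show ?thesis by (intro exI[of _ k]) auto
  qed
  then have "\<exists>k. \<forall>q. k q \<in> borel_measurable B \<and> (\<forall>y. k q y \<le> (1::ennreal)) \<and>
     (\<forall>D\<in>sets B. (\<integral>\<^sup>+y. k q y * indicator D y \<partial>P) = emeasure M {x\<in>space M. f x \<in> D \<and> Z x \<le> of_rat q})"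
    by (intro choice allI)
  then obtain k where [measurable]: "\<And>q. k q \<in> borel_measurable B" and k1: "\<And>q y. k q y \<le> (1::ennreal)"
    and k: "\<And>q D. D \<in> sets B \<Longrightarrow> (\<integral>\<^sup>+y. k q y * indicator D y \<partial>P) = emeasure M {x\<in>space M. f x \<in> D \<and> Z x \<le> of_rat q}"
    by blast
  have PB[simp]: "emeasure P (space B) = 1" using P.emeasure_space_1 by simp
  have fin: "(\<integral>\<^sup>+x. k q x \<partial>P) < \<infinity>" for q
    using nn_integral_mono[of P "k q" "\<lambda>_. 1"] k1 by (simp add: P.emeasure_space_1 le_less_trans)
  have kfin: "k q y < \<top>" for q y using k1[of q y] by (simp add: le_less_trans)
  have mono: "AE y in P. \<forall>q r. q \<le> r \<longrightarrow> k q y \<le> k r y"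
  proof -
    have "AE y in P. k q y \<le> k r y" if "q \<le> r" for q r
      using fin that by (intro AE_le_if_nn_integral_le)
        (auto simp: k intro!: emeasure_mono simp: of_rat_less_eq intro: order_trans[OF _ of_rat_less_eq[THEN iffD2]])
    then show ?thesis by (simp add: AE_all_countable)
  qed
  \<comment> \<open>The events \<open>Z \<le> n\<close> increase to the whole space, and the
    integrals of the versions over \<open>D\<close> follow by continuity from below.\<close>
  have top: "AE y in P. 1 \<le> (SUP n::nat. k (of_nat n) y)"
  proof (rule AE_le_if_nn_integral_le)
    fix D assume "D \<in> sets P" then have D[measurable]: "D \<in> sets B" by simp
    have "(\<integral>\<^sup>+x. 1 * indicator D x \<partial>P) = emeasure M {x\<in>space M. f x \<in> D}"
      unfolding P_def by (subst nn_integral_distr)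
        (auto simp flip: nn_integral_indicator intro!: nn_integral_cong split: split_indicator)
    also have "{x\<in>space M. f x \<in> D} = (\<Union>n::nat. {x\<in>space M. f x \<in> D \<and> Z x \<le> of_rat (of_nat n)})"
      by (auto simp: real_arch_simple)
    also have "emeasure M \<dots> = (SUP n::nat. emeasure M {x\<in>space M. f x \<in> D \<and> Z x \<le> of_rat (of_nat n)})"
      by (intro SUP_emeasure_incseq[symmetric]) (auto simp: incseq_def)
    also have "\<dots> \<le> (\<integral>\<^sup>+x. (SUP n::nat. k (of_nat n) x) * indicator D x \<partial>P)"
      unfolding k[OF D, symmetric]
      by (intro SUP_least nn_integral_mono mult_right_mono SUP_upper) auto
    finally show "(\<integral>\<^sup>+x. 1 * indicator D x \<partial>P) \<le> (\<integral>\<^sup>+x. (SUP n::nat. k (of_nat n) x) * indicator D x \<partial>P)" .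
    next
    have "(\<integral>\<^sup>+x. (SUP n::nat. k (of_nat n) x) \<partial>P) \<le> (\<integral>\<^sup>+x. 1 \<partial>P)"
      by (intro nn_integral_mono SUP_least k1)
    then show "(\<integral>\<^sup>+x. (SUP n::nat. k (of_nat n) x) \<partial>P) < \<infinity>"
      by (simp add: P.emeasure_space_1 le_less_trans)
  qed auto
  have bot: "AE y in P. (INF n::nat. k (- of_nat n) y) \<le> 0"
  proof (rule AE_le_if_nn_integral_le)
    fix D assume "D \<in> sets P" then have D[measurable]: "D \<in> sets B" by simp
    have "(\<integral>\<^sup>+x. (INF n::nat. k (- of_nat n) x) * indicator D x \<partial>P) \<le> (INF n::nat. \<integral>\<^sup>+x. k (- of_nat n) x * indicator D x \<partial>P)"
      by (intro INF_greatest nn_integral_mono mult_right_mono INF_lower) auto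
    also have "\<dots> = emeasure M (\<Inter>n::nat. {x\<in>space M. f x \<in> D \<and> Z x \<le> of_rat (- of_nat n)})"
      unfolding k[OF D]
      by (intro INF_emeasure_decseq) (auto simp: decseq_def of_rat_minus)
    also have "(\<Inter>n::nat. {x\<in>space M. f x \<in> D \<and> Z x \<le> of_rat (- of_nat n)}) = {}"
    proof -
      have "\<exists>n::nat. \<not> Z x \<le> - of_nat n" for x
      proof -
        obtain n :: nat where "- Z x < of_nat n" using reals_Archimedean2[of "- Z x"] by auto
        then have "\<not> Z x \<le> - of_nat n" by linarith
        then show ?thesis ..
      qed
      then show ?thesis by (auto simp: of_rat_minus)
    qed
    finally show "(\<integral>\<^sup>+x. (INF n::nat. k (- of_nat n) x) * indicator D x \<partial>P) \<le> (\<integral>\<^sup>+x. 0 * indicator D x \<partial>P)" by simp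
  qed auto
  define E where "E = {y\<in>space B. (\<forall>q r. q \<le> r \<longrightarrow> k q y \<le> k r y) \<and> 1 \<le> (SUP n::nat. k (of_nat n) y) \<and> (INF n::nat. k (- of_nat n) y) \<le> 0}"
  have [measurable]: "E \<in> sets B" unfolding E_def by measurable
  have AE_E: "AE y in P. y \<in> E"
    using mono top bot AE_space by eventually_elim (auto simp: E_def)
  \<comment> \<open>Off \<open>E\<close> the distribution function of the point mass at 0 is
    substituted, so that \<kappa> is a probability kernel at every point.\<close>
  define h where "h y q = (if y \<in> E then enn2real (k q y) else if 0 \<le> q then 1 else 0)" for y q
  have hm[measurable]: "(\<lambda>y. h y q) \<in> borel_measurable B" for q unfolding h_def by measurable
  have h0: "0 \<le> h y q" for y q by (auto simp: h_def)
  have h1: "h y q \<le> 1" for y q using k1[of q y] by (auto simp: h_def intro: enn2real_leI)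
  have hk: "ennreal (h y q) = k q y" if "y \<in> E" for y q
    using that kfin[of q y] by (simp add: h_def)
  have hmono: "h y q \<le> h y r" if "q \<le> r" for y q r
  proof (cases "y \<in> E")
    case True
    then have "ennreal (h y q) \<le> ennreal (h y r)" using that hk by (auto simp: E_def)
    then show ?thesis using h0 by simp
  qed (use that in \<open>auto simp: h_def\<close>)
  have htop: "\<exists>q. h y q > 1 - e" if "e > 0" for y e
  proof (cases "y \<in> E")
    case True
    have "ennreal (1 - e) < 1" using that by (simp add: ennreal_less_one_iff)
    also have "1 \<le> (SUP n::nat. k (of_nat n) y)" using True by (auto simp: E_def)
    finally obtain n :: nat where "ennreal (1 - e) < k (of_nat n) y" by (auto simp: less_SUP_iff)
    then have "ennreal (1 - e) < ennreal (h y (of_nat n))" using hk[OF True] by simp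
    then show ?thesis by (metis ennreal_leI not_le)
  qed (use that in \<open>auto simp: h_def intro!: exI[of _ 0]\<close>)
  have hbot: "\<exists>q. h y q < e" if "e > 0" for y e
  proof (cases "y \<in> E")
    case True
    have "(INF n::nat. k (- of_nat n) y) \<le> 0" using True by (auto simp: E_def)
    also have "0 < ennreal e" using that by simp
    finally obtain n :: nat where "k (- of_nat n) y < ennreal e" by (auto simp: INF_less_iff)
    then have "ennreal (h y (- of_nat n)) < ennreal e" using hk[OF True] by simp
    then show ?thesis by (metis ennreal_leI not_le)
  qed (rule exI[of _ "-1"], use that in \<open>simp add: h_def\<close>)
  define \<kappa> where "\<kappa> y = interval_measure (rat_cdf (h y))" for y
  have rd: "real_distribution (\<kappa> y)" for y
    unfolding \<kappa>_def by (rule rat_cdf_real_distribution[OF hmono h0 h1 htop hbot])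
  have em: "emeasure (\<kappa> y) {..x} = (INF q\<in>{q. x < of_rat q}. ennreal (h y q))" for y x
    unfolding \<kappa>_def by (subst rat_cdf_real_distribution(2)[OF hmono h0 h1 htop hbot])
       (auto simp: ennreal_rat_cdf h0)
  have [simp]: "sets (\<kappa> y) = sets borel" "space (\<kappa> y) = UNIV" for y by (auto simp: \<kappa>_def)
  interpret K: prob_space "\<kappa> y" for y using rd[of y] by (rule real_distribution.axioms)
  have \<kappa>[measurable]: "\<kappa> \<in> B \<rightarrow>\<^sub>M prob_algebra borel"
  proof (rule measurable_prob_algebra_generated[where G="range atMost" and \<Omega>=UNIV])
    show "sets (borel::real measure) = sigma_sets UNIV (range atMost)" by (subst borel_eq_atMost) simp
    show "Int_stable (range (atMost :: real \<Rightarrow> _))" by (auto simp: Int_stable_def)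
    show "(\<lambda>a. emeasure (\<kappa> a) A) \<in> borel_measurable B" if "A \<in> range atMost" for A
      using that by (auto simp: em)
  qed (auto intro: K.prob_space_axioms)
  \<comment> \<open>The defining property of the versions is extended from rational to real levels.
    One inequality approximates \<open>x\<close> from above by rationals; the other has to take all
    rationals above \<open>x\<close> into account.\<close>
  have IC: "(\<integral>\<^sup>+y. emeasure (\<kappa> y) {..x} * indicator D y \<partial>P) = emeasure M {z\<in>space M. f z \<in> D \<and> Z z \<le> x}" (is "?L = ?R")
    if [measurable]: "D \<in> sets B" for D x
  proof (rule antisym)
    obtain s :: "nat \<Rightarrow> rat" where s: "\<And>n. x < of_rat (s n)" "\<And>n. of_rat (s n) < x + 1 / Suc n"
      using of_rat_dense[of x "x + 1 / Suc _"] by (metis less_add_same_cancel1 of_nat_0_less_iff zero_less_Suc zero_less_divide_1_iff)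
    have "?L = (\<integral>\<^sup>+y. (INF q\<in>{q. x < of_rat q}. k q y) * indicator D y \<partial>P)"
      using AE_E by (intro nn_integral_cong_AE) (auto simp: em hk)
    also have "\<dots> \<le> (INF n. \<integral>\<^sup>+y. k (s n) y * indicator D y \<partial>P)"
      using s by (intro INF_greatest nn_integral_mono mult_right_mono INF_lower) auto
    also have "\<dots> \<le> (INF n::nat. emeasure M {z\<in>space M. f z \<in> D \<and> Z z \<le> x + 1 / Suc n})"
    proof (rule INF_mono')
      fix n
      have "{z\<in>space M. f z \<in> D \<and> Z z \<le> of_rat (s n)} \<subseteq> {z\<in>space M. f z \<in> D \<and> Z z \<le> x + 1 / Suc n}"
        using s(2)[of n] by auto
      then show "(\<integral>\<^sup>+y. k (s n) y * indicator D y \<partial>P) \<le> emeasure M {z\<in>space M. f z \<in> D \<and> Z z \<le> x + 1 / Suc n}"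
        by (auto simp: k intro!: emeasure_mono)
    qed
    also have "\<dots> = emeasure M (\<Inter>n::nat. {z\<in>space M. f z \<in> D \<and> Z z \<le> x + 1 / Suc n})"
    proof (intro INF_emeasure_decseq)
      have "(1::real) / Suc n \<le> 1 / Suc m" if "m \<le> n" for m n using that by (simp add: field_simps)
      then show "decseq (\<lambda>n::nat. {z\<in>space M. f z \<in> D \<and> Z z \<le> x + 1 / Suc n})"
        by (fastforce simp: decseq_def)
    qed auto
    also have "(\<Inter>n::nat. {z\<in>space M. f z \<in> D \<and> Z z \<le> x + 1 / Suc n}) = {z\<in>space M. f z \<in> D \<and> Z z \<le> x}"
    proof -
      have "Z z \<le> x" if "\<forall>n::nat. Z z \<le> x + 1 / Suc n" for z
      proof (rule ccontr)
        assume "\<not> Z z \<le> x"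
        then obtain n where "inverse (of_nat (Suc n)) < Z z - x" using reals_Archimedean[of "Z z - x"] by auto
        with that[rule_format, of n] show False by (simp add: inverse_eq_divide)
      qed
      then show ?thesis by (auto intro: order_trans)
    qed
    finally show "?L \<le> ?R" .
    define s' where "s' = from_nat_into {q::rat. x < of_rat q}"
    have s': "range s' = {q::rat. x < of_rat q}"
      unfolding s'_def using of_rat_dense[of x "x+1"] by (intro range_from_nat_into) auto
    \<comment> \<open>The infimum over all rationals above \<open>x\<close> is written as a
      decreasing limit of minima over finitely many of them, to which monotone convergence applies.
      By almost sure monotonicity each minimum is attained at the smallest rational
      involved.\<close>
    have "?R \<le> (INF n. \<integral>\<^sup>+y. (MIN i\<in>{..n}. k (s' i) y) * indicator D y \<partial>P)"
    proof (rule INF_greatest)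
      fix n
      define m where "m = Min (s' ` {..n})"
      have mI: "m \<in> s' ` {..n}" unfolding m_def by (intro Min_in) auto
      then have xm: "x < of_rat m" using s' by auto
      have "?R \<le> (\<integral>\<^sup>+y. k m y * indicator D y \<partial>P)"
        using xm by (auto simp: k intro!: emeasure_mono)
      also have "\<dots> \<le> (\<integral>\<^sup>+y. (MIN i\<in>{..n}. k (s' i) y) * indicator D y \<partial>P)"
        using mono by (intro nn_integral_mono_AE, eventually_elim)
           (auto simp: m_def intro!: mult_right_mono)
      finally show "?R \<le> (\<integral>\<^sup>+y. (MIN i\<in>{..n}. k (s' i) y) * indicator D y \<partial>P)" .
    qed
    also have "\<dots> = (\<integral>\<^sup>+y. (INF n. (MIN i\<in>{..n}. k (s' i) y) * indicator D y) \<partial>P)"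
    proof (rule nn_integral_monotone_convergence_INF_decseq[symmetric])
      show "decseq (\<lambda>n y. (MIN i\<in>{..n}. k (s' i) y) * indicator D y)"
        by (intro decseq_SucI le_funI mult_right_mono Min_antimono) auto
      have "(\<integral>\<^sup>+y. (MIN i\<in>{..0}. k (s' i) y) * indicator D y \<partial>P) \<le> (\<integral>\<^sup>+y. k (s' 0) y \<partial>P)"
        by (intro nn_integral_mono) (auto split: split_indicator)
      then show "(\<integral>\<^sup>+y. (MIN i\<in>{..0}. k (s' i) y) * indicator D y \<partial>P) < \<infinity>"
        using fin le_less_trans by blast
    qed measurable
    also have "\<dots> \<le> ?L"
    proof (rule nn_integral_mono_AE, use AE_E in eventually_elim)
      fix y assume y: "y \<in> E"
      have "(INF n. (MIN i\<in>{..n}. k (s' i) y) * indicator D y) \<le> k q y * indicator D y" if q: "x < of_rat q" for q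
      proof -
        obtain n where n: "q = s' n" using q s' by blast
        show ?thesis by (rule INF_lower2[of n]) (auto simp: n intro!: mult_right_mono Min_le)
      qed
      then show "(INF n. (MIN i\<in>{..n}. k (s' i) y) * indicator D y) \<le> emeasure (\<kappa> y) {..x} * indicator D y"
        by (auto simp: em hk[OF y] split: split_indicator intro!: INF_greatest)
    qed
    finally show "?R \<le> ?L" .
  qed
  have PM: "Pair y \<in> \<kappa> z \<rightarrow>\<^sub>M B \<Otimes>\<^sub>M borel" if "y \<in> space B" for y z
    using that by (subst measurable_cong_sets[OF _ refl, of _ borel]) (auto intro: measurable_Pair1')
  \<comment> \<open>Both sides are measures on a product, so rectangles suffice. With the first side
    \<open>D\<close> fixed, the second side is reduced to half-lines, where \<open>IC\<close>
    applies.\<close>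
  have key: "distr M (B \<Otimes>\<^sub>M borel) (\<lambda>x. (f x, Z x)) = M \<bind> (\<lambda>x. distr (\<kappa> (f x)) (B \<Otimes>\<^sub>M borel) (\<lambda>z. (f x, z)))"
    (is "?N1 = ?N2")
  proof (rule measure_eqI_rectangles)
    have K2: "(\<lambda>x. distr (\<kappa> (f x)) (B \<Otimes>\<^sub>M borel) (\<lambda>z. (f x, z))) \<in> M \<rightarrow>\<^sub>M subprob_algebra (B \<Otimes>\<^sub>M borel)"
      by (rule measurable_distr2[where M=borel]) (auto intro!: measurable_prob_algebraD measurable_compose[OF _ \<kappa>])
    show "sets ?N1 = sets (B \<Otimes>\<^sub>M borel)" by simp
    show "sets ?N2 = sets (B \<Otimes>\<^sub>M borel)" using M.not_empty by (intro sets_bind) auto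
    show "finite_measure ?N1" by (intro M.finite_measure_distr) measurable
    fix D A assume [measurable]: "D \<in> sets B" "A \<in> sets (borel::real measure)"
    define R1 where "R1 = distr (density M (\<lambda>x. indicator D (f x))) borel Z"
    define R2 where "R2 = density M (\<lambda>x. indicator D (f x)) \<bind> (\<lambda>x. \<kappa> (f x))"
    have k2: "(\<lambda>x. \<kappa> (f x)) \<in> density M (\<lambda>x. indicator D (f x)) \<rightarrow>\<^sub>M subprob_algebra borel"
      by (auto intro!: measurable_prob_algebraD measurable_compose[OF _ \<kappa>])
    have R1: "emeasure R1 X = emeasure M {z\<in>space M. f z \<in> D \<and> Z z \<in> X}" if [measurable]: "X \<in> sets borel" for X
    proof -
      have "emeasure R1 X = (\<integral>\<^sup>+x. indicator D (f x) * indicator (Z -` X \<inter> space M) x \<partial>M)"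
        unfolding R1_def by (subst emeasure_distr) (auto simp: emeasure_density)
      also have "\<dots> = (\<integral>\<^sup>+x. indicator {z\<in>space M. f z \<in> D \<and> Z z \<in> X} x \<partial>M)"
        by (intro nn_integral_cong) (auto split: split_indicator)
      finally show ?thesis by simp
    qed
    have R2: "emeasure R2 X = (\<integral>\<^sup>+x. indicator D (f x) * emeasure (\<kappa> (f x)) X \<partial>M)" if [measurable]: "X \<in> sets borel" for X
    proof -
      have [measurable]: "(\<lambda>x. emeasure (\<kappa> (f x)) X) \<in> borel_measurable M"
        by (rule measurable_compose[OF _ measurable_emeasure_subprob_algebra[OF that]])
          (auto intro!: measurable_prob_algebraD measurable_compose[OF _ \<kappa>])
      show ?thesis
        unfolding R2_def using M.not_empty by (subst emeasure_bind[OF _ k2]) (auto simp: nn_integral_density)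
    qed
    have "R1 = R2"
    proof (rule measure_eqI_generator_eq[where E="range atMost" and \<Omega>=UNIV and A="\<lambda>n::nat. {..of_nat n}"])
      show "Int_stable (range (atMost :: real \<Rightarrow> _))" by (auto simp: Int_stable_def)
      show "sets R1 = sigma_sets UNIV (range atMost)" unfolding R1_def by (simp, subst borel_eq_atMost) simp
      have "sets R2 = sets borel" unfolding R2_def using M.not_empty by (intro sets_bind) auto
      then show "sets R2 = sigma_sets UNIV (range atMost)" by (simp, subst borel_eq_atMost) simp
      show "emeasure R1 {..real i} \<noteq> \<infinity>" for i by (simp add: R1)
      fix X assume "X \<in> range (atMost :: real \<Rightarrow> _)"
      then obtain x where X: "X = {..x}" by auto
      have "emeasure R1 X = (\<integral>\<^sup>+y. emeasure (\<kappa> y) {..x} * indicator D y \<partial>P)"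
        by (simp add: R1 X IC)
      also have "\<dots> = emeasure R2 X"
        unfolding P_def by (subst nn_integral_distr) (auto simp: R2 X em mult.commute)
      finally show "emeasure R1 X = emeasure R2 X" .
    qed (auto simp: real_arch_simple)
    then have eq: "emeasure R1 A = emeasure R2 A" by simp
    have "emeasure ?N1 (D \<times> A) = emeasure R1 A"
      by (subst emeasure_distr) (auto simp: R1 intro!: arg_cong[of _ _ "emeasure M"])
    also have "\<dots> = (\<integral>\<^sup>+x. indicator D (f x) * emeasure (\<kappa> (f x)) A \<partial>M)"
      by (simp add: eq R2)
    also have "\<dots> = emeasure ?N2 (D \<times> A)"
    proof (subst emeasure_bind[OF _ K2])
      show "(\<integral>\<^sup>+x. indicator D (f x) * emeasure (\<kappa> (f x)) A \<partial>M) =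
         (\<integral>\<^sup>+x. emeasure (distr (\<kappa> (f x)) (B \<Otimes>\<^sub>M borel) (Pair (f x))) (D \<times> A) \<partial>M)"
      proof (rule nn_integral_cong)
        fix x assume "x \<in> space M"
        then have fx: "f x \<in> space B" using measurable_space[of f M B] by simp
        have "emeasure (distr (\<kappa> (f x)) (B \<Otimes>\<^sub>M borel) (Pair (f x))) (D \<times> A) = emeasure (\<kappa> (f x)) (Pair (f x) -` (D \<times> A))"
          using fx by (subst emeasure_distr) (auto simp: PM)
        also have "Pair (f x) -` (D \<times> A) = (if f x \<in> D then A else {})" by auto
        finally show "indicator D (f x) * emeasure (\<kappa> (f x)) A = emeasure (distr (\<kappa> (f x)) (B \<Otimes>\<^sub>M borel) (Pair (f x))) (D \<times> A)"
          by auto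
      qed
    qed (use M.not_empty in auto)
    finally show "emeasure ?N1 (D \<times> A) = emeasure ?N2 (D \<times> A)" .
  qed
  show thesis
  proof (rule that[OF \<kappa>])
    fix g :: "_ \<Rightarrow> ennreal" assume [measurable]: "g \<in> borel_measurable (B \<Otimes>\<^sub>M (borel::real measure))"
    have K2: "(\<lambda>x. distr (\<kappa> (f x)) (B \<Otimes>\<^sub>M borel) (\<lambda>z. (f x, z))) \<in> M \<rightarrow>\<^sub>M subprob_algebra (B \<Otimes>\<^sub>M borel)"
      by (rule measurable_distr2[where M=borel]) (auto intro!: measurable_prob_algebraD measurable_compose[OF _ \<kappa>])
    have "(\<integral>\<^sup>+x. g (f x, Z x) \<partial>M) = (\<integral>\<^sup>+u. g u \<partial>distr M (B \<Otimes>\<^sub>M borel) (\<lambda>x. (f x, Z x)))"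
      by (simp add: nn_integral_distr)
    also have "\<dots> = (\<integral>\<^sup>+x. (\<integral>\<^sup>+u. g u \<partial>distr (\<kappa> (f x)) (B \<Otimes>\<^sub>M borel) (\<lambda>z. (f x, z))) \<partial>M)"
      unfolding key by (rule nn_integral_bind[OF _ K2]) measurable
    also have "\<dots> = (\<integral>\<^sup>+x. (\<integral>\<^sup>+z. g (f x, z) \<partial>\<kappa> (f x)) \<partial>M)"
    proof (rule nn_integral_cong)
      fix x assume "x \<in> space M"
      then have fx: "f x \<in> space B" using measurable_space[of f M B] by simp
      show "(\<integral>\<^sup>+u. g u \<partial>distr (\<kappa> (f x)) (B \<Otimes>\<^sub>M borel) (\<lambda>z. (f x, z))) = (\<integral>\<^sup>+z. g (f x, z) \<partial>\<kappa> (f x))"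
        using fx by (subst nn_integral_distr) (auto simp: PM)
    qed
    finally show "(\<integral>\<^sup>+x. g (f x, Z x) \<partial>M) = (\<integral>\<^sup>+x. (\<integral>\<^sup>+z. g (f x, z) \<partial>\<kappa> (f x)) \<partial>M)" .
  qed
qed

text \<open>\<kappa> is a regular conditional distribution of \<open>X\<close> given
  \<open>f\<close>. Testing on nonnegative functions of the pair covers infinite integrals as
  well.\<close>

definition disintegrates :: "'e measure \<Rightarrow> ('e \<Rightarrow> 'b) \<Rightarrow> 'b measure \<Rightarrow> ('e \<Rightarrow> 'c) \<Rightarrow> 'c measure \<Rightarrow> ('b \<Rightarrow> 'c measure) \<Rightarrow> bool" where
  "disintegrates M f B X S \<kappa> \<longleftrightarrow> \<kappa> \<in> B \<rightarrow>\<^sub>M prob_algebra S \<and>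
     (\<forall>g\<in>borel_measurable (B \<Otimes>\<^sub>M S). (\<integral>\<^sup>+x. g (f x, X x) \<partial>M) = (\<integral>\<^sup>+x. (\<integral>\<^sup>+z. g (f x, z) \<partial>\<kappa> (f x)) \<partial>M))"

text \<open>Chain rule for conditional laws: the law of a new coordinate, given \<open>f\<close> and
  the earlier coordinates, is composed with the kernel of the earlier ones.\<close>

lemma disintegration_PiM:
  fixes Z :: "'i \<Rightarrow> 'e \<Rightarrow> real"
  assumes "finite I" and M: "prob_space M" and [measurable]: "f \<in> M \<rightarrow>\<^sub>M B" "\<And>i. Z i \<in> borel_measurable M"
  shows "\<exists>\<kappa>. disintegrates M f B (\<lambda>x. \<lambda>i\<in>I. Z i x) (Pi\<^sub>M I (\<lambda>_. borel)) \<kappa>"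
  using \<open>finite I\<close>
proof induction
  case empty
  let ?S0 = "Pi\<^sub>M {} (\<lambda>_. borel) :: ('i \<Rightarrow> real) measure"
  \<comment> \<open>An extensional function on the empty set is constantly \<open>undefined\<close>,
    so the kernel of the base case is a point mass.\<close>
  have r: "(\<lambda>i. undefined) \<in> space (?S0)" by (simp add: space_PiM)
  have "(\<lambda>_. return (?S0) (\<lambda>i. undefined)) \<in> B \<rightarrow>\<^sub>M prob_algebra (?S0)"
    using r by (intro measurable_const) (auto simp: space_prob_algebra prob_space_return)
  moreover have ret: "(\<integral>\<^sup>+z. g (f x, z) \<partial>return (?S0) (\<lambda>i. undefined)) = g (f x, \<lambda>i. undefined)"
    if [measurable]: "g \<in> borel_measurable (B \<Otimes>\<^sub>M ?S0)" and x: "x \<in> space M" for g :: "_ \<Rightarrow> ennreal" and x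
  proof -
    have "f x \<in> space B" using measurable_space[of f M B] x by simp
    then show ?thesis using r by (intro nn_integral_return) auto
  qed
  ultimately show ?case
    unfolding disintegrates_def
    by (intro exI[of _ "\<lambda>_. return (?S0) (\<lambda>i. undefined)"] conjI ballI nn_integral_cong)
      (simp_all add: restrict_def)
next
  case (insert i I)
  let ?S = "Pi\<^sub>M I (\<lambda>_. borel) :: ('i \<Rightarrow> real) measure"
  let ?S' = "Pi\<^sub>M (insert i I) (\<lambda>_. borel) :: ('i \<Rightarrow> real) measure"
  from insert.IH obtain \<kappa> where \<kappa>: "disintegrates M f B (\<lambda>x. \<lambda>i\<in>I. Z i x) ?S \<kappa>" by blast
  then have [measurable]: "\<kappa> \<in> B \<rightarrow>\<^sub>M prob_algebra ?S" by (simp add: disintegrates_def)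
  obtain \<kappa>2 where [measurable]: "\<kappa>2 \<in> B \<Otimes>\<^sub>M ?S \<rightarrow>\<^sub>M prob_algebra borel"
    and \<kappa>2: "\<And>g. g \<in> borel_measurable ((B \<Otimes>\<^sub>M ?S) \<Otimes>\<^sub>M borel) \<Longrightarrow>
       (\<integral>\<^sup>+x. g ((f x, \<lambda>i\<in>I. Z i x), Z i x) \<partial>M) = (\<integral>\<^sup>+x. (\<integral>\<^sup>+z. g ((f x, \<lambda>i\<in>I. Z i x), z) \<partial>\<kappa>2 (f x, \<lambda>i\<in>I. Z i x)) \<partial>M)"
    by (rule disintegration_real[OF M, of "\<lambda>x. (f x, \<lambda>i\<in>I. Z i x)" "B \<Otimes>\<^sub>M ?S" "Z i"]) auto
  define \<kappa>3 where "\<kappa>3 b = \<kappa> b \<bind> (\<lambda>y. distr (\<kappa>2 (b, y)) ?S' (\<lambda>z. y(i := z)))" for b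
  have k2s[measurable]: "\<kappa>2 \<in> B \<Otimes>\<^sub>M ?S \<rightarrow>\<^sub>M subprob_algebra borel" by (rule measurable_prob_algebraD) measurable
  have u: "(\<lambda>(p, z). (snd p)(i := z)) \<in> (B \<Otimes>\<^sub>M ?S) \<Otimes>\<^sub>M borel \<rightarrow>\<^sub>M ?S'"
    unfolding split_beta' by (rule measurable_fun_upd[where J=I]) auto
  have inner: "(\<lambda>p. distr (\<kappa>2 p) ?S' (\<lambda>z. (snd p)(i := z))) \<in> B \<Otimes>\<^sub>M ?S \<rightarrow>\<^sub>M prob_algebra ?S'"
    by (rule measurable_distr_prob_space2[OF _ u]) measurable
  have k3[measurable]: "\<kappa>3 \<in> B \<rightarrow>\<^sub>M prob_algebra ?S'"
    unfolding \<kappa>3_def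
    by (rule measurable_bind_prob_space2[where N="?S"]) (use inner in \<open>auto simp: split_beta'\<close>)
  have "(\<integral>\<^sup>+x. g (f x, \<lambda>j\<in>insert i I. Z j x) \<partial>M) = (\<integral>\<^sup>+x. (\<integral>\<^sup>+z. g (f x, z) \<partial>\<kappa>3 (f x)) \<partial>M)"
    if g[measurable]: "g \<in> borel_measurable (B \<Otimes>\<^sub>M ?S')" for g :: "_ \<Rightarrow> ennreal"
  proof -
    have [measurable]: "(\<lambda>p. g (fst (fst p), (snd (fst p))(i := snd p))) \<in> borel_measurable ((B \<Otimes>\<^sub>M ?S) \<Otimes>\<^sub>M borel)"
      using u by (intro measurable_compose[OF _ g] measurable_Pair) (auto simp: split_beta')
    have "(\<integral>\<^sup>+x. g (f x, \<lambda>j\<in>insert i I. Z j x) \<partial>M) = (\<integral>\<^sup>+x. g (f x, (\<lambda>j\<in>I. Z j x)(i := Z i x)) \<partial>M)"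
      by (intro nn_integral_cong arg_cong[of _ _ g]) (auto simp: fun_eq_iff)
    also have "\<dots> = (\<integral>\<^sup>+x. (\<integral>\<^sup>+z. g (f x, (\<lambda>j\<in>I. Z j x)(i := z)) \<partial>\<kappa>2 (f x, \<lambda>i\<in>I. Z i x)) \<partial>M)"
      using \<kappa>2[of "\<lambda>p. g (fst (fst p), (snd (fst p))(i := snd p))"] by simp
    also have "\<dots> = (\<integral>\<^sup>+x. (\<integral>\<^sup>+y. (\<integral>\<^sup>+z. g (f x, y(i := z)) \<partial>\<kappa>2 (f x, y)) \<partial>\<kappa> (f x)) \<partial>M)"
    proof -
      have "(\<lambda>p. \<integral>\<^sup>+z. g (fst p, (snd p)(i := z)) \<partial>\<kappa>2 p) \<in> borel_measurable (B \<Otimes>\<^sub>M ?S)"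
        by (rule nn_integral_measurable_subprob_algebra2[where N=borel]) (auto simp: split_beta')
      then show ?thesis
        using \<kappa> unfolding disintegrates_def by (auto dest!: bspec)
    qed
    also have "\<dots> = (\<integral>\<^sup>+x. (\<integral>\<^sup>+z. g (f x, z) \<partial>\<kappa>3 (f x)) \<partial>M)"
    proof (rule nn_integral_cong)
      fix x assume "x \<in> space M"
      then have fx[measurable]: "f x \<in> space B" using measurable_space[of f M B] by simp
      have sk: "sets (\<kappa> (f x)) = sets ?S"
        using fx measurable_space[of \<kappa> B "prob_algebra ?S" "f x"] by (auto simp: space_prob_algebra)
      have m1: "(\<lambda>y. distr (\<kappa>2 (f x, y)) ?S' (\<lambda>z. y(i := z))) \<in> \<kappa> (f x) \<rightarrow>\<^sub>M subprob_algebra ?S'"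
        using measurable_compose[OF measurable_Pair1'[OF fx] inner] sk
        by (auto intro!: measurable_prob_algebraD cong: measurable_cong_sets)
      have gm: "(\<lambda>z. g (f x, z)) \<in> borel_measurable ?S'"
        using fx by (intro measurable_compose[OF measurable_Pair1' g])
      have "(\<integral>\<^sup>+z. g (f x, z) \<partial>\<kappa>3 (f x)) = (\<integral>\<^sup>+y. (\<integral>\<^sup>+z. g (f x, z) \<partial>distr (\<kappa>2 (f x, y)) ?S' (\<lambda>z. y(i := z))) \<partial>\<kappa> (f x))"
        unfolding \<kappa>3_def by (rule nn_integral_bind[OF gm m1])
      also have "\<dots> = (\<integral>\<^sup>+y. (\<integral>\<^sup>+z. g (f x, y(i := z)) \<partial>\<kappa>2 (f x, y)) \<partial>\<kappa> (f x))"
      proof (rule nn_integral_cong)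
        fix y assume "y \<in> space (\<kappa> (f x))"
        then have y: "y \<in> space ?S" using sets_eq_imp_space_eq[OF sk] by simp
        have sk2: "sets (\<kappa>2 (f x, y)) = sets borel"
          using fx y measurable_space[of \<kappa>2 "B \<Otimes>\<^sub>M ?S" "prob_algebra borel" "(f x, y)"] by (auto simp: space_prob_algebra space_pair_measure)
        have "(\<lambda>z. y(i := z)) \<in> borel \<rightarrow>\<^sub>M ?S'"
          using measurable_compose[OF measurable_Pair1'[of "(f x, y)" "B \<Otimes>\<^sub>M ?S" borel] u] fx y
          by (auto simp: space_pair_measure)
        then show "(\<integral>\<^sup>+z. g (f x, z) \<partial>distr (\<kappa>2 (f x, y)) ?S' (\<lambda>z. y(i := z))) = (\<integral>\<^sup>+z. g (f x, y(i := z)) \<partial>\<kappa>2 (f x, y))"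
          using gm sk2 by (subst nn_integral_distr) (auto cong: measurable_cong_sets)
      qed
      finally show "(\<integral>\<^sup>+y. (\<integral>\<^sup>+z. g (f x, y(i := z)) \<partial>\<kappa>2 (f x, y)) \<partial>\<kappa> (f x)) = (\<integral>\<^sup>+z. g (f x, z) \<partial>\<kappa>3 (f x))" by simp
    qed
    finally show ?thesis .
  qed
  with k3 show ?case unfolding disintegrates_def by blast
qed

text \<open>A point of a Euclidean space is recovered from its coordinates by a measurable map,
  along which the coordinate kernel is pushed forward.\<close>

lemma disintegration:
  fixes X :: "'e \<Rightarrow> 'a::euclidean_space"
  assumes M: "prob_space M" and [measurable]: "f \<in> M \<rightarrow>\<^sub>M B" "X \<in> borel_measurable M"
  shows "\<exists>\<kappa>. disintegrates M f B X borel \<kappa>"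
proof -
  let ?S = "Pi\<^sub>M Basis (\<lambda>_. borel) :: ('a \<Rightarrow> real) measure"
  let ?h = "\<lambda>v. \<Sum>b\<in>Basis. v b *\<^sub>R b :: 'a"
  have h[measurable]: "?h \<in> ?S \<rightarrow>\<^sub>M borel" by measurable
  obtain \<kappa> where \<kappa>: "disintegrates M f B (\<lambda>x. \<lambda>b\<in>Basis. X x \<bullet> b) ?S \<kappa>"
    using disintegration_PiM[OF finite_Basis M, of f B "\<lambda>b x. X x \<bullet> b"] by auto
  then have km[measurable]: "\<kappa> \<in> B \<rightarrow>\<^sub>M prob_algebra ?S" by (simp add: disintegrates_def)
  define \<kappa>' where "\<kappa>' b = distr (\<kappa> b) borel ?h" for b
  have "\<kappa>' \<in> B \<rightarrow>\<^sub>M prob_algebra borel"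
    unfolding \<kappa>'_def by (rule measurable_compose[OF km measurable_distr_prob_space[OF h]])
  moreover have "(\<integral>\<^sup>+x. g (f x, X x) \<partial>M) = (\<integral>\<^sup>+x. (\<integral>\<^sup>+z. g (f x, z) \<partial>\<kappa>' (f x)) \<partial>M)"
    if g[measurable]: "g \<in> borel_measurable (B \<Otimes>\<^sub>M borel)" for g :: "_ \<Rightarrow> ennreal"
  proof -
    have "(\<integral>\<^sup>+x. g (f x, X x) \<partial>M) = (\<integral>\<^sup>+x. g (f x, ?h (\<lambda>b\<in>Basis. X x \<bullet> b)) \<partial>M)"
      by (simp add: euclidean_representation)
    also have "\<dots> = (\<integral>\<^sup>+x. (\<integral>\<^sup>+z. g (f x, ?h z) \<partial>\<kappa> (f x)) \<partial>M)"
    proof -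
      have m: "(\<lambda>p. g (fst p, ?h (snd p))) \<in> borel_measurable (B \<Otimes>\<^sub>M ?S)" by measurable
      show ?thesis using bspec[OF conjunct2[OF \<kappa>[unfolded disintegrates_def]] m] by simp
    qed
    also have "\<dots> = (\<integral>\<^sup>+x. (\<integral>\<^sup>+z. g (f x, z) \<partial>\<kappa>' (f x)) \<partial>M)"
    proof (rule nn_integral_cong)
      fix x assume "x \<in> space M"
      then have fx: "f x \<in> space B" using measurable_space[of f M B] by simp
      have sk: "sets (\<kappa> (f x)) = sets ?S"
        using fx measurable_space[of \<kappa> B "prob_algebra ?S" "f x"] by (auto simp: space_prob_algebra)
      have gm: "(\<lambda>z. g (f x, z)) \<in> borel_measurable borel"
        using fx by (intro measurable_compose[OF measurable_Pair1' g])
      show "(\<integral>\<^sup>+z. g (f x, ?h z) \<partial>\<kappa> (f x)) = (\<integral>\<^sup>+z. g (f x, z) \<partial>\<kappa>' (f x))"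
        unfolding \<kappa>'_def using gm sk h by (subst nn_integral_distr) (auto cong: measurable_cong_sets)
    qed
    finally show ?thesis .
  qed
  ultimately show ?thesis unfolding disintegrates_def by blast
qed

section \<open>Causality and gluing of couplings\<close>

text \<open>
  \<open>E[a(Y) | X]\<close> is a function of \<open>X\<close> that is measurable with respect to the sub-sigma-algebra \<open>F\<close> whenever
  \<open>a\<close> is. With \<open>F\<close> generated by the path up to time \<open>t\<close> this says that \<open>Y\<close> up to \<open>t\<close> and the future of \<open>X\<close> after
  \<open>t\<close> are conditionally independent given the past of \<open>X\<close>.
\<close>

definition causal :: "'a::euclidean_space measure \<Rightarrow> 'e measure \<Rightarrow> ('e \<Rightarrow> 'a) \<Rightarrow> ('e \<Rightarrow> 'a) \<Rightarrow> bool" where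
  "causal F M X Y \<longleftrightarrow>
     (\<forall>a\<in>borel_measurable F. (\<forall>x. a x \<le> (1::ennreal)) \<longrightarrow>
        (\<exists>k\<in>borel_measurable F. (\<forall>x. k x \<le> 1) \<and>
           (\<forall>c\<in>borel_measurable borel. (\<integral>\<^sup>+p. a (Y p) * c (X p) \<partial>M) = (\<integral>\<^sup>+p. k (X p) * c (X p) \<partial>M))))"

lemma causalI:
  assumes "\<And>a. a \<in> borel_measurable F \<Longrightarrow> (\<And>x. a x \<le> (1::ennreal)) \<Longrightarrow>
     \<exists>k\<in>borel_measurable F. (\<forall>x. k x \<le> 1) \<and>
       (\<forall>c\<in>borel_measurable borel. (\<integral>\<^sup>+p. a (Y p) * c (X p) \<partial>M) = (\<integral>\<^sup>+p. k (X p) * c (X p) \<partial>M))"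
  shows "causal F M X Y"
  using assms unfolding causal_def by blast

lemma causalE:
  assumes "causal F M X Y" "a \<in> borel_measurable F" "\<And>x. a x \<le> (1::ennreal)"
  obtains k where "k \<in> borel_measurable F" "\<And>x. k x \<le> 1"
    "\<And>c. c \<in> borel_measurable borel \<Longrightarrow> (\<integral>\<^sup>+p. a (Y p) * c (X p) \<partial>M) = (\<integral>\<^sup>+p. k (X p) * c (X p) \<partial>M)"
  using assms unfolding causal_def by blast

lemma AE_eq_if_nn_integral_eq:
  fixes f g :: "'a \<Rightarrow> ennreal"
  assumes [measurable]: "f \<in> borel_measurable M" "g \<in> borel_measurable M"
    and fin: "(\<integral>\<^sup>+x. g x \<partial>M) < \<infinity>"
    and eq: "\<And>A. A \<in> sets M \<Longrightarrow> (\<integral>\<^sup>+x. f x * indicator A x \<partial>M) = (\<integral>\<^sup>+x. g x * indicator A x \<partial>M)"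
  shows "AE x in M. f x = g x"
proof -
  have "(\<integral>\<^sup>+x. f x \<partial>M) = (\<integral>\<^sup>+x. g x \<partial>M)"
    using eq[OF sets.top] by (simp cong: nn_integral_cong)
  then have fin': "(\<integral>\<^sup>+x. f x \<partial>M) < \<infinity>" using fin by simp
  have "AE x in M. f x \<le> g x"
    by (rule AE_le_if_nn_integral_le[OF _ _ fin]) (auto simp: eq)
  moreover have "AE x in M. g x \<le> f x"
    by (rule AE_le_if_nn_integral_le[OF _ _ fin']) (auto simp: eq)
  ultimately show ?thesis by eventually_elim auto
qed

section \<open>Couplings, their marginals and their composition\<close>

lemma couplingsD:
  assumes "\<pi> \<in> couplings \<mu> \<nu>"
  shows "prob_space \<pi>" "sets \<pi> = sets (borel \<Otimes>\<^sub>M borel)" "distr \<pi> borel fst = \<mu>" "distr \<pi> borel snd = \<nu>"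
    "sets \<mu> = sets borel" "sets \<nu> = sets borel" "prob_space \<mu>" "prob_space \<nu>"
  using assms by (auto simp: couplings_def intro!: prob_space.prob_space_distr)

lemma nn_integral_coupling_fst:
  assumes \<pi>: "\<pi> \<in> couplings \<mu> \<nu>" and [measurable]: "g \<in> borel_measurable borel"
  shows "(\<integral>\<^sup>+p. g (fst p) \<partial>\<pi>) = (\<integral>\<^sup>+x. g x \<partial>\<mu>)"
proof -
  have [measurable_cong]: "sets \<pi> = sets (borel \<Otimes>\<^sub>M borel)" by (rule couplingsD[OF \<pi>])
  show ?thesis unfolding couplingsD(3)[OF \<pi>, symmetric] by (simp add: nn_integral_distr)
qed

lemma nn_integral_coupling_snd:
  assumes \<pi>: "\<pi> \<in> couplings \<mu> \<nu>" and [measurable]: "g \<in> borel_measurable borel"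
  shows "(\<integral>\<^sup>+p. g (snd p) \<partial>\<pi>) = (\<integral>\<^sup>+x. g x \<partial>\<nu>)"
proof -
  have [measurable_cong]: "sets \<pi> = sets (borel \<Otimes>\<^sub>M borel)" by (rule couplingsD[OF \<pi>])
  show ?thesis unfolding couplingsD(4)[OF \<pi>, symmetric] by (simp add: nn_integral_distr)
qed

lemma couplings_distrI:
  assumes "prob_space M" and [measurable]: "X \<in> borel_measurable M" "Y \<in> borel_measurable M"
    and "distr M borel X = \<mu>" "distr M borel Y = \<nu>"
  shows "distr M (borel \<Otimes>\<^sub>M borel) (\<lambda>w. (X w, Y w)) \<in> couplings \<mu> \<nu>"
  using assms by (auto simp: couplings_def distr_distr comp_def intro!: prob_space.prob_space_distr)

text \<open>Causality depends on the joint law only. Variables on a glued space can therefore be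
  handled in place of the coupling that they induce.\<close>

lemma causal_distr:
  assumes F: "subalgebra borel F"
    and [measurable]: "X \<in> borel_measurable M" "Y \<in> borel_measurable M"
  shows "causal F (distr M (borel \<Otimes>\<^sub>M borel) (\<lambda>w. (X w, Y w))) fst snd \<longleftrightarrow> causal F M X Y"
    and "causal F (distr M (borel \<Otimes>\<^sub>M borel) (\<lambda>w. (X w, Y w))) snd fst \<longleftrightarrow> causal F M Y X"
proof -
  have Fm: "h \<in> borel_measurable borel" if "h \<in> borel_measurable F" for h :: "'a \<Rightarrow> ennreal"
    by (rule measurable_from_subalg[OF F that])
  have E: "(\<integral>\<^sup>+p. g p \<partial>distr M (borel \<Otimes>\<^sub>M borel) (\<lambda>w. (X w, Y w))) = (\<integral>\<^sup>+w. g (X w, Y w) \<partial>M)"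
    if "g \<in> borel_measurable (borel \<Otimes>\<^sub>M borel)" for g
    using that by (subst nn_integral_distr) auto
  have m1: "(\<lambda>p. a (snd p) * c (fst p)) \<in> borel_measurable (borel \<Otimes>\<^sub>M borel)"
      "(\<lambda>p. a (fst p) * c (fst p)) \<in> borel_measurable (borel \<Otimes>\<^sub>M borel)"
      "(\<lambda>p. a (fst p) * c (snd p)) \<in> borel_measurable (borel \<Otimes>\<^sub>M borel)"
      "(\<lambda>p. a (snd p) * c (snd p)) \<in> borel_measurable (borel \<Otimes>\<^sub>M borel)"
    if a: "a \<in> borel_measurable F" and [measurable]: "c \<in> borel_measurable borel" for a c :: "'a \<Rightarrow> ennreal"
    using Fm[OF a] by measurable
  show "causal F (distr M (borel \<Otimes>\<^sub>M borel) (\<lambda>w. (X w, Y w))) fst snd \<longleftrightarrow> causal F M X Y"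
    unfolding causal_def
    by (intro ball_cong refl imp_cong bex_cong conj_cong) (simp add: E m1)
  show "causal F (distr M (borel \<Otimes>\<^sub>M borel) (\<lambda>w. (X w, Y w))) snd fst \<longleftrightarrow> causal F M Y X"
    unfolding causal_def
    by (intro ball_cong refl imp_cong bex_cong conj_cong) (simp add: E m1)
qed

text \<open>Draw \<open>(y, z)\<close> from \<open>\<pi>2\<close> and then \<open>x\<close> from the
  conditional law of \<open>\<pi>1\<close> given \<open>y\<close>, so that \<open>x\<close> and
  \<open>z\<close> are conditionally independent given \<open>y\<close>. The conditional expectation
  of a function of \<open>z\<close> given \<open>x\<close> is then the composition of the operators
  of \<open>\<pi>2\<close> and \<open>\<pi>1\<close>, each of which preserves measurability for
  \<open>F\<close>; the other direction is analogous.\<close>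

lemma gluing:
  fixes \<mu> \<nu> \<eta> :: "'a::euclidean_space measure"
  assumes p1: "\<pi>1 \<in> couplings \<mu> \<nu>" and p2: "\<pi>2 \<in> couplings \<nu> \<eta>"
  obtains \<Gamma> :: "('a \<times> 'a \<times> 'a) measure" where "prob_space \<Gamma>" "sets \<Gamma> = sets (borel \<Otimes>\<^sub>M (borel \<Otimes>\<^sub>M borel))"
    "distr \<Gamma> (borel \<Otimes>\<^sub>M borel) (\<lambda>(x, y, z). (x, y)) = \<pi>1"
    "distr \<Gamma> (borel \<Otimes>\<^sub>M borel) (\<lambda>(x, y, z). (y, z)) = \<pi>2"
    "\<And>F. subalgebra borel F \<Longrightarrow> causal F \<pi>1 fst snd \<Longrightarrow> causal F \<pi>2 fst snd \<Longrightarrow> causal F \<Gamma> fst (\<lambda>w. snd (snd w))"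
    "\<And>F. subalgebra borel F \<Longrightarrow> causal F \<pi>1 snd fst \<Longrightarrow> causal F \<pi>2 snd fst \<Longrightarrow> causal F \<Gamma> (\<lambda>w. snd (snd w)) fst"
proof -
  have s1[measurable_cong, simp]: "sets \<pi>1 = sets (borel \<Otimes>\<^sub>M borel)" and s2[measurable_cong, simp]: "sets \<pi>2 = sets (borel \<Otimes>\<^sub>M borel)"
    using couplingsD(2)[OF p1] couplingsD(2)[OF p2] by simp_all
  interpret p1: prob_space \<pi>1 using couplingsD p1 by auto
  interpret p2: prob_space \<pi>2 using couplingsD p2 by auto
  have sp2[simp]: "space \<pi>2 = UNIV" using sets_eq_imp_space_eq[OF s2] by (simp add: space_pair_measure)
  let ?T = "borel \<Otimes>\<^sub>M (borel \<Otimes>\<^sub>M borel) :: ('a \<times> 'a \<times> 'a) measure"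
  obtain \<kappa> where k: "disintegrates \<pi>1 snd borel fst borel \<kappa>"
    using disintegration[OF p1.prob_space_axioms, of snd borel fst] by auto
  then have [measurable]: "\<kappa> \<in> borel \<rightarrow>\<^sub>M prob_algebra borel" by (simp add: disintegrates_def)
  then have [measurable]: "\<kappa> \<in> borel \<rightarrow>\<^sub>M subprob_algebra borel" by (rule measurable_prob_algebraD)
  have sk[simp, measurable_cong]: "sets (\<kappa> y) = sets borel" and pk: "prob_space (\<kappa> y)" for y
    using measurable_space[of \<kappa> borel "prob_algebra borel" y] by (auto simp: space_prob_algebra)
  interpret K: prob_space "\<kappa> y" for y by (rule pk)
  have kd: "(\<integral>\<^sup>+p. g (snd p, fst p) \<partial>\<pi>1) = (\<integral>\<^sup>+p. (\<integral>\<^sup>+x. g (snd p, x) \<partial>\<kappa> (snd p)) \<partial>\<pi>1)"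
    if "g \<in> borel_measurable (borel \<Otimes>\<^sub>M borel)" for g
    using k that unfolding disintegrates_def by blast
  define \<Gamma> where "\<Gamma> = \<pi>2 \<bind> (\<lambda>p. distr (\<kappa> (fst p)) ?T (\<lambda>x. (x, p)))"
  have km: "(\<lambda>p. distr (\<kappa> (fst p)) ?T (\<lambda>x. (x, p))) \<in> \<pi>2 \<rightarrow>\<^sub>M prob_algebra ?T"
    by (rule measurable_distr_prob_space2[where M=borel]) measurable
  have km': "(\<lambda>p. distr (\<kappa> (fst p)) ?T (\<lambda>x. (x, p))) \<in> \<pi>2 \<rightarrow>\<^sub>M subprob_algebra ?T"
    by (rule measurable_prob_algebraD[OF km])
  have sG[simp, measurable_cong]: "sets \<Gamma> = sets ?T"
    unfolding \<Gamma>_def by (rule sets_bind) auto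
  have pG: "prob_space \<Gamma>"
    unfolding \<Gamma>_def by (rule p2.prob_space_bind[OF _ km']) (auto intro!: AE_I2 K.prob_space_distr)
  have I: "(\<integral>\<^sup>+w. g w \<partial>\<Gamma>) = (\<integral>\<^sup>+p. (\<integral>\<^sup>+x. g (x, p) \<partial>\<kappa> (fst p)) \<partial>\<pi>2)" if [measurable]: "g \<in> borel_measurable ?T" for g
    unfolding \<Gamma>_def by (subst nn_integral_bind[OF _ km'], measurable) (intro nn_integral_cong, subst nn_integral_distr, auto)
  have Iyz: "(\<integral>\<^sup>+w. g (snd w) \<partial>\<Gamma>) = (\<integral>\<^sup>+p. g p \<partial>\<pi>2)" if [measurable]: "g \<in> borel_measurable (borel \<Otimes>\<^sub>M borel)" for g
    by (subst I) (auto simp: K.emeasure_space_1)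
  have Ixy: "(\<integral>\<^sup>+w. g (fst w, fst (snd w)) \<partial>\<Gamma>) = (\<integral>\<^sup>+p. g p \<partial>\<pi>1)" if [measurable]: "g \<in> borel_measurable (borel \<Otimes>\<^sub>M borel)" for g
  proof -
    have m: "(\<lambda>y. \<integral>\<^sup>+x. g (x, y) \<partial>\<kappa> y) \<in> borel_measurable borel"
      by (rule nn_integral_measurable_subprob_algebra2[where N=borel]) measurable
    have "(\<integral>\<^sup>+w. g (fst w, fst (snd w)) \<partial>\<Gamma>) = (\<integral>\<^sup>+p. (\<integral>\<^sup>+x. g (x, fst p) \<partial>\<kappa> (fst p)) \<partial>\<pi>2)"
      by (subst I) auto
    also have "\<dots> = (\<integral>\<^sup>+p. (\<integral>\<^sup>+x. g (x, snd p) \<partial>\<kappa> (snd p)) \<partial>\<pi>1)"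
      using nn_integral_coupling_fst[OF p2 m] nn_integral_coupling_snd[OF p1 m] by simp
    also have "\<dots> = (\<integral>\<^sup>+p. g p \<partial>\<pi>1)"
      using kd[of "\<lambda>q. g (snd q, fst q)"] by simp
    finally show ?thesis .
  qed
  \<comment> \<open>Conditional independence in tested form: given \<open>y\<close>, a function of
    \<open>x\<close> may be replaced by its mean under the kernel.\<close>
  have CI: "(\<integral>\<^sup>+w. a (fst w) * b (snd w) \<partial>\<Gamma>) = (\<integral>\<^sup>+w. (\<integral>\<^sup>+x. a x \<partial>\<kappa> (fst (snd w))) * b (snd w) \<partial>\<Gamma>)"
    if [measurable]: "a \<in> borel_measurable borel" "b \<in> borel_measurable (borel \<Otimes>\<^sub>M borel)" for a b
  proof -
    have m[measurable]: "(\<lambda>y. \<integral>\<^sup>+x. a x \<partial>\<kappa> y) \<in> borel_measurable borel"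
      by (rule nn_integral_measurable_subprob_algebra2[where N=borel]) measurable
    show ?thesis
      by (subst I, measurable, subst I, measurable) (simp add: nn_integral_multc K.emeasure_space_1)
  qed
  have e1: "distr \<Gamma> (borel \<Otimes>\<^sub>M borel) (\<lambda>(x, y, z). (x, y)) = \<pi>1"
  proof (rule measure_eqI)
    fix A assume "A \<in> sets (distr \<Gamma> (borel \<Otimes>\<^sub>M borel) (\<lambda>(x, y, z). (x, y)))"
    then have [measurable]: "A \<in> sets (borel \<Otimes>\<^sub>M borel)" by simp
    show "emeasure (distr \<Gamma> (borel \<Otimes>\<^sub>M borel) (\<lambda>(x, y, z). (x, y))) A = emeasure \<pi>1 A"
    proof -
      have "emeasure (distr \<Gamma> (borel \<Otimes>\<^sub>M borel) (\<lambda>(x, y, z). (x, y))) A = (\<integral>\<^sup>+w. indicator A (fst w, fst (snd w)) \<partial>\<Gamma>)"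
        by (subst nn_integral_indicator[symmetric], simp, subst nn_integral_distr) (auto simp: split_beta')
      also have "\<dots> = emeasure \<pi>1 A" by (subst Ixy) auto
      finally show ?thesis .
    qed
  qed auto
  have e2: "distr \<Gamma> (borel \<Otimes>\<^sub>M borel) (\<lambda>(x, y, z). (y, z)) = \<pi>2"
  proof (rule measure_eqI)
    fix A assume "A \<in> sets (distr \<Gamma> (borel \<Otimes>\<^sub>M borel) (\<lambda>(x, y, z). (y, z)))"
    then have [measurable]: "A \<in> sets (borel \<Otimes>\<^sub>M borel)" by simp
    show "emeasure (distr \<Gamma> (borel \<Otimes>\<^sub>M borel) (\<lambda>(x, y, z). (y, z))) A = emeasure \<pi>2 A"
    proof -
      have "emeasure (distr \<Gamma> (borel \<Otimes>\<^sub>M borel) (\<lambda>(x, y, z). (y, z))) A = (\<integral>\<^sup>+w. indicator A (snd w) \<partial>\<Gamma>)"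
        by (subst nn_integral_indicator[symmetric], simp, subst nn_integral_distr) (auto simp: split_beta')
      also have "\<dots> = emeasure \<pi>2 A" by (subst Iyz) auto
      finally show ?thesis .
    qed
  qed auto
  have c1: "causal F \<Gamma> fst (\<lambda>w. snd (snd w))"
    if F: "subalgebra borel F" and ca1: "causal F \<pi>1 fst snd" and ca2: "causal F \<pi>2 fst snd" for F
  proof (rule causalI)
    fix a :: "'a \<Rightarrow> ennreal" assume a: "a \<in> borel_measurable F" "\<And>x. a x \<le> 1"
    obtain k2 where k2: "k2 \<in> borel_measurable F" "\<And>x. k2 x \<le> 1"
      "\<And>c. c \<in> borel_measurable borel \<Longrightarrow> (\<integral>\<^sup>+p. a (snd p) * c (fst p) \<partial>\<pi>2) = (\<integral>\<^sup>+p. k2 (fst p) * c (fst p) \<partial>\<pi>2)"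
      by (rule causalE[OF ca2 a]) blast
    obtain k1 where k1: "k1 \<in> borel_measurable F" "\<And>x. k1 x \<le> 1"
      "\<And>c. c \<in> borel_measurable borel \<Longrightarrow> (\<integral>\<^sup>+p. k2 (snd p) * c (fst p) \<partial>\<pi>1) = (\<integral>\<^sup>+p. k1 (fst p) * c (fst p) \<partial>\<pi>1)"
      by (rule causalE[OF ca1 k2(1,2)]) blast
    have [measurable]: "a \<in> borel_measurable borel" "k1 \<in> borel_measurable borel" "k2 \<in> borel_measurable borel"
      by (rule measurable_from_subalg[OF F], rule a k1 k2)+
    have "(\<integral>\<^sup>+w. a (snd (snd w)) * c (fst w) \<partial>\<Gamma>) = (\<integral>\<^sup>+w. k1 (fst w) * c (fst w) \<partial>\<Gamma>)"
      if [measurable]: "c \<in> borel_measurable borel" for c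
    proof -
      \<comment> \<open>The test function of \<open>x\<close> is averaged to a function of
        \<open>y\<close>, where the causality of \<open>\<pi>2\<close> applies. The average is
        undone before the causality of \<open>\<pi>1\<close> is used.\<close>
      define c' where "c' y = (\<integral>\<^sup>+x. c x \<partial>\<kappa> y)" for y
      have m[measurable]: "c' \<in> borel_measurable borel"
        unfolding c'_def by (rule nn_integral_measurable_subprob_algebra2[where N=borel]) measurable
      have "(\<integral>\<^sup>+w. a (snd (snd w)) * c (fst w) \<partial>\<Gamma>) = (\<integral>\<^sup>+w. a (snd (snd w)) * c' (fst (snd w)) \<partial>\<Gamma>)"
        using CI[of c "\<lambda>p. a (snd p)"] by (simp add: c'_def mult.commute)
      also have "\<dots> = (\<integral>\<^sup>+p. k2 (fst p) * c' (fst p) \<partial>\<pi>2)"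
        using Iyz[of "\<lambda>p. a (snd p) * c' (fst p)"] k2(3) by simp
      also have "\<dots> = (\<integral>\<^sup>+w. k2 (fst (snd w)) * c' (fst (snd w)) \<partial>\<Gamma>)"
        using Iyz[of "\<lambda>p. k2 (fst p) * c' (fst p)"] by simp
      also have "\<dots> = (\<integral>\<^sup>+w. k2 (fst (snd w)) * c (fst w) \<partial>\<Gamma>)"
        using CI[of c "\<lambda>p. k2 (fst p)"] by (simp add: c'_def mult.commute)
      also have "\<dots> = (\<integral>\<^sup>+p. k1 (fst p) * c (fst p) \<partial>\<pi>1)"
        using Ixy[of "\<lambda>p. k2 (snd p) * c (fst p)"] k1(3) by simp
      also have "\<dots> = (\<integral>\<^sup>+w. k1 (fst w) * c (fst w) \<partial>\<Gamma>)"
        using Ixy[of "\<lambda>p. k1 (fst p) * c (fst p)"] by simp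
      finally show ?thesis .
    qed
    with k1(1,2) show "\<exists>k\<in>borel_measurable F. (\<forall>x. k x \<le> 1) \<and>
       (\<forall>c\<in>borel_measurable borel. (\<integral>\<^sup>+w. a (snd (snd w)) * c (fst w) \<partial>\<Gamma>) = (\<integral>\<^sup>+w. k (fst w) * c (fst w) \<partial>\<Gamma>))"
      by blast
  qed
  have c2: "causal F \<Gamma> (\<lambda>w. snd (snd w)) fst"
    if F: "subalgebra borel F" and ca1: "causal F \<pi>1 snd fst" and ca2: "causal F \<pi>2 snd fst" for F
  proof (rule causalI)
    fix a :: "'a \<Rightarrow> ennreal" assume a: "a \<in> borel_measurable F" "\<And>x. a x \<le> 1"
    obtain k1 where k1: "k1 \<in> borel_measurable F" "\<And>x. k1 x \<le> 1"
      "\<And>c. c \<in> borel_measurable borel \<Longrightarrow> (\<integral>\<^sup>+p. a (fst p) * c (snd p) \<partial>\<pi>1) = (\<integral>\<^sup>+p. k1 (snd p) * c (snd p) \<partial>\<pi>1)"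
      by (rule causalE[OF ca1 a]) blast
    obtain k2 where k2: "k2 \<in> borel_measurable F" "\<And>x. k2 x \<le> 1"
      "\<And>c. c \<in> borel_measurable borel \<Longrightarrow> (\<integral>\<^sup>+p. k1 (fst p) * c (snd p) \<partial>\<pi>2) = (\<integral>\<^sup>+p. k2 (snd p) * c (snd p) \<partial>\<pi>2)"
      by (rule causalE[OF ca2 k1(1,2)]) blast
    have [measurable]: "a \<in> borel_measurable borel" "k1 \<in> borel_measurable borel" "k2 \<in> borel_measurable borel"
      by (rule measurable_from_subalg[OF F], rule a k1 k2)+
    define a' where "a' y = (\<integral>\<^sup>+x. a x \<partial>\<kappa> y)" for y
    have m[measurable]: "a' \<in> borel_measurable borel"
      unfolding a'_def by (rule nn_integral_measurable_subprob_algebra2[where N=borel]) measurable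
    have [measurable_cong]: "sets \<nu> = sets borel" by (rule couplingsD[OF p1])
    interpret nu: prob_space \<nu> by (rule couplingsD[OF p1])
    \<comment> \<open>The kernel average \<open>a'\<close> is only known to be Borel, while
      \<open>k1\<close> is measurable for \<open>F\<close>. Both are versions of the same
      conditional expectation given \<open>y\<close>, so they agree \<nu>-almost everywhere.\<close>
    have ae: "AE y in \<nu>. a' y = k1 y"
    proof (rule AE_eq_if_nn_integral_eq)
      have "(\<integral>\<^sup>+x. k1 x \<partial>\<nu>) \<le> (\<integral>\<^sup>+x. 1 \<partial>\<nu>)" by (intro nn_integral_mono k1)
      then show "(\<integral>\<^sup>+x. k1 x \<partial>\<nu>) < \<infinity>" by (simp add: nu.emeasure_space_1 le_less_trans)
      fix A assume "A \<in> sets \<nu>"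
      then have [measurable]: "A \<in> sets borel" using couplingsD(6)[OF p1] by simp
      have "(\<integral>\<^sup>+x. a' x * indicator A x \<partial>\<nu>) = (\<integral>\<^sup>+p. a' (fst p) * indicator A (fst p) \<partial>\<pi>2)"
        by (rule nn_integral_coupling_fst[OF p2, symmetric]) measurable
      also have "\<dots> = (\<integral>\<^sup>+w. a' (fst (snd w)) * indicator A (fst (snd w)) \<partial>\<Gamma>)"
        by (rule Iyz[symmetric]) measurable
      also have "\<dots> = (\<integral>\<^sup>+w. a (fst w) * indicator A (fst (snd w)) \<partial>\<Gamma>)"
        using CI[of a "\<lambda>p. indicator A (fst p)"] by (simp add: a'_def)
      also have "\<dots> = (\<integral>\<^sup>+p. a (fst p) * indicator A (snd p) \<partial>\<pi>1)"
        using Ixy[of "\<lambda>p. a (fst p) * indicator A (snd p)"] by simp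
      also have "\<dots> = (\<integral>\<^sup>+p. k1 (snd p) * indicator A (snd p) \<partial>\<pi>1)"
        by (rule k1(3)) measurable
      also have "\<dots> = (\<integral>\<^sup>+x. k1 x * indicator A x \<partial>\<nu>)"
        by (rule nn_integral_coupling_snd[OF p1]) measurable
      finally show "(\<integral>\<^sup>+x. a' x * indicator A x \<partial>\<nu>) = (\<integral>\<^sup>+x. k1 x * indicator A x \<partial>\<nu>)" .
    qed measurable
    have "AE y in distr \<pi>2 borel fst. a' y = k1 y"
      unfolding couplingsD(3)[OF p2] by (rule ae)
    then have ae': "AE p in \<pi>2. a' (fst p) = k1 (fst p)"
      by (subst (asm) AE_distr_iff) auto
    have "(\<integral>\<^sup>+w. a (fst w) * c (snd (snd w)) \<partial>\<Gamma>) = (\<integral>\<^sup>+w. k2 (snd (snd w)) * c (snd (snd w)) \<partial>\<Gamma>)"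
      if [measurable]: "c \<in> borel_measurable borel" for c
    proof -
      have "(\<integral>\<^sup>+w. a (fst w) * c (snd (snd w)) \<partial>\<Gamma>) = (\<integral>\<^sup>+w. a' (fst (snd w)) * c (snd (snd w)) \<partial>\<Gamma>)"
        using CI[of a "\<lambda>p. c (snd p)"] by (simp add: a'_def)
      also have "\<dots> = (\<integral>\<^sup>+p. a' (fst p) * c (snd p) \<partial>\<pi>2)"
        by (rule Iyz) measurable
      also have "\<dots> = (\<integral>\<^sup>+p. k1 (fst p) * c (snd p) \<partial>\<pi>2)"
        using ae' by (intro nn_integral_cong_AE) auto
      also have "\<dots> = (\<integral>\<^sup>+p. k2 (snd p) * c (snd p) \<partial>\<pi>2)"
        by (rule k2(3)) measurable
      also have "\<dots> = (\<integral>\<^sup>+w. k2 (snd (snd w)) * c (snd (snd w)) \<partial>\<Gamma>)"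
        by (rule Iyz[symmetric]) measurable
      finally show ?thesis .
    qed
    with k2(1,2) show "\<exists>k\<in>borel_measurable F. (\<forall>x. k x \<le> 1) \<and>
       (\<forall>c\<in>borel_measurable borel. (\<integral>\<^sup>+w. a (fst w) * c (snd (snd w)) \<partial>\<Gamma>) = (\<integral>\<^sup>+w. k (snd (snd w)) * c (snd (snd w)) \<partial>\<Gamma>))"
      by blast
  qed
  show thesis by (rule that[OF pG sG e1 e2 c1 c2])
qed

section \<open>Couplings of densities that share a conditional law\<close>

text \<open>With both variables the identity, \<open>dis\<close> makes \<open>\<kappa> x\<close> the
  regular conditional law of \<rho> given the sub-sigma-algebra \<open>G\<close>, evaluated at
  \<open>x\<close>.\<close>

locale conditional_kernel = prob_space \<rho> for \<rho> :: "'a::euclidean_space measure" +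
  fixes G :: "'a measure" and \<kappa> :: "'a \<Rightarrow> 'a measure"
  assumes sets_rho[measurable_cong]: "sets \<rho> = sets borel"
    and G: "subalgebra borel G"
    and dis: "disintegrates \<rho> (\<lambda>x. x) G (\<lambda>x. x) borel \<kappa>"
begin

lemma kernel_G: "\<kappa> \<in> G \<rightarrow>\<^sub>M prob_algebra borel"
  using dis by (simp add: disintegrates_def)

lemma kernel[measurable]: "\<kappa> \<in> borel \<rightarrow>\<^sub>M prob_algebra borel"
  by (rule measurable_from_subalg[OF G kernel_G])

lemma kernel_sub[measurable]: "\<kappa> \<in> borel \<rightarrow>\<^sub>M subprob_algebra borel"
  by (rule measurable_prob_algebraD) measurable

lemma sets_kernel'[simp, measurable_cong]: "sets (\<kappa> y) = sets borel"
  and prob_kernel: "prob_space (\<kappa> y)"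
  using measurable_space[OF kernel, of y] by (auto simp: space_prob_algebra)

lemma cond_G:
  assumes "s \<in> borel_measurable borel"
  shows "(\<lambda>x. \<integral>\<^sup>+y. s y \<partial>\<kappa> x) \<in> borel_measurable G"
  by (rule nn_integral_measurable_subprob_algebra2[where N=borel])
    (use assms kernel_G in \<open>auto intro: measurable_prob_algebraD\<close>)

lemma from_G: "q \<in> borel_measurable G \<Longrightarrow> q \<in> borel_measurable borel"
  by (rule measurable_from_subalg[OF G])

lemma cond:
  assumes q: "q \<in> borel_measurable G" and [measurable]: "s \<in> borel_measurable borel"
  shows "(\<integral>\<^sup>+x. q x * (\<integral>\<^sup>+y. s y \<partial>\<kappa> x) \<partial>\<rho>) = (\<integral>\<^sup>+x. q x * s x \<partial>\<rho>)"
proof -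
  have m: "(\<lambda>p. q (fst p) * s (snd p)) \<in> borel_measurable (G \<Otimes>\<^sub>M borel)"
    using q by measurable
  have "(\<integral>\<^sup>+x. q x * s x \<partial>\<rho>) = (\<integral>\<^sup>+x. (\<integral>\<^sup>+y. q x * s y \<partial>\<kappa> x) \<partial>\<rho>)"
    using bspec[OF conjunct2[OF dis[unfolded disintegrates_def]] m] by simp
  also have "\<dots> = (\<integral>\<^sup>+x. q x * (\<integral>\<^sup>+y. s y \<partial>\<kappa> x) \<partial>\<rho>)"
    by (simp add: nn_integral_cmult)
  finally show ?thesis by simp
qed

lemma subalg: "subalgebra \<rho> G"
  using G sets_rho sets_eq_imp_space_eq[OF sets_rho] by (simp add: subalgebra_def)

text \<open>Both functions are measurable for \<open>G\<close>, so they are compared in the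
  restriction of \<rho> to \<open>G\<close>, where the sets of \<open>G\<close> are all the
  measurable sets.\<close>

lemma AE_eq_G:
  fixes f g :: "'a \<Rightarrow> ennreal"
  assumes f: "f \<in> borel_measurable G" and g: "g \<in> borel_measurable G"
    and fin: "(\<integral>\<^sup>+x. g x \<partial>\<rho>) < \<infinity>"
    and eq: "\<And>A. A \<in> sets G \<Longrightarrow> (\<integral>\<^sup>+x. f x * indicator A x \<partial>\<rho>) = (\<integral>\<^sup>+x. g x * indicator A x \<partial>\<rho>)"
  shows "AE x in \<rho>. f x = g x"
proof (rule AE_restr_to_subalg[OF subalg])
  have m: "h \<in> borel_measurable (restr_to_subalg \<rho> G) \<longleftrightarrow> h \<in> borel_measurable G" for h :: "'a \<Rightarrow> ennreal"
    by (rule measurable_cong_sets[OF sets_restr_to_subalg[OF subalg] refl, THEN arg_cong[where f="\<lambda>X. h \<in> X"]])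
  show "AE x in restr_to_subalg \<rho> G. f x = g x"
  proof (rule AE_eq_if_nn_integral_eq)
    show "f \<in> borel_measurable (restr_to_subalg \<rho> G)" "g \<in> borel_measurable (restr_to_subalg \<rho> G)"
      using f g m by auto
    show "integral\<^sup>N (restr_to_subalg \<rho> G) g < \<infinity>"
      using fin by (subst nn_integral_subalgebra2[OF subalg g])
    fix A assume "A \<in> sets (restr_to_subalg \<rho> G)"
    then have A[measurable]: "A \<in> sets G" by (simp add: sets_restr_to_subalg[OF subalg])
    show "(\<integral>\<^sup>+x. f x * indicator A x \<partial>restr_to_subalg \<rho> G) = (\<integral>\<^sup>+x. g x * indicator A x \<partial>restr_to_subalg \<rho> G)"
      using f g by (subst (1 2) nn_integral_subalgebra2[OF subalg]) (auto simp: eq[OF A])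
  qed
qed

lemma cond_unique:
  assumes f: "f \<in> borel_measurable G" and s[measurable]: "s \<in> borel_measurable borel" and fin: "(\<integral>\<^sup>+x. s x \<partial>\<rho>) < \<infinity>"
    and eq: "\<And>A. A \<in> sets G \<Longrightarrow> (\<integral>\<^sup>+x. f x * indicator A x \<partial>\<rho>) = (\<integral>\<^sup>+x. s x * indicator A x \<partial>\<rho>)"
  shows "AE x in \<rho>. f x = (\<integral>\<^sup>+y. s y \<partial>\<kappa> x)"
proof (rule AE_eq_G[OF f cond_G[OF s]])
  show "(\<integral>\<^sup>+x. \<integral>\<^sup>+y. s y \<partial>\<kappa> x \<partial>\<rho>) < \<infinity>"
    using cond[of "\<lambda>_. 1" s] fin by simp
  fix A assume A[measurable]: "A \<in> sets G"
  show "(\<integral>\<^sup>+x. f x * indicator A x \<partial>\<rho>) = (\<integral>\<^sup>+x. (\<integral>\<^sup>+y. s y \<partial>\<kappa> x) * indicator A x \<partial>\<rho>)"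
    using cond[of "indicator A" s] by (simp add: eq mult.commute)
qed

text \<open>The set where \<open>m\<close> vanishes lies in \<open>G\<close>, so the integral of
  \<alpha> over it equals that of its conditional expectation, which is 0.\<close>

lemma AE_zero_if_cond_zero:
  assumes m: "m \<in> borel_measurable G" and [measurable]: "\<alpha> \<in> borel_measurable borel"
    and m\<alpha>: "AE x in \<rho>. m x = (\<integral>\<^sup>+y. \<alpha> y \<partial>\<kappa> x)"
  shows "AE x in \<rho>. m x = 0 \<longrightarrow> \<alpha> x = 0"
proof -
  have [measurable]: "m \<in> borel_measurable borel" by (rule from_G[OF m])
  have "(\<integral>\<^sup>+x. indicator {x. m x = 0} x * \<alpha> x \<partial>\<rho>) = (\<integral>\<^sup>+x. indicator {x. m x = 0} x * (\<integral>\<^sup>+y. \<alpha> y \<partial>\<kappa> x) \<partial>\<rho>)"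
  proof (rule cond[symmetric])
    have "space G = UNIV" using G by (simp add: subalgebra_def)
    then have "{x. m x = 0} = m -` {0} \<inter> space G" by auto
    then have [measurable]: "{x. m x = 0} \<in> sets G" using m by simp
    show "indicator {x. m x = 0} \<in> borel_measurable G" by measurable
  qed measurable
  also have "\<dots> = (\<integral>\<^sup>+x. 0 \<partial>\<rho>)"
    using m\<alpha> by (intro nn_integral_cong_AE) (auto split: split_indicator)
  finally have "(\<integral>\<^sup>+x. indicator {x. m x = 0} x * \<alpha> x \<partial>\<rho>) = 0" by simp
  then have "AE x in \<rho>. indicator {x. m x = 0} x * \<alpha> x = 0"
    by (subst (asm) nn_integral_0_iff_AE) auto
  then show ?thesis by eventually_elim (auto split: split_indicator_asm)
qed

text \<open>The left side is what the coupling below yields for the mean of \<open>a\<close> of the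
  second point, as a density in the first point. Relative to the density
  \<open>mn + \<alpha>\<close> of the first marginal it has to leave a function measurable for
  \<open>F\<close>. For \<open>F\<close> below \<open>G\<close> the function \<open>a\<close> can be
  taken out of the kernel and \<open>k = a\<close>. For \<open>F\<close> above \<open>H\<close>
  every ingredient is measurable for \<open>F\<close>. These two cases exhaust a filtration in which
  \<open>H\<close> follows \<open>G\<close> immediately.\<close>

lemma causal_density:
  fixes mn \<alpha> \<beta> m a :: "'a \<Rightarrow> ennreal"
  assumes GH: "subalgebra H G" and H: "subalgebra borel H"
    and mn: "mn \<in> borel_measurable H" and \<alpha>: "\<alpha> \<in> borel_measurable H" and \<beta>[measurable]: "\<beta> \<in> borel_measurable borel"
    and fin: "\<And>x. mn x + \<alpha> x < \<top>" and I\<beta>: "(\<integral>\<^sup>+x. \<beta> x \<partial>\<rho>) < \<infinity>"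
    and m: "m \<in> borel_measurable G" and m\<alpha>: "AE x in \<rho>. m x = (\<integral>\<^sup>+y. \<alpha> y \<partial>\<kappa> x)" and m\<beta>: "AE x in \<rho>. m x = (\<integral>\<^sup>+y. \<beta> y \<partial>\<kappa> x)"
    and F: "subalgebra borel F" "subalgebra G F \<or> subalgebra F H"
    and a: "a \<in> borel_measurable F" "\<And>x. a x \<le> 1"
  shows "\<exists>k\<in>borel_measurable F. (\<forall>x. k x \<le> 1) \<and>
    (AE x in \<rho>. mn x * a x + (\<integral>\<^sup>+y. \<beta> y * a y \<partial>\<kappa> x) / m x * \<alpha> x = k x * (mn x + \<alpha> x))"
proof -
  have [measurable]: "a \<in> borel_measurable borel" by (rule measurable_from_subalg[OF F(1) a(1)])
  have [measurable]: "\<alpha> \<in> borel_measurable borel" by (rule measurable_from_subalg[OF H \<alpha>])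
  have mb[measurable]: "m \<in> borel_measurable borel" by (rule from_G[OF m])
  have cG: "(\<lambda>x. \<integral>\<^sup>+y. \<beta> y * a y \<partial>\<kappa> x) \<in> borel_measurable G" by (rule cond_G) measurable
  have Im: "(\<integral>\<^sup>+x. m x \<partial>\<rho>) < \<infinity>"
  proof -
    have "(\<integral>\<^sup>+x. m x \<partial>\<rho>) = (\<integral>\<^sup>+x. \<integral>\<^sup>+y. \<beta> y \<partial>\<kappa> x \<partial>\<rho>)" by (rule nn_integral_cong_AE[OF m\<beta>])
    then show ?thesis using cond[of "\<lambda>_. 1" \<beta>] I\<beta> by simp
  qed
  have mfin: "AE x in \<rho>. m x < \<top>"
    using nn_integral_PInf_AE[of m \<rho>] Im by (auto simp: less_top)
  have le: "AE x in \<rho>. (\<integral>\<^sup>+y. \<beta> y * a y \<partial>\<kappa> x) \<le> m x"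
    using m\<beta>
  proof eventually_elim
    case (elim x)
    have "(\<integral>\<^sup>+y. \<beta> y * a y \<partial>\<kappa> x) \<le> (\<integral>\<^sup>+y. \<beta> y * 1 \<partial>\<kappa> x)"
      by (intro nn_integral_mono mult_left_mono a) simp
    then show ?case using elim by simp
  qed
  from F(2) show ?thesis
  proof
    assume FG: "subalgebra G F"
    have aG: "a \<in> borel_measurable G" by (rule measurable_from_subalg[OF FG a(1)])
    have "AE x in \<rho>. m x * a x = (\<integral>\<^sup>+y. \<beta> y * a y \<partial>\<kappa> x)"
    proof (rule cond_unique)
      show "(\<lambda>x. m x * a x) \<in> borel_measurable G" using m aG by measurable
      have "(\<integral>\<^sup>+x. \<beta> x * a x \<partial>\<rho>) \<le> (\<integral>\<^sup>+x. \<beta> x * 1 \<partial>\<rho>)"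
        by (intro nn_integral_mono mult_left_mono a) simp
      then show "(\<integral>\<^sup>+x. \<beta> x * a x \<partial>\<rho>) < \<infinity>" using I\<beta> by simp
      fix A assume [measurable]: "A \<in> sets G"
      have "(\<integral>\<^sup>+x. m x * a x * indicator A x \<partial>\<rho>) = (\<integral>\<^sup>+x. (a x * indicator A x) * (\<integral>\<^sup>+y. \<beta> y \<partial>\<kappa> x) \<partial>\<rho>)"
        using m\<beta> by (intro nn_integral_cong_AE) (auto simp: mult_ac)
      also have "\<dots> = (\<integral>\<^sup>+x. (a x * indicator A x) * \<beta> x \<partial>\<rho>)"
        using aG by (intro cond) auto
      finally show "(\<integral>\<^sup>+x. m x * a x * indicator A x \<partial>\<rho>) = (\<integral>\<^sup>+x. \<beta> x * a x * indicator A x \<partial>\<rho>)"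
        by (simp add: mult_ac)
    qed measurable
    moreover have "AE x in \<rho>. m x = 0 \<longrightarrow> \<alpha> x = 0"
      by (rule AE_zero_if_cond_zero[OF m _ m\<alpha>]) measurable
    ultimately have "AE x in \<rho>. mn x * a x + (\<integral>\<^sup>+y. \<beta> y * a y \<partial>\<kappa> x) / m x * \<alpha> x = a x * (mn x + \<alpha> x)"
      using mfin
    proof eventually_elim
      case (elim x)
      show ?case
      proof (cases "m x = 0")
        case True
        then show ?thesis using elim by (simp add: mult.commute)
      next
        case False
        have "(\<integral>\<^sup>+y. \<beta> y * a y \<partial>\<kappa> x) / m x = a x * m x / m x"
          using elim(1) by (simp add: mult.commute)
        also have "\<dots> = a x" using elim False by (intro mult_divide_eq_ennreal) auto
        finally show ?thesis by (simp add: distrib_left mult.commute)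
      qed
    qed
    then show ?thesis using a by blast
  next
    assume HF: "subalgebra F H"
    define w where "w x = mn x * a x + (\<integral>\<^sup>+y. \<beta> y * a y \<partial>\<kappa> x) / m x * \<alpha> x" for x
    have wF: "w \<in> borel_measurable F"
      unfolding w_def using a(1) measurable_from_subalg[OF HF mn] measurable_from_subalg[OF HF \<alpha>]
        measurable_from_subalg[OF HF measurable_from_subalg[OF GH m]] measurable_from_subalg[OF HF measurable_from_subalg[OF GH cG]]
      by measurable
    \<comment> \<open>Where \<open>mn + \<alpha>\<close> vanishes, \<open>w\<close> vanishes almost
      surely as well, so any value of the quotient is consistent there. The cut keeps
      \<open>k\<close> below 1 everywhere.\<close>
    define k where "k x = min 1 (w x / (mn x + \<alpha> x))" for x
    have kF: "k \<in> borel_measurable F"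
      unfolding k_def using wF measurable_from_subalg[OF HF mn] measurable_from_subalg[OF HF \<alpha>] by measurable
    have "AE x in \<rho>. w x = k x * (mn x + \<alpha> x)"
      using le mfin
    proof eventually_elim
      case (elim x)
      have "(\<integral>\<^sup>+y. \<beta> y * a y \<partial>\<kappa> x) / m x \<le> 1"
      proof (cases "m x = 0")
        case False
        then show ?thesis using elim by (intro divide_le_posI_ennreal) (auto simp: zero_less_iff_neq_zero)
      qed (use elim in simp)
      then have wle: "w x \<le> mn x + \<alpha> x"
        unfolding w_def using a(2)[of x] mult_left_mono[of "a x" 1 "mn x"] mult_right_mono[of "(\<integral>\<^sup>+y. \<beta> y * a y \<partial>\<kappa> x) / m x" 1 "\<alpha> x"]
        by (intro add_mono) auto
      show ?case
      proof (cases "mn x + \<alpha> x = 0")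
        case True
        then show ?thesis using wle by simp
      next
        case False
        then have "w x / (mn x + \<alpha> x) \<le> 1" 
          using wle by (intro divide_le_posI_ennreal) (auto simp: zero_less_iff_neq_zero)
        then have "k x = w x / (mn x + \<alpha> x)" by (simp add: k_def min_def)
        then show ?thesis using False fin[of x] by (simp add: ennreal_divide_times mult_divide_eq_ennreal)
      qed
    qed
    then show ?thesis using kF by (auto simp: w_def k_def intro!: bexI[of _ k])
  qed
qed

text \<open>
  With \<open>mn = min u v\<close>, \<open>\<alpha> = u - mn\<close>, \<open>\<beta> = v - mn\<close> and \<open>m\<close> the common conditional expectation of \<open>\<alpha>\<close> and \<open>\<beta>\<close>
  given \<open>G\<close>, the measure below keeps the common part on the diagonal and couples the remainders
  independently given \<open>G\<close>. Where \<open>m = 0\<close> also \<open>\<alpha> = 0\<close> almost surely, so \<open>\<alpha> / m = 0 / 0 = 0\<close> is harmless.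
\<close>

lemma step_measure:
  fixes mn \<alpha> \<beta> :: "'a \<Rightarrow> ennreal"
  assumes [measurable]: "mn \<in> borel_measurable borel" "\<alpha> \<in> borel_measurable borel" "\<beta> \<in> borel_measurable borel" "m \<in> borel_measurable borel"
  obtains \<pi> where "sets \<pi> = sets (borel \<Otimes>\<^sub>M borel)"
    "\<And>g. g \<in> borel_measurable (borel \<Otimes>\<^sub>M borel) \<Longrightarrow>
       (\<integral>\<^sup>+p. g p \<partial>\<pi>) = (\<integral>\<^sup>+x. mn x * g (x, x) + \<alpha> x / m x * (\<integral>\<^sup>+y. \<beta> y * g (x, y) \<partial>\<kappa> x) \<partial>\<rho>)"
proof -
  let ?P = "borel \<Otimes>\<^sub>M borel :: ('a \<times> 'a) measure"
  interpret K: prob_space "\<kappa> y" for y by (rule prob_kernel)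
  define \<gamma> where "\<gamma> = \<rho> \<bind> (\<lambda>x. distr (\<kappa> x) ?P (\<lambda>y. (x, y)))"
  have km: "(\<lambda>x. distr (\<kappa> x) ?P (\<lambda>y. (x, y))) \<in> \<rho> \<rightarrow>\<^sub>M subprob_algebra ?P"
    by (rule measurable_distr2[where M=borel]) measurable
  have sg[simp, measurable_cong]: "sets \<gamma> = sets ?P"
    unfolding \<gamma>_def using not_empty by (intro sets_bind) auto
  interpret g: prob_space \<gamma>
    unfolding \<gamma>_def by (rule prob_space_bind[OF _ km]) (auto intro!: AE_I2 K.prob_space_distr)
  have I\<gamma>: "(\<integral>\<^sup>+p. g p \<partial>\<gamma>) = (\<integral>\<^sup>+x. (\<integral>\<^sup>+y. g (x, y) \<partial>\<kappa> x) \<partial>\<rho>)" if [measurable]: "g \<in> borel_measurable ?P" for g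
    unfolding \<gamma>_def by (subst nn_integral_bind[OF _ km], measurable) (intro nn_integral_cong, subst nn_integral_distr, auto)
  let ?B = "count_space (UNIV :: bool set)"
  interpret B: sigma_finite_measure ?B by (rule sigma_finite_measure_count_space)
  \<comment> \<open>The flag realizes the sum of two measures as a single image. \<open>True\<close>
    carries the diagonal part, whose density depends on the first point only, and
    \<open>False\<close> carries the remainders, which are independent given
    \<open>G\<close>.\<close>
  define D where "D q = (if snd q then mn (fst (fst q)) else \<alpha> (fst (fst q)) / m (fst (fst q)) * \<beta> (snd (fst q)))" for q :: "('a \<times> 'a) \<times> bool"
  define T where "T q = (if snd q then (fst (fst q), fst (fst q)) else fst q)" for q :: "('a \<times> 'a) \<times> bool"
  have [measurable]: "D \<in> borel_measurable (\<gamma> \<Otimes>\<^sub>M ?B)" unfolding D_def by measurable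
  have [measurable]: "T \<in> \<gamma> \<Otimes>\<^sub>M ?B \<rightarrow>\<^sub>M ?P" unfolding T_def by measurable
  define \<pi> where "\<pi> = distr (density (\<gamma> \<Otimes>\<^sub>M ?B) D) ?P T"
  have "(\<integral>\<^sup>+p. g p \<partial>\<pi>) = (\<integral>\<^sup>+x. mn x * g (x, x) + \<alpha> x / m x * (\<integral>\<^sup>+y. \<beta> y * g (x, y) \<partial>\<kappa> x) \<partial>\<rho>)"
    if [measurable]: "g \<in> borel_measurable ?P" for g
  proof -
    have "(\<integral>\<^sup>+p. g p \<partial>\<pi>) = (\<integral>\<^sup>+q. D q * g (T q) \<partial>(\<gamma> \<Otimes>\<^sub>M ?B))"
      unfolding \<pi>_def by (simp add: nn_integral_distr nn_integral_density)
    also have "\<dots> = (\<integral>\<^sup>+p. (\<integral>\<^sup>+b. D (p, b) * g (T (p, b)) \<partial>?B) \<partial>\<gamma>)"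
      by (rule B.nn_integral_fst[symmetric]) measurable
    also have "\<dots> = (\<integral>\<^sup>+p. mn (fst p) * g (fst p, fst p) + \<alpha> (fst p) / m (fst p) * \<beta> (snd p) * g p \<partial>\<gamma>)"
      by (simp add: nn_integral_count_space_finite UNIV_bool D_def T_def add.commute)
    also have "\<dots> = (\<integral>\<^sup>+x. (\<integral>\<^sup>+y. mn x * g (x, x) + \<alpha> x / m x * (\<beta> y * g (x, y)) \<partial>\<kappa> x) \<partial>\<rho>)"
      by (subst I\<gamma>) (auto simp: mult.assoc)
    also have "\<dots> = (\<integral>\<^sup>+x. mn x * g (x, x) + \<alpha> x / m x * (\<integral>\<^sup>+y. \<beta> y * g (x, y) \<partial>\<kappa> x) \<partial>\<rho>)"
      by (subst nn_integral_add) (auto simp: nn_integral_cmult K.emeasure_space_1)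
    finally show ?thesis .
  qed
  then show thesis by (intro that[of \<pi>]) (auto simp: \<pi>_def)
qed

text \<open>Equal integrals over \<open>G\<close> give \<alpha> and \<beta> the same conditional
  expectation \<open>m\<close>. This makes the construction symmetric in the two coordinates, so the
  second marginal and the second causality follow like the first ones. Only the part outside
  \<open>mn\<close> can leave the diagonal.\<close>

lemma step_coupling:
  fixes u v :: "'a \<Rightarrow> ennreal"
  assumes GH: "subalgebra H G" and H: "subalgebra borel H"
    and u: "u \<in> borel_measurable H" "\<And>x. u x < \<top>" "(\<integral>\<^sup>+x. u x \<partial>\<rho>) = 1"
    and v: "v \<in> borel_measurable H" "\<And>x. v x < \<top>"
    and uv: "\<And>A. A \<in> sets G \<Longrightarrow> (\<integral>\<^sup>+x. u x * indicator A x \<partial>\<rho>) = (\<integral>\<^sup>+x. v x * indicator A x \<partial>\<rho>)"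
  obtains \<pi> where "\<pi> \<in> couplings (density \<rho> u) (density \<rho> v)"
    "emeasure \<pi> {p. fst p \<noteq> snd p} \<le> (\<integral>\<^sup>+x. u x - v x \<partial>\<rho>)"
    "\<And>F. subalgebra borel F \<Longrightarrow> subalgebra G F \<or> subalgebra F H \<Longrightarrow> causal F \<pi> fst snd \<and> causal F \<pi> snd fst"
proof -
  let ?P = "borel \<Otimes>\<^sub>M borel :: ('a \<times> 'a) measure"
  interpret K: prob_space "\<kappa> y" for y by (rule prob_kernel)
  have fromH: "h \<in> borel_measurable borel" if "h \<in> borel_measurable H" for h :: "'a \<Rightarrow> ennreal"
    by (rule measurable_from_subalg[OF H that])
  have [measurable]: "u \<in> borel_measurable borel" "v \<in> borel_measurable borel" using fromH[OF u(1)] fromH[OF v(1)] .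
  have sUNIV: "space G = UNIV" using G by (simp add: subalgebra_def)
  have sr: "space \<rho> = UNIV" using sets_eq_imp_space_eq[OF sets_rho] by simp
  have v1: "(\<integral>\<^sup>+x. v x \<partial>\<rho>) = 1"
    using uv[OF sets.top] by (simp add: sUNIV u(3))
  define mn \<alpha> \<beta> m where "mn x = min (u x) (v x)" and "\<alpha> x = u x - v x" and "\<beta> x = v x - u x"
    and "m x = (\<integral>\<^sup>+y. \<beta> y \<partial>\<kappa> x)" for x
  have H': "mn \<in> borel_measurable H" "\<alpha> \<in> borel_measurable H" "\<beta> \<in> borel_measurable H"
    unfolding mn_def \<alpha>_def \<beta>_def using u(1) v(1) by measurable
  have [measurable]: "mn \<in> borel_measurable borel" "\<alpha> \<in> borel_measurable borel" "\<beta> \<in> borel_measurable borel"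
    using fromH[OF H'(1)] fromH[OF H'(2)] fromH[OF H'(3)] by simp_all
  have mG: "m \<in> borel_measurable G" unfolding m_def by (rule cond_G) measurable
  have [measurable]: "m \<in> borel_measurable borel" by (rule from_G[OF mG])
  have ua: "mn x + \<alpha> x = u x" and vb: "mn x + \<beta> x = v x" for x
  proof -
    have *: "min a b + (a - b) = a" if "b < \<top>" for a b :: ennreal
    proof (cases "a \<le> b")
      case True
      then have "a - b = 0" using that by (subst diff_eq_0_iff_ennreal) auto
      then show ?thesis using True by simp
    next
      case False
      then have "b + (a - b) = a" by (intro add_diff_inverse_ennreal) simp
      then show ?thesis using False by simp
    qed
    show "mn x + \<alpha> x = u x" unfolding mn_def \<alpha>_def by (rule *[OF v(2)])
    show "mn x + \<beta> x = v x" unfolding mn_def \<beta>_def by (subst min.commute) (rule *[OF u(2)])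
  qed
  have I\<alpha>: "(\<integral>\<^sup>+x. \<alpha> x \<partial>\<rho>) < \<infinity>"
  proof -
    have "(\<integral>\<^sup>+x. \<alpha> x \<partial>\<rho>) \<le> (\<integral>\<^sup>+x. u x \<partial>\<rho>)" by (intro nn_integral_mono) (simp add: \<alpha>_def diff_le_self_ennreal)
    then show ?thesis using u(3) by (simp add: le_less_trans)
  qed
  have I\<beta>: "(\<integral>\<^sup>+x. \<beta> x \<partial>\<rho>) < \<infinity>"
  proof -
    have "(\<integral>\<^sup>+x. \<beta> x \<partial>\<rho>) \<le> (\<integral>\<^sup>+x. v x \<partial>\<rho>)" by (intro nn_integral_mono) (simp add: \<beta>_def diff_le_self_ennreal)
    then show ?thesis using v1 by (simp add: le_less_trans)
  qed
  have Imn: "(\<integral>\<^sup>+x. mn x * indicator A x \<partial>\<rho>) < \<infinity>" for A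
  proof -
    have "(\<integral>\<^sup>+x. mn x * indicator A x \<partial>\<rho>) \<le> (\<integral>\<^sup>+x. u x \<partial>\<rho>)"
      by (intro nn_integral_mono) (auto simp: mn_def split: split_indicator)
    then show ?thesis using u(3) by (simp add: le_less_trans)
  qed
  have m\<beta>: "AE x in \<rho>. m x = (\<integral>\<^sup>+y. \<beta> y \<partial>\<kappa> x)" by (simp add: m_def)
  \<comment> \<open>Both \<open>u\<close> and \<open>v\<close> contain the common part
    \<open>mn\<close>, whose integral is finite and cancels.\<close>
  have m\<alpha>: "AE x in \<rho>. m x = (\<integral>\<^sup>+y. \<alpha> y \<partial>\<kappa> x)"
  proof (rule cond_unique[OF mG _ I\<alpha>])
    fix A assume A[measurable]: "A \<in> sets G"
    then have [measurable]: "A \<in> sets borel" using G by (auto simp: subalgebra_def)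
    have "(\<integral>\<^sup>+x. mn x * indicator A x \<partial>\<rho>) + (\<integral>\<^sup>+x. \<alpha> x * indicator A x \<partial>\<rho>) = (\<integral>\<^sup>+x. u x * indicator A x \<partial>\<rho>)"
      by (subst nn_integral_add[symmetric]) (auto simp: ua distrib_right[symmetric])
    also have "\<dots> = (\<integral>\<^sup>+x. v x * indicator A x \<partial>\<rho>)" by (rule uv[OF A])
    also have "\<dots> = (\<integral>\<^sup>+x. mn x * indicator A x \<partial>\<rho>) + (\<integral>\<^sup>+x. \<beta> x * indicator A x \<partial>\<rho>)"
      by (subst nn_integral_add[symmetric]) (auto simp: vb distrib_right[symmetric])
    finally have "(\<integral>\<^sup>+x. \<alpha> x * indicator A x \<partial>\<rho>) = (\<integral>\<^sup>+x. \<beta> x * indicator A x \<partial>\<rho>)"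
      using Imn[of A] by (auto simp: ennreal_add_left_cancel)
    moreover have "(\<integral>\<^sup>+x. m x * indicator A x \<partial>\<rho>) = (\<integral>\<^sup>+x. \<beta> x * indicator A x \<partial>\<rho>)"
      using cond[of "indicator A" \<beta>] by (simp add: m_def mult.commute)
    ultimately show "(\<integral>\<^sup>+x. m x * indicator A x \<partial>\<rho>) = (\<integral>\<^sup>+x. \<alpha> x * indicator A x \<partial>\<rho>)" by simp
  qed measurable
  obtain \<pi> where s\<pi>[measurable_cong, simp]: "sets \<pi> = sets ?P"
    and I: "\<And>g. g \<in> borel_measurable ?P \<Longrightarrow>
       (\<integral>\<^sup>+p. g p \<partial>\<pi>) = (\<integral>\<^sup>+x. mn x * g (x, x) + \<alpha> x / m x * (\<integral>\<^sup>+y. \<beta> y * g (x, y) \<partial>\<kappa> x) \<partial>\<rho>)"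
    by (rule step_measure[of mn \<alpha> \<beta> m]) auto
  have I1: "(\<integral>\<^sup>+p. a (snd p) * c (fst p) \<partial>\<pi>) = (\<integral>\<^sup>+x. (mn x * a x + (\<integral>\<^sup>+y. \<beta> y * a y \<partial>\<kappa> x) / m x * \<alpha> x) * c x \<partial>\<rho>)"
    if [measurable]: "a \<in> borel_measurable borel" "c \<in> borel_measurable borel" for a c
  proof -
    have "(\<integral>\<^sup>+y. \<beta> y * (a y * c x) \<partial>\<kappa> x) = (\<integral>\<^sup>+y. \<beta> y * a y \<partial>\<kappa> x) * c x" for x
      by (subst nn_integral_multc[symmetric]) (auto simp: mult_ac)
    then show ?thesis
      by (subst I) (auto simp: distrib_left distrib_right mult_ac divide_ennreal_def)
  qed
  \<comment> \<open>The formula for \<pi> treats its coordinates differently. Moving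
    \<open>\<alpha> a\<close> into the kernel and \<open>\<beta> c\<close> out of it, by two uses of
    \<open>cond\<close>, produces the mirror image of \<open>I1\<close>.\<close>
  have I2: "(\<integral>\<^sup>+p. a (fst p) * c (snd p) \<partial>\<pi>) = (\<integral>\<^sup>+x. (mn x * a x + (\<integral>\<^sup>+y. \<alpha> y * a y \<partial>\<kappa> x) / m x * \<beta> x) * c x \<partial>\<rho>)"
    if [measurable]: "a \<in> borel_measurable borel" "c \<in> borel_measurable borel" for a c
  proof -
    define bc where "bc x = (\<integral>\<^sup>+y. \<beta> y * c y \<partial>\<kappa> x)" for x
    define e where "e x = (\<integral>\<^sup>+y. \<alpha> y * a y \<partial>\<kappa> x)" for x
    have bG: "bc \<in> borel_measurable G" and eG: "e \<in> borel_measurable G" unfolding bc_def e_def by (intro cond_G; measurable)+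
    have [measurable]: "bc \<in> borel_measurable borel" "e \<in> borel_measurable borel" using from_G[OF bG] from_G[OF eG] .
    have "(\<integral>\<^sup>+y. \<beta> y * (a x * c y) \<partial>\<kappa> x) = a x * bc x" for x
      unfolding bc_def by (subst nn_integral_cmult[symmetric]) (auto simp: mult_ac)
    then have "(\<integral>\<^sup>+p. a (fst p) * c (snd p) \<partial>\<pi>) = (\<integral>\<^sup>+x. mn x * a x * c x + bc x / m x * (\<alpha> x * a x) \<partial>\<rho>)"
      by (subst I) (auto simp: mult_ac divide_ennreal_def)
    also have "\<dots> = (\<integral>\<^sup>+x. mn x * a x * c x \<partial>\<rho>) + (\<integral>\<^sup>+x. bc x / m x * (\<alpha> x * a x) \<partial>\<rho>)"
      by (rule nn_integral_add) measurable
    also have "(\<integral>\<^sup>+x. bc x / m x * (\<alpha> x * a x) \<partial>\<rho>) = (\<integral>\<^sup>+x. bc x / m x * e x \<partial>\<rho>)"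
      unfolding e_def using bG mG by (intro cond[symmetric]) auto
    also have "\<dots> = (\<integral>\<^sup>+x. e x / m x * bc x \<partial>\<rho>)"
      by (simp add: mult_ac divide_ennreal_def)
    also have "\<dots> = (\<integral>\<^sup>+x. e x / m x * (\<beta> x * c x) \<partial>\<rho>)"
      unfolding bc_def using eG mG by (intro cond) auto
    also have "(\<integral>\<^sup>+x. mn x * a x * c x \<partial>\<rho>) + \<dots> = (\<integral>\<^sup>+x. (mn x * a x + e x / m x * \<beta> x) * c x \<partial>\<rho>)"
      by (subst nn_integral_add[symmetric]) (auto simp: distrib_left distrib_right mult_ac)
    finally show ?thesis by (simp add: e_def)
  qed
  have fin: "mn x + \<alpha> x < \<top>" "mn x + \<beta> x < \<top>" for x using u(2) v(2) ua vb by auto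
  have C1: "\<exists>k\<in>borel_measurable F. (\<forall>x. k x \<le> 1) \<and>
      (AE x in \<rho>. mn x * a x + (\<integral>\<^sup>+y. \<beta> y * a y \<partial>\<kappa> x) / m x * \<alpha> x = k x * u x)"
    if "subalgebra borel F" "subalgebra G F \<or> subalgebra F H" "a \<in> borel_measurable F" "\<And>x. a x \<le> 1" for F a
    using causal_density[OF GH H H'(1,2) _ fin(1) I\<beta> mG m\<alpha> m\<beta> that] by (simp add: ua)
  have C2: "\<exists>k\<in>borel_measurable F. (\<forall>x. k x \<le> 1) \<and>
      (AE x in \<rho>. mn x * a x + (\<integral>\<^sup>+y. \<alpha> y * a y \<partial>\<kappa> x) / m x * \<beta> x = k x * v x)"
    if "subalgebra borel F" "subalgebra G F \<or> subalgebra F H" "a \<in> borel_measurable F" "\<And>x. a x \<le> 1" for F a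
    using causal_density[OF GH H H'(1,3) _ fin(2) I\<alpha> mG m\<beta> m\<alpha> that] by (simp add: vb)
  have Im: "(\<integral>\<^sup>+x. m x \<partial>\<rho>) < \<infinity>"
    using cond[of "\<lambda>_. 1" \<beta>] I\<beta> by (simp add: m_def)
  have mfin: "AE x in \<rho>. m x < \<top>"
    using nn_integral_PInf_AE[of m \<rho>] Im by (auto simp: less_top)
  have quot: "c / b * a = a" if "c = b" "b < \<top>" "b = 0 \<longrightarrow> a = 0" for a b c :: ennreal
    using that by (cases "b = 0") (auto simp: ennreal_divide_self)
  have "AE x in \<rho>. m x = 0 \<longrightarrow> \<alpha> x = 0" "AE x in \<rho>. m x = 0 \<longrightarrow> \<beta> x = 0"
    by (rule AE_zero_if_cond_zero[OF mG _ m\<alpha>], measurable) (rule AE_zero_if_cond_zero[OF mG _ m\<beta>], measurable)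
  then have M1: "AE x in \<rho>. mn x + (\<integral>\<^sup>+y. \<beta> y \<partial>\<kappa> x) / m x * \<alpha> x = u x"
    and M2: "AE x in \<rho>. mn x + (\<integral>\<^sup>+y. \<alpha> y \<partial>\<kappa> x) / m x * \<beta> x = v x"
    using mfin m\<alpha> m\<beta> by (eventually_elim, simp add: quot ua vb)+
  have f1: "(\<integral>\<^sup>+p. c (fst p) \<partial>\<pi>) = (\<integral>\<^sup>+x. u x * c x \<partial>\<rho>)" if [measurable]: "c \<in> borel_measurable borel" for c
    using I1[of "\<lambda>_. 1" c] M1 by (auto intro!: nn_integral_cong_AE)
  have f2: "(\<integral>\<^sup>+p. c (snd p) \<partial>\<pi>) = (\<integral>\<^sup>+x. v x * c x \<partial>\<rho>)" if [measurable]: "c \<in> borel_measurable borel" for c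
    using I2[of "\<lambda>_. 1" c] M2 by (auto intro!: nn_integral_cong_AE)
  have cp: "\<pi> \<in> couplings (density \<rho> u) (density \<rho> v)"
    unfolding couplings_def
  proof (intro CollectI conjI)
    show "prob_space \<pi>"
      using f1[of "\<lambda>_. 1"] u(3) by (intro prob_spaceI) simp
    show "distr \<pi> borel fst = density \<rho> u"
    proof (rule measure_eqI)
      fix A assume "A \<in> sets (distr \<pi> borel fst)"
      then have [measurable]: "A \<in> sets borel" by simp
      have "emeasure (distr \<pi> borel fst) A = (\<integral>\<^sup>+p. indicator A (fst p) \<partial>\<pi>)"
        by (subst nn_integral_indicator[symmetric], simp, subst nn_integral_distr) auto
      then show "emeasure (distr \<pi> borel fst) A = emeasure (density \<rho> u) A"
        by (simp add: f1 emeasure_density)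
    qed (simp add: sets_rho)
    show "distr \<pi> borel snd = density \<rho> v"
    proof (rule measure_eqI)
      fix A assume "A \<in> sets (distr \<pi> borel snd)"
      then have [measurable]: "A \<in> sets borel" by simp
      have "emeasure (distr \<pi> borel snd) A = (\<integral>\<^sup>+p. indicator A (snd p) \<partial>\<pi>)"
        by (subst nn_integral_indicator[symmetric], simp, subst nn_integral_distr) auto
      then show "emeasure (distr \<pi> borel snd) A = emeasure (density \<rho> v) A"
        by (simp add: f2 emeasure_density)
    qed (simp add: sets_rho)
  qed simp
  have le: "a / b * b \<le> a" for a b :: ennreal
  proof -
    have "b / b \<le> 1" by (cases "b = 0"; cases "b = \<top>") (auto simp: ennreal_divide_self less_top)
    then show ?thesis using mult_left_mono[of "b / b" 1 a] by (simp add: ennreal_divide_times)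
  qed
  have bd: "emeasure \<pi> {p. fst p \<noteq> snd p} \<le> (\<integral>\<^sup>+x. u x - v x \<partial>\<rho>)"
  proof -
    have [measurable]: "{p. fst p \<noteq> snd p} \<in> sets ?P"
      by (subst borel_prod) (intro borel_open open_Collect_neq continuous_intros)
    have "emeasure \<pi> {p. fst p \<noteq> snd p} = (\<integral>\<^sup>+p. indicator {p. fst p \<noteq> snd p} p \<partial>\<pi>)"
      by (simp)
    also have "\<dots> = (\<integral>\<^sup>+x. \<alpha> x / m x * (\<integral>\<^sup>+y. \<beta> y * indicator {p. fst p \<noteq> snd p} (x, y) \<partial>\<kappa> x) \<partial>\<rho>)"
      by (subst I) (auto intro!: nn_integral_cong)
    also have "\<dots> \<le> (\<integral>\<^sup>+x. \<alpha> x / m x * m x \<partial>\<rho>)"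
      unfolding m_def by (intro nn_integral_mono mult_left_mono) (auto split: split_indicator)
    also have "\<dots> \<le> (\<integral>\<^sup>+x. \<alpha> x \<partial>\<rho>)"
      by (intro nn_integral_mono le)
    finally show ?thesis by (simp add: \<alpha>_def)
  qed
  have "causal F \<pi> fst snd \<and> causal F \<pi> snd fst" if F: "subalgebra borel F" "subalgebra G F \<or> subalgebra F H" for F
  proof (intro conjI causalI)
    fix a :: "'a \<Rightarrow> ennreal" assume a: "a \<in> borel_measurable F" "\<And>x. a x \<le> 1"
    have [measurable]: "a \<in> borel_measurable borel" by (rule measurable_from_subalg[OF F(1) a(1)])
    obtain k where k: "k \<in> borel_measurable F" "\<forall>x. k x \<le> 1"
      "AE x in \<rho>. mn x * a x + (\<integral>\<^sup>+y. \<beta> y * a y \<partial>\<kappa> x) / m x * \<alpha> x = k x * u x"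
      using C1[OF F a] by blast
    have [measurable]: "k \<in> borel_measurable borel" by (rule measurable_from_subalg[OF F(1) k(1)])
    have "(\<integral>\<^sup>+p. a (snd p) * c (fst p) \<partial>\<pi>) = (\<integral>\<^sup>+p. k (fst p) * c (fst p) \<partial>\<pi>)"
      if [measurable]: "c \<in> borel_measurable borel" for c
      using k(3) f1[of "\<lambda>x. k x * c x"] by (auto simp: I1 mult_ac intro!: nn_integral_cong_AE)
    with k show "\<exists>k\<in>borel_measurable F. (\<forall>x. k x \<le> 1) \<and>
       (\<forall>c\<in>borel_measurable borel. (\<integral>\<^sup>+p. a (snd p) * c (fst p) \<partial>\<pi>) = (\<integral>\<^sup>+p. k (fst p) * c (fst p) \<partial>\<pi>))"
      by blast
  next
    fix a :: "'a \<Rightarrow> ennreal" assume a: "a \<in> borel_measurable F" "\<And>x. a x \<le> 1"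
    have [measurable]: "a \<in> borel_measurable borel" by (rule measurable_from_subalg[OF F(1) a(1)])
    obtain k where k: "k \<in> borel_measurable F" "\<forall>x. k x \<le> 1"
      "AE x in \<rho>. mn x * a x + (\<integral>\<^sup>+y. \<alpha> y * a y \<partial>\<kappa> x) / m x * \<beta> x = k x * v x"
      using C2[OF F a] by blast
    have [measurable]: "k \<in> borel_measurable borel" by (rule measurable_from_subalg[OF F(1) k(1)])
    have "(\<integral>\<^sup>+p. a (fst p) * c (snd p) \<partial>\<pi>) = (\<integral>\<^sup>+p. k (snd p) * c (snd p) \<partial>\<pi>)"
      if [measurable]: "c \<in> borel_measurable borel" for c
      using k(3) f2[of "\<lambda>x. k x * c x"] by (auto simp: I2 mult_ac intro!: nn_integral_cong_AE)
    with k show "\<exists>k\<in>borel_measurable F. (\<forall>x. k x \<le> 1) \<and>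
       (\<forall>c\<in>borel_measurable borel. (\<integral>\<^sup>+p. a (fst p) * c (snd p) \<partial>\<pi>) = (\<integral>\<^sup>+p. k (snd p) * c (snd p) \<partial>\<pi>))"
      by blast
  qed
  then show thesis using that cp bd by blast
qed

end

section \<open>Bicausal couplings of measures close in total variation\<close>

text \<open>Bicausality relative to an arbitrary family of sub-sigma-algebras. The empty family
  gives all couplings, so ordinary transport is the special case \<open>FF = {}\<close>.\<close>

definition bc_couplings :: "'a::euclidean_space measure set \<Rightarrow> 'a measure \<Rightarrow> 'a measure \<Rightarrow> ('a \<times> 'a) measure set" where
  "bc_couplings FF \<mu> \<nu> = {\<pi> \<in> couplings \<mu> \<nu>. \<forall>F\<in>FF. causal F \<pi> fst snd \<and> causal F \<pi> snd fst}"

lemma bc_couplings_distrI: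
  assumes "prob_space M" and [measurable]: "X \<in> borel_measurable M" "Y \<in> borel_measurable M"
    and "distr M borel X = \<mu>" "distr M borel Y = \<nu>"
    and "\<And>F. F \<in> FF \<Longrightarrow> subalgebra borel F" "\<And>F. F \<in> FF \<Longrightarrow> causal F M X Y" "\<And>F. F \<in> FF \<Longrightarrow> causal F M Y X"
  shows "distr M (borel \<Otimes>\<^sub>M borel) (\<lambda>w. (X w, Y w)) \<in> bc_couplings FF \<mu> \<nu>"
  using assms by (auto simp: bc_couplings_def causal_distr intro!: couplings_distrI)

lemma bc_couplings_sym:
  assumes \<pi>: "\<pi> \<in> bc_couplings FF \<mu> \<nu>" and FF: "\<And>F. F \<in> FF \<Longrightarrow> subalgebra borel F"
  shows "distr \<pi> (borel \<Otimes>\<^sub>M borel) (\<lambda>p. (snd p, fst p)) \<in> bc_couplings FF \<nu> \<mu>"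
proof -
  have c: "\<pi> \<in> couplings \<mu> \<nu>" using \<pi> by (simp add: bc_couplings_def)
  have [measurable_cong]: "sets \<pi> = sets (borel \<Otimes>\<^sub>M borel)" by (rule couplingsD[OF c])
  show ?thesis
    using couplingsD[OF c] \<pi> FF by (intro bc_couplings_distrI) (auto simp: bc_couplings_def)
qed

lemma bc_couplings_refl:
  assumes \<mu>: "prob_space \<mu>" "sets \<mu> = sets borel" and FF: "\<And>F. F \<in> FF \<Longrightarrow> subalgebra borel F"
  shows "distr \<mu> (borel \<Otimes>\<^sub>M borel) (\<lambda>x. (x, x)) \<in> bc_couplings FF \<mu> \<mu>"
proof -
  have [measurable_cong]: "sets \<mu> = sets borel" by fact
  have "distr \<mu> borel (\<lambda>x. x) = \<mu>" using \<mu>(2) by (intro distr_id2) simp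
  moreover have "causal F \<mu> (\<lambda>x. x) (\<lambda>x. x)" for F by (rule causalI) blast
  ultimately show ?thesis
    using assms by (intro bc_couplings_distrI) auto
qed

text \<open>Under independence the conditional expectation of a function of one coordinate is a
  constant, which is measurable for every \<open>F\<close>. Bicausal couplings therefore always
  exist.\<close>

lemma bc_couplings_pair:
  assumes \<mu>: "prob_space \<mu>" "sets \<mu> = sets borel" and \<nu>: "prob_space \<nu>" "sets \<nu> = sets borel"
    and FF: "\<And>F. F \<in> FF \<Longrightarrow> subalgebra borel F"
  shows "\<mu> \<Otimes>\<^sub>M \<nu> \<in> bc_couplings FF \<mu> \<nu>"
proof -
  have [measurable_cong, simp]: "sets \<mu> = sets borel" "sets \<nu> = sets borel" by fact+
  interpret \<mu>: prob_space \<mu> by fact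
  interpret \<nu>: prob_space \<nu> by fact
  interpret P: pair_prob_space \<mu> \<nu> ..
  have fromF: "h \<in> borel_measurable borel" if "F \<in> FF" "h \<in> borel_measurable F" for F and h :: "'a \<Rightarrow> ennreal"
    by (rule measurable_from_subalg[OF FF that(2)]) (rule that)
  have "\<mu> \<Otimes>\<^sub>M \<nu> \<in> couplings \<mu> \<nu>"
    unfolding couplings_def
  proof (intro CollectI conjI)
    show "sets (\<mu> \<Otimes>\<^sub>M \<nu>) = sets (borel \<Otimes>\<^sub>M borel)" by (rule sets_pair_measure_cong) simp_all
    have "distr (\<mu> \<Otimes>\<^sub>M \<nu>) \<mu> fst = \<mu>" by (rule \<nu>.distr_pair_fst)
    moreover have "distr (\<mu> \<Otimes>\<^sub>M \<nu>) \<mu> fst = distr (\<mu> \<Otimes>\<^sub>M \<nu>) borel fst" by (rule distr_cong) simp_all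
    ultimately show "distr (\<mu> \<Otimes>\<^sub>M \<nu>) borel fst = \<mu>" by simp
    show "distr (\<mu> \<Otimes>\<^sub>M \<nu>) borel snd = \<nu>"
    proof (rule measure_eqI)
      fix A assume "A \<in> sets (distr (\<mu> \<Otimes>\<^sub>M \<nu>) borel snd)"
      then have [measurable]: "A \<in> sets borel" by simp
      have "snd -` A \<inter> space (\<mu> \<Otimes>\<^sub>M \<nu>) = space \<mu> \<times> A"
        using sets_eq_imp_space_eq[OF \<open>sets \<nu> = sets borel\<close>] by (auto simp: space_pair_measure)
      then show "emeasure (distr (\<mu> \<Otimes>\<^sub>M \<nu>) borel snd) A = emeasure \<nu> A"
        using \<nu>.emeasure_pair_measure_Times[of "space \<mu>" \<mu> A] sets_eq_imp_space_eq[OF \<open>sets \<mu> = sets borel\<close>] \<mu>.emeasure_space_1 by (subst emeasure_distr) (auto simp: \<mu>.emeasure_space_1)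
    qed simp
  qed (rule P.prob_space_axioms)
  moreover have "causal F (\<mu> \<Otimes>\<^sub>M \<nu>) fst snd" if F: "F \<in> FF" for F
  proof (rule causalI)
    fix a :: "'a \<Rightarrow> ennreal" assume a: "a \<in> borel_measurable F" "\<And>x. a x \<le> 1"
    have [measurable]: "a \<in> borel_measurable borel" by (rule fromF[OF F a(1)])
    have "(\<integral>\<^sup>+y. a y \<partial>\<nu>) \<le> (\<integral>\<^sup>+y. 1 \<partial>\<nu>)" by (intro nn_integral_mono a)
    then have le: "(\<integral>\<^sup>+y. a y \<partial>\<nu>) \<le> 1" by (simp add: \<nu>.emeasure_space_1)
    have "(\<integral>\<^sup>+p. a (snd p) * c (fst p) \<partial>(\<mu> \<Otimes>\<^sub>M \<nu>)) = (\<integral>\<^sup>+p. (\<integral>\<^sup>+y. a y \<partial>\<nu>) * c (fst p) \<partial>(\<mu> \<Otimes>\<^sub>M \<nu>))"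
      if [measurable]: "c \<in> borel_measurable borel" for c
      by (subst (1 2) \<nu>.nn_integral_fst[symmetric]) (auto simp: nn_integral_multc \<nu>.emeasure_space_1)
    then show "\<exists>k\<in>borel_measurable F. (\<forall>x. k x \<le> 1) \<and>
       (\<forall>c\<in>borel_measurable borel. (\<integral>\<^sup>+p. a (snd p) * c (fst p) \<partial>(\<mu> \<Otimes>\<^sub>M \<nu>)) = (\<integral>\<^sup>+p. k (fst p) * c (fst p) \<partial>(\<mu> \<Otimes>\<^sub>M \<nu>)))"
      using le by (intro bexI[of _ "\<lambda>_. \<integral>\<^sup>+y. a y \<partial>\<nu>"]) auto
  qed
  moreover have "causal F (\<mu> \<Otimes>\<^sub>M \<nu>) snd fst" if F: "F \<in> FF" for F
  proof (rule causalI)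
    fix a :: "'a \<Rightarrow> ennreal" assume a: "a \<in> borel_measurable F" "\<And>x. a x \<le> 1"
    have [measurable]: "a \<in> borel_measurable borel" by (rule fromF[OF F a(1)])
    have "(\<integral>\<^sup>+y. a y \<partial>\<mu>) \<le> (\<integral>\<^sup>+y. 1 \<partial>\<mu>)" by (intro nn_integral_mono a)
    then have le: "(\<integral>\<^sup>+y. a y \<partial>\<mu>) \<le> 1" by (simp add: \<mu>.emeasure_space_1)
    have "(\<integral>\<^sup>+p. a (fst p) * c (snd p) \<partial>(\<mu> \<Otimes>\<^sub>M \<nu>)) = (\<integral>\<^sup>+p. (\<integral>\<^sup>+y. a y \<partial>\<mu>) * c (snd p) \<partial>(\<mu> \<Otimes>\<^sub>M \<nu>))"
      if [measurable]: "c \<in> borel_measurable borel" for c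
      by (subst (1 2) \<nu>.nn_integral_fst[symmetric]) (auto simp: nn_integral_multc nn_integral_cmult \<mu>.emeasure_space_1)
    then show "\<exists>k\<in>borel_measurable F. (\<forall>x. k x \<le> 1) \<and>
       (\<forall>c\<in>borel_measurable borel. (\<integral>\<^sup>+p. a (fst p) * c (snd p) \<partial>(\<mu> \<Otimes>\<^sub>M \<nu>)) = (\<integral>\<^sup>+p. k (snd p) * c (snd p) \<partial>(\<mu> \<Otimes>\<^sub>M \<nu>)))"
      using le by (intro bexI[of _ "\<lambda>_. \<integral>\<^sup>+y. a y \<partial>\<mu>"]) auto
  qed
  ultimately show ?thesis by (simp add: bc_couplings_def)
qed

lemma bc_couplings_glue:
  fixes \<mu> \<nu> \<eta> :: "'a::euclidean_space measure"
  assumes p1: "\<pi>1 \<in> bc_couplings FF \<mu> \<nu>" and p2: "\<pi>2 \<in> bc_couplings FF \<nu> \<eta>" and FF: "\<And>F. F \<in> FF \<Longrightarrow> subalgebra borel F"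
  obtains \<Gamma> :: "('a \<times> 'a \<times> 'a) measure" where "sets \<Gamma> = sets (borel \<Otimes>\<^sub>M (borel \<Otimes>\<^sub>M borel))"
    "\<And>g. g \<in> borel_measurable (borel \<Otimes>\<^sub>M borel) \<Longrightarrow> (\<integral>\<^sup>+w. g (fst w, fst (snd w)) \<partial>\<Gamma>) = (\<integral>\<^sup>+p. g p \<partial>\<pi>1)"
    "\<And>g. g \<in> borel_measurable (borel \<Otimes>\<^sub>M borel) \<Longrightarrow> (\<integral>\<^sup>+w. g (snd w) \<partial>\<Gamma>) = (\<integral>\<^sup>+p. g p \<partial>\<pi>2)"
    "distr \<Gamma> (borel \<Otimes>\<^sub>M borel) (\<lambda>w. (fst w, snd (snd w))) \<in> bc_couplings FF \<mu> \<eta>"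
proof -
  have c1: "\<pi>1 \<in> couplings \<mu> \<nu>" and c2: "\<pi>2 \<in> couplings \<nu> \<eta>" using p1 p2 by (auto simp: bc_couplings_def)
  from gluing[OF c1 c2] obtain \<Gamma> :: "('a \<times> 'a \<times> 'a) measure" where
    G: "prob_space \<Gamma>" "sets \<Gamma> = sets (borel \<Otimes>\<^sub>M (borel \<Otimes>\<^sub>M borel))"
    "distr \<Gamma> (borel \<Otimes>\<^sub>M borel) (\<lambda>(x, y, z). (x, y)) = \<pi>1"
    "distr \<Gamma> (borel \<Otimes>\<^sub>M borel) (\<lambda>(x, y, z). (y, z)) = \<pi>2"
    "\<And>F. subalgebra borel F \<Longrightarrow> causal F \<pi>1 fst snd \<Longrightarrow> causal F \<pi>2 fst snd \<Longrightarrow> causal F \<Gamma> fst (\<lambda>w. snd (snd w))"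
    "\<And>F. subalgebra borel F \<Longrightarrow> causal F \<pi>1 snd fst \<Longrightarrow> causal F \<pi>2 snd fst \<Longrightarrow> causal F \<Gamma> (\<lambda>w. snd (snd w)) fst"
    by blast
  have [measurable_cong]: "sets \<Gamma> = sets (borel \<Otimes>\<^sub>M (borel \<Otimes>\<^sub>M borel))" by fact
  have d1: "distr \<Gamma> borel fst = \<mu>"
    unfolding couplingsD(3)[OF c1, symmetric] G(3)[symmetric] by (subst distr_distr) (auto simp: comp_def split_beta')
  have d2: "distr \<Gamma> borel (\<lambda>w. snd (snd w)) = \<eta>"
    unfolding couplingsD(4)[OF c2, symmetric] G(4)[symmetric] by (subst distr_distr) (auto simp: comp_def split_beta')
  show thesis
  proof (rule that[OF G(2)])
    show "(\<integral>\<^sup>+w. g (fst w, fst (snd w)) \<partial>\<Gamma>) = (\<integral>\<^sup>+p. g p \<partial>\<pi>1)" if [measurable]: "g \<in> borel_measurable (borel \<Otimes>\<^sub>M borel)" for g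
      unfolding G(3)[symmetric] by (subst nn_integral_distr) (auto simp: split_beta')
    show "(\<integral>\<^sup>+w. g (snd w) \<partial>\<Gamma>) = (\<integral>\<^sup>+p. g p \<partial>\<pi>2)" if [measurable]: "g \<in> borel_measurable (borel \<Otimes>\<^sub>M borel)" for g
      unfolding G(4)[symmetric] by (subst nn_integral_distr) (auto simp: split_beta')
    show "distr \<Gamma> (borel \<Otimes>\<^sub>M borel) (\<lambda>w. (fst w, snd (snd w))) \<in> bc_couplings FF \<mu> \<eta>"
      using p1 p2 FF by (intro bc_couplings_distrI G d1 d2) (auto simp: bc_couplings_def)
  qed
qed

section \<open>Probability of leaving the diagonal, and total variation\<close>

lemma sets_neq[measurable]: "{p. fst p \<noteq> snd p} \<in> sets (borel \<Otimes>\<^sub>M borel :: ('a::euclidean_space \<times> 'a) measure)"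
  by (subst borel_prod) (intro borel_open open_Collect_neq continuous_intros)

text \<open>Union bound on the glued triple: if the outer points differ, then at least one of the
  neighbouring pairs differs.\<close>

lemma bc_couplings_neq_trans:
  assumes p1: "\<pi>1 \<in> bc_couplings FF \<mu> \<nu>" and p2: "\<pi>2 \<in> bc_couplings FF \<nu> \<eta>" and FF: "\<And>F. F \<in> FF \<Longrightarrow> subalgebra borel F"
  shows "\<exists>\<pi>\<in>bc_couplings FF \<mu> \<eta>. emeasure \<pi> {p. fst p \<noteq> snd p} \<le> emeasure \<pi>1 {p. fst p \<noteq> snd p} + emeasure \<pi>2 {p. fst p \<noteq> snd p}"
proof -
  from bc_couplings_glue[OF p1 p2 FF] obtain \<Gamma> where
    s[measurable_cong]: "sets \<Gamma> = sets (borel \<Otimes>\<^sub>M (borel \<Otimes>\<^sub>M borel))" and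
    1: "\<And>g. g \<in> borel_measurable (borel \<Otimes>\<^sub>M borel) \<Longrightarrow> (\<integral>\<^sup>+w. g (fst w, fst (snd w)) \<partial>\<Gamma>) = (\<integral>\<^sup>+p. g p \<partial>\<pi>1)" and
    2: "\<And>g. g \<in> borel_measurable (borel \<Otimes>\<^sub>M borel) \<Longrightarrow> (\<integral>\<^sup>+w. g (snd w) \<partial>\<Gamma>) = (\<integral>\<^sup>+p. g p \<partial>\<pi>2)" and
    3: "distr \<Gamma> (borel \<Otimes>\<^sub>M borel) (\<lambda>w. (fst w, snd (snd w))) \<in> bc_couplings FF \<mu> \<eta>" by blast
  have [measurable_cong]: "sets \<pi>1 = sets (borel \<Otimes>\<^sub>M borel)" "sets \<pi>2 = sets (borel \<Otimes>\<^sub>M borel)"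
    using p1 p2 couplingsD(2) by (auto simp: bc_couplings_def)
  let ?N = "{p. fst p \<noteq> snd p} :: ('a \<times> 'a) set"
  have "emeasure (distr \<Gamma> (borel \<Otimes>\<^sub>M borel) (\<lambda>w. (fst w, snd (snd w)))) ?N = (\<integral>\<^sup>+w. indicator ?N (fst w, snd (snd w)) \<partial>\<Gamma>)"
    by (subst nn_integral_indicator[symmetric], simp, subst nn_integral_distr) auto
  also have "\<dots> \<le> (\<integral>\<^sup>+w. indicator ?N (fst w, fst (snd w)) + indicator ?N (snd w) \<partial>\<Gamma>)"
    by (intro nn_integral_mono) (auto split: split_indicator)
  also have "\<dots> = (\<integral>\<^sup>+w. indicator ?N (fst w, fst (snd w)) \<partial>\<Gamma>) + (\<integral>\<^sup>+w. indicator ?N (snd w) \<partial>\<Gamma>)"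
    by (rule nn_integral_add) measurable
  also have "\<dots> = emeasure \<pi>1 ?N + emeasure \<pi>2 ?N"
    using 1[of "indicator ?N"] 2[of "indicator ?N"] by simp
  finally show ?thesis using 3 by blast
qed

lemma bc_couplings_neq_sym:
  assumes \<pi>: "\<pi> \<in> bc_couplings FF \<mu> \<nu>" and FF: "\<And>F. F \<in> FF \<Longrightarrow> subalgebra borel F"
  shows "\<exists>\<pi>'\<in>bc_couplings FF \<nu> \<mu>. emeasure \<pi>' {p. fst p \<noteq> snd p} = emeasure \<pi> {p. fst p \<noteq> snd p}"
proof -
  have c: "\<pi> \<in> couplings \<mu> \<nu>" using \<pi> by (simp add: bc_couplings_def)
  have s[measurable_cong]: "sets \<pi> = sets (borel \<Otimes>\<^sub>M borel)" by (rule couplingsD[OF c])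
  have sp: "space \<pi> = UNIV" using sets_eq_imp_space_eq[OF s] by (simp add: space_pair_measure)
  have "emeasure (distr \<pi> (borel \<Otimes>\<^sub>M borel) (\<lambda>p. (snd p, fst p))) {p. fst p \<noteq> snd p} = emeasure \<pi> {p. fst p \<noteq> snd p}"
    by (subst emeasure_distr) (auto intro!: arg_cong[of _ _ "emeasure \<pi>"] simp: sp)
  then show ?thesis using bc_couplings_sym[OF \<pi> FF] by blast
qed

text \<open>Total variation is measured as the largest difference on events. The bound lives in
  \<open>ennreal\<close>, so that a transport cost can be inserted directly.\<close>

definition tv_le :: "'a::euclidean_space measure \<Rightarrow> 'a measure \<Rightarrow> ennreal \<Rightarrow> bool" where
  "tv_le \<mu> \<nu> \<delta> \<longleftrightarrow> (\<forall>A\<in>sets borel. emeasure \<mu> A \<le> emeasure \<nu> A + \<delta> \<and> emeasure \<nu> A \<le> emeasure \<mu> A + \<delta>)"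

text \<open>The density of the restrictions to \<open>H\<close> is the conditional expectation given
  \<open>H\<close> of the full density. It is set to 0 on the null set where it is infinite, because
  densities of this kind are subtracted later.\<close>

lemma RN_subalg:
  assumes \<rho>: "prob_space \<rho>" "sets \<rho> = sets borel" and \<mu>: "prob_space \<mu>" "sets \<mu> = sets borel"
    and ac: "absolutely_continuous \<rho> \<mu>" and H: "subalgebra borel H"
  shows "\<exists>\<phi>\<in>borel_measurable H. (\<forall>x. \<phi> x < (\<top>::ennreal)) \<and> (\<forall>A\<in>sets H. (\<integral>\<^sup>+x. \<phi> x * indicator A x \<partial>\<rho>) = emeasure \<mu> A)"
proof -
  have sr: "subalgebra \<rho> H" and sm: "subalgebra \<mu> H"
    using H \<rho>(2) \<mu>(2) sets_eq_imp_space_eq[OF \<rho>(2)] sets_eq_imp_space_eq[OF \<mu>(2)] by (auto simp: subalgebra_def)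
  interpret r: prob_space "restr_to_subalg \<rho> H" by (rule prob_space_restr_to_subalg[OF sr \<rho>(1)])
  interpret m: prob_space "restr_to_subalg \<mu> H" by (rule prob_space_restr_to_subalg[OF sm \<mu>(1)])
  have "absolutely_continuous (restr_to_subalg \<rho> H) (restr_to_subalg \<mu> H)"
    using ac by (auto simp: absolutely_continuous_def null_sets_restr_to_subalg sr sm)
  from r.Radon_Nikodym[OF this] obtain \<phi>0 where \<phi>0: "\<phi>0 \<in> borel_measurable (restr_to_subalg \<rho> H)"
    "density (restr_to_subalg \<rho> H) \<phi>0 = restr_to_subalg \<mu> H"
    by (auto simp: sets_restr_to_subalg sr sm)
  have \<phi>0H[measurable]: "\<phi>0 \<in> borel_measurable H" by (rule measurable_in_subalg'[OF sr \<phi>0(1)])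
  have A0: "(\<integral>\<^sup>+x. \<phi>0 x * indicator A x \<partial>\<rho>) = emeasure \<mu> A" if [measurable]: "A \<in> sets H" for A
  proof -
    have "emeasure \<mu> A = emeasure (density (restr_to_subalg \<rho> H) \<phi>0) A"
      by (simp add: \<phi>0(2) emeasure_restr_to_subalg sm that)
    also have "\<dots> = (\<integral>\<^sup>+x. \<phi>0 x * indicator A x \<partial>restr_to_subalg \<rho> H)"
      by (rule emeasure_density[OF \<phi>0(1)]) (simp add: sets_restr_to_subalg sr that)
    also have "\<dots> = (\<integral>\<^sup>+x. \<phi>0 x * indicator A x \<partial>\<rho>)"
      by (rule nn_integral_subalgebra2[OF sr]) measurable
    finally show ?thesis by simp
  qed
  have sU: "space H = UNIV" using H by (simp add: subalgebra_def)
  have "(\<integral>\<^sup>+x. \<phi>0 x \<partial>\<rho>) = 1"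
    using A0[OF sets.top] prob_space.emeasure_space_1[OF \<mu>(1)] sets_eq_imp_space_eq[OF \<mu>(2)] by (simp add: sU)
  moreover have "\<phi>0 \<in> borel_measurable \<rho>" by (rule measurable_from_subalg[OF sr \<phi>0H])
  ultimately have ae: "AE x in \<rho>. \<phi>0 x \<noteq> \<top>" using nn_integral_PInf_AE[of \<phi>0 \<rho>] by auto
  define \<phi> where "\<phi> x = (if \<phi>0 x = \<top> then 0 else \<phi>0 x)" for x
  have "\<phi> \<in> borel_measurable H" unfolding \<phi>_def by measurable
  moreover have "(\<integral>\<^sup>+x. \<phi> x * indicator A x \<partial>\<rho>) = emeasure \<mu> A" if "A \<in> sets H" for A
    unfolding A0[OF that, symmetric] using ae by (intro nn_integral_cong_AE) (auto simp: \<phi>_def)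
  ultimately show ?thesis by (intro bexI[of _ \<phi>]) (auto simp: \<phi>_def less_top)
qed

text \<open>Subtraction in \<open>ennreal\<close> is truncated at 0, so these integrals are those of
  the positive and negative part of \<open>\<phi> - 1\<close>. Each part lives on an event of
  \<open>H\<close>, where \<phi> exceeds 1 or not, and its integral is a difference of probabilities
  of that event.\<close>

lemma density_diff_le:
  assumes \<rho>: "prob_space \<rho>" "sets \<rho> = sets borel" and tv: "tv_le \<mu> \<rho> \<delta>" and H: "subalgebra borel H"
    and \<phi>: "\<phi> \<in> borel_measurable H" "\<And>A. A \<in> sets H \<Longrightarrow> (\<integral>\<^sup>+x. \<phi> x * indicator A x \<partial>\<rho>) = emeasure \<mu> A"
    and \<mu>: "prob_space \<mu>"
  shows "(\<integral>\<^sup>+x. \<phi> x - 1 \<partial>\<rho>) \<le> \<delta>" "(\<integral>\<^sup>+x. 1 - \<phi> x \<partial>\<rho>) \<le> \<delta>"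
proof -
  have [measurable_cong]: "sets \<rho> = sets borel" by fact
  interpret prob_space \<rho> by fact
  have sU: "space H = UNIV" using H by (simp add: subalgebra_def)
  have [measurable]: "\<phi> \<in> borel_measurable borel" by (rule measurable_from_subalg[OF H \<phi>(1)])
  define B where "B = {x. 1 < \<phi> x}"
  have "B = {x\<in>space H. 1 < \<phi> x}" by (simp add: B_def sU)
  also have "\<dots> \<in> sets H" using \<phi>(1) by measurable
  finally have B: "B \<in> sets H" .
  then have [measurable]: "B \<in> sets borel" using H by (auto simp: subalgebra_def)
  have B': "- B \<in> sets H" using B sets.compl_sets[OF B] by (simp add: sU Compl_eq_Diff_UNIV)
  then have [measurable]: "- B \<in> sets borel" using H by (auto simp: subalgebra_def)
  have "(\<integral>\<^sup>+x. \<phi> x - 1 \<partial>\<rho>) = (\<integral>\<^sup>+x. \<phi> x * indicator B x - indicator B x \<partial>\<rho>)"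
  proof (rule nn_integral_cong)
    fix x show "\<phi> x - 1 = \<phi> x * indicator B x - indicator B x"
      using diff_eq_0_ennreal[of "\<phi> x" 1] le_less_trans[of "\<phi> x" 1 \<top>]
      by (cases "x \<in> B") (auto simp: B_def not_less)
  qed
  also have "\<dots> = emeasure \<mu> B - emeasure \<rho> B"
  proof (subst nn_integral_diff)
    show "AE x in \<rho>. indicator B x \<le> \<phi> x * indicator B x"
      by (intro AE_I2) (auto simp: B_def less_imp_le split: split_indicator)
  qed (simp_all add: \<phi>(2)[OF B] emeasure_eq_measure)
  also have "\<dots> \<le> \<delta>"
    using tv \<open>B \<in> sets borel\<close> by (auto simp: tv_le_def ennreal_minus_le_iff add.commute)
  finally show "(\<integral>\<^sup>+x. \<phi> x - 1 \<partial>\<rho>) \<le> \<delta>" .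
  have "(\<integral>\<^sup>+x. 1 - \<phi> x \<partial>\<rho>) = (\<integral>\<^sup>+x. indicator (- B) x - \<phi> x * indicator (- B) x \<partial>\<rho>)"
  proof (rule nn_integral_cong)
    fix x
    have "1 - \<phi> x = 0" if "x \<in> B"
      using that diff_eq_0_iff_ennreal[of 1 "\<phi> x"] by (auto simp: B_def less_imp_le)
    then show "1 - \<phi> x = indicator (- B) x - \<phi> x * indicator (- B) x"
      by (cases "x \<in> B") auto
  qed
  also have "\<dots> = emeasure \<rho> (- B) - emeasure \<mu> (- B)"
  proof (subst nn_integral_diff)
    show "AE x in \<rho>. \<phi> x * indicator (- B) x \<le> indicator (- B) x"
      by (intro AE_I2) (auto simp: B_def not_less split: split_indicator)
    have "emeasure \<mu> (- B) \<noteq> \<top>"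
      using prob_space.emeasure_le_1[OF \<mu>, of "- B"] by (auto simp: top_unique)
    then show "(\<integral>\<^sup>+x. \<phi> x * indicator (- B) x \<partial>\<rho>) \<noteq> \<infinity>" by (simp add: \<phi>(2)[OF B'])
  qed (simp_all add: \<phi>(2)[OF B'])
  also have "\<dots> \<le> \<delta>"
    using tv \<open>- B \<in> sets borel\<close> by (auto simp: tv_le_def ennreal_minus_le_iff add.commute)
  finally show "(\<integral>\<^sup>+x. 1 - \<phi> x \<partial>\<rho>) \<le> \<delta>" .
qed

text \<open>The densities \<open>\<phi> i\<close> form a martingale under \<rho>. Consecutive ones
  have equal integrals over the sets of \<open>H i\<close> and are both measurable for
  \<open>H (Suc i)\<close>, which is what \<open>step_coupling\<close> asks for.\<close>

lemma chain_coupling: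
  fixes \<rho> \<mu> :: "'a::euclidean_space measure" and H :: "nat \<Rightarrow> 'a measure"
  assumes \<rho>: "prob_space \<rho>" "sets \<rho> = sets borel" and \<mu>: "prob_space \<mu>" "sets \<mu> = sets borel"
    and ac: "absolutely_continuous \<rho> \<mu>" and tv: "tv_le \<mu> \<rho> \<delta>"
    and H: "\<And>i. subalgebra borel (H i)" and Hmono: "\<And>i j. i \<le> j \<Longrightarrow> subalgebra (H j) (H i)"
    and H0: "sets (H 0) = {{}, UNIV}" and Hn: "sets (H n) = sets borel"
    and FF: "FF \<subseteq> range H"
  shows "\<exists>\<pi>\<in>bc_couplings FF \<rho> \<mu>. emeasure \<pi> {p. fst p \<noteq> snd p} \<le> of_nat n * (2 * \<delta>)"
proof -
  interpret \<rho>: prob_space \<rho> by fact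
  have [measurable_cong]: "sets \<rho> = sets borel" by fact
  have sr: "space \<rho> = UNIV" using sets_eq_imp_space_eq[OF \<rho>(2)] by simp
  have \<mu>1: "emeasure \<mu> UNIV = 1" using prob_space.emeasure_space_1[OF \<mu>(1)] sets_eq_imp_space_eq[OF \<mu>(2)] by simp
  have FF': "subalgebra borel F" if "F \<in> FF" for F using that FF H by auto
  \<comment> \<open>At \<open>i = 0\<close> the density is fixed as the constant 1, so that the
    chain visibly starts at \<rho>.\<close>
  let ?P = "\<lambda>i \<phi>. \<phi> \<in> borel_measurable (H i) \<and> (\<forall>x. \<phi> x < (\<top>::ennreal)) \<and>
    (\<forall>A\<in>sets (H i). (\<integral>\<^sup>+x. \<phi> x * indicator A x \<partial>\<rho>) = emeasure \<mu> A) \<and> (i = 0 \<longrightarrow> \<phi> = (\<lambda>_. 1))"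
  have "\<exists>\<phi>. ?P i \<phi>" for i
  proof (cases i)
    case 0
    then show ?thesis using \<mu>1 \<rho>.emeasure_space_1 by (intro exI[of _ "\<lambda>_. 1"]) (auto simp: H0 sr)
  next
    case (Suc j)
    then show ?thesis using RN_subalg[OF \<rho> \<mu> ac H, of i] by auto
  qed
  then have "\<exists>\<phi>. \<forall>i. ?P i (\<phi> i)" by (intro choice allI)
  then obtain \<phi> where P: "\<And>i. ?P i (\<phi> i)" by blast
  have \<phi>: "\<phi> i \<in> borel_measurable (H i)" "\<phi> i x < \<top>" "A \<in> sets (H i) \<Longrightarrow> (\<integral>\<^sup>+x. \<phi> i x * indicator A x \<partial>\<rho>) = emeasure \<mu> A"
    for i x A using P[of i] by auto
  have \<phi>0: "\<phi> 0 = (\<lambda>_. 1)" using P[of 0] by auto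
  have [measurable]: "\<phi> i \<in> borel_measurable borel" for i by (rule measurable_from_subalg[OF H \<phi>(1)])
  have sU: "space (H i) = UNIV" for i using H by (simp add: subalgebra_def)
  have step: "\<exists>\<pi>\<in>bc_couplings FF (density \<rho> (\<phi> i)) (density \<rho> (\<phi> (Suc i))). emeasure \<pi> {p. fst p \<noteq> snd p} \<le> 2 * \<delta>" for i
  proof -
    have sub: "subalgebra \<rho> (H i)" using H[of i] \<rho>(2) sr by (simp add: subalgebra_def)
    have "(\<lambda>x. x) \<in> \<rho> \<rightarrow>\<^sub>M H i" by (rule measurable_from_subalg[OF sub]) simp
    then obtain \<kappa> where "disintegrates \<rho> (\<lambda>x. x) (H i) (\<lambda>x. x) borel \<kappa>"
      using disintegration[OF \<rho>(1), of "\<lambda>x. x" "H i" "\<lambda>x. x"] by auto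
    then interpret conditional_kernel \<rho> "H i" \<kappa>
      using \<rho> H by unfold_locales auto
    have Hi: "A \<in> sets (H (Suc i))" if "A \<in> sets (H i)" for A using Hmono[of i "Suc i"] that by (auto simp: subalgebra_def)
    obtain \<pi> where \<pi>: "\<pi> \<in> couplings (density \<rho> (\<phi> i)) (density \<rho> (\<phi> (Suc i)))"
      "emeasure \<pi> {p. fst p \<noteq> snd p} \<le> (\<integral>\<^sup>+x. \<phi> i x - \<phi> (Suc i) x \<partial>\<rho>)"
      "\<And>F. subalgebra borel F \<Longrightarrow> subalgebra (H i) F \<or> subalgebra F (H (Suc i)) \<Longrightarrow> causal F \<pi> fst snd \<and> causal F \<pi> snd fst"
    proof (rule step_coupling[of "H (Suc i)" "\<phi> i" "\<phi> (Suc i)"])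
      show "subalgebra (H (Suc i)) (H i)" by (rule Hmono) simp
      then show "\<phi> i \<in> borel_measurable (H (Suc i))" by (rule measurable_from_subalg) (rule \<phi>)
      show "(\<integral>\<^sup>+x. \<phi> i x \<partial>\<rho>) = 1" using \<phi>(3)[OF sets.top, of i] by (simp add: sU \<mu>1)
      show "\<And>A. A \<in> sets (H i) \<Longrightarrow> (\<integral>\<^sup>+x. \<phi> i x * indicator A x \<partial>\<rho>) = (\<integral>\<^sup>+x. \<phi> (Suc i) x * indicator A x \<partial>\<rho>)"
        using \<phi>(3) Hi by simp
    qed (auto intro: H \<phi>)
    \<comment> \<open>The filtration is a chain: an index \<open>j \<le> i\<close> puts
      \<open>F\<close> inside \<open>H i\<close>, and otherwise \<open>F\<close> contains
      \<open>H (Suc i)\<close>.\<close>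
    have "causal F \<pi> fst snd \<and> causal F \<pi> snd fst" if F: "F \<in> FF" for F
    proof -
      obtain j where j: "F = H j" using F FF by blast
      show ?thesis
        using Hmono[of j i] Hmono[of "Suc i" j] by (intro \<pi>(3) FF' F) (cases "j \<le> i"; simp add: j)
    qed
    then have "\<pi> \<in> bc_couplings FF (density \<rho> (\<phi> i)) (density \<rho> (\<phi> (Suc i)))"
      using \<pi>(1) by (simp add: bc_couplings_def)
    \<comment> \<open>A drop from \<open>\<phi> i\<close> to \<open>\<phi> (Suc i)\<close> is split
      at the level 1. Each part is controlled by the distance between \<mu> and \<rho>, which
      explains the factor 2.\<close>
    moreover have "(\<integral>\<^sup>+x. \<phi> i x - \<phi> (Suc i) x \<partial>\<rho>) \<le> (\<integral>\<^sup>+x. (\<phi> i x - 1) + (1 - \<phi> (Suc i) x) \<partial>\<rho>)"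
    proof (rule nn_integral_mono)
      fix x
      obtain a b where ab: "\<phi> i x = ennreal a" "0 \<le> a" "\<phi> (Suc i) x = ennreal b" "0 \<le> b"
        using \<phi>(2)[of i x] \<phi>(2)[of "Suc i" x] by (cases "\<phi> i x"; cases "\<phi> (Suc i) x") auto
      show "\<phi> i x - \<phi> (Suc i) x \<le> (\<phi> i x - 1) + (1 - \<phi> (Suc i) x)"
      proof -
        have "ennreal a - ennreal b = ennreal (a - b)" "ennreal a - 1 = ennreal (a - 1)" "1 - ennreal b = ennreal (1 - b)"
          using ab ennreal_minus[of b a] ennreal_minus[of 1 a] ennreal_minus[of b 1] by simp_all
        moreover have "ennreal (a - b) \<le> ennreal (a - 1) + ennreal (1 - b)"
        proof -
          have "ennreal (a - b) \<le> ennreal (max 0 (a - 1) + max 0 (1 - b))" by (rule ennreal_leI) (auto simp: max_def)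
          also have "\<dots> = ennreal (max 0 (a - 1)) + ennreal (max 0 (1 - b))" by (rule ennreal_plus) auto
          also have "\<dots> = ennreal (a - 1) + ennreal (1 - b)" by (simp add: max_def ennreal_neg)
          finally show ?thesis .
        qed
        ultimately show ?thesis by (simp add: ab)
      qed
    qed
    moreover have "\<dots> = (\<integral>\<^sup>+x. \<phi> i x - 1 \<partial>\<rho>) + (\<integral>\<^sup>+x. 1 - \<phi> (Suc i) x \<partial>\<rho>)"
      by (rule nn_integral_add) measurable
    moreover have "\<dots> \<le> \<delta> + \<delta>"
      by (rule add_mono[OF density_diff_le(1)[OF \<rho> tv H \<phi>(1) \<phi>(3) \<mu>(1)] density_diff_le(2)[OF \<rho> tv H \<phi>(1) \<phi>(3) \<mu>(1)]])
    ultimately show ?thesis using \<pi>(2) by (auto simp: mult_2 intro!: bexI[of _ \<pi>])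
  qed
  have IND: "\<exists>\<pi>\<in>bc_couplings FF (density \<rho> (\<phi> 0)) (density \<rho> (\<phi> i)). emeasure \<pi> {p. fst p \<noteq> snd p} \<le> of_nat i * (2 * \<delta>)" for i
  proof (induction i)
    case 0
    have d1: "density \<rho> (\<lambda>_. 1) = \<rho>" by (rule density_1)
    have "emeasure (distr \<rho> (borel \<Otimes>\<^sub>M borel) (\<lambda>x. (x, x))) {p. fst p \<noteq> snd p} = 0"
      by (subst emeasure_distr) auto
    then show ?case
      unfolding \<phi>0 d1 by (intro bexI[OF _ bc_couplings_refl[OF \<rho> FF']]) simp_all
  next
    case (Suc i)
    then obtain \<pi>1 where 1: "\<pi>1 \<in> bc_couplings FF (density \<rho> (\<phi> 0)) (density \<rho> (\<phi> i))" "emeasure \<pi>1 {p. fst p \<noteq> snd p} \<le> of_nat i * (2 * \<delta>)" by blast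
    obtain \<pi>2 where 2: "\<pi>2 \<in> bc_couplings FF (density \<rho> (\<phi> i)) (density \<rho> (\<phi> (Suc i)))" "emeasure \<pi>2 {p. fst p \<noteq> snd p} \<le> 2 * \<delta>"
      using step by blast
    have "emeasure \<pi>1 {p. fst p \<noteq> snd p} + emeasure \<pi>2 {p. fst p \<noteq> snd p} \<le> of_nat (Suc i) * (2 * \<delta>)"
      using add_mono[OF 1(2) 2(2)] by (simp add: distrib_right add.commute)
    moreover obtain \<pi> where "\<pi> \<in> bc_couplings FF (density \<rho> (\<phi> 0)) (density \<rho> (\<phi> (Suc i)))"
      "emeasure \<pi> {p. fst p \<noteq> snd p} \<le> emeasure \<pi>1 {p. fst p \<noteq> snd p} + emeasure \<pi>2 {p. fst p \<noteq> snd p}"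
      using bc_couplings_neq_trans[OF 1(1) 2(1) FF'] by blast
    ultimately show ?case by (intro bexI[of _ \<pi>]) auto
  qed
  have d0: "density \<rho> (\<phi> 0) = \<rho>" by (simp add: \<phi>0 density_1)
  have dn: "density \<rho> (\<phi> n) = \<mu>"
  proof (rule measure_eqI)
    fix A assume "A \<in> sets (density \<rho> (\<phi> n))"
    then have [measurable]: "A \<in> sets borel" using \<rho>(2) by simp
    then show "emeasure (density \<rho> (\<phi> n)) A = emeasure \<mu> A"
      using \<phi>(3)[of A n] Hn by (simp add: emeasure_density)
  qed (simp add: \<rho> \<mu>)
  show ?thesis using IND[of n] by (simp only: d0 dn)
qed

text \<open>A fair coin decides from which of the two measures to draw. The doubled form of the
  conclusion keeps division out of \<open>ennreal\<close> arithmetic.\<close>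

lemma average_measure:
  fixes \<mu> \<nu> :: "'a::euclidean_space measure"
  assumes \<mu>: "prob_space \<mu>" "sets \<mu> = sets borel" and \<nu>: "prob_space \<nu>" "sets \<nu> = sets borel"
  obtains \<rho> :: "'a measure" where "prob_space \<rho>" "sets \<rho> = sets borel"
    "\<And>A. A \<in> sets borel \<Longrightarrow> 2 * emeasure \<rho> A = emeasure \<mu> A + emeasure \<nu> A"
proof -
  define \<rho> where "\<rho> = measure_pmf (pmf_of_set (UNIV :: bool set)) \<bind> (\<lambda>b. if b then \<mu> else \<nu>)"
  have k: "(\<lambda>b. if b then \<mu> else \<nu>) \<in> measure_pmf (pmf_of_set (UNIV :: bool set)) \<rightarrow>\<^sub>M subprob_algebra borel"
    using \<mu> \<nu> by (auto simp: space_subprob_algebra prob_space_imp_subprob_space)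
  have "prob_space \<rho>" unfolding \<rho>_def
    by (rule prob_space.prob_space_bind[OF _ _ k]) (use \<mu> \<nu> in \<open>auto simp: measure_pmf.prob_space_axioms intro!: AE_I2\<close>)
  moreover have "sets \<rho> = sets borel" unfolding \<rho>_def using \<mu> \<nu> by (intro sets_bind) auto
  moreover have "2 * emeasure \<rho> A = emeasure \<mu> A + emeasure \<nu> A" if A: "A \<in> sets borel" for A
  proof -
    have "emeasure \<rho> A = (\<integral>\<^sup>+b. emeasure (if b then \<mu> else \<nu>) A \<partial>measure_pmf (pmf_of_set UNIV))"
      unfolding \<rho>_def by (rule emeasure_bind[OF _ k A]) simp
    also have "\<dots> = (emeasure \<mu> A + emeasure \<nu> A) / 2"
      by (subst nn_integral_pmf_of_set) (auto simp: UNIV_bool add.commute)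
    finally have "2 * emeasure \<rho> A = (emeasure \<mu> A + emeasure \<nu> A) / 2 * 2" by (simp only: mult.commute)
    also have "\<dots> = emeasure \<mu> A + emeasure \<nu> A"
      by (simp only: ennreal_divide_times) (simp add: ennreal_divide_self)
    finally show ?thesis .
  qed
  ultimately show thesis by (rule that)
qed

text \<open>The average dominates both measures and is within \<delta> of each. The chain from
  \<rho> to \<mu> is reversed and glued at \<rho> to the chain from \<rho> to \<nu>; each
  contributes \<open>2 n \<delta>\<close>.\<close>

lemma tv_coupling:
  fixes \<nu> \<mu> :: "'a::euclidean_space measure" and H :: "nat \<Rightarrow> 'a measure"
  assumes \<mu>: "prob_space \<mu>" "sets \<mu> = sets borel" and \<nu>: "prob_space \<nu>" "sets \<nu> = sets borel"
    and tv: "tv_le \<mu> \<nu> \<delta>"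
    and H: "\<And>i. subalgebra borel (H i)" and Hmono: "\<And>i j. i \<le> j \<Longrightarrow> subalgebra (H j) (H i)"
    and H0: "sets (H 0) = {{}, UNIV}" and Hn: "sets (H n) = sets borel"
    and FF: "FF \<subseteq> range H"
  shows "\<exists>\<pi>\<in>bc_couplings FF \<mu> \<nu>. emeasure \<pi> {p. fst p \<noteq> snd p} \<le> of_nat (4 * n) * \<delta>"
proof -
  have FF': "subalgebra borel F" if "F \<in> FF" for F using that FF H by auto
  obtain \<rho> :: "'a measure" where \<rho>: "prob_space \<rho>" "sets \<rho> = sets borel"
    and av: "\<And>A. A \<in> sets borel \<Longrightarrow> 2 * emeasure \<rho> A = emeasure \<mu> A + emeasure \<nu> A"
    by (rule average_measure[OF \<mu> \<nu>]) blast
  have two: "2 * a \<le> 2 * b \<longleftrightarrow> a \<le> b" for a b :: ennreal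
    using ennreal_mult_le_mult_iff[of 2 a b] by simp
  have ac: "absolutely_continuous \<rho> \<mu>" "absolutely_continuous \<rho> \<nu>"
  proof -
    have "emeasure \<mu> A = 0 \<and> emeasure \<nu> A = 0" if "A \<in> null_sets \<rho>" for A
      using av[of A] that \<rho>(2) by (auto simp: null_sets_def)
    then show "absolutely_continuous \<rho> \<mu>" "absolutely_continuous \<rho> \<nu>"
      using \<rho>(2) \<mu>(2) \<nu>(2) by (auto simp: absolutely_continuous_def null_sets_def)
  qed
  have key: "a \<le> c + \<delta> \<and> c \<le> a + \<delta>" if "2 * c = a + b" "a \<le> b + \<delta>" "b \<le> a + \<delta>" for a b c
  proof -
    have "2 * a \<le> a + (b + \<delta>)" using add_left_mono[OF that(2), of a] by (simp add: mult_2)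
    also have "\<dots> = 2 * c + \<delta>" by (simp add: that(1) add.assoc)
    also have "\<dots> \<le> 2 * c + (\<delta> + \<delta>)" by (intro add_left_mono) simp
    also have "\<dots> = 2 * (c + \<delta>)" by (simp add: distrib_left mult_2)
    finally have 1: "2 * a \<le> 2 * (c + \<delta>)" .
    have "2 * c \<le> a + (a + \<delta>)" using add_left_mono[OF that(3), of a] by (simp add: that(1))
    also have "\<dots> \<le> a + (a + \<delta>) + \<delta>" by simp
    also have "\<dots> = 2 * (a + \<delta>)" by (simp add: distrib_left mult_2 add_ac)
    finally have 2: "2 * c \<le> 2 * (a + \<delta>)" .
    from 1 2 show ?thesis by (simp only: two)
  qed
  have tv1: "tv_le \<mu> \<rho> \<delta>"
    unfolding tv_le_def
  proof
    fix A :: "'a set" assume "A \<in> sets borel"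
    then show "emeasure \<mu> A \<le> emeasure \<rho> A + \<delta> \<and> emeasure \<rho> A \<le> emeasure \<mu> A + \<delta>"
      using tv by (intro key[OF av]) (auto simp: tv_le_def)
  qed
  have tv2: "tv_le \<nu> \<rho> \<delta>"
    unfolding tv_le_def
  proof
    fix A :: "'a set" assume A: "A \<in> sets borel"
    show "emeasure \<nu> A \<le> emeasure \<rho> A + \<delta> \<and> emeasure \<rho> A \<le> emeasure \<nu> A + \<delta>"
      using tv A av[OF A] by (intro key[of _ _ "emeasure \<mu> A"]) (auto simp: tv_le_def add.commute)
  qed
  obtain \<pi>1 where 1: "\<pi>1 \<in> bc_couplings FF \<rho> \<mu>" "emeasure \<pi>1 {p. fst p \<noteq> snd p} \<le> of_nat n * (2 * \<delta>)"
    using chain_coupling[OF \<rho> \<mu> ac(1) tv1 H Hmono H0 Hn FF] by blast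
  obtain \<pi>2 where 2: "\<pi>2 \<in> bc_couplings FF \<rho> \<nu>" "emeasure \<pi>2 {p. fst p \<noteq> snd p} \<le> of_nat n * (2 * \<delta>)"
    using chain_coupling[OF \<rho> \<nu> ac(2) tv2 H Hmono H0 Hn FF] by blast
  obtain \<pi>3 where 3: "\<pi>3 \<in> bc_couplings FF \<mu> \<rho>" "emeasure \<pi>3 {p. fst p \<noteq> snd p} = emeasure \<pi>1 {p. fst p \<noteq> snd p}"
    using bc_couplings_neq_sym[OF 1(1) FF'] by blast
  have "emeasure \<pi>3 {p. fst p \<noteq> snd p} + emeasure \<pi>2 {p. fst p \<noteq> snd p} \<le> of_nat n * (2 * \<delta>) + of_nat n * (2 * \<delta>)"
    using 1(2) 2(2) 3(2) by (intro add_mono) auto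
  also have "\<dots> = of_nat (4 * n) * \<delta>"
  proof -
    have "of_nat n * (2 * \<delta>) + of_nat n * (2 * \<delta>) = 2 * (of_nat n * (2 * \<delta>))" by (rule mult_2[symmetric])
    also have "\<dots> = (2 * 2) * (of_nat n * \<delta>)" by (simp only: mult_ac)
    also have "\<dots> = of_nat (4 * n) * \<delta>" by (simp only: of_nat_mult mult.assoc) simp
    finally show ?thesis .
  qed
  finally have le: "emeasure \<pi>3 {p. fst p \<noteq> snd p} + emeasure \<pi>2 {p. fst p \<noteq> snd p} \<le> of_nat (4 * n) * \<delta>" .
  obtain \<pi> where "\<pi> \<in> bc_couplings FF \<mu> \<nu>" "emeasure \<pi> {p. fst p \<noteq> snd p} \<le> emeasure \<pi>3 {p. fst p \<noteq> snd p} + emeasure \<pi>2 {p. fst p \<noteq> snd p}"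
    using bc_couplings_neq_trans[OF 3(1) 2(1) FF'] by blast
  then show ?thesis using le by (intro bexI[of _ \<pi>]) auto
qed

section \<open>Transport distances\<close>

text \<open>Convexity of the power at the points \<open>a / w1\<close> and \<open>b / w2\<close>,
  whose weighted mean is \<open>a + b\<close>. With weights adapted to two given costs this becomes
  Minkowski's inequality.\<close>

lemma powr_add_convex:
  fixes a b p w1 w2 :: real
  assumes p: "1 \<le> p" and ab: "0 \<le> a" "0 \<le> b" and w: "0 < w1" "0 < w2" "w1 + w2 = 1"
  shows "(a + b) powr p \<le> w1 * (a / w1) powr p + w2 * (b / w2) powr p"
proof -
  \<comment> \<open>This covers a vanishing summand, by \<open>w powr p \<le> w\<close> for weights
    at most 1. Convexity is then applied to positive arguments.\<close>
  have one: "x powr p \<le> w * (x / w) powr p" if "0 < w" "w \<le> 1" "0 \<le> x" for x w :: real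
  proof -
    have "w powr p \<le> w powr 1" using that p by (intro powr_mono') auto
    then have "w powr p \<le> w" using that by simp
    then have "x powr p * w powr p \<le> x powr p * w" by (intro mult_left_mono) auto
    then show ?thesis using that by (simp add: powr_divide field_simps)
  qed
  consider "a = 0" | "b = 0" | "a > 0" "b > 0" using ab by linarith
  then show ?thesis
  proof cases
    case 1 then show ?thesis using one[of w2 b] w ab p by simp
  next
    case 2 then show ?thesis using one[of w1 a] w ab p by simp
  next
    case 3
    have "((1 - w2) *\<^sub>R (a / w1) + w2 *\<^sub>R (b / w2)) powr p \<le> (1 - w2) * (a / w1) powr p + w2 * (b / w2) powr p"
      by (rule convex_onD[OF powr_convex[OF p]]) (use w 3 in auto)
    moreover have "1 - w2 = w1" using w by simp
    ultimately show ?thesis using w by simp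
  qed
qed

text \<open>Each term is at most the maximum, whose power is one of the summands on the right. The
  constant is cruder than the one from convexity, but it serves all exponents
  \<open>p \<ge> 0\<close>.\<close>

lemma powr_sum_le:
  fixes a :: "'i \<Rightarrow> real"
  assumes "finite I" "0 \<le> p" "\<And>i. i \<in> I \<Longrightarrow> 0 \<le> a i"
  shows "(\<Sum>i\<in>I. a i) powr p \<le> real (card I) powr p * (\<Sum>i\<in>I. a i powr p)"
proof (cases "I = {}")
  case False
  define m where "m = Max (a ` I)"
  have "m \<in> a ` I" unfolding m_def using assms False by (intro Max_in) auto
  then obtain i where i: "i \<in> I" "m = a i" by auto
  have "(\<Sum>i\<in>I. a i) \<le> (\<Sum>i\<in>I. m)" unfolding m_def using assms by (intro sum_mono Max_ge) auto
  then have "(\<Sum>i\<in>I. a i) powr p \<le> (real (card I) * m) powr p"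
    using assms by (intro powr_mono2) (auto intro: sum_nonneg)
  also have "\<dots> = real (card I) powr p * m powr p" using assms i by (subst powr_mult) auto
  also have "m powr p \<le> (\<Sum>i\<in>I. a i powr p)"
    unfolding i(2) using assms i by (intro member_le_sum) auto
  finally show ?thesis by (simp add: mult_left_mono)
qed simp

lemma norm_add_powr_le:
  fixes x y :: "'a::real_normed_vector"
  assumes "0 \<le> p"
  shows "norm (x + y) powr p \<le> 2 powr p * (norm x powr p + norm y powr p)"
proof -
  have "norm (x + y) \<le> 2 * max (norm x) (norm y)" using norm_triangle_ineq[of x y] by linarith
  then have "norm (x + y) powr p \<le> (2 * max (norm x) (norm y)) powr p" using assms by (intro powr_mono2) auto
  also have "\<dots> = 2 powr p * max (norm x) (norm y) powr p" by (subst powr_mult) auto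
  also have "\<dots> \<le> 2 powr p * (norm x powr p + norm y powr p)" by (intro mult_left_mono) (auto simp: max_def)
  finally show ?thesis .
qed

definition tail_moment :: "real \<Rightarrow> 'a::euclidean_space measure \<Rightarrow> real \<Rightarrow> ennreal" where
  "tail_moment p \<mu> R = (\<integral>\<^sup>+x. ennreal (norm x powr p) * indicator {x. R < norm x} x \<partial>\<mu>)"

lemma prob_finite_momentD:
  assumes "\<mu> \<in> prob_finite_moment p"
  shows "prob_space \<mu>" "sets \<mu> = sets borel" "(\<integral>\<^sup>+x. ennreal (norm x powr p) \<partial>\<mu>) < \<infinity>"
  using assms by (auto simp: prob_finite_moment_def integrable_iff_bounded)

lemma prob_finite_momentI:
  assumes "prob_space \<mu>" "sets \<mu> = sets borel" "(\<integral>\<^sup>+x. ennreal (norm x powr p) \<partial>\<mu>) < \<infinity>"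
  shows "\<mu> \<in> prob_finite_moment p"
proof -
  have [measurable_cong]: "sets \<mu> = sets borel" by fact
  show ?thesis using assms by (auto simp: prob_finite_moment_def integrable_iff_bounded)
qed

text \<open>One locale serves both distances: the norms at the single times with the family of
  histories give the adapted one, and the full norm with the empty family gives the ordinary one.
  The bounds between \<open>N\<close> and the norm make either cost comparable to the p-th power of
  the norm.\<close>

locale transport =
  fixes p :: real and FF :: "'a::euclidean_space measure set" and I :: "'i set" and N :: "'i \<Rightarrow> 'a \<Rightarrow> real"
  assumes p: "1 \<le> p" and FF: "\<And>F. F \<in> FF \<Longrightarrow> subalgebra borel F" and finI: "finite I"
    and N_meas[measurable]: "\<And>i. N i \<in> borel_measurable borel"
    and N_nonneg: "\<And>i x. 0 \<le> N i x" and N_minus: "\<And>i x. N i (- x) = N i x"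
    and N_tri: "\<And>i x y. N i (x + y) \<le> N i x + N i y" and N_le: "\<And>i x. N i x \<le> norm x"
    and N_norm: "\<And>x. norm x \<le> (\<Sum>i\<in>I. N i x)"
begin

definition cost :: "'a \<Rightarrow> 'a \<Rightarrow> real" where
  "cost x y = (\<Sum>i\<in>I. N i (x - y) powr p)"

definition total :: "('a \<times> 'a) measure \<Rightarrow> ennreal" where
  "total \<pi> = (\<integral>\<^sup>+q. ennreal (cost (fst q) (snd q)) \<partial>\<pi>)"

definition D :: "'a measure \<Rightarrow> 'a measure \<Rightarrow> real" where
  "D \<mu> \<nu> = enn2real (INF \<pi>\<in>bc_couplings FF \<mu> \<nu>. total \<pi>) powr (1 / p)"

lemma cost_nonneg: "0 \<le> cost x y" unfolding cost_def by (intro sum_nonneg) simp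

lemma cost_measurable[measurable]: "(\<lambda>q. cost (fst q) (snd q)) \<in> borel_measurable (borel \<Otimes>\<^sub>M borel)"
  unfolding cost_def by measurable

lemma cost_refl: "cost x x = 0"
proof -
  have "N i 0 = 0" for i using N_le[of i 0] N_nonneg[of i 0] by simp
  then show ?thesis by (simp add: cost_def)
qed

lemma cost_sym: "cost x y = cost y x"
  unfolding cost_def using N_minus[of _ "x - y"] by simp

lemma cost_le_norm: "cost x y \<le> real (card I) * norm (x - y) powr p"
proof -
  have "cost x y \<le> (\<Sum>i\<in>I. norm (x - y) powr p)"
    unfolding cost_def using p by (intro sum_mono powr_mono2 N_nonneg N_le) auto
  then show ?thesis by simp
qed

lemma norm_le_cost: "norm (x - y) powr p \<le> real (card I) powr p * cost x y"
proof -
  have "norm (x - y) powr p \<le> (\<Sum>i\<in>I. N i (x - y)) powr p"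
    using p by (intro powr_mono2 N_norm) auto
  also have "\<dots> \<le> real (card I) powr p * cost x y"
    unfolding cost_def using p by (intro powr_sum_le finI N_nonneg) auto
  finally show ?thesis .
qed

lemma bcD: "\<pi> \<in> bc_couplings FF \<mu> \<nu> \<Longrightarrow> \<pi> \<in> couplings \<mu> \<nu>" by (simp add: bc_couplings_def)

lemma total_finite:
  assumes \<mu>: "\<mu> \<in> prob_finite_moment p" and \<nu>: "\<nu> \<in> prob_finite_moment p" and \<pi>: "\<pi> \<in> couplings \<mu> \<nu>"
  shows "total \<pi> < \<infinity>"
proof -
  have [measurable_cong]: "sets \<pi> = sets (borel \<Otimes>\<^sub>M borel)" by (rule couplingsD[OF \<pi>])
  let ?C = "real (card I) * 2 powr p"
  have "total \<pi> \<le> (\<integral>\<^sup>+q. ennreal (?C * (norm (fst q) powr p + norm (snd q) powr p)) \<partial>\<pi>)"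
    unfolding total_def
  proof (intro nn_integral_mono ennreal_leI)
    fix q :: "'a \<times> 'a"
    have "norm (fst q - snd q) powr p \<le> 2 powr p * (norm (fst q) powr p + norm (snd q) powr p)"
      using norm_add_powr_le[of p "fst q" "- snd q"] p by simp
    then have "real (card I) * norm (fst q - snd q) powr p \<le> real (card I) * (2 powr p * (norm (fst q) powr p + norm (snd q) powr p))"
      by (rule mult_left_mono) simp
    then show "cost (fst q) (snd q) \<le> ?C * (norm (fst q) powr p + norm (snd q) powr p)"
      using cost_le_norm[of "fst q" "snd q"] by (simp add: mult.assoc)
  qed
  also have "\<dots> = (\<integral>\<^sup>+q. ennreal ?C * (ennreal (norm (fst q) powr p) + ennreal (norm (snd q) powr p)) \<partial>\<pi>)"
    by (simp add: ennreal_mult')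
  also have "\<dots> = ennreal ?C * ((\<integral>\<^sup>+q. ennreal (norm (fst q) powr p) \<partial>\<pi>) + (\<integral>\<^sup>+q. ennreal (norm (snd q) powr p) \<partial>\<pi>))"
    by (simp add: nn_integral_cmult nn_integral_add)
  also have "\<dots> = ennreal ?C * ((\<integral>\<^sup>+x. ennreal (norm x powr p) \<partial>\<mu>) + (\<integral>\<^sup>+x. ennreal (norm x powr p) \<partial>\<nu>))"
    by (simp add: nn_integral_coupling_fst[OF \<pi>, of "\<lambda>x. ennreal (norm x powr p)"] nn_integral_coupling_snd[OF \<pi>, of "\<lambda>x. ennreal (norm x powr p)"])
  also have "\<dots> < \<infinity>"
    using prob_finite_momentD(3)[OF \<mu>] prob_finite_momentD(3)[OF \<nu>] by (simp add: ennreal_mult_less_top)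
  finally show ?thesis .
qed

section \<open>The transport distance as a metric\<close>

lemma INF_finite:
  assumes \<mu>: "\<mu> \<in> prob_finite_moment p" and \<nu>: "\<nu> \<in> prob_finite_moment p"
  shows "(INF \<pi>\<in>bc_couplings FF \<mu> \<nu>. total \<pi>) < \<infinity>"
proof -
  have "\<mu> \<Otimes>\<^sub>M \<nu> \<in> bc_couplings FF \<mu> \<nu>"
    using prob_finite_momentD[OF \<mu>] prob_finite_momentD[OF \<nu>] by (intro bc_couplings_pair FF)
  then show ?thesis
    using total_finite[OF \<mu> \<nu> bcD] by (auto simp: INF_less_iff)
qed

lemma D_nonneg: "0 \<le> D \<mu> \<nu>" by (simp add: D_def)

text \<open>An infimum below a bound is beaten by some coupling, even if it is not attained.
  Finiteness of the infimum makes \<open>enn2real\<close> faithful.\<close>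

lemma D_less_iff:
  assumes \<mu>: "\<mu> \<in> prob_finite_moment p" and \<nu>: "\<nu> \<in> prob_finite_moment p" and r: "0 < r"
  shows "D \<mu> \<nu> < r \<longleftrightarrow> (\<exists>\<pi>\<in>bc_couplings FF \<mu> \<nu>. total \<pi> < ennreal (r powr p))"
proof -
  let ?i = "INF \<pi>\<in>bc_couplings FF \<mu> \<nu>. total \<pi>"
  have fin: "?i < \<infinity>" by (rule INF_finite[OF \<mu> \<nu>])
  have "D \<mu> \<nu> < r \<longleftrightarrow> enn2real ?i < r powr p"
  proof
    assume "D \<mu> \<nu> < r"
    then have "(enn2real ?i powr (1 / p)) powr p < r powr p"
      unfolding D_def using p by (intro powr_less_mono2) auto
    then show "enn2real ?i < r powr p" using p by (simp add: powr_powr)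
  next
    assume "enn2real ?i < r powr p"
    then have "D \<mu> \<nu> < (r powr p) powr (1 / p)"
      unfolding D_def using p by (intro powr_less_mono2) auto
    then show "D \<mu> \<nu> < r" using p r by (simp add: powr_powr)
  qed
  also have "\<dots> \<longleftrightarrow> ?i < ennreal (r powr p)"
    using fin by (cases ?i) (auto simp: ennreal_less_iff)
  also have "\<dots> \<longleftrightarrow> (\<exists>\<pi>\<in>bc_couplings FF \<mu> \<nu>. total \<pi> < ennreal (r powr p))"
    by (simp add: INF_less_iff)
  finally show ?thesis .
qed

lemma D_sym: "D \<mu> \<nu> = D \<nu> \<mu>"
proof -
  have le: "(INF \<pi>\<in>bc_couplings FF \<mu> \<nu>. total \<pi>) \<le> (INF \<pi>\<in>bc_couplings FF \<nu> \<mu>. total \<pi>)" for \<mu> \<nu>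
  proof (rule INF_greatest)
    fix \<pi> assume \<pi>: "\<pi> \<in> bc_couplings FF \<nu> \<mu>"
    have [measurable_cong]: "sets \<pi> = sets (borel \<Otimes>\<^sub>M borel)" by (rule couplingsD[OF bcD[OF \<pi>]])
    have "total (distr \<pi> (borel \<Otimes>\<^sub>M borel) (\<lambda>p. (snd p, fst p))) = total \<pi>"
      unfolding total_def by (subst nn_integral_distr) (auto simp: cost_sym)
    then show "(INF \<pi>\<in>bc_couplings FF \<mu> \<nu>. total \<pi>) \<le> total \<pi>"
      using INF_lower[OF bc_couplings_sym[OF \<pi> FF], where f=total] by simp
  qed
  show ?thesis unfolding D_def using antisym[OF le[of \<mu> \<nu>] le[of \<nu> \<mu>]] by simp
qed

lemma D_refl:
  assumes \<mu>: "\<mu> \<in> prob_finite_moment p"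
  shows "D \<mu> \<mu> = 0"
proof -
  have [measurable_cong]: "sets \<mu> = sets borel" by (rule prob_finite_momentD[OF \<mu>])
  have "total (distr \<mu> (borel \<Otimes>\<^sub>M borel) (\<lambda>x. (x, x))) = 0"
    unfolding total_def by (subst nn_integral_distr) (auto simp: cost_refl)
  then have "(INF \<pi>\<in>bc_couplings FF \<mu> \<mu>. total \<pi>) = 0"
    using INF_lower[OF bc_couplings_refl[OF prob_finite_momentD(1,2)[OF \<mu>] FF], where f=total] by simp
  then show ?thesis using p by (simp add: D_def)
qed

text \<open>Minkowski's inequality for strict bounds. With weights proportional to \<open>r\<close>
  and \<open>s\<close>, the two terms from \<open>powr_add_convex\<close> stay below
  \<open>w1 * (r + s) powr p\<close> and \<open>w2 * (r + s) powr p\<close>, and the weights add up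
  to 1.\<close>

lemma total_glue:
  fixes M :: "'w measure"
  assumes [measurable]: "X \<in> borel_measurable M" "Y \<in> borel_measurable M" "Z \<in> borel_measurable M"
    and rs: "0 < r" "0 < s"
    and 1: "(\<integral>\<^sup>+w. ennreal (cost (X w) (Y w)) \<partial>M) < ennreal (r powr p)"
    and 2: "(\<integral>\<^sup>+w. ennreal (cost (Y w) (Z w)) \<partial>M) < ennreal (s powr p)"
  shows "(\<integral>\<^sup>+w. ennreal (cost (X w) (Z w)) \<partial>M) < ennreal ((r + s) powr p)"
proof -
  define w1 w2 where "w1 = r / (r + s)" and "w2 = s / (r + s)"
  have w: "0 < w1" "0 < w2" "w1 + w2 = 1" using rs by (auto simp: w1_def w2_def add_divide_distrib[symmetric])
  define c1 c2 where "c1 = w1 * (1 / w1) powr p" and "c2 = w2 * (1 / w2) powr p"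
  have c: "0 < c1" "0 < c2" using w by (auto simp: c1_def c2_def)
  have pw: "cost x z \<le> c1 * cost x y + c2 * cost y z" for x y z
  proof -
    have "N i (x - z) powr p \<le> c1 * N i (x - y) powr p + c2 * N i (y - z) powr p" for i
    proof -
      have "N i (x - z) powr p \<le> (N i (x - y) + N i (y - z)) powr p"
        using N_tri[of i "x - y" "y - z"] p by (intro powr_mono2 N_nonneg) auto
      also have "\<dots> \<le> w1 * (N i (x - y) / w1) powr p + w2 * (N i (y - z) / w2) powr p"
        by (intro powr_add_convex p N_nonneg w)
      also have "\<dots> = c1 * N i (x - y) powr p + c2 * N i (y - z) powr p"
        using w by (simp add: c1_def c2_def powr_divide N_nonneg)
      finally show ?thesis .
    qed
    then show ?thesis unfolding cost_def by (simp add: sum_distrib_left sum.distrib[symmetric] sum_mono)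
  qed
  have cm: "(\<lambda>w. cost (f w) (g w)) \<in> borel_measurable M" if [measurable]: "f \<in> borel_measurable M" "g \<in> borel_measurable M" for f g
    unfolding cost_def by measurable
  have "(\<integral>\<^sup>+w. ennreal (cost (X w) (Z w)) \<partial>M) \<le> (\<integral>\<^sup>+w. ennreal c1 * ennreal (cost (X w) (Y w)) + ennreal c2 * ennreal (cost (Y w) (Z w)) \<partial>M)"
    using c by (intro nn_integral_mono) (auto simp: ennreal_mult'[symmetric] ennreal_plus[symmetric] cost_nonneg simp del: ennreal_plus intro!: ennreal_leI pw)
  also have "\<dots> = ennreal c1 * (\<integral>\<^sup>+w. ennreal (cost (X w) (Y w)) \<partial>M) + ennreal c2 * (\<integral>\<^sup>+w. ennreal (cost (Y w) (Z w)) \<partial>M)"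
    using cm by (simp add: nn_integral_add nn_integral_cmult)
  also have "\<dots> < ennreal c1 * ennreal (r powr p) + ennreal c2 * ennreal (s powr p)"
    using c 1 2 by (intro add_strict_mono ennreal_mult_strict_left_mono) auto
  also have "\<dots> = ennreal (c1 * r powr p + c2 * s powr p)"
    using c by (simp add: ennreal_mult)
  also have "c1 * r powr p + c2 * s powr p = (r + s) powr p"
  proof -
    have "c1 * r powr p = w1 * (r + s) powr p" "c2 * s powr p = w2 * (r + s) powr p"
      using rs by (auto simp: c1_def c2_def w1_def w2_def powr_divide)
    then show ?thesis using w(3) by (simp add: distrib_right[symmetric])
  qed
  finally show ?thesis .
qed

lemma D_triangle:
  assumes \<mu>: "\<mu> \<in> prob_finite_moment p" and \<nu>: "\<nu> \<in> prob_finite_moment p" and \<eta>: "\<eta> \<in> prob_finite_moment p"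
  shows "D \<mu> \<eta> \<le> D \<mu> \<nu> + D \<nu> \<eta>"
proof (rule field_le_epsilon)
  fix e :: real assume e: "0 < e"
  \<comment> \<open>Half of the slack goes to each distance, which also keeps both radii positive
    when a distance is 0.\<close>
  define r s where "r = D \<mu> \<nu> + e / 2" and "s = D \<nu> \<eta> + e / 2"
  have rs: "0 < r" "0 < s" using e D_nonneg[of \<mu> \<nu>] D_nonneg[of \<nu> \<eta>] by (auto simp: r_def s_def)
  obtain \<pi>1 where 1: "\<pi>1 \<in> bc_couplings FF \<mu> \<nu>" "total \<pi>1 < ennreal (r powr p)"
    using D_less_iff[OF \<mu> \<nu> rs(1)] e by (auto simp: r_def)
  obtain \<pi>2 where 2: "\<pi>2 \<in> bc_couplings FF \<nu> \<eta>" "total \<pi>2 < ennreal (s powr p)"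
    using D_less_iff[OF \<nu> \<eta> rs(2)] e by (auto simp: s_def)
  from bc_couplings_glue[OF 1(1) 2(1) FF] obtain \<Gamma> where
    s[measurable_cong]: "sets \<Gamma> = sets (borel \<Otimes>\<^sub>M (borel \<Otimes>\<^sub>M borel))" and
    g1: "\<And>g. g \<in> borel_measurable (borel \<Otimes>\<^sub>M borel) \<Longrightarrow> (\<integral>\<^sup>+w. g (fst w, fst (snd w)) \<partial>\<Gamma>) = (\<integral>\<^sup>+p. g p \<partial>\<pi>1)" and
    g2: "\<And>g. g \<in> borel_measurable (borel \<Otimes>\<^sub>M borel) \<Longrightarrow> (\<integral>\<^sup>+w. g (snd w) \<partial>\<Gamma>) = (\<integral>\<^sup>+p. g p \<partial>\<pi>2)" and
    g3: "distr \<Gamma> (borel \<Otimes>\<^sub>M borel) (\<lambda>w. (fst w, snd (snd w))) \<in> bc_couplings FF \<mu> \<eta>" by blast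
  have "total (distr \<Gamma> (borel \<Otimes>\<^sub>M borel) (\<lambda>w. (fst w, snd (snd w)))) = (\<integral>\<^sup>+w. ennreal (cost (fst w) (snd (snd w))) \<partial>\<Gamma>)"
    unfolding total_def by (subst nn_integral_distr) auto
  also have "\<dots> < ennreal ((r + s) powr p)"
  proof (rule total_glue[where Y="\<lambda>w. fst (snd w)", OF _ _ _ rs])
    show "(\<integral>\<^sup>+w. ennreal (cost (fst w) (fst (snd w))) \<partial>\<Gamma>) < ennreal (r powr p)"
      using g1[of "\<lambda>q. ennreal (cost (fst q) (snd q))"] 1(2) by (simp add: total_def)
    show "(\<integral>\<^sup>+w. ennreal (cost (fst (snd w)) (snd (snd w))) \<partial>\<Gamma>) < ennreal (s powr p)"
      using g2[of "\<lambda>q. ennreal (cost (fst q) (snd q))"] 2(2) by (simp add: total_def)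
  qed measurable
  finally have "D \<mu> \<eta> < r + s" using g3 rs by (subst D_less_iff[OF \<mu> \<eta>]) auto
  then show "D \<mu> \<eta> \<le> D \<mu> \<nu> + D \<nu> \<eta> + e" by (simp add: r_def s_def)
qed

text \<open>Markov's inequality: a coupling of small cost rarely moves a point of \<open>C\<close>
  out of the closed \<open>e\<close>-neighbourhood of \<open>C\<close>. As \<open>e\<close> tends to
  0 the neighbourhoods shrink to \<open>C\<close>, because \<open>C\<close> is closed.\<close>

lemma D_zero_closed_le:
  assumes \<mu>: "\<mu> \<in> prob_finite_moment p" and \<nu>: "\<nu> \<in> prob_finite_moment p" and 0: "D \<mu> \<nu> = 0" and C: "closed C"
  shows "emeasure \<mu> C \<le> emeasure \<nu> C"
proof (cases "C = {}")
  case False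
  have [measurable_cong]: "sets \<mu> = sets borel" "sets \<nu> = sets borel" using prob_finite_momentD \<mu> \<nu> by blast+
  interpret nu: prob_space \<nu> by (rule prob_finite_momentD[OF \<nu>])
  have [measurable]: "C \<in> sets borel" using C by simp
  have le: "emeasure \<mu> C \<le> emeasure \<nu> {y. infdist y C \<le> e}" if e: "0 < e" for e
  proof (rule ennreal_le_epsilon)
    fix d :: real assume d: "0 < d"
    define K where "K = real (card I) powr p"
    have K0: "0 \<le> K" by (simp add: K_def)
    \<comment> \<open>Chosen so that \<open>K / e powr p * t \<le> d\<close>; the summand 1 covers
      \<open>K = 0\<close>.\<close>
    define t where "t = d * e powr p / (K + 1)"
    have t: "0 < t" using d e K0 by (simp add: t_def)
    obtain \<pi> where \<pi>: "\<pi> \<in> bc_couplings FF \<mu> \<nu>" "total \<pi> < ennreal ((t powr (1/p)) powr p)"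
      using D_less_iff[OF \<mu> \<nu>, of "t powr (1/p)"] t 0 by auto
    have tot: "total \<pi> < ennreal t" using \<pi>(2) p t by (simp add: powr_powr)
    have c: "\<pi> \<in> couplings \<mu> \<nu>" by (rule bcD[OF \<pi>(1)])
    have [measurable_cong]: "sets \<pi> = sets (borel \<Otimes>\<^sub>M borel)" by (rule couplingsD[OF c])
    have [measurable]: "{y. infdist y C \<le> e} \<in> sets borel"
      by (intro borel_closed closed_Collect_le continuous_intros)
    have pw: "indicator C (fst q) \<le> indicator {y. infdist y C \<le> e} (snd q) + ennreal (K / e powr p) * ennreal (cost (fst q) (snd q))" for q
    proof (cases "fst q \<in> C \<and> \<not> infdist (snd q) C \<le> e")
      case True
      then have "infdist (snd q) C \<le> dist (snd q) (fst q)" by (intro infdist_le) auto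
      then have "e \<le> norm (fst q - snd q)" using True by (simp add: dist_norm norm_minus_commute)
      then have "e powr p \<le> norm (fst q - snd q) powr p" using e p by (intro powr_mono2) auto
      also have "\<dots> \<le> K * cost (fst q) (snd q)" unfolding K_def by (rule norm_le_cost)
      finally have "1 \<le> K / e powr p * cost (fst q) (snd q)" using e by (simp add: field_simps)
      then have "ennreal 1 \<le> ennreal (K / e powr p) * ennreal (cost (fst q) (snd q))"
        using K0 by (subst ennreal_mult[symmetric]) (auto simp: cost_nonneg intro: ennreal_leI)
      then show ?thesis using True by simp
    qed (auto split: split_indicator)
    have "emeasure \<mu> C = (\<integral>\<^sup>+q. indicator C (fst q) \<partial>\<pi>)"
      by (subst nn_integral_coupling_fst[OF c]) auto
    also have "\<dots> \<le> (\<integral>\<^sup>+q. indicator {y. infdist y C \<le> e} (snd q) + ennreal (K / e powr p) * ennreal (cost (fst q) (snd q)) \<partial>\<pi>)"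
      by (rule nn_integral_mono) (rule pw)
    also have "\<dots> = (\<integral>\<^sup>+q. indicator {y. infdist y C \<le> e} (snd q) \<partial>\<pi>) + ennreal (K / e powr p) * total \<pi>"
      unfolding total_def by (subst nn_integral_add) (auto simp: nn_integral_cmult)
    also have "(\<integral>\<^sup>+q. indicator {y. infdist y C \<le> e} (snd q) \<partial>\<pi>) = emeasure \<nu> {y. infdist y C \<le> e}"
      by (subst nn_integral_coupling_snd[OF c]) auto
    also have "ennreal (K / e powr p) * total \<pi> \<le> ennreal (K / e powr p) * ennreal t"
      using tot by (intro mult_left_mono) auto
    also have "\<dots> = ennreal (K / e powr p * t)" by (rule ennreal_mult[symmetric]) (use K0 t in auto)
    also have "\<dots> \<le> ennreal d"
    proof (rule ennreal_leI)
      have "K / e powr p * t = d * (K / (K + 1))" using e by (simp add: t_def)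
      also have "\<dots> \<le> d * 1" using d K0 by (intro mult_left_mono) auto
      finally show "K / e powr p * t \<le> d" by simp
    qed
    finally show "emeasure \<mu> C \<le> emeasure \<nu> {y. infdist y C \<le> e} + ennreal d" by (simp add: add_left_mono)
  qed
  have "emeasure \<mu> C \<le> (INF n::nat. emeasure \<nu> {y. infdist y C \<le> 1 / Suc n})"
    by (rule INF_greatest) (rule le, simp)
  also have "\<dots> = emeasure \<nu> (\<Inter>n::nat. {y. infdist y C \<le> 1 / Suc n})"
  proof (intro INF_emeasure_decseq)
    have "(1::real) / Suc n \<le> 1 / Suc m" if "m \<le> n" for m n using that by (simp add: field_simps)
    then show "decseq (\<lambda>n::nat. {y. infdist y C \<le> 1 / Suc n})" by (fastforce simp: decseq_def)
    have "{y. infdist y C \<le> 1 / Suc n} \<in> sets borel" for n :: nat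
      by (intro borel_closed closed_Collect_le continuous_intros)
    then show "range (\<lambda>n::nat. {y. infdist y C \<le> 1 / Suc n}) \<subseteq> sets \<nu>" using prob_finite_momentD(2)[OF \<nu>] by auto
  qed auto
  also have "(\<Inter>n::nat. {y. infdist y C \<le> 1 / Suc n}) = C"
  proof -
    have "y \<in> C" if "\<forall>n::nat. infdist y C \<le> 1 / Suc n" for y
    proof -
      have "infdist y C \<le> 0"
      proof (rule ccontr)
        assume "\<not> infdist y C \<le> 0"
        then obtain n where "inverse (of_nat (Suc n)) < infdist y C" using reals_Archimedean[of "infdist y C"] by auto
        with that[rule_format, of n] show False by (simp add: inverse_eq_divide)
      qed
      then show ?thesis using C False in_closed_iff_infdist_zero[OF C False] infdist_nonneg[of y C] by auto
    qed
    then show ?thesis by auto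
  qed
  finally show ?thesis .
qed simp

lemma D_zero_imp_eq:
  assumes \<mu>: "\<mu> \<in> prob_finite_moment p" and \<nu>: "\<nu> \<in> prob_finite_moment p" and 0: "D \<mu> \<nu> = 0"
  shows "\<mu> = \<nu>"
proof (rule measure_eqI_generator_eq[where E="Collect closed" and \<Omega>=UNIV and A="\<lambda>_. UNIV"])
  show "Int_stable (Collect closed :: 'a set set)" by (auto simp: Int_stable_def)
  have b: "sets (borel :: 'a measure) = sigma_sets UNIV (Collect closed)" by (subst borel_eq_closed) simp
  show "sets \<mu> = sigma_sets UNIV (Collect closed)" "sets \<nu> = sigma_sets UNIV (Collect closed)"
    using prob_finite_momentD(2)[OF \<mu>] prob_finite_momentD(2)[OF \<nu>] b by auto
  have Z': "D \<nu> \<mu> = 0" using 0 D_sym by simp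
  show "emeasure \<mu> X = emeasure \<nu> X" if "X \<in> Collect closed" for X
    using that D_zero_closed_le[OF \<mu> \<nu> 0] D_zero_closed_le[OF \<nu> \<mu> Z'] by (auto intro: antisym)
  show "emeasure \<mu> UNIV \<noteq> \<infinity>"
    using prob_space.emeasure_le_1[OF prob_finite_momentD(1)[OF \<mu>], of UNIV] by (auto simp: top_unique)
qed auto

lemma Metric_space_D: "Metric_space (prob_finite_moment p) D"
proof
  fix x y z
  show "0 \<le> D x y" by (rule D_nonneg)
  show "D x y = D y x" by (rule D_sym)
  show "D x y = 0 \<longleftrightarrow> x = y" if "x \<in> prob_finite_moment p" "y \<in> prob_finite_moment p"
    using that D_zero_imp_eq D_refl by blast
  show "D x z \<le> D x y + D y z" if "x \<in> prob_finite_moment p" "y \<in> prob_finite_moment p" "z \<in> prob_finite_moment p"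
    using that by (rule D_triangle)
qed

lemma D_tendsto_0_iff:
  assumes \<mu>s: "\<And>n::nat. \<mu>s n \<in> prob_finite_moment p" and \<mu>: "\<mu> \<in> prob_finite_moment p"
  shows "(\<lambda>n. D (\<mu>s n) \<mu>) \<longlonglongrightarrow> 0 \<longleftrightarrow> (\<exists>\<pi>. (\<forall>n. \<pi> n \<in> bc_couplings FF (\<mu>s n) \<mu>) \<and> (\<lambda>n. total (\<pi> n)) \<longlonglongrightarrow> 0)"
proof
  assume lim: "(\<lambda>n. D (\<mu>s n) \<mu>) \<longlonglongrightarrow> 0"
  \<comment> \<open>The summand \<open>1 / Suc n\<close> leaves room above an infimum that may not
    be attained, and keeps the radius positive.\<close>
  define r where "r n = D (\<mu>s n) \<mu> + 1 / Suc n" for n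
  have r0: "0 < r n" for n using D_nonneg[of "\<mu>s n" \<mu>] by (auto simp: r_def intro: add_nonneg_pos)
  have "\<exists>\<pi>. \<pi> \<in> bc_couplings FF (\<mu>s n) \<mu> \<and> total \<pi> < ennreal (r n powr p)" for n
    using D_less_iff[OF \<mu>s \<mu> r0[of n], of n] by (auto simp: r_def)
  then have "\<exists>\<pi>. \<forall>n. \<pi> n \<in> bc_couplings FF (\<mu>s n) \<mu> \<and> total (\<pi> n) < ennreal (r n powr p)"
    by (intro choice allI)
  then obtain \<pi> where \<pi>: "\<And>n. \<pi> n \<in> bc_couplings FF (\<mu>s n) \<mu>" "\<And>n. total (\<pi> n) < ennreal (r n powr p)" by blast
  have "r \<longlonglongrightarrow> 0 + 0" unfolding r_def by (intro tendsto_add lim LIMSEQ_Suc[OF lim_1_over_n])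
  then have "(\<lambda>n. r n powr p) \<longlonglongrightarrow> 0"
    using p r0 by (intro tendsto_zero_powrI[where b=p]) (auto intro!: always_eventually less_imp_le)
  then have "(\<lambda>n. ennreal (r n powr p)) \<longlonglongrightarrow> ennreal 0" by (intro tendsto_ennrealI)
  then have "(\<lambda>n. total (\<pi> n)) \<longlonglongrightarrow> 0"
    using tendsto_sandwich[of "\<lambda>_. 0" "\<lambda>n. total (\<pi> n)" sequentially "\<lambda>n. ennreal (r n powr p)" 0] \<pi>(2)
    by (simp add: less_imp_le)
  with \<pi>(1) show "\<exists>\<pi>. (\<forall>n. \<pi> n \<in> bc_couplings FF (\<mu>s n) \<mu>) \<and> (\<lambda>n. total (\<pi> n)) \<longlonglongrightarrow> 0" by blast
next
  assume "\<exists>\<pi>. (\<forall>n. \<pi> n \<in> bc_couplings FF (\<mu>s n) \<mu>) \<and> (\<lambda>n. total (\<pi> n)) \<longlonglongrightarrow> 0"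
  then obtain \<pi> where \<pi>: "\<And>n. \<pi> n \<in> bc_couplings FF (\<mu>s n) \<mu>" and lim: "(\<lambda>n. total (\<pi> n)) \<longlonglongrightarrow> 0" by blast
  show "(\<lambda>n. D (\<mu>s n) \<mu>) \<longlonglongrightarrow> 0"
  proof (rule tendstoI)
    fix e :: real assume e: "0 < e"
    have "\<forall>\<^sub>F n in sequentially. total (\<pi> n) < ennreal (e powr p)"
      using order_tendstoD(2)[OF lim, of "ennreal (e powr p)"] e by simp
    then show "\<forall>\<^sub>F n in sequentially. dist (D (\<mu>s n) \<mu>) 0 < e"
    proof eventually_elim
      case (elim n)
      then have "D (\<mu>s n) \<mu> < e" using D_less_iff[OF \<mu>s \<mu> e, of n] \<pi> by blast
      then show ?case using D_nonneg[of "\<mu>s n" \<mu>] by simp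
    qed
  qed
qed

end

section \<open>Tails and convergence in total variation\<close>

text \<open>The longer of the two vectors has at least half the norm of the sum. It therefore lies
  beyond \<open>R / 2\<close>, and its p-th power times \<open>2 powr p\<close> dominates.\<close>

lemma tail_pointwise:
  fixes u v :: "'a::real_normed_vector"
  assumes p: "0 \<le> p"
  shows "ennreal (norm (u + v) powr p) * indicator {x. R < norm x} (u + v)
    \<le> ennreal (2 powr p) * (ennreal (norm u powr p) * indicator {x. R / 2 < norm x} u + ennreal (norm v powr p) * indicator {x. R / 2 < norm x} v)"
proof (cases "R < norm (u + v)")
  case True
  have le: "norm (u + v) \<le> norm u + norm v" by (rule norm_triangle_ineq)
  have *: "ennreal (norm (u + v) powr p) \<le> ennreal (2 powr p) * ennreal (m powr p)" if "norm (u + v) \<le> 2 * m" "0 \<le> m" for m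
  proof -
    have "norm (u + v) powr p \<le> (2 * m) powr p" using that p by (intro powr_mono2) auto
    also have "\<dots> = 2 powr p * m powr p" using that by (subst powr_mult) auto
    finally have "ennreal (norm (u + v) powr p) \<le> ennreal (2 powr p * m powr p)" by (rule ennreal_leI)
    then show ?thesis by (simp add: ennreal_mult)
  qed
  show ?thesis
  proof (cases "norm v \<le> norm u")
    case True
    then have "R / 2 < norm u" using le \<open>R < norm (u + v)\<close> by linarith
    then show ?thesis using *[of "norm u"] True le \<open>R < norm (u + v)\<close>
      by (auto simp: distrib_left intro: add_increasing2)
  next
    case False
    then have "R / 2 < norm v" using le \<open>R < norm (u + v)\<close> by linarith
    then show ?thesis using *[of "norm v"] False le \<open>R < norm (u + v)\<close>
      by (auto simp: distrib_left intro: add_increasing)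
  qed
qed simp

lemma tail_sum:
  fixes U V :: "'w \<Rightarrow> 'a::euclidean_space"
  assumes p: "0 \<le> p" and [measurable]: "U \<in> borel_measurable M" "V \<in> borel_measurable M"
  shows "tail_moment p (distr M borel (\<lambda>w. U w + V w)) R
     \<le> ennreal (2 powr p) * (tail_moment p (distr M borel U) (R / 2) + tail_moment p (distr M borel V) (R / 2))"
proof -
  have [measurable]: "{x. r < norm x} \<in> sets (borel :: 'a measure)" for r
    by (intro borel_open open_Collect_less continuous_intros)
  let ?t = "\<lambda>r x. ennreal (norm x powr p) * indicator {x. r < norm x} (x::'a)"
  have E: "tail_moment p (distr M borel W) r = (\<integral>\<^sup>+w. ?t r (W w) \<partial>M)" if [measurable]: "W \<in> borel_measurable M" for W r
    unfolding tail_moment_def by (subst nn_integral_distr) auto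
  have "tail_moment p (distr M borel (\<lambda>w. U w + V w)) R = (\<integral>\<^sup>+w. ?t R (U w + V w) \<partial>M)"
    by (rule E) measurable
  also have "\<dots> \<le> (\<integral>\<^sup>+w. ennreal (2 powr p) * (?t (R / 2) (U w) + ?t (R / 2) (V w)) \<partial>M)"
    by (intro nn_integral_mono tail_pointwise p)
  also have "\<dots> = ennreal (2 powr p) * ((\<integral>\<^sup>+w. ?t (R / 2) (U w) \<partial>M) + (\<integral>\<^sup>+w. ?t (R / 2) (V w) \<partial>M))"
    by (subst nn_integral_cmult, measurable, subst nn_integral_add, measurable)
  finally show ?thesis by (simp only: E[OF assms(2)] E[OF assms(3)])
qed

lemma tail_moment_antimono:
  assumes "R \<le> R'" shows "tail_moment p \<mu> R' \<le> tail_moment p \<mu> R"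
  unfolding tail_moment_def using assms by (intro nn_integral_mono) (auto split: split_indicator)

text \<open>Uniform integrability of the p-th powers of the norms, asked only of late members of the
  sequence.\<close>

definition uniform_tails :: "real \<Rightarrow> (nat \<Rightarrow> 'a::euclidean_space measure) \<Rightarrow> bool" where
  "uniform_tails p \<mu>s \<longleftrightarrow> (\<forall>e>0. \<exists>R. \<forall>\<^sub>F n in sequentially. tail_moment p (\<mu>s n) R \<le> ennreal e)"

text \<open>Monotone convergence: the truncated integrands decrease to 0 pointwise, and the first of
  them is integrable.\<close>

lemma uniform_tails_const:
  assumes \<mu>: "\<mu> \<in> prob_finite_moment p"
  shows "uniform_tails p (\<lambda>_. \<mu>)"
  unfolding uniform_tails_def
proof (intro allI impI)
  fix e :: real assume e: "0 < e"
  have [measurable_cong]: "sets \<mu> = sets borel" by (rule prob_finite_momentD[OF \<mu>])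
  have [measurable]: "{x. r < norm x} \<in> sets (borel :: 'a measure)" for r
    by (intro borel_open open_Collect_less continuous_intros)
  have z: "(INF n::nat. ennreal (norm x powr p) * indicator {x. real n < norm x} x) = 0" for x :: 'a
  proof -
    obtain n :: nat where "norm x \<le> real n" using real_arch_simple by blast
    then have "(INF n::nat. ennreal (norm x powr p) * indicator {x. real n < norm x} x) \<le> 0"
      by (intro INF_lower2[of n]) auto
    then show ?thesis by simp
  qed
  have "(INF n::nat. tail_moment p \<mu> (real n)) = (\<integral>\<^sup>+x. (INF n::nat. ennreal (norm x powr p) * indicator {x. real n < norm x} x) \<partial>\<mu>)"
    unfolding tail_moment_def
  proof (rule nn_integral_monotone_convergence_INF_decseq[symmetric])
    show "decseq (\<lambda>n x. ennreal (norm x powr p) * indicator {x. real n < norm x} (x::'a))"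
      by (intro decseq_SucI le_funI) (auto split: split_indicator)
    have "(\<integral>\<^sup>+x. ennreal (norm x powr p) * indicator {x. real 0 < norm x} x \<partial>\<mu>) \<le> (\<integral>\<^sup>+x. ennreal (norm x powr p) \<partial>\<mu>)"
      by (intro nn_integral_mono) (auto split: split_indicator)
    then show "(\<integral>\<^sup>+x. ennreal (norm x powr p) * indicator {x. real 0 < norm x} x \<partial>\<mu>) < \<infinity>"
      using prob_finite_momentD(3)[OF \<mu>] by (rule le_less_trans)
  qed measurable
  also have "\<dots> = 0" by (simp add: z)
  finally have "(INF n::nat. tail_moment p \<mu> (real n)) < ennreal e" using e by simp
  then obtain n :: nat where "tail_moment p \<mu> (real n) < ennreal e" by (auto simp: INF_less_iff)
  then show "\<exists>R. \<forall>\<^sub>F n in sequentially. tail_moment p \<mu> R \<le> ennreal e"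
    by (intro exI[of _ "real n"]) (simp add: less_imp_le)
qed

lemma uniform_tails_bound:
  assumes 1: "uniform_tails p \<mu>s" and 2: "uniform_tails p \<nu>s" and C: "0 \<le> C"
    and le: "\<And>n R. tail_moment p (\<eta>s n) R \<le> ennreal C * (tail_moment p (\<mu>s n) (R / 2) + tail_moment p (\<nu>s n) (R / 2))"
  shows "uniform_tails p \<eta>s"
  unfolding uniform_tails_def
proof (intro allI impI)
  fix e :: real assume e: "0 < e"
  \<comment> \<open>Chosen so that \<open>C * (d + d) \<le> e\<close>, with \<open>C + 1\<close> in
    place of \<open>C\<close> to cover \<open>C = 0\<close>.\<close>
  define d where "d = e / (C + 1) / 2"
  have d: "0 < d" using e C by (simp add: d_def)
  obtain R1 where R1: "\<forall>\<^sub>F n in sequentially. tail_moment p (\<mu>s n) R1 \<le> ennreal d" using 1 d by (auto simp: uniform_tails_def)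
  obtain R2 where R2: "\<forall>\<^sub>F n in sequentially. tail_moment p (\<nu>s n) R2 \<le> ennreal d" using 2 d by (auto simp: uniform_tails_def)
  define R where "R = 2 * max R1 R2"
  show "\<exists>R. \<forall>\<^sub>F n in sequentially. tail_moment p (\<eta>s n) R \<le> ennreal e"
  proof (intro exI[of _ R], use R1 R2 in eventually_elim)
    fix n assume n: "tail_moment p (\<mu>s n) R1 \<le> ennreal d" "tail_moment p (\<nu>s n) R2 \<le> ennreal d"
    have "tail_moment p (\<mu>s n) (R / 2) \<le> ennreal d" "tail_moment p (\<nu>s n) (R / 2) \<le> ennreal d"
      using n tail_moment_antimono[of R1 "R / 2" p "\<mu>s n"] tail_moment_antimono[of R2 "R / 2" p "\<nu>s n"] by (auto simp: R_def)
    then have "ennreal C * (tail_moment p (\<mu>s n) (R / 2) + tail_moment p (\<nu>s n) (R / 2)) \<le> ennreal C * (ennreal d + ennreal d)"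
      by (intro mult_left_mono add_mono) auto
    also have "\<dots> = ennreal (C * (d + d))" using C d by (simp add: ennreal_mult ennreal_plus[symmetric] del: ennreal_plus)
    also have "\<dots> \<le> ennreal e"
    proof (rule ennreal_leI)
      have "d + d = e / (C + 1)" unfolding d_def by (rule field_sum_of_halves)
      then have "C * (d + d) = e * (C / (C + 1))" by simp
      also have "\<dots> \<le> e * 1" using e C by (intro mult_left_mono) auto
      finally show "C * (d + d) \<le> e" by simp
    qed
    finally show "tail_moment p (\<eta>s n) R \<le> ennreal e" using le[of n R] by (rule order_trans[rotated])
  qed
qed

context transport
begin

text \<open>Equal pairs cost nothing. For unequal pairs each of the two points contributes at most
  \<open>R powr p\<close> plus its tail beyond \<open>R\<close>.\<close>

lemma tv_total:
  assumes \<pi>: "\<pi> \<in> couplings \<mu> \<nu>"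
  shows "total \<pi> \<le> ennreal (real (card I) * 2 powr p) *
    (2 * ennreal (R powr p) * emeasure \<pi> {q. fst q \<noteq> snd q} + (tail_moment p \<mu> R + tail_moment p \<nu> R))"
proof -
  have s[measurable_cong]: "sets \<pi> = sets (borel \<Otimes>\<^sub>M borel)" by (rule couplingsD[OF \<pi>])
  have [measurable]: "{x. r < norm x} \<in> sets (borel :: 'a measure)" for r
    by (intro borel_open open_Collect_less continuous_intros)
  let ?C = "real (card I) * 2 powr p"
  let ?N = "{q. fst q \<noteq> snd q} :: ('a \<times> 'a) set"
  let ?t = "\<lambda>x. ennreal (norm x powr p) * indicator {x. R < norm x} (x::'a)"
  have c: "norm x powr p \<le> R powr p" if "\<not> R < norm x" for x :: 'a
    using that p by (intro powr_mono2) auto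
  have b: "ennreal (norm x powr p) \<le> ennreal (R powr p) + ?t x" for x
    using c[of x] by (cases "R < norm x") (auto intro: ennreal_leI)
  have pw: "ennreal (cost (fst q) (snd q)) \<le> ennreal ?C * (2 * ennreal (R powr p) * indicator ?N q + (?t (fst q) + ?t (snd q)))" for q
  proof (cases "fst q = snd q")
    case False
    have "norm (fst q - snd q) powr p \<le> 2 powr p * (norm (fst q) powr p + norm (snd q) powr p)"
      using norm_add_powr_le[of p "fst q" "- snd q"] p by simp
    then have "real (card I) * norm (fst q - snd q) powr p \<le> real (card I) * (2 powr p * (norm (fst q) powr p + norm (snd q) powr p))"
      by (rule mult_left_mono) simp
    then have "cost (fst q) (snd q) \<le> ?C * (norm (fst q) powr p + norm (snd q) powr p)"
      using cost_le_norm[of "fst q" "snd q"] by (simp add: mult.assoc)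
    then have "ennreal (cost (fst q) (snd q)) \<le> ennreal (?C * (norm (fst q) powr p + norm (snd q) powr p))" by (rule ennreal_leI)
    also have "\<dots> = ennreal ?C * (ennreal (norm (fst q) powr p) + ennreal (norm (snd q) powr p))"
      by (simp add: ennreal_mult')
    also have "\<dots> \<le> ennreal ?C * ((ennreal (R powr p) + ?t (fst q)) + (ennreal (R powr p) + ?t (snd q)))"
      by (intro mult_left_mono add_mono b) simp
    also have "(ennreal (R powr p) + ?t (fst q)) + (ennreal (R powr p) + ?t (snd q)) = 2 * ennreal (R powr p) * indicator ?N q + (?t (fst q) + ?t (snd q))"
      using False by (simp only: mult_2 indicator_def) (simp add: add_ac)
    finally show ?thesis .
  qed (simp add: cost_refl)
  have "total \<pi> \<le> (\<integral>\<^sup>+q. ennreal ?C * (2 * ennreal (R powr p) * indicator ?N q + (?t (fst q) + ?t (snd q))) \<partial>\<pi>)"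
    unfolding total_def by (rule nn_integral_mono) (rule pw)
  also have "\<dots> = ennreal ?C * (\<integral>\<^sup>+q. 2 * ennreal (R powr p) * indicator ?N q + (?t (fst q) + ?t (snd q)) \<partial>\<pi>)"
    by (rule nn_integral_cmult) measurable
  also have "(\<integral>\<^sup>+q. 2 * ennreal (R powr p) * indicator ?N q + (?t (fst q) + ?t (snd q)) \<partial>\<pi>)
     = 2 * ennreal (R powr p) * emeasure \<pi> ?N + ((\<integral>\<^sup>+q. ?t (fst q) \<partial>\<pi>) + (\<integral>\<^sup>+q. ?t (snd q) \<partial>\<pi>))"
    by (subst nn_integral_add, measurable, subst nn_integral_add, measurable) (simp add: nn_integral_cmult)
  also have "(\<integral>\<^sup>+q. ?t (fst q) \<partial>\<pi>) = tail_moment p \<mu> R"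
    unfolding tail_moment_def by (rule nn_integral_coupling_fst[OF \<pi>]) measurable
  also have "(\<integral>\<^sup>+q. ?t (snd q) \<partial>\<pi>) = tail_moment p \<nu> R"
    unfolding tail_moment_def by (rule nn_integral_coupling_snd[OF \<pi>]) measurable
  finally show ?thesis .
qed

lemma D_tendsto_0_if_tv:
  fixes H :: "nat \<Rightarrow> 'a measure"
  assumes \<mu>s: "\<And>n::nat. \<mu>s n \<in> prob_finite_moment p" and \<mu>: "\<mu> \<in> prob_finite_moment p"
    and tv: "\<And>n. tv_le (\<mu>s n) \<mu> (\<delta> n)" and \<delta>: "\<delta> \<longlonglongrightarrow> 0" and ut: "uniform_tails p \<mu>s"
    and H: "\<And>i. subalgebra borel (H i)" "\<And>i j. i \<le> j \<Longrightarrow> subalgebra (H j) (H i)"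
      "sets (H 0) = {{}, UNIV}" "sets (H m) = sets borel" "FF \<subseteq> range H"
  shows "(\<lambda>n. D (\<mu>s n) \<mu>) \<longlonglongrightarrow> 0"
proof -
  have "\<exists>\<pi>. \<pi> \<in> bc_couplings FF (\<mu>s n) \<mu> \<and> emeasure \<pi> {p. fst p \<noteq> snd p} \<le> of_nat (4 * m) * \<delta> n" for n
    using tv_coupling[OF prob_finite_momentD(1,2)[OF \<mu>s] prob_finite_momentD(1,2)[OF \<mu>] tv H] by blast
  then have "\<exists>\<pi>. \<forall>n. \<pi> n \<in> bc_couplings FF (\<mu>s n) \<mu> \<and> emeasure (\<pi> n) {p. fst p \<noteq> snd p} \<le> of_nat (4 * m) * \<delta> n"
    by (intro choice allI)
  then obtain \<pi> where \<pi>: "\<And>n. \<pi> n \<in> bc_couplings FF (\<mu>s n) \<mu>" and le: "\<And>n. emeasure (\<pi> n) {p. fst p \<noteq> snd p} \<le> of_nat (4 * m) * \<delta> n"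
    by blast
  define C where "C = real (card I) * 2 powr p"
  have C: "0 \<le> C" by (simp add: C_def)
  have "(\<lambda>n. total (\<pi> n)) \<longlonglongrightarrow> 0"
  proof (rule order_tendstoI)
    fix e :: ennreal assume "0 < e"
    then obtain d' where d': "0 < d'" "d' < e" using dense by blast
    then obtain d where d: "d' = ennreal d" "0 < d" by (cases d') auto
    \<comment> \<open>Three terms of size \<open>h\<close> have to be absorbed: the off-diagonal
      part and the two tails.\<close>
    define h where "h = d / (C + 1) / 3"
    have h: "0 < h" using d C by (simp add: h_def)
    obtain R1 where R1: "\<forall>\<^sub>F n in sequentially. tail_moment p (\<mu>s n) R1 \<le> ennreal h" using ut h by (auto simp: uniform_tails_def)
    obtain R2 where R2: "tail_moment p \<mu> R2 \<le> ennreal h" using uniform_tails_const[OF \<mu>] h by (auto simp: uniform_tails_def)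
    define R where "R = max R1 R2"
    \<comment> \<open>The radius \<open>R\<close> has been fixed by the tails, so \<open>K\<close>
      is a finite constant and the off-diagonal part vanishes with
      \<open>\<delta> n\<close>.\<close>
    define K where "K = 2 * ennreal (R powr p) * of_nat (4 * m)"
    have K: "K < \<top>" by (simp add: K_def ennreal_mult_less_top of_nat_less_top)
    have "(\<lambda>n. K * \<delta> n) \<longlonglongrightarrow> K * 0" using K by (intro ennreal_tendsto_cmult \<delta>)
    then have "\<forall>\<^sub>F n in sequentially. K * \<delta> n < ennreal h" using h by (intro order_tendstoD(2)) auto
    then show "\<forall>\<^sub>F n in sequentially. total (\<pi> n) < e" using R1
    proof eventually_elim
      case (elim n)
      have "total (\<pi> n) \<le> ennreal C * (2 * ennreal (R powr p) * emeasure (\<pi> n) {q. fst q \<noteq> snd q} + (tail_moment p (\<mu>s n) R + tail_moment p \<mu> R))"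
        unfolding C_def by (rule tv_total[OF bcD[OF \<pi>]])
      also have "\<dots> \<le> ennreal C * (ennreal h + (ennreal h + ennreal h))"
      proof (intro mult_left_mono add_mono)
        have "2 * ennreal (R powr p) * emeasure (\<pi> n) {q. fst q \<noteq> snd q} \<le> 2 * ennreal (R powr p) * (of_nat (4 * m) * \<delta> n)"
          by (intro mult_left_mono le) simp
        also have "\<dots> = K * \<delta> n" by (simp only: K_def mult.assoc)
        finally show "2 * ennreal (R powr p) * emeasure (\<pi> n) {q. fst q \<noteq> snd q} \<le> ennreal h" using elim by simp
        show "tail_moment p (\<mu>s n) R \<le> ennreal h"
          using tail_moment_antimono[of R1 R p "\<mu>s n"] elim by (auto simp: R_def)
        show "tail_moment p \<mu> R \<le> ennreal h"
          using tail_moment_antimono[of R2 R p \<mu>] R2 by (auto simp: R_def)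
      qed simp
      also have "\<dots> = ennreal (C * (3 * h))"
      proof -
        have "ennreal h + (ennreal h + ennreal h) = ennreal (3 * h)"
          using h by (simp add: ennreal_plus[symmetric] del: ennreal_plus)
        then show ?thesis using C h by (simp add: ennreal_mult[symmetric])
      qed
      also have "\<dots> \<le> ennreal d"
      proof (rule ennreal_leI)
        have "3 * (x / 3) = x" for x :: real by simp
        then have "3 * h = d / (C + 1)" unfolding h_def by (simp only:)
        then have "C * (3 * h) = d * (C / (C + 1))" by simp
        also have "\<dots> \<le> d * 1" using d C by (intro mult_left_mono) auto
        finally show "C * (3 * h) \<le> d" by simp
      qed
      finally show ?case using d' d by simp
    qed
  qed simp
  with \<pi> show ?thesis by (subst D_tendsto_0_iff[OF \<mu>s \<mu>]) blast
qed

text \<open>The first coordinate of a coupling is the difference of the coordinates plus the second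
  one. The second has the fixed law \<mu>, and the difference tends to 0 in p-th mean.\<close>

lemma uniform_tails_if_D:
  assumes \<mu>s: "\<And>n::nat. \<mu>s n \<in> prob_finite_moment p" and \<mu>: "\<mu> \<in> prob_finite_moment p"
    and lim: "(\<lambda>n. D (\<mu>s n) \<mu>) \<longlonglongrightarrow> 0"
  shows "uniform_tails p \<mu>s"
proof -
  obtain \<pi> where \<pi>: "\<And>n. \<pi> n \<in> bc_couplings FF (\<mu>s n) \<mu>" and tot: "(\<lambda>n. total (\<pi> n)) \<longlonglongrightarrow> 0"
    using lim unfolding D_tendsto_0_iff[OF \<mu>s \<mu>] by blast
  have c: "\<pi> n \<in> couplings (\<mu>s n) \<mu>" for n by (rule bcD[OF \<pi>])
  have s[measurable_cong]: "sets (\<pi> n) = sets (borel \<Otimes>\<^sub>M borel)" for n by (rule couplingsD[OF c])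
  have [measurable]: "{x. r < norm x} \<in> sets (borel :: 'a measure)" for r
    by (intro borel_open open_Collect_less continuous_intros)
  define \<nu>s where "\<nu>s n = distr (\<pi> n) borel (\<lambda>q. fst q - snd q)" for n
  define K where "K = real (card I) powr p"
  have K: "0 \<le> K" by (simp add: K_def)
  have \<nu>t: "tail_moment p (\<nu>s n) R \<le> ennreal K * total (\<pi> n)" for n R
  proof -
    have "tail_moment p (\<nu>s n) R = (\<integral>\<^sup>+q. ennreal (norm (fst q - snd q) powr p) * indicator {x. R < norm x} (fst q - snd q) \<partial>\<pi> n)"
      unfolding tail_moment_def \<nu>s_def by (subst nn_integral_distr) auto
    also have "\<dots> \<le> (\<integral>\<^sup>+q. ennreal K * ennreal (cost (fst q) (snd q)) \<partial>\<pi> n)"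
    proof (rule nn_integral_mono)
      fix q :: "'a \<times> 'a"
      have "ennreal (norm (fst q - snd q) powr p) \<le> ennreal (K * cost (fst q) (snd q))"
        unfolding K_def by (rule ennreal_leI[OF norm_le_cost])
      then show "ennreal (norm (fst q - snd q) powr p) * indicator {x. R < norm x} (fst q - snd q) \<le> ennreal K * ennreal (cost (fst q) (snd q))"
        using K by (auto simp: ennreal_mult cost_nonneg split: split_indicator)
    qed
    finally show ?thesis by (simp add: total_def nn_integral_cmult)
  qed
  have ut: "uniform_tails p \<nu>s"
    unfolding uniform_tails_def
  proof (intro allI impI)
    fix e :: real assume e: "0 < e"
    have "(\<lambda>n. ennreal K * total (\<pi> n)) \<longlonglongrightarrow> ennreal K * 0" by (intro ennreal_tendsto_cmult tot) simp
    then have "\<forall>\<^sub>F n in sequentially. ennreal K * total (\<pi> n) < ennreal e" using e by (intro order_tendstoD(2)) auto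
    \<comment> \<open>Radius 0 suffices, since the whole p-th moment of the difference becomes
      small.\<close>
    then have "\<forall>\<^sub>F n in sequentially. tail_moment p (\<nu>s n) 0 \<le> ennreal e"
      by (rule eventually_mono) (rule order_trans[OF \<nu>t less_imp_le])
    then show "\<exists>R. \<forall>\<^sub>F n in sequentially. tail_moment p (\<nu>s n) R \<le> ennreal e" by blast
  qed
  have le: "tail_moment p (\<mu>s n) R \<le> ennreal (2 powr p) * (tail_moment p (\<nu>s n) (R / 2) + tail_moment p \<mu> (R / 2))" for n R
  proof -
    have "distr (\<pi> n) borel (\<lambda>q. (fst q - snd q) + snd q) = \<mu>s n"
      using couplingsD(3)[OF c] by simp
    then show ?thesis
      using tail_sum[of p "\<lambda>q. fst q - snd q" "\<pi> n" snd R] p couplingsD(4)[OF c, of n] by (simp add: \<nu>s_def)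
  qed
  show ?thesis by (rule uniform_tails_bound[OF ut uniform_tails_const[OF \<mu>] _ le]) simp
qed

end

section \<open>Conditional independence and causality\<close>

text \<open>This translates between \<open>real_cond_exp\<close>, in which \<open>cond_indep\<close>
  is phrased, and the tested identities between nonnegative integrals in which \<open>causal\<close>
  is phrased. Every set of the pulled-back sigma-algebra is the preimage under \<open>X\<close> of a
  set of \<open>F\<close>.\<close>

lemma real_cond_exp_indicator_eq_iff:
  fixes k :: "'b \<Rightarrow> ennreal"
  assumes M: "prob_space M" and X[measurable]: "X \<in> M \<rightarrow>\<^sub>M F" and E[measurable]: "E \<in> sets M"
    and k[measurable]: "k \<in> borel_measurable F" and k1: "\<And>x. k x \<le> 1"
  shows "(AE w in M. real_cond_exp M (vimage_algebra (space M) X F) (indicator E) w = enn2real (k (X w)))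
    \<longleftrightarrow> (\<forall>D\<in>sets F. (\<integral>\<^sup>+w. indicator E w * indicator D (X w) \<partial>M) = (\<integral>\<^sup>+w. k (X w) * indicator D (X w) \<partial>M))"
proof -
  interpret prob_space M by fact
  let ?G = "vimage_algebra (space M) X F"
  have sub: "subalgebra M ?G"
    unfolding subalgebra_def using X by (auto simp: sets_vimage_algebra2 measurable_def)
  interpret fs: finite_measure_subalgebra M ?G by unfold_locales (rule sub)
  have XG: "X \<in> ?G \<rightarrow>\<^sub>M F" using measurable_space[OF X] by (intro measurable_vimage_algebra1) auto
  have kfin: "k x < \<top>" for x using k1[of x] by (simp add: le_less_trans)
  have kG: "(\<lambda>w. enn2real (k (X w))) \<in> borel_measurable ?G" using XG by measurable
  have r1: "enn2real (k x) \<le> 1" for x using k1[of x] by (intro enn2real_leI) auto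
  have ik: "integrable M (\<lambda>w. enn2real (k (X w)))"
    by (rule integrable_const_bound[where B=1]) (auto simp: r1)
  have iE: "integrable M (indicator E :: _ \<Rightarrow> real)"
    by (rule integrable_const_bound[where B=1]) (auto split: split_indicator)
  have eqD: "(\<integral>w\<in>X -` D \<inter> space M. indicat_real E w \<partial>M) = (\<integral>w\<in>X -` D \<inter> space M. enn2real (k (X w)) \<partial>M) \<longleftrightarrow>
     (\<integral>\<^sup>+w. indicator E w * indicator D (X w) \<partial>M) = (\<integral>\<^sup>+w. k (X w) * indicator D (X w) \<partial>M)"
    if [measurable]: "D \<in> sets F" for D
  proof -
    have 1: "(\<integral>\<^sup>+w. indicator E w * indicator D (X w) \<partial>M) = ennreal (\<integral>w\<in>X -` D \<inter> space M. indicat_real E w \<partial>M)"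
    proof -
      have "(\<integral>\<^sup>+w. indicator E w * indicator D (X w) \<partial>M) = (\<integral>\<^sup>+w. ennreal (indicator (X -` D \<inter> space M) w * indicator E w) \<partial>M)"
        by (intro nn_integral_cong) (auto split: split_indicator)
      also have "\<dots> = ennreal (\<integral>w. indicator (X -` D \<inter> space M) w * indicator E w \<partial>M)"
        by (intro nn_integral_eq_integral integrable_const_bound[where B=1]) (auto split: split_indicator)
      finally show ?thesis by (simp add: set_lebesgue_integral_def)
    qed
    have 2: "(\<integral>\<^sup>+w. k (X w) * indicator D (X w) \<partial>M) = ennreal (\<integral>w\<in>X -` D \<inter> space M. enn2real (k (X w)) \<partial>M)"
    proof -
      have "(\<integral>\<^sup>+w. k (X w) * indicator D (X w) \<partial>M) = (\<integral>\<^sup>+w. ennreal (indicator (X -` D \<inter> space M) w * enn2real (k (X w))) \<partial>M)"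
        by (intro nn_integral_cong) (auto simp: kfin split: split_indicator)
      also have "\<dots> = ennreal (\<integral>w. indicator (X -` D \<inter> space M) w * enn2real (k (X w)) \<partial>M)"
        by (intro nn_integral_eq_integral integrable_const_bound[where B=1]) (auto simp: r1 split: split_indicator)
      finally show ?thesis by (simp add: set_lebesgue_integral_def)
    qed
    have "0 \<le> (\<integral>w\<in>X -` D \<inter> space M. indicat_real E w \<partial>M)"
      unfolding set_lebesgue_integral_def by (rule integral_nonneg_AE) auto
    moreover have "0 \<le> (\<integral>w\<in>X -` D \<inter> space M. enn2real (k (X w)) \<partial>M)"
      unfolding set_lebesgue_integral_def by (rule integral_nonneg_AE) auto
    ultimately show ?thesis unfolding 1 2 by (subst ennreal_inj) auto
  qed
  have Gsets: "A \<in> sets ?G \<longleftrightarrow> (\<exists>D\<in>sets F. A = X -` D \<inter> space M)" for A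
    using measurable_space[OF X] by (subst sets_vimage_algebra2) auto
  show ?thesis
  proof
    assume ae: "AE w in M. real_cond_exp M ?G (indicator E) w = enn2real (k (X w))"
    show "\<forall>D\<in>sets F. (\<integral>\<^sup>+w. indicator E w * indicator D (X w) \<partial>M) = (\<integral>\<^sup>+w. k (X w) * indicator D (X w) \<partial>M)"
    proof
      fix D assume D[measurable]: "D \<in> sets F"
      then have "X -` D \<inter> space M \<in> sets ?G" using Gsets by blast
      then have "(\<integral>w\<in>X -` D \<inter> space M. indicator E w \<partial>M) = (\<integral>w\<in>X -` D \<inter> space M. real_cond_exp M ?G (indicator E) w \<partial>M)"
        by (rule fs.real_cond_exp_intA[OF iE])
      also have "\<dots> = (\<integral>w\<in>X -` D \<inter> space M. enn2real (k (X w)) \<partial>M)"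
        using ae unfolding set_lebesgue_integral_def by (intro integral_cong_AE) auto
      finally show "(\<integral>\<^sup>+w. indicator E w * indicator D (X w) \<partial>M) = (\<integral>\<^sup>+w. k (X w) * indicator D (X w) \<partial>M)"
        unfolding eqD[OF D] .
    qed
  next
    assume *: "\<forall>D\<in>sets F. (\<integral>\<^sup>+w. indicator E w * indicator D (X w) \<partial>M) = (\<integral>\<^sup>+w. k (X w) * indicator D (X w) \<partial>M)"
    show "AE w in M. real_cond_exp M ?G (indicator E) w = enn2real (k (X w))"
    proof (rule fs.real_cond_exp_charact[OF _ iE ik kG])
      fix A assume "A \<in> sets ?G"
      then obtain D where "D \<in> sets F" "A = X -` D \<inter> space M" using Gsets by blast
      then show "(\<integral>w\<in>A. indicator E w \<partial>M) = (\<integral>w\<in>A. enn2real (k (X w)) \<partial>M)"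
        using * eqD by blast
    qed
  qed
qed

text \<open>The maps \<open>u\<close> and \<open>v\<close> together generate the Borel sets, so
  products of indicators determine the images under \<open>X\<close> of the measures with densities
  \<open>f\<close> and \<open>g\<close>. The bound on \<open>f\<close> makes them finite.\<close>

lemma nn_integral_eqI_rectangles:
  fixes X :: "'e \<Rightarrow> 'a::euclidean_space" and f g :: "'e \<Rightarrow> ennreal"
  assumes M: "prob_space M" and [measurable]: "X \<in> borel_measurable M" "f \<in> borel_measurable M" "g \<in> borel_measurable M"
    and f1: "\<And>w. f w \<le> 1" and u[measurable]: "u \<in> borel \<rightarrow>\<^sub>M S" and v[measurable]: "v \<in> borel \<rightarrow>\<^sub>M S'"
    and uv: "sets (borel :: 'a measure) \<subseteq> sets (vimage_algebra UNIV (\<lambda>x. (u x, v x)) (S \<Otimes>\<^sub>M S'))"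
    and eq: "\<And>D B. D \<in> sets S \<Longrightarrow> B \<in> sets S' \<Longrightarrow>
       (\<integral>\<^sup>+w. f w * (indicator D (u (X w)) * indicator B (v (X w))) \<partial>M) = (\<integral>\<^sup>+w. g w * (indicator D (u (X w)) * indicator B (v (X w))) \<partial>M)"
    and c: "c \<in> borel_measurable borel"
  shows "(\<integral>\<^sup>+w. f w * c (X w) \<partial>M) = (\<integral>\<^sup>+w. g w * c (X w) \<partial>M)"
proof -
  interpret prob_space M by fact
  let ?uv = "\<lambda>w. (u (X w), v (X w))"
  define N1 where "N1 = distr (density M f) (S \<Otimes>\<^sub>M S') ?uv"
  define N2 where "N2 = distr (density M g) (S \<Otimes>\<^sub>M S') ?uv"
  have e1: "emeasure (distr (density M h) (S \<Otimes>\<^sub>M S') ?uv) A = (\<integral>\<^sup>+w. h w * indicator A (?uv w) \<partial>M)"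
    if [measurable]: "h \<in> borel_measurable M" "A \<in> sets (S \<Otimes>\<^sub>M S')" for h A
    by (subst nn_integral_indicator[symmetric], simp, subst nn_integral_distr) (auto simp: nn_integral_density)
  have N: "N1 = N2"
  proof (rule measure_eqI_rectangles)
    show "finite_measure N1"
    proof
      have "emeasure N1 (space N1) = (\<integral>\<^sup>+w. f w * indicator (space (S \<Otimes>\<^sub>M S')) (?uv w) \<partial>M)"
        unfolding N1_def using e1[of f "space (S \<Otimes>\<^sub>M S')"] by simp
      also have "\<dots> \<le> (\<integral>\<^sup>+w. 1 \<partial>M)" by (intro nn_integral_mono) (auto simp: f1 split: split_indicator)
      finally show "emeasure N1 (space N1) \<noteq> \<infinity>" by (auto simp: emeasure_space_1 top_unique)
    qed
    fix D B assume [measurable]: "D \<in> sets S" "B \<in> sets S'"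
    have i: "indicator (D \<times> B) (?uv w) = (indicator D (u (X w)) * indicator B (v (X w)) :: ennreal)" for w
      by (simp split: split_indicator)
    show "emeasure N1 (D \<times> B) = emeasure N2 (D \<times> B)"
      unfolding N1_def N2_def by (subst (1 2) e1) (auto simp: i eq)
  qed (auto simp: N1_def N2_def)
  have "distr (density M f) borel X = distr (density M g) borel X"
  proof (rule measure_eqI)
    fix A assume "A \<in> sets (distr (density M f) borel X)"
    then have A[measurable]: "A \<in> sets borel" by simp
    then have "A \<in> sets (vimage_algebra UNIV (\<lambda>x. (u x, v x)) (S \<Otimes>\<^sub>M S'))" using uv by blast
    moreover have "(\<lambda>x. (u x, v x)) \<in> UNIV \<rightarrow> space (S \<Otimes>\<^sub>M S')"
      using measurable_space[OF u] measurable_space[OF v] by (auto simp: space_pair_measure)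
    ultimately obtain C where C[measurable]: "C \<in> sets (S \<Otimes>\<^sub>M S')" and AC: "A = (\<lambda>x. (u x, v x)) -` C"
      by (auto simp: sets_vimage_algebra2)
    have "emeasure (distr (density M h) borel X) A = (\<integral>\<^sup>+w. h w * indicator C (?uv w) \<partial>M)"
      if [measurable]: "h \<in> borel_measurable M" for h
      by (subst nn_integral_indicator[symmetric], simp, subst nn_integral_distr) (auto simp: nn_integral_density AC indicator_def)
    then show "emeasure (distr (density M f) borel X) A = emeasure (distr (density M g) borel X) A"
      using e1[of f C] e1[of g C] N by (simp add: N1_def N2_def)
  qed simp
  then have "(\<integral>\<^sup>+x. c x \<partial>distr (density M f) borel X) = (\<integral>\<^sup>+x. c x \<partial>distr (density M g) borel X)" by simp
  then show ?thesis using c by (simp add: nn_integral_distr nn_integral_density)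
qed

text \<open>The hypothesis says that the two weighted images under \<open>Y\<close> agree on the
  sigma-algebra of \<open>u\<close>, and \<open>a\<close> is a function measurable there.\<close>

lemma nn_integral_eqI_vimage:
  fixes Y :: "'e \<Rightarrow> 'a::euclidean_space" and f g :: "'e \<Rightarrow> ennreal"
  assumes [measurable]: "Y \<in> borel_measurable M" "f \<in> borel_measurable M" "g \<in> borel_measurable M"
    and u[measurable]: "u \<in> borel \<rightarrow>\<^sub>M S"
    and eq: "\<And>A. A \<in> sets S \<Longrightarrow> (\<integral>\<^sup>+w. indicator A (u (Y w)) * f w \<partial>M) = (\<integral>\<^sup>+w. indicator A (u (Y w)) * g w \<partial>M)"
    and a: "a \<in> borel_measurable (vimage_algebra UNIV u S)"
  shows "(\<integral>\<^sup>+w. a (Y w) * f w \<partial>M) = (\<integral>\<^sup>+w. a (Y w) * g w \<partial>M)"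
proof -
  let ?F = "vimage_algebra UNIV u S"
  have uF: "u \<in> UNIV \<rightarrow> space S" using measurable_space[OF u] by auto
  have [measurable]: "Y \<in> M \<rightarrow>\<^sub>M ?F"
    by (rule measurable_vimage_algebra2) auto
  have "distr (density M f) ?F Y = distr (density M g) ?F Y"
  proof (rule measure_eqI)
    fix C assume "C \<in> sets (distr (density M f) ?F Y)"
    then have C[measurable]: "C \<in> sets ?F" by simp
    then obtain A where A: "A \<in> sets S" "C = u -` A" by (subst (asm) sets_vimage_algebra2[OF uF]) auto
    have i: "indicator C (Y w) = (indicator A (u (Y w)) :: ennreal)" for w
      by (simp add: A indicator_def)
    have "emeasure (distr (density M h) ?F Y) C = (\<integral>\<^sup>+w. indicator A (u (Y w)) * h w \<partial>M)"
      if [measurable]: "h \<in> borel_measurable M" for h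
    proof -
      have "emeasure (distr (density M h) ?F Y) C = (\<integral>\<^sup>+w. h w * indicator C (Y w) \<partial>M)"
        using C by (subst nn_integral_indicator[symmetric], simp, subst nn_integral_distr) (auto simp: nn_integral_density)
      then show ?thesis by (simp add: i mult.commute)
    qed
    then show "emeasure (distr (density M f) ?F Y) C = emeasure (distr (density M g) ?F Y) C"
      using eq[OF A(1)] by simp
  qed simp
  then have "(\<integral>\<^sup>+x. a x \<partial>distr (density M f) ?F Y) = (\<integral>\<^sup>+x. a x \<partial>distr (density M g) ?F Y)" by simp
  then show ?thesis using a by (simp add: nn_integral_distr nn_integral_density mult.commute)
qed

text \<open>Given the past \<open>u (X)\<close>, the future \<open>v (X)\<close> adds nothing to the
  prediction of \<open>u (Y)\<close>, so the conditional expectation of a function of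
  \<open>u (Y)\<close> given \<open>X\<close> is a function of the past. Past and future jointly
  generate the Borel sets, hence products of their indicators suffice as test functions.\<close>

lemma cond_indep_iff_causal:
  fixes X Y :: "'e \<Rightarrow> 'a::euclidean_space"
  assumes M: "prob_space M" and sM: "space M = UNIV" and [measurable]: "X \<in> borel_measurable M" "Y \<in> borel_measurable M"
    and u[measurable]: "u \<in> borel \<rightarrow>\<^sub>M S" and v[measurable]: "v \<in> borel \<rightarrow>\<^sub>M S'"
    and uv: "sets (borel :: 'a measure) \<subseteq> sets (vimage_algebra UNIV (\<lambda>x. (u x, v x)) (S \<Otimes>\<^sub>M S'))"
  shows "cond_indep M (\<lambda>w. u (Y w)) S (\<lambda>w. v (X w)) S' (\<lambda>w. u (X w)) S \<longleftrightarrow> causal (vimage_algebra UNIV u S) M X Y"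
proof -
  interpret prob_space M by fact
  let ?F = "vimage_algebra UNIV u S"
  have uF: "u \<in> UNIV \<rightarrow> space S" using measurable_space[OF u] by auto
  have XF[measurable]: "X \<in> M \<rightarrow>\<^sub>M ?F" by (rule measurable_vimage_algebra2) auto
  have uF'[measurable]: "u \<in> ?F \<rightarrow>\<^sub>M S" by (rule measurable_vimage_algebra1[OF uF])
  have FB: "h \<in> borel_measurable borel" if "h \<in> borel_measurable ?F" for h :: "'a \<Rightarrow> ennreal"
  proof (rule measurable_from_subalg[OF _ that])
    show "subalgebra borel ?F" unfolding subalgebra_def using u by (auto simp: sets_vimage_algebra2[OF uF] measurable_def)
  qed
  have il: "indicator C x \<le> (1::ennreal)" for C and x :: "'z" by (simp split: split_indicator)
  have us[simp]: "u x \<in> space S" for x using measurable_space[OF u] by simp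
  \<comment> \<open>Conditioning on \<open>u (X)\<close> is the same as pulling the sigma-algebra of
    \<open>u\<close> back along \<open>X\<close>. This matches the definition of
    \<open>cond_indep\<close> with that of \<open>causal\<close>.\<close>
  have GG: "vimage_algebra (space M) (\<lambda>w. u (X w)) S = vimage_algebra (space M) X ?F"
    by (subst vimage_algebra_vimage_algebra_eq) auto
  have Fset: "C \<in> sets ?F \<longleftrightarrow> (\<exists>D\<in>sets S. C = u -` D)" for C
    by (subst sets_vimage_algebra2[OF uF]) auto
  have EM: "(\<lambda>w. u (Y w)) -` A \<in> sets M" "(\<lambda>w. v (X w)) -` B \<in> sets M" if "A \<in> sets S" "B \<in> sets S'" for A B
  proof -
    have "(\<lambda>w. u (Y w)) -` A \<inter> space M \<in> sets M" "(\<lambda>w. v (X w)) -` B \<inter> space M \<in> sets M"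
      using that by measurable
    then show "(\<lambda>w. u (Y w)) -` A \<in> sets M" "(\<lambda>w. v (X w)) -` B \<in> sets M" by (simp_all add: sM)
  qed
  have version: "\<exists>k\<in>borel_measurable ?F. (\<forall>x. k x \<le> (1::ennreal)) \<and>
      (\<forall>q\<in>borel_measurable ?F. (\<integral>\<^sup>+w. h w * q (X w) \<partial>M) = (\<integral>\<^sup>+w. k (X w) * q (X w) \<partial>M))"
    if "h \<in> borel_measurable M" "\<And>w. h w \<le> 1" for h :: "'e \<Rightarrow> ennreal"
    by (rule cond_version[OF M XF that]) blast
  show ?thesis
  proof
    assume ci: "cond_indep M (\<lambda>w. u (Y w)) S (\<lambda>w. v (X w)) S' (\<lambda>w. u (X w)) S"
    show "causal ?F M X Y"
    proof (rule causalI)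
      fix a :: "'a \<Rightarrow> ennreal" assume a: "a \<in> borel_measurable ?F" "\<And>x. a x \<le> 1"
      have [measurable]: "a \<in> borel_measurable borel" by (rule FB[OF a(1)])
      have aY: "(\<lambda>w. a (Y w)) \<in> borel_measurable M" by measurable
      obtain k where k: "k \<in> borel_measurable ?F" "\<forall>x. k x \<le> 1"
        "\<forall>q\<in>borel_measurable ?F. (\<integral>\<^sup>+w. a (Y w) * q (X w) \<partial>M) = (\<integral>\<^sup>+w. k (X w) * q (X w) \<partial>M)"
        using version[of "\<lambda>w. a (Y w)", OF aY a(2)] by blast
      have [measurable]: "k \<in> borel_measurable borel" by (rule FB[OF k(1)])
      have "(\<integral>\<^sup>+w. a (Y w) * c (X w) \<partial>M) = (\<integral>\<^sup>+w. k (X w) * c (X w) \<partial>M)"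
        if c: "c \<in> borel_measurable borel" for c
      proof (rule nn_integral_eqI_rectangles[OF M _ _ _ _ u v uv _ c])
        fix D B assume D[measurable]: "D \<in> sets S" and B[measurable]: "B \<in> sets S'"
        have mB: "(\<lambda>w. indicator B (v (X w)) :: ennreal) \<in> borel_measurable M" by measurable
        obtain kB where kB: "kB \<in> borel_measurable ?F" "\<forall>x. kB x \<le> 1"
          "\<forall>q\<in>borel_measurable ?F. (\<integral>\<^sup>+w. indicator B (v (X w)) * q (X w) \<partial>M) = (\<integral>\<^sup>+w. kB (X w) * q (X w) \<partial>M)"
          using version[of "\<lambda>w. indicator B (v (X w))", OF mB il] by blast
        have [measurable]: "kB \<in> borel_measurable borel" by (rule FB[OF kB(1)])
        have "(\<integral>\<^sup>+w. a (Y w) * (indicator D (u (X w)) * indicator B (v (X w))) \<partial>M)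
            = (\<integral>\<^sup>+w. a (Y w) * (kB (X w) * indicator D (u (X w))) \<partial>M)"
        \<comment> \<open>Against functions of \<open>u (Y)\<close> and \<open>u (X)\<close>, the
          future indicator may be replaced by its prediction \<open>kB\<close>. For \<open>a\<close>
          an indicator this is the product formula of \<open>cond_indep\<close>.\<close>
        proof (rule nn_integral_eqI_vimage[OF _ _ _ u _ a(1)])
          fix A assume A[measurable]: "A \<in> sets S"
          have mA: "(\<lambda>w. indicator A (u (Y w)) :: ennreal) \<in> borel_measurable M" by measurable
          obtain kA where kA: "kA \<in> borel_measurable ?F" "\<forall>x. kA x \<le> 1"
            "\<forall>q\<in>borel_measurable ?F. (\<integral>\<^sup>+w. indicator A (u (Y w)) * q (X w) \<partial>M) = (\<integral>\<^sup>+w. kA (X w) * q (X w) \<partial>M)"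
            using version[of "\<lambda>w. indicator A (u (Y w))", OF mA il] by blast
          let ?EA = "(\<lambda>w. u (Y w)) -` A" and ?EB = "(\<lambda>w. v (X w)) -` B"
          have indA: "indicator ?EA w = (indicator A (u (Y w)) :: ennreal)" "indicator ?EB w = (indicator B (v (X w)) :: ennreal)" for w
            by (auto split: split_indicator)
          have ind: "(\<lambda>x. indicator C x) \<in> borel_measurable ?F" if "C \<in> sets ?F" for C using that by simp
          have rA: "AE w in M. real_cond_exp M (vimage_algebra (space M) X ?F) (indicator ?EA) w = enn2real (kA (X w))"
            by (subst real_cond_exp_indicator_eq_iff[OF M XF EM(1)[OF A B] kA(1)]) (simp add: kA(2), rule ballI, unfold indA, rule bspec[OF kA(3) ind])
          have rB: "AE w in M. real_cond_exp M (vimage_algebra (space M) X ?F) (indicator ?EB) w = enn2real (kB (X w))"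
            by (subst real_cond_exp_indicator_eq_iff[OF M XF EM(2)[OF A B] kB(1)]) (simp add: kB(2), rule ballI, unfold indA, rule bspec[OF kB(3) ind])
          have "AE w in M. real_cond_exp M (vimage_algebra (space M) X ?F) (indicator (?EA \<inter> ?EB)) w = 
             real_cond_exp M (vimage_algebra (space M) X ?F) (indicator ?EA) w * real_cond_exp M (vimage_algebra (space M) X ?F) (indicator ?EB) w"
            using ci A B unfolding cond_indep_def Let_def GG by blast
          then have rAB: "AE w in M. real_cond_exp M (vimage_algebra (space M) X ?F) (indicator (?EA \<inter> ?EB)) w = enn2real (kA (X w) * kB (X w))"
            using rA rB by eventually_elim (simp add: enn2real_mult)
          have AB1: "kA x * kB x \<le> 1" for x using kA(2) kB(2) mult_mono[of "kA x" 1 "kB x" 1] by simp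
          have kAB: "(\<lambda>x. kA x * kB x) \<in> borel_measurable ?F" using kA(1) kB(1) by measurable
          have uD: "u -` D \<in> sets ?F" using Fset D by blast
          have L: "indicator A (u (Y w)) * (indicator D (u (X w)) * indicator B (v (X w))) = (indicator (?EA \<inter> ?EB) w * indicator (u -` D) (X w) :: ennreal)" for w
            by (auto split: split_indicator)
          have R: "indicator D (u (X w)) = (indicator (u -` D) (X w) :: ennreal)" for w by (simp split: split_indicator)
          have "(\<integral>\<^sup>+w. indicator (?EA \<inter> ?EB) w * indicator (u -` D) (X w) \<partial>M) = (\<integral>\<^sup>+w. (kA (X w) * kB (X w)) * indicator (u -` D) (X w) \<partial>M)"
            using rAB uD unfolding real_cond_exp_indicator_eq_iff[OF M XF sets.Int[OF EM(1)[OF A B] EM(2)[OF A B]] kAB AB1] by blast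
          also have "\<dots> = (\<integral>\<^sup>+w. kA (X w) * (kB (X w) * indicator (u -` D) (X w)) \<partial>M)" by (simp only: mult.assoc)
          also have "\<dots> = (\<integral>\<^sup>+w. indicator A (u (Y w)) * (kB (X w) * indicator (u -` D) (X w)) \<partial>M)"
          proof -
            have m3: "(\<lambda>x. kB x * indicator (u -` D) x) \<in> borel_measurable ?F" using kB(1) ind[OF uD] by measurable
            show ?thesis by (rule bspec[OF kA(3) m3, symmetric])
          qed
          finally show "(\<integral>\<^sup>+w. indicator A (u (Y w)) * (indicator D (u (X w)) * indicator B (v (X w))) \<partial>M)
              = (\<integral>\<^sup>+w. indicator A (u (Y w)) * (kB (X w) * indicator D (u (X w))) \<partial>M)"
            unfolding L unfolding R .
        qed measurable
        also have "\<dots> = (\<integral>\<^sup>+w. k (X w) * (kB (X w) * indicator D (u (X w))) \<partial>M)"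
        proof -
          have "(\<lambda>x. kB x * indicator D (u x)) \<in> borel_measurable ?F" using kB(1) by measurable
          from bspec[OF k(3) this] show ?thesis .
        qed
        also have "\<dots> = (\<integral>\<^sup>+w. kB (X w) * (k (X w) * indicator D (u (X w))) \<partial>M)" by (simp only: mult_ac)
        also have "\<dots> = (\<integral>\<^sup>+w. indicator B (v (X w)) * (k (X w) * indicator D (u (X w))) \<partial>M)"
        proof -
          have "(\<lambda>x. k x * indicator D (u x)) \<in> borel_measurable ?F" using k(1) by measurable
          from bspec[OF kB(3) this] show ?thesis by (rule sym)
        qed
        also have "\<dots> = (\<integral>\<^sup>+w. k (X w) * (indicator D (u (X w)) * indicator B (v (X w))) \<partial>M)" by (simp only: mult_ac)
        finally show "(\<integral>\<^sup>+w. a (Y w) * (indicator D (u (X w)) * indicator B (v (X w))) \<partial>M) = (\<integral>\<^sup>+w. k (X w) * (indicator D (u (X w)) * indicator B (v (X w))) \<partial>M)" .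
      qed (auto simp: a)
      with k show "\<exists>k\<in>borel_measurable ?F. (\<forall>x. k x \<le> 1) \<and>
         (\<forall>c\<in>borel_measurable borel. (\<integral>\<^sup>+w. a (Y w) * c (X w) \<partial>M) = (\<integral>\<^sup>+w. k (X w) * c (X w) \<partial>M))" by blast
    qed
  next
    assume ca: "causal ?F M X Y"
    show "cond_indep M (\<lambda>w. u (Y w)) S (\<lambda>w. v (X w)) S' (\<lambda>w. u (X w)) S"
      unfolding cond_indep_def Let_def GG
    proof (intro ballI)
      fix A B assume A[measurable]: "A \<in> sets S" and B[measurable]: "B \<in> sets S'"
      let ?EA = "(\<lambda>w. u (Y w)) -` A" and ?EB = "(\<lambda>w. v (X w)) -` B"
      have indA: "indicator ?EA w = (indicator A (u (Y w)) :: ennreal)" "indicator ?EB w = (indicator B (v (X w)) :: ennreal)" for w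
        by (auto split: split_indicator)
      have ind: "(\<lambda>x. indicator C x) \<in> borel_measurable ?F" if "C \<in> sets ?F" for C using that by simp
      have "(\<lambda>y. indicator A (u y)) \<in> borel_measurable ?F" by measurable
      then obtain kA where kA: "kA \<in> borel_measurable ?F" "\<And>x. kA x \<le> 1"
        "\<And>c. c \<in> borel_measurable borel \<Longrightarrow> (\<integral>\<^sup>+w. indicator A (u (Y w)) * c (X w) \<partial>M) = (\<integral>\<^sup>+w. kA (X w) * c (X w) \<partial>M)"
        by (rule causalE[OF ca]) (auto split: split_indicator)
      have mB: "(\<lambda>w. indicator B (v (X w)) :: ennreal) \<in> borel_measurable M" by measurable
      obtain kB where kB: "kB \<in> borel_measurable ?F" "\<forall>x. kB x \<le> 1"
        "\<forall>q\<in>borel_measurable ?F. (\<integral>\<^sup>+w. indicator B (v (X w)) * q (X w) \<partial>M) = (\<integral>\<^sup>+w. kB (X w) * q (X w) \<partial>M)"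
        using version[of "\<lambda>w. indicator B (v (X w))", OF mB il] by blast
      have rA: "AE w in M. real_cond_exp M (vimage_algebra (space M) X ?F) (indicator ?EA) w = enn2real (kA (X w))"
        by (subst real_cond_exp_indicator_eq_iff[OF M XF EM(1)[OF A B] kA(1,2)]) (rule ballI, unfold indA, rule kA(3)[OF FB[OF ind]])
      have rB: "AE w in M. real_cond_exp M (vimage_algebra (space M) X ?F) (indicator ?EB) w = enn2real (kB (X w))"
        by (subst real_cond_exp_indicator_eq_iff[OF M XF EM(2)[OF A B] kB(1)]) (simp add: kB(2), rule ballI, unfold indA, rule bspec[OF kB(3) ind])
      have AB1: "kA x * kB x \<le> 1" for x using kA(2) kB(2) mult_mono[of "kA x" 1 "kB x" 1] by simp
      have kAB: "(\<lambda>x. kA x * kB x) \<in> borel_measurable ?F" using kA(1) kB(1) by measurable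
      have rAB: "AE w in M. real_cond_exp M (vimage_algebra (space M) X ?F) (indicator (?EA \<inter> ?EB)) w = enn2real (kA (X w) * kB (X w))"
      proof (subst real_cond_exp_indicator_eq_iff[OF M XF _ kAB AB1])
        show "?EA \<inter> ?EB \<in> sets M" by (rule sets.Int[OF EM(1)[OF A B] EM(2)[OF A B]])
        show "\<forall>D\<in>sets ?F. (\<integral>\<^sup>+w. indicator (?EA \<inter> ?EB) w * indicator D (X w) \<partial>M) = (\<integral>\<^sup>+w. kA (X w) * kB (X w) * indicator D (X w) \<partial>M)"
        proof
          fix D assume D: "D \<in> sets ?F"
          \<comment> \<open>Causality admits test functions of the whole of \<open>X\<close>; this
            one carries the future through \<open>B\<close>.\<close>
          have 1: "(\<lambda>x. indicator B (v x) * indicator D x :: ennreal) \<in> borel_measurable borel"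
            using FB[OF ind[OF D]] by measurable
          have 2: "(\<lambda>x. kA x * indicator D x) \<in> borel_measurable ?F" using kA(1) D by measurable
          have "(\<integral>\<^sup>+w. indicator (?EA \<inter> ?EB) w * indicator D (X w) \<partial>M) = (\<integral>\<^sup>+w. indicator A (u (Y w)) * (indicator B (v (X w)) * indicator D (X w)) \<partial>M)"
            by (simp add: indicator_inter_arith indA mult_ac)
          also have "\<dots> = (\<integral>\<^sup>+w. kA (X w) * (indicator B (v (X w)) * indicator D (X w)) \<partial>M)"
            by (rule kA(3)[OF 1])
          also have "\<dots> = (\<integral>\<^sup>+w. indicator B (v (X w)) * (kA (X w) * indicator D (X w)) \<partial>M)" by (simp only: mult_ac)
          also have "\<dots> = (\<integral>\<^sup>+w. kB (X w) * (kA (X w) * indicator D (X w)) \<partial>M)" by (rule bspec[OF kB(3) 2])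
          finally show "(\<integral>\<^sup>+w. indicator (?EA \<inter> ?EB) w * indicator D (X w) \<partial>M) = (\<integral>\<^sup>+w. kA (X w) * kB (X w) * indicator D (X w) \<partial>M)"
            by (simp add: mult_ac)
        qed
      qed
      show "AE w in M. real_cond_exp M (vimage_algebra (space M) X ?F) (indicator (?EA \<inter> ?EB)) w =
          real_cond_exp M (vimage_algebra (space M) X ?F) (indicator ?EA) w * real_cond_exp M (vimage_algebra (space M) X ?F) (indicator ?EB) w"
        using rAB rA rB by eventually_elim (simp add: enn2real_mult)
    qed
  qed
qed

section \<open>The filtration of the path space\<close>

text \<open>For \<open>S = {..t}\<close> and \<open>S = {t<..}\<close> this is
  \<open>path_upto t\<close> and \<open>path_after t\<close>, which are thereby treated at
  once.\<close>

definition coords :: "'t set \<Rightarrow> real ^ 'd ^ 't \<Rightarrow> 't \<Rightarrow> real ^ 'd" where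
  "coords S x = (\<lambda>s\<in>S. x $ s)"

definition history :: "'t set \<Rightarrow> (real ^ 'd ^ 't) measure" where
  "history S = vimage_algebra UNIV (coords S) (Pi\<^sub>M S (\<lambda>_. borel))"

lemma measurable_coords[measurable]: "coords S \<in> borel \<rightarrow>\<^sub>M Pi\<^sub>M S (\<lambda>_. borel)"
  unfolding coords_def
  by (intro measurable_restrict borel_measurable_continuous_onI continuous_intros)

lemma coords_space: "coords S \<in> UNIV \<rightarrow> space (Pi\<^sub>M S (\<lambda>_. borel))"
  by (auto simp: coords_def space_PiM)

lemma sets_history: "sets (history S) = {coords S -` A |A. A \<in> sets (Pi\<^sub>M S (\<lambda>_. borel))}"
  unfolding history_def by (subst sets_vimage_algebra2[OF coords_space]) auto

lemma subalgebra_history: "subalgebra borel (history S)"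
proof -
  have "coords S -` A \<in> sets borel" if "A \<in> sets (Pi\<^sub>M S (\<lambda>_. borel))" for A
    using measurable_sets[OF measurable_coords that] by simp
  then show ?thesis by (auto simp: subalgebra_def sets_history) (simp_all add: history_def)
qed

lemma history_mono:
  assumes "S \<subseteq> S'"
  shows "subalgebra (history S') (history S)"
proof -
  have "coords S -` A \<in> sets (history S')" if A: "A \<in> sets (Pi\<^sub>M S (\<lambda>_. borel))" for A :: "('a \<Rightarrow> real^'b) set"
  proof -
    let ?r = "\<lambda>f. restrict f S :: 'a \<Rightarrow> real^'b"
    have r: "?r \<in> Pi\<^sub>M S' (\<lambda>_. borel) \<rightarrow>\<^sub>M Pi\<^sub>M S (\<lambda>_. borel)"
      using assms by (rule measurable_restrict_subset)
    have "coords S x = ?r (coords S' x)" for x :: "real^'b^'a" using assms by (auto simp: coords_def fun_eq_iff)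
    then have "coords S -` A = coords S' -` (?r -` A \<inter> space (Pi\<^sub>M S' (\<lambda>_. borel)))"
      using coords_space[of S'] by auto
    then show ?thesis using measurable_sets[OF r A] unfolding sets_history by blast
  qed
  then show ?thesis by (auto simp: subalgebra_def sets_history[of S]) (simp_all add: history_def)
qed

text \<open>All extensional functions on the empty set coincide, so every preimage is either empty
  or everything.\<close>

lemma history_empty: "sets (history {} :: (real^'d^'t) measure) = {{}, UNIV}"
proof -
  have "coords {} x = (\<lambda>_. undefined)" for x :: "real^'d^'t" by (auto simp: coords_def fun_eq_iff)
  then have *: "coords {} -` A = {x :: real^'d^'t. (\<lambda>_. undefined) \<in> A}" for A by auto
  show ?thesis unfolding sets_history sets_PiM_empty * by (auto intro: exI[of _ "{\<lambda>_. undefined}"])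
qed

lemma measurable_vec_of_coords: "(\<lambda>g. \<chi> s. g s) \<in> Pi\<^sub>M UNIV (\<lambda>_. borel) \<rightarrow>\<^sub>M (borel :: (real^'d^'t) measure)"
proof -
  have e: "(\<chi> s. g s) = (\<Sum>s\<in>UNIV. axis s (g s))" for g :: "'t \<Rightarrow> real^'d"
    by (simp add: vec_eq_iff axis_def if_distrib cong: if_cong)
  have l: "bounded_linear (axis s :: real^'d \<Rightarrow> real^'d^'t)" for s
    by (rule linear_conv_bounded_linear[THEN iffD1], rule linearI) (auto simp: vec_eq_iff axis_def)
  have [measurable]: "axis s \<in> borel_measurable (borel :: (real^'d) measure)" for s :: 't
    by (rule borel_measurable_continuous_onI) (rule linear_continuous_on[OF l])
  show ?thesis unfolding e by measurable
qed

text \<open>A path is a measurable function of its two coordinate blocks: coordinates in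
  \<open>S\<close> are read from the first, all others from the second. Hence Borel sets of paths
  are preimages of product sets.\<close>

lemma borel_subset_history:
  assumes "S \<union> S' = UNIV"
  shows "sets (borel :: (real^'d^'t) measure) \<subseteq>
    sets (vimage_algebra UNIV (\<lambda>x. (coords S x, coords S' x)) (Pi\<^sub>M S (\<lambda>_. borel) \<Otimes>\<^sub>M Pi\<^sub>M S' (\<lambda>_. borel)))"
proof
  fix A :: "(real^'d^'t) set" assume A: "A \<in> sets borel"
  let ?P = "Pi\<^sub>M S (\<lambda>_. borel) \<Otimes>\<^sub>M Pi\<^sub>M S' (\<lambda>_. borel) :: (('t \<Rightarrow> real^'d) \<times> ('t \<Rightarrow> real^'d)) measure"
  let ?m = "\<lambda>q. \<lambda>s\<in>UNIV. if s \<in> S then fst q s else snd q s :: real^'d"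
  have c: "(\<lambda>q. if s \<in> S then fst q s else snd q s :: real^'d) \<in> ?P \<rightarrow>\<^sub>M borel" for s
  proof (cases "s \<in> S")
    case True
    then show ?thesis by (simp add: measurable_compose[OF measurable_fst measurable_component_singleton[OF True]])
  next
    case False
    then have "s \<in> S'" using assms by auto
    then show ?thesis using False by (simp add: measurable_compose[OF measurable_snd measurable_component_singleton])
  qed
  have "?m \<in> ?P \<rightarrow>\<^sub>M Pi\<^sub>M UNIV (\<lambda>_. borel)" by (rule measurable_restrict) (rule c)
  then have h: "(\<lambda>q. \<chi> s. ?m q s) \<in> ?P \<rightarrow>\<^sub>M borel" by (rule measurable_compose[OF _ measurable_vec_of_coords])
  have id: "(\<chi> s. ?m (coords S x, coords S' x) s) = x" for x
    using assms by (auto simp: vec_eq_iff coords_def)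
  have "A = (\<lambda>x. (coords S x, coords S' x)) -` ((\<lambda>q. \<chi> s. ?m q s) -` A \<inter> space ?P)"
    using coords_space[of S] coords_space[of S'] id by (auto simp: space_pair_measure)
  moreover have "(\<lambda>q. \<chi> s. ?m q s) -` A \<inter> space ?P \<in> sets ?P" by (rule measurable_sets[OF h A])
  moreover have "(\<lambda>x. (coords S x, coords S' x)) \<in> UNIV \<rightarrow> space ?P"
    using coords_space[of S] coords_space[of S'] by (auto simp: space_pair_measure)
  ultimately show "A \<in> sets (vimage_algebra UNIV (\<lambda>x. (coords S x, coords S' x)) ?P)"
    unfolding sets_vimage_algebra2[OF \<open>_ \<in> UNIV \<rightarrow> space ?P\<close>] by blast
qed

lemma history_UNIV: "sets (history UNIV) = sets (borel :: (real^'d^'t) measure)"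
proof
  show "sets (history UNIV) \<subseteq> sets (borel :: (real^'d^'t) measure)"
    using subalgebra_history by (auto simp: subalgebra_def)
  show "sets (borel :: (real^'d^'t) measure) \<subseteq> sets (history UNIV)"
  proof
    fix A :: "(real^'d^'t) set" assume A: "A \<in> sets borel"
    have "A = coords UNIV -` ((\<lambda>g. \<chi> s. g s) -` A \<inter> space (Pi\<^sub>M UNIV (\<lambda>_. borel)))"
      by (auto simp: coords_def space_PiM restrict_def)
    then show "A \<in> sets (history UNIV)"
      using measurable_sets[OF measurable_vec_of_coords A] unfolding sets_history by blast
  qed
qed

text \<open>\<open>past i\<close> consists of the first \<open>i\<close> time points.\<close>

definition past :: "nat \<Rightarrow> 't::{finite,linorder} set" where
  "past i = {s. card {..<s} < i}"

lemma past_mono: "i \<le> j \<Longrightarrow> past i \<subseteq> past j" by (auto simp: past_def)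

lemma past_0: "past 0 = {}" by (simp add: past_def)

lemma past_card: "past CARD('t) = (UNIV :: 't::{finite,linorder} set)"
proof -
  have "card {..<s} < CARD('t)" for s :: 't by (rule psubset_card_mono) auto
  then show ?thesis by (simp add: past_def)
qed

text \<open>\<open>card {..<s}\<close> is the rank of \<open>s\<close> counted from 0 and strictly
  increasing in \<open>s\<close>. The \<open>Suc\<close> accounts for \<open>{..t}\<close>
  containing \<open>t\<close>.\<close>

lemma atMost_eq_past: "{..t} = past (Suc (card {..<t}))" for t :: "'t::{finite,linorder}"
proof -
  have "card {..<s} \<le> card {..<t} \<longleftrightarrow> s \<le> t" for s
  proof
    assume le: "card {..<s} \<le> card {..<t}"
    show "s \<le> t"
    proof (rule ccontr)
      assume "\<not> s \<le> t"
      then have "{..<t} \<subset> {..<s}" by auto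
      then have "card {..<t} < card {..<s}" by (intro psubset_card_mono) auto
      with le show False by simp
    qed
  qed (auto intro!: card_mono)
  then show ?thesis by (auto simp: past_def less_Suc_eq_le)
qed

definition histories :: "(real ^ 'd ^ 't::{finite,linorder}) measure set" where
  "histories = (\<lambda>t. history {..t}) ` {t. t < Max UNIV}"

lemma histories_subset: "histories \<subseteq> range (\<lambda>i. history (past i))"
  unfolding histories_def by (auto simp: atMost_eq_past)

text \<open>The past and the future of a time cover all coordinates, so
  \<open>cond_indep_iff_causal\<close> applies. The half of \<open>bicausal\<close> that conditions
  on the first path becomes causality from \<open>fst\<close> to \<open>snd\<close>.\<close>

lemma bicausal_iff:
  fixes \<pi> :: "((real ^ 'd ^ 't::{finite,linorder}) \<times> (real ^ 'd ^ 't::{finite,linorder})) measure"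
  assumes \<pi>: "\<pi> \<in> couplings \<mu> \<nu>"
  shows "bicausal \<pi> \<longleftrightarrow> (\<forall>F\<in>histories. causal F \<pi> fst snd \<and> causal F \<pi> snd fst)"
proof -
  have s[measurable_cong]: "sets \<pi> = sets (borel \<Otimes>\<^sub>M borel)" by (rule couplingsD[OF \<pi>])
  have sp: "space \<pi> = UNIV" using sets_eq_imp_space_eq[OF s] by (simp add: space_pair_measure)
  have ps: "prob_space \<pi>" by (rule couplingsD[OF \<pi>])
  have up: "path_upto t = coords {..t}" and af: "path_after t = coords {t<..}" for t :: 't
    by (auto simp: fun_eq_iff path_upto_def path_after_def coords_def)
  have cov: "{..t} \<union> {t<..} = UNIV" for t :: 't by auto
  note ci = cond_indep_iff_causal[OF ps sp _ _ measurable_coords measurable_coords borel_subset_history[OF cov]]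
  have 1: "cond_indep \<pi> (\<lambda>(x, y). path_upto t y) (Pi\<^sub>M {..t} (\<lambda>_. borel))
          (\<lambda>(x, y). path_after t x) (Pi\<^sub>M {t<..} (\<lambda>_. borel))
          (\<lambda>(x, y). path_upto t x) (Pi\<^sub>M {..t} (\<lambda>_. borel)) \<longleftrightarrow> causal (history {..t}) \<pi> fst snd" for t
    unfolding history_def up af split_beta' by (rule ci) measurable
  have 2: "cond_indep \<pi> (\<lambda>(x, y). path_upto t x) (Pi\<^sub>M {..t} (\<lambda>_. borel))
          (\<lambda>(x, y). path_after t y) (Pi\<^sub>M {t<..} (\<lambda>_. borel))
          (\<lambda>(x, y). path_upto t y) (Pi\<^sub>M {..t} (\<lambda>_. borel)) \<longleftrightarrow> causal (history {..t}) \<pi> snd fst" for t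
    unfolding history_def up af split_beta' by (rule ci) measurable
  show ?thesis unfolding bicausal_def 1 2 histories_def by auto
qed

lemma bicausal_couplings_eq: "bicausal_couplings \<mu> \<nu> = bc_couplings histories \<mu> \<nu>"
  unfolding bicausal_couplings_def bc_couplings_def by (rule Collect_cong) (simp add: bicausal_iff cong: conj_cong)

section \<open>Smoothing by convolution\<close>

text \<open>Fundamental theorem of calculus along the segment from \<open>w\<close> to
  \<open>w + h\<close>, then Tonelli and the invariance of Lebesgue measure under the shift by
  \<open>t *\<^sub>R h\<close>.\<close>

lemma gderiv_translation_bound:
  fixes f :: "'a::euclidean_space \<Rightarrow> real"
  assumes f: "\<And>x. GDERIV f x :> g x" and g: "continuous_on UNIV g"
  shows "(\<integral>\<^sup>+w. ennreal \<bar>f (w + h) - f w\<bar> \<partial>lborel) \<le> ennreal (norm h) * (\<integral>\<^sup>+w. ennreal (norm (g w)) \<partial>lborel)"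
proof -
  have gm[measurable]: "g \<in> borel_measurable borel" by (rule borel_measurable_continuous_onI[OF g])
  have pw: "ennreal \<bar>f (w + h) - f w\<bar> \<le> (\<integral>\<^sup>+t. ennreal (norm h) * (ennreal (norm (g (w + t *\<^sub>R h))) * indicator {0..1::real} t) \<partial>lborel)" for w
  proof -
    define F where "F t = f (w + t *\<^sub>R h)" for t :: real
    have d: "(F has_vector_derivative (h \<bullet> g (w + t *\<^sub>R h))) (at t within {0..1})" for t
    proof -
      have "(f has_derivative (\<lambda>v. v \<bullet> g (w + t *\<^sub>R h))) (at (w + t *\<^sub>R h))"
        using f[of "w + t *\<^sub>R h"] by (simp add: gderiv_def)
      moreover have "((\<lambda>t. w + t *\<^sub>R h) has_derivative (\<lambda>s. s *\<^sub>R h)) (at t within {0..1})"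
        by (auto intro!: derivative_eq_intros)
      ultimately have "((\<lambda>t. f (w + t *\<^sub>R h)) has_derivative (\<lambda>s. (s *\<^sub>R h) \<bullet> g (w + t *\<^sub>R h))) (at t within {0..1})"
        by (rule has_derivative_compose[rotated])
      then show ?thesis by (simp add: has_vector_derivative_def F_def[abs_def])
    qed
    have c: "continuous_on {0..1} (\<lambda>t. h \<bullet> g (w + t *\<^sub>R h))"
      by (intro continuous_intros continuous_on_compose2[OF g]) auto
    have "has_bochner_integral lborel (\<lambda>t. indicator {0..1} t *\<^sub>R (h \<bullet> g (w + t *\<^sub>R h))) (F 1 - F 0)"
      by (rule has_bochner_integral_FTC_Icc[OF _ d c]) simp
    then have i: "integrable lborel (\<lambda>t. indicator {0..1} t *\<^sub>R (h \<bullet> g (w + t *\<^sub>R h)))"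
      and e: "F 1 - F 0 = (LINT t|lborel. indicator {0..1} t *\<^sub>R (h \<bullet> g (w + t *\<^sub>R h)))"
      by (auto simp: has_bochner_integral_iff)
    have "ennreal \<bar>F 1 - F 0\<bar> \<le> (\<integral>\<^sup>+t. ennreal (norm (indicator {0..1} t *\<^sub>R (h \<bullet> g (w + t *\<^sub>R h)))) \<partial>lborel)"
      unfolding e using integral_norm_bound_ennreal[OF i] by simp
    also have "\<dots> \<le> (\<integral>\<^sup>+t. ennreal (norm h) * (ennreal (norm (g (w + t *\<^sub>R h))) * indicator {0..1::real} t) \<partial>lborel)"
    proof (rule nn_integral_mono)
      fix t :: real
      have "ennreal \<bar>h \<bullet> g (w + t *\<^sub>R h)\<bar> \<le> ennreal (norm h * norm (g (w + t *\<^sub>R h)))"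
        by (rule ennreal_leI[OF Cauchy_Schwarz_ineq2])
      then show "ennreal (norm (indicator {0..1} t *\<^sub>R (h \<bullet> g (w + t *\<^sub>R h)))) \<le> ennreal (norm h) * (ennreal (norm (g (w + t *\<^sub>R h))) * indicator {0..1::real} t)"
        by (simp add: ennreal_mult split: split_indicator)
    qed
    finally show ?thesis by (simp add: F_def)
  qed
  have "(\<integral>\<^sup>+w. ennreal \<bar>f (w + h) - f w\<bar> \<partial>lborel) \<le>
     (\<integral>\<^sup>+w. (\<integral>\<^sup>+t. ennreal (norm h) * (ennreal (norm (g (w + t *\<^sub>R h))) * indicator {0..1::real} t) \<partial>lborel) \<partial>lborel)"
    by (rule nn_integral_mono) (rule pw)
  also have "\<dots> = (\<integral>\<^sup>+t. (\<integral>\<^sup>+w. ennreal (norm h) * (ennreal (norm (g (w + t *\<^sub>R h))) * indicator {0..1::real} t) \<partial>lborel) \<partial>lborel)"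
    by (rule lborel_pair.Fubini') measurable
  also have "\<dots> = (\<integral>\<^sup>+t. ennreal (norm h) * ((\<integral>\<^sup>+w. ennreal (norm (g w)) \<partial>lborel) * indicator {0..1::real} t) \<partial>lborel)"
  proof (rule nn_integral_cong)
    fix t :: real
    have "(\<integral>\<^sup>+w. ennreal (norm (g (w + t *\<^sub>R h))) \<partial>lborel) = (\<integral>\<^sup>+w. ennreal (norm (g w)) \<partial>distr lborel borel ((+) (t *\<^sub>R h)))"
      by (subst nn_integral_distr) (auto simp: add.commute)
    then have "(\<integral>\<^sup>+w. ennreal (norm (g (w + t *\<^sub>R h))) \<partial>lborel) = (\<integral>\<^sup>+w. ennreal (norm (g w)) \<partial>lborel)"
      by (simp add: lborel_distr_plus)
    then show "(\<integral>\<^sup>+w. ennreal (norm h) * (ennreal (norm (g (w + t *\<^sub>R h))) * indicator {0..1::real} t) \<partial>lborel) = ennreal (norm h) * ((\<integral>\<^sup>+w. ennreal (norm (g w)) \<partial>lborel) * indicator {0..1::real} t)"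
      by (simp add: nn_integral_cmult nn_integral_multc)
  qed
  also have "\<dots> = ennreal (norm h) * (\<integral>\<^sup>+w. ennreal (norm (g w)) \<partial>lborel)"
    by (simp add: nn_integral_cmult)
  finally show ?thesis .
qed

text \<open>Translates of \<zeta> depend on the shift in a Lipschitz way with respect to total
  variation. One inequality expresses this, since \<open>x\<close> and \<open>y\<close> may be
  exchanged.\<close>

definition shift_lipschitz :: "'a::euclidean_space measure \<Rightarrow> real \<Rightarrow> bool" where
  "shift_lipschitz \<zeta> L \<longleftrightarrow> (\<forall>A\<in>sets borel. \<forall>x y. emeasure \<zeta> {z. x + z \<in> A} \<le> emeasure \<zeta> {z. y + z \<in> A} + ennreal (L * norm (x - y)))"

text \<open>Shifting the scaled noise by \<open>x\<close> shifts the density by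
  \<open>x / \<sigma>\<close>, which is the source of the factor \<open>1 / \<sigma>\<close> in the
  constant.\<close>

lemma shift_lipschitz_scaled_noise:
  fixes f :: "'a::euclidean_space \<Rightarrow> real"
  assumes f0: "\<And>x. 0 \<le> f x" and \<xi>: "\<xi> = density lborel (\<lambda>x. ennreal (f x))"
    and f: "\<And>x. GDERIV f x :> g x" and g: "continuous_on UNIV g" and ig: "integrable lborel g" and \<sigma>: "0 < \<sigma>"
  shows "shift_lipschitz (scaled_noise \<sigma> \<xi>) ((LINT w|lborel. norm (g w)) / \<sigma>)"
  unfolding shift_lipschitz_def
proof (intro ballI allI)
  fix A :: "'a set" and x y :: 'a assume A[measurable]: "A \<in> sets borel"
  have "continuous_on UNIV f"
    using f by (auto simp: continuous_on_eq_continuous_at gderiv_def intro: has_derivative_continuous)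
  then have [measurable]: "f \<in> borel_measurable borel" by (rule borel_measurable_continuous_onI)
  have E: "emeasure (scaled_noise \<sigma> \<xi>) {z. x + z \<in> A} = (\<integral>\<^sup>+w. ennreal (f (w - (1 / \<sigma>) *\<^sub>R x)) * indicator A (\<sigma> *\<^sub>R w) \<partial>lborel)" for x
  proof -
    have [measurable]: "{z. x + z \<in> A} \<in> sets borel" using measurable_sets[of "\<lambda>z. x + z" borel borel A] by (simp add: vimage_def)
    have "emeasure (scaled_noise \<sigma> \<xi>) {z. x + z \<in> A} = (\<integral>\<^sup>+w. ennreal (f w) * indicator {z. x + z \<in> A} (\<sigma> *\<^sub>R w) \<partial>lborel)"
      unfolding scaled_noise_def \<xi> by (subst nn_integral_indicator[symmetric], simp, subst nn_integral_distr) (auto simp: nn_integral_density)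
    also have "\<dots> = (\<integral>\<^sup>+w. ennreal (f w) * indicator {z. x + z \<in> A} (\<sigma> *\<^sub>R w) \<partial>distr lborel borel ((+) (- ((1 / \<sigma>) *\<^sub>R x))))"
      by (simp only: lborel_distr_plus)
    also have "\<dots> = (\<integral>\<^sup>+w. ennreal (f (w - (1 / \<sigma>) *\<^sub>R x)) * indicator A (\<sigma> *\<^sub>R w) \<partial>lborel)"
      using \<sigma> by (subst nn_integral_distr) (auto simp: algebra_simps indicator_def)
    finally show ?thesis .
  qed
  have "emeasure (scaled_noise \<sigma> \<xi>) {z. x + z \<in> A} \<le>
     (\<integral>\<^sup>+w. ennreal (f (w - (1 / \<sigma>) *\<^sub>R y)) * indicator A (\<sigma> *\<^sub>R w) + ennreal \<bar>f (w - (1 / \<sigma>) *\<^sub>R x) - f (w - (1 / \<sigma>) *\<^sub>R y)\<bar> \<partial>lborel)"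
    unfolding E
  proof (rule nn_integral_mono)
    fix w
    have "ennreal (f (w - (1 / \<sigma>) *\<^sub>R x)) \<le> ennreal (f (w - (1 / \<sigma>) *\<^sub>R y) + \<bar>f (w - (1 / \<sigma>) *\<^sub>R x) - f (w - (1 / \<sigma>) *\<^sub>R y)\<bar>)"
      by (rule ennreal_leI) linarith
    then show "ennreal (f (w - (1 / \<sigma>) *\<^sub>R x)) * indicator A (\<sigma> *\<^sub>R w) \<le> ennreal (f (w - (1 / \<sigma>) *\<^sub>R y)) * indicator A (\<sigma> *\<^sub>R w) + ennreal \<bar>f (w - (1 / \<sigma>) *\<^sub>R x) - f (w - (1 / \<sigma>) *\<^sub>R y)\<bar>"
      by (simp add: f0 split: split_indicator)
  qed
  also have "\<dots> = emeasure (scaled_noise \<sigma> \<xi>) {z. y + z \<in> A} + (\<integral>\<^sup>+w. ennreal \<bar>f (w - (1 / \<sigma>) *\<^sub>R x) - f (w - (1 / \<sigma>) *\<^sub>R y)\<bar> \<partial>lborel)"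
    unfolding E by (rule nn_integral_add) measurable
  also have "(\<integral>\<^sup>+w. ennreal \<bar>f (w - (1 / \<sigma>) *\<^sub>R x) - f (w - (1 / \<sigma>) *\<^sub>R y)\<bar> \<partial>lborel)
      = (\<integral>\<^sup>+w. ennreal \<bar>f (w - (1 / \<sigma>) *\<^sub>R x) - f (w - (1 / \<sigma>) *\<^sub>R y)\<bar> \<partial>distr lborel borel ((+) ((1 / \<sigma>) *\<^sub>R y)))"
    by (simp only: lborel_distr_plus)
  also have "\<dots> = (\<integral>\<^sup>+w. ennreal \<bar>f (w + (1 / \<sigma>) *\<^sub>R (y - x)) - f w\<bar> \<partial>lborel)"
    by (subst nn_integral_distr) (auto simp: algebra_simps)
  also have "\<dots> \<le> ennreal (norm ((1 / \<sigma>) *\<^sub>R (y - x))) * (\<integral>\<^sup>+w. ennreal (norm (g w)) \<partial>lborel)"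
    by (rule gderiv_translation_bound[OF f g])
  also have "(\<integral>\<^sup>+w. ennreal (norm (g w)) \<partial>lborel) = ennreal (LINT w|lborel. norm (g w))"
    using ig by (intro nn_integral_eq_integral integrable_norm) auto
  also have "ennreal (norm ((1 / \<sigma>) *\<^sub>R (y - x))) * \<dots> = ennreal ((LINT w|lborel. norm (g w)) / \<sigma> * norm (x - y))"
    using \<sigma> by (subst ennreal_mult[symmetric]) (auto simp: norm_minus_commute mult.commute)
  finally show "emeasure (scaled_noise \<sigma> \<xi>) {z. x + z \<in> A} \<le> emeasure (scaled_noise \<sigma> \<xi>) {z. y + z \<in> A} + ennreal ((LINT w|lborel. norm (g w)) / \<sigma> * norm (x - y))"
    by (simp add: add_left_mono)
qed

section \<open>Moments, tails and total variation of convolutions\<close>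

lemma scaled_noise_moment:
  assumes \<xi>: "\<xi> \<in> prob_finite_moment p" and \<sigma>: "0 \<le> \<sigma>"
  shows "scaled_noise \<sigma> \<xi> \<in> prob_finite_moment p"
    and "(\<integral>\<^sup>+z. ennreal (norm z powr p) \<partial>scaled_noise \<sigma> \<xi>) = ennreal (\<sigma> powr p) * (\<integral>\<^sup>+z. ennreal (norm z powr p) \<partial>\<xi>)"
proof -
  have [measurable_cong]: "sets \<xi> = sets borel" by (rule prob_finite_momentD[OF \<xi>])
  have "(\<integral>\<^sup>+z. ennreal (norm z powr p) \<partial>scaled_noise \<sigma> \<xi>) = (\<integral>\<^sup>+z. ennreal (\<sigma> powr p) * ennreal (norm z powr p) \<partial>\<xi>)"
    unfolding scaled_noise_def using \<sigma> by (subst nn_integral_distr) (auto simp: powr_mult ennreal_mult intro!: nn_integral_cong)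
  then show e: "(\<integral>\<^sup>+z. ennreal (norm z powr p) \<partial>scaled_noise \<sigma> \<xi>) = ennreal (\<sigma> powr p) * (\<integral>\<^sup>+z. ennreal (norm z powr p) \<partial>\<xi>)"
    by (simp add: nn_integral_cmult)
  show "scaled_noise \<sigma> \<xi> \<in> prob_finite_moment p"
  proof (rule prob_finite_momentI)
    show "prob_space (scaled_noise \<sigma> \<xi>)" unfolding scaled_noise_def
      by (rule prob_space.prob_space_distr[OF prob_finite_momentD(1)[OF \<xi>]]) measurable
    show "(\<integral>\<^sup>+z. ennreal (norm z powr p) \<partial>scaled_noise \<sigma> \<xi>) < \<infinity>"
      unfolding e using prob_finite_momentD(3)[OF \<xi>] by (simp add: ennreal_mult_less_top)
  qed (simp add: scaled_noise_def)
qed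

lemma distr_pair_prob:
  fixes \<mu> \<nu> :: "'a::euclidean_space measure"
  assumes \<mu>: "prob_space \<mu>" "sets \<mu> = sets borel" and \<nu>: "prob_space \<nu>" "sets \<nu> = sets borel"
  shows "distr (\<mu> \<Otimes>\<^sub>M \<nu>) borel fst = \<mu>" "distr (\<mu> \<Otimes>\<^sub>M \<nu>) borel snd = \<nu>" "prob_space (\<mu> \<Otimes>\<^sub>M \<nu>)"
    "sets (\<mu> \<Otimes>\<^sub>M \<nu>) = sets (borel \<Otimes>\<^sub>M borel)"
  using couplingsD[of "\<mu> \<Otimes>\<^sub>M \<nu>" \<mu> \<nu>] bc_couplings_pair[OF \<mu> \<nu>, of "{}"] by (auto simp: bc_couplings_def)

lemma convolution_moment:
  fixes \<mu> \<nu> :: "'a::ordered_euclidean_space measure"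
  assumes p: "0 \<le> p" and \<mu>: "\<mu> \<in> prob_finite_moment p" and \<nu>: "\<nu> \<in> prob_finite_moment p"
  shows "(\<mu> \<star> \<nu>) \<in> prob_finite_moment p"
proof (rule prob_finite_momentI)
  note m = prob_finite_momentD[OF \<mu>] and n = prob_finite_momentD[OF \<nu>]
  have [measurable_cong]: "sets \<mu> = sets borel" "sets \<nu> = sets borel" by fact+
  interpret \<mu>: prob_space \<mu> by fact
  interpret \<nu>: prob_space \<nu> by fact
  show "prob_space (\<mu> \<star> \<nu>)" unfolding convolution_def
    by (rule prob_space.prob_space_distr[OF distr_pair_prob(3)[OF m(1,2) n(1,2)]]) measurable
  have "(\<integral>\<^sup>+x. ennreal (norm x powr p) \<partial>(\<mu> \<star> \<nu>)) = (\<integral>\<^sup>+x. (\<integral>\<^sup>+y. ennreal (norm (x + y) powr p) \<partial>\<nu>) \<partial>\<mu>)"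
    using m n by (intro nn_integral_convolution prob_space.finite_measure) auto
  also have "\<dots> \<le> (\<integral>\<^sup>+x. (\<integral>\<^sup>+y. ennreal (2 powr p) * (ennreal (norm x powr p) + ennreal (norm y powr p)) \<partial>\<nu>) \<partial>\<mu>)"
  proof (intro nn_integral_mono)
    fix x y :: 'a
    have "ennreal (norm (x + y) powr p) \<le> ennreal (2 powr p * (norm x powr p + norm y powr p))"
      by (rule ennreal_leI[OF norm_add_powr_le[OF p]])
    then show "ennreal (norm (x + y) powr p) \<le> ennreal (2 powr p) * (ennreal (norm x powr p) + ennreal (norm y powr p))"
      by (simp add: ennreal_mult)
  qed
  also have "\<dots> = ennreal (2 powr p) * ((\<integral>\<^sup>+x. ennreal (norm x powr p) \<partial>\<mu>) + (\<integral>\<^sup>+x. ennreal (norm x powr p) \<partial>\<nu>))"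
    by (simp add: nn_integral_cmult nn_integral_add \<mu>.emeasure_space_1 \<nu>.emeasure_space_1)
  also have "\<dots> < \<infinity>" using m(3) n(3) by (simp add: ennreal_mult_less_top)
  finally show "(\<integral>\<^sup>+x. ennreal (norm x powr p) \<partial>(\<mu> \<star> \<nu>)) < \<infinity>" .
qed simp

text \<open>The second bound recovers the original variable as the smoothed one plus the negated
  noise, which has the same tail as the noise.\<close>

lemma tail_convolution:
  fixes \<mu> \<nu> :: "'a::ordered_euclidean_space measure"
  assumes p: "0 \<le> p" and \<mu>: "prob_space \<mu>" "sets \<mu> = sets borel" and \<nu>: "prob_space \<nu>" "sets \<nu> = sets borel"
  shows "tail_moment p (\<mu> \<star> \<nu>) R \<le> ennreal (2 powr p) * (tail_moment p \<mu> (R / 2) + tail_moment p \<nu> (R / 2))"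
    and "tail_moment p \<mu> R \<le> ennreal (2 powr p) * (tail_moment p (\<mu> \<star> \<nu>) (R / 2) + tail_moment p \<nu> (R / 2))"
proof -
  note d = distr_pair_prob[OF \<mu> \<nu>]
  have [measurable_cong]: "sets (\<mu> \<Otimes>\<^sub>M \<nu>) = sets (borel \<Otimes>\<^sub>M borel)" by (rule d)
  have c: "\<mu> \<star> \<nu> = distr (\<mu> \<Otimes>\<^sub>M \<nu>) borel (\<lambda>q. fst q + snd q)" by (simp add: convolution_def split_beta')
  show "tail_moment p (\<mu> \<star> \<nu>) R \<le> ennreal (2 powr p) * (tail_moment p \<mu> (R / 2) + tail_moment p \<nu> (R / 2))"
    using tail_sum[OF p, of fst "\<mu> \<Otimes>\<^sub>M \<nu>" snd R] by (simp add: c d)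
  have [measurable]: "{x. r < norm x} \<in> sets (borel :: 'a measure)" for r
    by (intro borel_open open_Collect_less continuous_intros)
  have [measurable_cong]: "sets \<nu> = sets borel" by fact
  have "tail_moment p (distr (\<mu> \<Otimes>\<^sub>M \<nu>) borel (\<lambda>q. - snd q)) r = tail_moment p (distr (\<mu> \<Otimes>\<^sub>M \<nu>) borel snd) r" for r
    unfolding tail_moment_def by (subst (1 2) nn_integral_distr) (auto simp: indicator_def)
  then show "tail_moment p \<mu> R \<le> ennreal (2 powr p) * (tail_moment p (\<mu> \<star> \<nu>) (R / 2) + tail_moment p \<nu> (R / 2))"
    using tail_sum[OF p, of "\<lambda>q. fst q + snd q" "\<mu> \<Otimes>\<^sub>M \<nu>" "\<lambda>q. - snd q" R] by (simp add: c d)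
qed

text \<open>Translates of the noise to two coupled points differ in total variation by at most
  \<open>L\<close> times the distance of the points. Averaging over the coupling gives the
  bound.\<close>

lemma tv_le_convolution:
  fixes \<mu> \<nu> \<zeta> :: "'a::ordered_euclidean_space measure"
  assumes \<pi>: "\<pi> \<in> couplings \<mu> \<nu>" and \<zeta>: "prob_space \<zeta>" "sets \<zeta> = sets borel" and L: "shift_lipschitz \<zeta> L" "0 \<le> L"
  shows "tv_le (\<mu> \<star> \<zeta>) (\<nu> \<star> \<zeta>) (ennreal L * (\<integral>\<^sup>+q. ennreal (norm (fst q - snd q)) \<partial>\<pi>))"
  unfolding tv_le_def
proof
  fix A :: "'a set" assume A[measurable]: "A \<in> sets borel"
  note c = couplingsD[OF \<pi>]
  have [measurable_cong]: "sets \<pi> = sets (borel \<Otimes>\<^sub>M borel)" "sets \<zeta> = sets borel" by fact+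
  interpret \<zeta>: prob_space \<zeta> by fact
  let ?I = "ennreal L * (\<integral>\<^sup>+q. ennreal (norm (fst q - snd q)) \<partial>\<pi>)"
  define k where "k x = emeasure \<zeta> {z. x + z \<in> A}" for x
  have kI: "k x = (\<integral>\<^sup>+z. indicator A (x + z) \<partial>\<zeta>)" for x
  proof -
    have "{z. x + z \<in> A} \<in> sets \<zeta>" using measurable_sets[of "\<lambda>z. x + z" borel borel A] \<zeta>(2) by (simp add: vimage_def)
    then have "k x = (\<integral>\<^sup>+z. indicator {z. x + z \<in> A} z \<partial>\<zeta>)" by (simp add: k_def)
    then show ?thesis by (simp add: indicator_def)
  qed
  have [measurable]: "k \<in> borel_measurable borel" unfolding kI[abs_def] by measurable
  have e: "emeasure (\<eta> \<star> \<zeta>) A = (\<integral>\<^sup>+x. k x \<partial>\<eta>)" if "prob_space \<eta>" "sets \<eta> = sets borel" for \<eta>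
    unfolding kI using that \<zeta> by (subst convolution_emeasure') (auto intro: prob_space.finite_measure)
  have le: "k x \<le> k y + ennreal L * ennreal (norm (x - y))" for x y
    using L A unfolding shift_lipschitz_def k_def by (simp add: ennreal_mult)
  have "(\<integral>\<^sup>+q. k (fst q) \<partial>\<pi>) \<le> (\<integral>\<^sup>+q. k (snd q) + ennreal L * ennreal (norm (fst q - snd q)) \<partial>\<pi>)"
    by (intro nn_integral_mono le)
  also have "\<dots> = (\<integral>\<^sup>+q. k (snd q) \<partial>\<pi>) + ?I" by (subst nn_integral_add) (auto simp: nn_integral_cmult)
  finally have 1: "emeasure (\<mu> \<star> \<zeta>) A \<le> emeasure (\<nu> \<star> \<zeta>) A + ?I"
    using c by (simp add: e nn_integral_coupling_fst[OF \<pi>] nn_integral_coupling_snd[OF \<pi>])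
  have "(\<integral>\<^sup>+q. k (snd q) \<partial>\<pi>) \<le> (\<integral>\<^sup>+q. k (fst q) + ennreal L * ennreal (norm (fst q - snd q)) \<partial>\<pi>)"
    by (intro nn_integral_mono) (subst norm_minus_commute, rule le)
  also have "\<dots> = (\<integral>\<^sup>+q. k (fst q) \<partial>\<pi>) + ?I" by (subst nn_integral_add) (auto simp: nn_integral_cmult)
  finally have 2: "emeasure (\<nu> \<star> \<zeta>) A \<le> emeasure (\<mu> \<star> \<zeta>) A + ?I"
    using c by (simp add: e nn_integral_coupling_fst[OF \<pi>] nn_integral_coupling_snd[OF \<pi>])
  from 1 2 show "emeasure (\<mu> \<star> \<zeta>) A \<le> emeasure (\<nu> \<star> \<zeta>) A + ?I \<and> emeasure (\<nu> \<star> \<zeta>) A \<le> emeasure (\<mu> \<star> \<zeta>) A + ?I" ..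
qed

lemma first_moment_tendsto_0:
  fixes \<pi> :: "nat \<Rightarrow> ('a::euclidean_space \<times> 'a) measure"
  assumes p: "1 \<le> p" and \<pi>: "\<And>n. prob_space (\<pi> n)" "\<And>n. sets (\<pi> n) = sets (borel \<Otimes>\<^sub>M borel)"
    and lim: "(\<lambda>n. \<integral>\<^sup>+q. ennreal (norm (fst q - snd q) powr p) \<partial>\<pi> n) \<longlonglongrightarrow> 0"
  shows "(\<lambda>n. \<integral>\<^sup>+q. ennreal (norm (fst q - snd q)) \<partial>\<pi> n) \<longlonglongrightarrow> 0"
proof (rule order_tendstoI)
  fix e :: ennreal assume "0 < e"
  then obtain d' where d': "0 < d'" "d' < e" using dense by blast
  then obtain d where d: "d' = ennreal d" "0 < d" by (cases d') auto
  have [measurable_cong]: "sets (\<pi> n) = sets (borel \<Otimes>\<^sub>M borel)" for n by fact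
  define h where "h = d / 2"
  have h: "0 < h" using d by (simp add: h_def)
  \<comment> \<open>Above the level \<open>h\<close> one has
    \<open>r \<le> h powr (1 - p) * r powr p\<close>; below it \<open>r\<close> is at most
    \<open>h\<close> itself.\<close>
  define K where "K = h powr (1 - p)"
  have K: "0 < K" using h by (simp add: K_def)
  have pw: "ennreal r \<le> ennreal h + ennreal K * ennreal (r powr p)" if "0 \<le> r" for r
  proof (cases "r \<le> h")
    case True
    then show ?thesis using ennreal_leI[OF True] by (simp add: add_increasing2)
  next
    case False
    then have "h powr (p - 1) \<le> r powr (p - 1)" using h p by (intro powr_mono2) auto
    then have "K * h powr (p - 1) \<le> K * r powr (p - 1)" using K by (intro mult_left_mono) auto
    moreover have "K * h powr (p - 1) = 1" using h by (simp add: K_def powr_add[symmetric])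
    ultimately have "1 * r \<le> (K * r powr (p - 1)) * r" using that by (intro mult_right_mono) auto
    also have "\<dots> = K * r powr p" using False h that by (simp add: powr_diff)
    finally have "ennreal r \<le> ennreal (K * r powr p)" by (intro ennreal_leI) simp
    then show ?thesis using K by (simp add: ennreal_mult add_increasing)
  qed
  have "(\<lambda>n. ennreal K * (\<integral>\<^sup>+q. ennreal (norm (fst q - snd q) powr p) \<partial>\<pi> n)) \<longlonglongrightarrow> ennreal K * 0"
    by (intro ennreal_tendsto_cmult lim) simp
  then have "\<forall>\<^sub>F n in sequentially. ennreal K * (\<integral>\<^sup>+q. ennreal (norm (fst q - snd q) powr p) \<partial>\<pi> n) < ennreal h"
    using h by (intro order_tendstoD(2)) auto
  then show "\<forall>\<^sub>F n in sequentially. (\<integral>\<^sup>+q. ennreal (norm (fst q - snd q)) \<partial>\<pi> n) < e"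
  proof eventually_elim
    case (elim n)
    interpret prob_space "\<pi> n" by fact
    have "(\<integral>\<^sup>+q. ennreal (norm (fst q - snd q)) \<partial>\<pi> n) \<le> (\<integral>\<^sup>+q. ennreal h + ennreal K * ennreal (norm (fst q - snd q) powr p) \<partial>\<pi> n)"
      by (intro nn_integral_mono pw) simp
    also have "\<dots> = ennreal h + ennreal K * (\<integral>\<^sup>+q. ennreal (norm (fst q - snd q) powr p) \<partial>\<pi> n)"
      by (subst nn_integral_add) (auto simp: nn_integral_cmult emeasure_space_1)
    also have "\<dots> \<le> ennreal h + ennreal h" using elim by (intro add_left_mono) simp
    also have "\<dots> = ennreal d" using h by (simp add: h_def ennreal_plus[symmetric] del: ennreal_plus)
    finally show ?case using d d' by simp
  qed
qed simp

section \<open>Gaussian smoothing and characteristic functions\<close>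

definition gauss_density :: "'a::euclidean_space \<Rightarrow> real" where
  "gauss_density x = (\<Prod>b\<in>Basis. std_normal_density (x \<bullet> b))"

definition gauss :: "'a::euclidean_space measure" where
  "gauss = density lborel (\<lambda>x. ennreal (gauss_density x))"

lemma gauss_density_nonneg: "0 \<le> gauss_density x"
  unfolding gauss_density_def by (intro prod_nonneg) (simp add: normal_density_nonneg)

lemma gauss_density_measurable[measurable]: "gauss_density \<in> borel_measurable borel"
  unfolding gauss_density_def by measurable

lemma nn_integral_std_normal: "(\<integral>\<^sup>+x. ennreal (std_normal_density x) \<partial>lborel) = 1"
  using prob_space.emeasure_space_1[OF prob_space_normal_density[of 1 0]] by (simp add: emeasure_density)

lemma prob_space_gauss: "prob_space (gauss :: 'a::euclidean_space measure)"
proof (rule prob_spaceI)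
  have "emeasure (gauss :: 'a measure) (space gauss) = (\<integral>\<^sup>+x. ennreal (gauss_density (x::'a)) \<partial>lborel)"
    by (simp add: gauss_def emeasure_density)
  also have "\<dots> = (\<integral>\<^sup>+x. (\<Prod>b\<in>Basis. ennreal (std_normal_density (x \<bullet> b))) \<partial>(lborel :: 'a measure))"
    unfolding gauss_density_def by (simp add: prod_ennreal normal_density_nonneg)
  also have "\<dots> = 1"
    by (subst nn_integral_lborel_prod[of "\<lambda>_ t. ennreal (std_normal_density t)"]) (auto simp: nn_integral_std_normal)
  finally show "emeasure (gauss :: 'a measure) (space gauss) = 1" .
qed

text \<open>The p-th power of the norm is dominated by powers of the coordinates with an integer
  exponent \<open>k \<ge> p\<close>, whose absolute moments under the normal law are finite. The
  product form of the density makes the integrals factorize.\<close>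

lemma gauss_moment:
  assumes p: "0 \<le> p"
  shows "(gauss :: 'a::euclidean_space measure) \<in> prob_finite_moment p"
proof (rule prob_finite_momentI[OF prob_space_gauss])
  show "sets (gauss :: 'a measure) = sets borel" by (simp add: gauss_def)
  define k where "k = nat \<lceil>p\<rceil>"
  have k: "p \<le> real k" unfolding k_def by linarith
  have b: "(\<integral>\<^sup>+x. ennreal (\<bar>x \<bullet> b\<bar> ^ k) \<partial>(gauss :: 'a measure)) < \<infinity>" if "b \<in> Basis" for b
  proof -
    have "(\<integral>\<^sup>+x. ennreal (\<bar>x \<bullet> b\<bar> ^ k) \<partial>(gauss :: 'a measure)) = (\<integral>\<^sup>+x. ennreal (gauss_density x) * ennreal (\<bar>x \<bullet> b\<bar> ^ k) \<partial>(lborel :: 'a measure))"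
      unfolding gauss_def by (rule nn_integral_density) measurable
    also have "\<dots> = (\<integral>\<^sup>+x. (\<Prod>b'\<in>Basis. ennreal (std_normal_density (x \<bullet> b') * (if b' = b then \<bar>x \<bullet> b'\<bar> ^ k else 1))) \<partial>(lborel :: 'a measure))"
    proof (rule nn_integral_cong)
      fix x :: 'a
      have "(\<Prod>b'\<in>Basis. std_normal_density (x \<bullet> b') * (if b' = b then \<bar>x \<bullet> b'\<bar> ^ k else 1)) = gauss_density x * \<bar>x \<bullet> b\<bar> ^ k"
        using that by (simp add: prod.distrib gauss_density_def)
      then show "ennreal (gauss_density x) * ennreal (\<bar>x \<bullet> b\<bar> ^ k) = (\<Prod>b'\<in>Basis. ennreal (std_normal_density (x \<bullet> b') * (if b' = b then \<bar>x \<bullet> b'\<bar> ^ k else 1)))"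
        by (subst prod_ennreal) (auto simp: normal_density_nonneg ennreal_mult gauss_density_nonneg)
    qed
    also have "\<dots> = (\<Prod>b'\<in>(Basis :: 'a set). (\<integral>\<^sup>+t. ennreal (std_normal_density t * (if b' = b then \<bar>t\<bar> ^ k else 1)) \<partial>lborel))"
      by (rule nn_integral_lborel_prod[of "\<lambda>b' t. ennreal (std_normal_density t * (if b' = b then \<bar>t\<bar> ^ k else 1))"]) auto
    also have "\<dots> < \<infinity>"
    proof -
      have fin: "(\<integral>\<^sup>+t. ennreal (std_normal_density t * (if b' = b then \<bar>t\<bar> ^ k else 1)) \<partial>lborel) < \<infinity>" for b'
      proof (cases "b' = b")
        case True
        then show ?thesis using integrable_std_normal_moment_abs[of k] by (simp add: integrable_iff_bounded normal_density_nonneg)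
      qed (simp add: nn_integral_std_normal)
      have "(\<Prod>b'\<in>B. (\<integral>\<^sup>+t. ennreal (std_normal_density t * (if b' = b then \<bar>t\<bar> ^ k else 1)) \<partial>lborel)) < \<infinity>" if "finite B" for B :: "'a set"
        using that by induction (use fin in \<open>auto simp: ennreal_mult_less_top\<close>)
      then show ?thesis by simp
    qed
    finally show ?thesis .
  qed
  let ?N = "real DIM('a) powr p"
  have "(\<integral>\<^sup>+x. ennreal (norm x powr p) \<partial>(gauss :: 'a measure)) \<le> (\<integral>\<^sup>+x. ennreal ?N * (\<Sum>b\<in>Basis. 1 + ennreal (\<bar>x \<bullet> b\<bar> ^ k)) \<partial>(gauss :: 'a measure))"
  proof (rule nn_integral_mono)
    fix x :: 'a
    have "norm x powr p \<le> (\<Sum>b\<in>Basis. \<bar>x \<bullet> b\<bar>) powr p" using p by (intro powr_mono2 norm_le_l1) auto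
    also have "\<dots> \<le> ?N * (\<Sum>b\<in>Basis. \<bar>x \<bullet> b\<bar> powr p)" by (rule powr_sum_le) (use p in auto)
    also have "\<dots> \<le> ?N * (\<Sum>b\<in>Basis. 1 + \<bar>x \<bullet> b\<bar> ^ k)"
    proof (intro mult_left_mono sum_mono)
      fix b :: 'a
      show "\<bar>x \<bullet> b\<bar> powr p \<le> 1 + \<bar>x \<bullet> b\<bar> ^ k"
      proof (cases "\<bar>x \<bullet> b\<bar> \<le> 1")
        case True
        then have "\<bar>x \<bullet> b\<bar> powr p \<le> 1 powr p" using p by (intro powr_mono2) auto
        then show ?thesis by (simp add: add_increasing2)
      next
        case False
        then have "\<bar>x \<bullet> b\<bar> powr p \<le> \<bar>x \<bullet> b\<bar> powr real k" using k by (intro powr_mono) auto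
        then show ?thesis using False by (simp add: powr_realpow)
      qed
    qed simp
    finally have "ennreal (norm x powr p) \<le> ennreal (?N * (\<Sum>b\<in>Basis. 1 + \<bar>x \<bullet> b\<bar> ^ k))" by (rule ennreal_leI)
    also have "\<dots> = ennreal ?N * (\<Sum>b\<in>Basis. 1 + ennreal (\<bar>x \<bullet> b\<bar> ^ k))"
    proof -
      have "ennreal (\<Sum>b\<in>Basis. 1 + \<bar>x \<bullet> b\<bar> ^ k) = (\<Sum>b\<in>Basis. ennreal (1 + \<bar>x \<bullet> b\<bar> ^ k))"
        by (rule sum_ennreal[symmetric]) simp
      also have "\<dots> = (\<Sum>b\<in>Basis. 1 + ennreal (\<bar>x \<bullet> b\<bar> ^ k))"
        by (rule sum.cong) (simp_all add: ennreal_plus)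
      finally show ?thesis by (subst ennreal_mult') simp_all
    qed
    finally show "ennreal (norm x powr p) \<le> ennreal ?N * (\<Sum>b\<in>Basis. 1 + ennreal (\<bar>x \<bullet> b\<bar> ^ k))" .
  qed
  also have "\<dots> = ennreal ?N * (\<Sum>b\<in>(Basis :: 'a set). 1 + (\<integral>\<^sup>+x. ennreal (\<bar>x \<bullet> b\<bar> ^ k) \<partial>(gauss :: 'a measure)))"
  proof -
    have [measurable_cong]: "sets (gauss :: 'a measure) = sets borel" by (simp add: gauss_def)
    show ?thesis
      using prob_space.emeasure_space_1[OF prob_space_gauss[where 'a='a]] by (simp add: nn_integral_cmult nn_integral_sum nn_integral_add)
  qed
  also have "\<dots> < \<infinity>"
  proof -
    have "(\<Sum>b\<in>(Basis :: 'a set). 1 + (\<integral>\<^sup>+x. ennreal (\<bar>x \<bullet> b\<bar> ^ k) \<partial>(gauss :: 'a measure))) < \<top>"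
    proof (rule iffD2[OF ennreal_sum_less_top[OF finite_Basis]], rule ballI)
      fix b :: 'a assume bB: "b \<in> Basis"
      have "1 + y < \<top>" if "y < \<infinity>" for y :: ennreal using that by simp
      then show "1 + (\<integral>\<^sup>+x. ennreal (\<bar>x \<bullet> b\<bar> ^ k) \<partial>(gauss :: 'a measure)) < \<top>" using b[OF bB] .
    qed
    moreover have "ennreal r * y < \<infinity>" if "y < \<top>" for r and y :: ennreal using that by (simp add: ennreal_mult_less_top)
    ultimately show ?thesis by blast
  qed
  finally show "(\<integral>\<^sup>+x. ennreal (norm x powr p) \<partial>(gauss :: 'a measure)) < \<infinity>" .
qed

section \<open>Characteristic functions and inversion for Gaussian smoothings\<close>

definition char_fun :: "'a::euclidean_space measure \<Rightarrow> 'a \<Rightarrow> complex" where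
  "char_fun \<mu> t = (CLINT y|\<mu>. iexp (t \<bullet> y))"

lemma integrable_iexp_inner:
  assumes "prob_space \<mu>" "g \<in> borel_measurable \<mu>"
  shows "integrable \<mu> (\<lambda>y. iexp (g y))"
proof -
  interpret prob_space \<mu> by fact
  show ?thesis using assms(2) by (intro integrable_const_bound[where B=1]) auto
qed

lemma lborel_prod_complex:
  fixes f :: "'a::euclidean_space \<Rightarrow> real \<Rightarrow> complex"
  assumes f: "\<And>b. b \<in> Basis \<Longrightarrow> integrable lborel (f b)"
  shows "(LINT x|lborel. (\<Prod>b\<in>Basis. f b (x \<bullet> b))) = (\<Prod>b\<in>Basis. integral\<^sup>L lborel (f b))"
proof -
  interpret P: product_sigma_finite "\<lambda>_::'a. lborel :: real measure" ..
  have m: "(\<lambda>x. \<Prod>b\<in>Basis. f b (x \<bullet> b)) \<in> borel_measurable borel"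
  proof (rule borel_measurable_prod)
    fix b :: 'a assume "b \<in> Basis"
    then have "f b \<in> borel_measurable borel" using borel_measurable_integrable[OF f] by simp
    then show "(\<lambda>x. f b (x \<bullet> b)) \<in> borel_measurable borel"
      by (rule measurable_compose[rotated]) measurable
  qed
  have "(LINT x|lborel. (\<Prod>b\<in>Basis. f b (x \<bullet> b))) = (LINT x|(\<Pi>\<^sub>M b\<in>Basis. lborel). (\<Prod>b\<in>Basis. f b ((\<Sum>b\<in>Basis. x b *\<^sub>R b) \<bullet> b)))"
    by (subst lborel_eq, rule integral_distr[OF _ m]) measurable
  also have "\<dots> = (LINT x|(\<Pi>\<^sub>M b\<in>Basis. lborel). (\<Prod>b\<in>Basis. f b (x b)))"
    by (intro Bochner_Integration.integral_cong refl prod.cong) simp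
  also have "\<dots> = (\<Prod>b\<in>Basis. integral\<^sup>L lborel (f b))"
    by (rule P.product_integral_prod) (auto intro: f)
  finally show ?thesis .
qed

lemma prod_exp_inner:
  fixes x :: "'a::euclidean_space"
  shows "(\<Prod>b\<in>Basis. exp (- (x \<bullet> b)\<^sup>2 / 2)) = exp (- (norm x)\<^sup>2 / 2)"
proof -
  have "(\<Sum>b\<in>Basis. (x \<bullet> b)\<^sup>2) = (norm x)\<^sup>2"
    unfolding power2_norm_eq_inner by (subst euclidean_inner) (simp add: power2_eq_square)
  then have "(\<Sum>b\<in>Basis. - (x \<bullet> b)\<^sup>2 / 2) = - (norm x)\<^sup>2 / 2"
    by (simp add: sum_negf sum_divide_distrib[symmetric])
  then show ?thesis by (simp only: exp_sum[OF finite_Basis, symmetric])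
qed

text \<open>Density and exponential both factorize over the coordinates, which reduces the claim to
  the standard normal law on the line.\<close>

lemma char_fun_gauss: "char_fun gauss t = complex_of_real (exp (- (norm t)\<^sup>2 / 2))" for t :: "'a::euclidean_space"
proof -
  have iF: "integrable lborel (\<lambda>u. complex_of_real (std_normal_density u) * iexp (r * u))" for r
  proof (rule Bochner_Integration.integrable_bound[of _ "std_normal_density"])
    show "integrable lborel std_normal_density" by (rule integrable_normal_density) simp
  qed (auto simp: norm_mult normal_density_nonneg)
  have e1: "(LINT u|lborel. complex_of_real (std_normal_density u) * iexp (r * u)) = complex_of_real (exp (- r\<^sup>2 / 2))" for r
  proof -
    have "char std_normal_distribution r = (LINT u|lborel. std_normal_density u *\<^sub>R iexp (r * u))"
      unfolding char_def by (rule integral_density) (auto simp: normal_density_nonneg)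
    then show ?thesis by (simp add: char_std_normal_distribution scaleR_conv_of_real)
  qed
  have "char_fun gauss t = (LINT x|lborel. gauss_density x *\<^sub>R iexp (t \<bullet> x))"
    unfolding char_fun_def gauss_def by (rule integral_density) (auto simp: gauss_density_nonneg)
  also have "\<dots> = (LINT x|lborel. (\<Prod>b\<in>Basis. complex_of_real (std_normal_density (x \<bullet> b)) * iexp ((t \<bullet> b) * (x \<bullet> b))))"
  proof (rule Bochner_Integration.integral_cong[OF refl])
    fix x :: 'a
    have "iexp (t \<bullet> x) = (\<Prod>b\<in>Basis. iexp ((t \<bullet> b) * (x \<bullet> b)))"
      by (subst euclidean_inner) (simp add: exp_sum sum_distrib_left)
    then show "gauss_density x *\<^sub>R iexp (t \<bullet> x) = (\<Prod>b\<in>Basis. complex_of_real (std_normal_density (x \<bullet> b)) * iexp ((t \<bullet> b) * (x \<bullet> b)))"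
      by (simp add: gauss_density_def prod.distrib scaleR_conv_of_real)
  qed
  also have "\<dots> = (\<Prod>b\<in>(Basis::'a set). LINT u|lborel. complex_of_real (std_normal_density u) * iexp ((t \<bullet> b) * u))"
    by (rule lborel_prod_complex[of "\<lambda>b u. complex_of_real (std_normal_density u) * iexp ((t \<bullet> b) * u)"]) (rule iF)
  also have "\<dots> = complex_of_real (\<Prod>b\<in>Basis. exp (- (t \<bullet> b)\<^sup>2 / 2))"
    by (simp only: e1) simp
  also have "(\<Prod>b\<in>Basis. exp (- (t \<bullet> b)\<^sup>2 / 2)) = exp (- (norm t)\<^sup>2 / 2)"
    by (rule prod_exp_inner)
  finally show ?thesis .
qed

text \<open>The Gaussian density is its own characteristic function up to normalization. The
  inversion formula for smoothed measures rests on this.\<close>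

lemma gauss_density_char_fun:
  fixes x :: "'a::euclidean_space"
  shows "complex_of_real (gauss_density x) = complex_of_real ((1 / sqrt (2 * pi)) ^ DIM('a)) * char_fun gauss x"
proof -
  have "gauss_density x = (\<Prod>b\<in>Basis. 1 / sqrt (2 * pi) * exp (- (x \<bullet> b)\<^sup>2 / 2))"
    by (simp add: gauss_density_def std_normal_density_def)
  also have "\<dots> = (1 / sqrt (2 * pi)) ^ DIM('a) * (\<Prod>b\<in>Basis. exp (- (x \<bullet> b)\<^sup>2 / 2))"
    by (subst prod.distrib) simp
  also have "(\<Prod>b\<in>Basis. exp (- (x \<bullet> b)\<^sup>2 / 2)) = exp (- (norm x)\<^sup>2 / 2)"
    by (rule prod_exp_inner)
  finally show ?thesis by (simp add: char_fun_gauss)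
qed

text \<open>The density at \<open>x\<close> of \<mu> convolved with the centered Gaussian of
  standard deviation \<open>e\<close> in each coordinate.\<close>

definition gauss_smooth :: "real \<Rightarrow> 'a::euclidean_space measure \<Rightarrow> 'a \<Rightarrow> real" where
  "gauss_smooth e \<mu> x = (LINT y|\<mu>. (1 / e) ^ DIM('a) * gauss_density ((1 / e) *\<^sub>R (x - y)))"

lemma gauss_density_bounded: "gauss_density (x::'a::euclidean_space) \<le> (1 / sqrt (2 * pi)) ^ DIM('a)"
proof -
  have "norm (char_fun gauss x) \<le> 1" by (simp add: char_fun_gauss)
  then have "norm (complex_of_real (gauss_density x)) \<le> (1 / sqrt (2 * pi)) ^ DIM('a) * 1"
    unfolding gauss_density_char_fun norm_mult norm_of_real by (intro mult_mono) auto
  then show ?thesis using gauss_density_nonneg[of x] by simp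
qed

lemma gauss_smooth_integrable:
  assumes \<mu>: "prob_space \<mu>" "sets \<mu> = sets borel" and e: "0 < e"
  shows "integrable \<mu> (\<lambda>y. (1 / e) ^ DIM('a) * gauss_density ((1 / e) *\<^sub>R (x - y :: 'a::euclidean_space)))"
proof -
  interpret prob_space \<mu> by fact
  have [measurable_cong]: "sets \<mu> = sets borel" by fact
  show ?thesis
    by (rule integrable_const_bound[where B="(1 / e) ^ DIM('a) * (1 / sqrt (2 * pi)) ^ DIM('a)"])
      (use e in \<open>auto simp: abs_mult gauss_density_nonneg intro!: mult_left_mono gauss_density_bounded AE_I2\<close>)
qed

lemma gauss_smooth_density:
  fixes \<mu> :: "'a::ordered_euclidean_space measure"
  assumes \<mu>: "prob_space \<mu>" "sets \<mu> = sets borel" and e: "0 < e"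
  shows "gauss_smooth e \<mu> \<in> borel_measurable borel" "0 \<le> gauss_smooth e \<mu> x"
    and "A \<in> sets borel \<Longrightarrow> emeasure (\<mu> \<star> scaled_noise e gauss) A = (\<integral>\<^sup>+x. ennreal (gauss_smooth e \<mu> x) * indicator A x \<partial>lborel)"
proof -
  interpret prob_space \<mu> by fact
  have [measurable_cong]: "sets \<mu> = sets borel" by fact
  show m[measurable]: "gauss_smooth e \<mu> \<in> borel_measurable borel"
    unfolding gauss_smooth_def by measurable
  show nn: "0 \<le> gauss_smooth e \<mu> x" for x
    unfolding gauss_smooth_def using e by (intro integral_nonneg_AE AE_I2) (auto simp: gauss_density_nonneg)
  let ?d = "\<lambda>x y. (1 / e) ^ DIM('a) * gauss_density ((1 / e) *\<^sub>R (x - y :: 'a))"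
  have g: "ennreal (gauss_smooth e \<mu> x) = (\<integral>\<^sup>+y. ennreal (?d x y) \<partial>\<mu>)" for x
    unfolding gauss_smooth_def using e
    by (intro nn_integral_eq_integral[symmetric] gauss_smooth_integrable[OF \<mu> e] AE_I2) (auto simp: gauss_density_nonneg)
  have G: "prob_space (scaled_noise e (gauss :: 'a measure))" "sets (scaled_noise e (gauss :: 'a measure)) = sets borel"
    using prob_finite_momentD[OF scaled_noise_moment(1)[OF gauss_moment[of 1], of e]] e by auto
  assume [measurable]: "A \<in> sets borel"
  have "emeasure (\<mu> \<star> scaled_noise e gauss) A = (\<integral>\<^sup>+y. (\<integral>\<^sup>+z. indicator A (y + z) \<partial>scaled_noise e gauss) \<partial>\<mu>)"
    using \<mu> G by (intro convolution_emeasure') (auto intro: prob_space.finite_measure)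
  also have "\<dots> = (\<integral>\<^sup>+y. (\<integral>\<^sup>+x. ennreal (?d x y) * indicator A x \<partial>lborel) \<partial>\<mu>)"
  proof (rule nn_integral_cong)
    fix y
    have "(\<integral>\<^sup>+x. ennreal (?d x y) * indicator A x \<partial>lborel) =
       (\<integral>\<^sup>+x. ennreal (?d x y) * indicator A x \<partial>density (distr lborel borel (\<lambda>x. y + e *\<^sub>R x)) (\<lambda>_. ennreal (\<bar>e\<bar>^DIM('a))))"
      using lborel_affine[of e y] e by simp
    also have "\<dots> = (\<integral>\<^sup>+z. ennreal (\<bar>e\<bar>^DIM('a)) * (ennreal (?d (y + e *\<^sub>R z) y) * indicator A (y + e *\<^sub>R z)) \<partial>lborel)"
      by (subst nn_integral_density, measurable, subst nn_integral_distr) auto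
    also have "\<dots> = (\<integral>\<^sup>+z. ennreal (gauss_density z) * indicator A (y + e *\<^sub>R z) \<partial>lborel)"
    proof (rule nn_integral_cong)
      fix z
      \<comment> \<open>The Jacobian of the substitution \<open>x = y + e *\<^sub>R z\<close>
        cancels the normalization of the rescaled Gaussian.\<close>
      have "\<bar>e\<bar>^DIM('a) * ?d (y + e *\<^sub>R z) y = gauss_density z"
        using e by (simp add: power_one_over)
      then show "ennreal (\<bar>e\<bar>^DIM('a)) * (ennreal (?d (y + e *\<^sub>R z) y) * indicator A (y + e *\<^sub>R z)) = ennreal (gauss_density z) * indicator A (y + e *\<^sub>R z)"
        by (subst mult.assoc[symmetric], subst ennreal_mult'[symmetric]) auto
    qed
    also have "\<dots> = (\<integral>\<^sup>+z. indicator A (y + z) \<partial>scaled_noise e gauss)"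
      unfolding scaled_noise_def gauss_def by (subst nn_integral_distr, measurable, subst nn_integral_density) auto
    finally show "(\<integral>\<^sup>+z. indicator A (y + z) \<partial>scaled_noise e gauss) = (\<integral>\<^sup>+x. ennreal (?d x y) * indicator A x \<partial>lborel)" by simp
  qed
  also have "\<dots> = (\<integral>\<^sup>+x. (\<integral>\<^sup>+y. ennreal (?d x y) * indicator A x \<partial>\<mu>) \<partial>lborel)"
  proof -
    interpret pair_sigma_finite \<mu> lborel ..
    show ?thesis by (rule Fubini'[symmetric]) measurable
  qed
  also have "\<dots> = (\<integral>\<^sup>+x. ennreal (gauss_smooth e \<mu> x) * indicator A x \<partial>lborel)"
    by (simp add: g nn_integral_multc)
  finally show "emeasure (\<mu> \<star> scaled_noise e gauss) A = (\<integral>\<^sup>+x. ennreal (gauss_smooth e \<mu> x) * indicator A x \<partial>lborel)" .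
qed

text \<open>Writing the Gaussian density as a characteristic function and exchanging the integrals
  leaves the characteristic function of \<mu> integrated against a Gaussian. Its values on a
  Lebesgue null set of frequencies therefore have no influence.\<close>

lemma gauss_smooth_char_fun:
  fixes \<mu> :: "'a::euclidean_space measure"
  assumes \<mu>: "prob_space \<mu>" "sets \<mu> = sets borel" and e: "0 < e"
  shows "complex_of_real (gauss_smooth e \<mu> x) =
    complex_of_real ((1 / e) ^ DIM('a) * (1 / sqrt (2 * pi)) ^ DIM('a)) *
      (CLINT s|gauss. iexp ((1 / e) *\<^sub>R x \<bullet> s) * char_fun \<mu> ((- 1 / e) *\<^sub>R s))"
proof -
  interpret prob_space \<mu> by fact
  interpret g: prob_space "gauss :: 'a measure" by (rule prob_space_gauss)
  have [measurable_cong]: "sets \<mu> = sets borel" "sets (gauss :: 'a measure) = sets borel" using \<mu> by (auto simp: gauss_def)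
  interpret pair_prob_space \<mu> "gauss :: 'a measure" ..
  let ?c = "complex_of_real ((1 / e) ^ DIM('a) * (1 / sqrt (2 * pi)) ^ DIM('a))"
  have "complex_of_real (gauss_smooth e \<mu> x) = (CLINT y|\<mu>. complex_of_real ((1 / e) ^ DIM('a) * gauss_density ((1 / e) *\<^sub>R (x - y))))"
    unfolding gauss_smooth_def by (rule integral_complex_of_real[symmetric])
  also have "\<dots> = (CLINT y|\<mu>. ?c * (CLINT s|gauss. iexp (((1 / e) *\<^sub>R (x - y)) \<bullet> s)))"
    by (simp add: gauss_density_char_fun char_fun_def mult.assoc)
  also have "\<dots> = ?c * (CLINT y|\<mu>. (CLINT s|gauss. iexp (((1 / e) *\<^sub>R (x - y)) \<bullet> s)))"
    by simp
  also have "(CLINT y|\<mu>. (CLINT s|gauss. iexp (((1 / e) *\<^sub>R (x - y)) \<bullet> s))) = (CLINT s|gauss. (CLINT y|\<mu>. iexp (((1 / e) *\<^sub>R (x - y)) \<bullet> s)))"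
    by (rule Fubini_integral[symmetric]) (unfold split_beta', rule integrable_iexp_inner[OF P.prob_space_axioms], measurable)
  also have "\<dots> = (CLINT s|gauss. iexp ((1 / e) *\<^sub>R x \<bullet> s) * char_fun \<mu> ((- 1 / e) *\<^sub>R s))"
  proof (rule Bochner_Integration.integral_cong[OF refl])
    fix s :: 'a
    have "iexp (((1 / e) *\<^sub>R (x - y)) \<bullet> s) = iexp ((1 / e) *\<^sub>R x \<bullet> s) * iexp (((- 1 / e) *\<^sub>R s) \<bullet> y)" for y
      by (simp add: exp_add[symmetric] algebra_simps inner_diff_left inner_commute diff_divide_distrib)
    then show "(CLINT y|\<mu>. iexp (((1 / e) *\<^sub>R (x - y)) \<bullet> s)) = iexp ((1 / e) *\<^sub>R x \<bullet> s) * char_fun \<mu> ((- 1 / e) *\<^sub>R s)"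
      by (simp add: char_fun_def)
  qed
  finally show ?thesis .
qed

lemma AE_lborel_scaleR:
  fixes P :: "'a::euclidean_space \<Rightarrow> bool"
  assumes P: "AE x in lborel. P x" and c: "c \<noteq> (0::real)"
  shows "AE x in lborel. P (c *\<^sub>R x)"
proof -
  obtain N where N: "{x. \<not> P x} \<subseteq> N" "N \<in> sets borel" "emeasure lborel N = 0"
    using P by (auto elim!: AE_E)
  have [measurable]: "N \<in> sets borel" by fact
  have s: "(\<lambda>x. c *\<^sub>R x) -` N \<in> sets (borel :: 'a measure)" using measurable_sets[of "\<lambda>x. c *\<^sub>R x" borel borel N] by simp
  have "0 = emeasure (density (distr lborel borel (\<lambda>x. 0 + c *\<^sub>R x)) (\<lambda>_. ennreal (\<bar>c\<bar>^DIM('a)))) N"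
    using lborel_affine[OF c, of "0::'a"] N(3) by simp
  also have "\<dots> = ennreal (\<bar>c\<bar>^DIM('a)) * emeasure lborel ((\<lambda>x. c *\<^sub>R x) -` N)"
    by (subst emeasure_density) (auto simp: nn_integral_cmult emeasure_distr)
  finally have "emeasure lborel ((\<lambda>x. c *\<^sub>R x) -` N) = 0" using c by (simp add: ennreal_zero_less_mult_iff)
  then have "(\<lambda>x. c *\<^sub>R x) -` N \<in> null_sets lborel" using s by (intro null_setsI) auto
  then show ?thesis by (rule AE_I') (use N(1) in auto)
qed

lemma char_fun_le_1: assumes "prob_space \<mu>" shows "norm (char_fun \<mu> t) \<le> 1"
proof -
  interpret prob_space \<mu> by fact
  have "norm (char_fun \<mu> t) \<le> (LINT y|\<mu>. norm (iexp (t \<bullet> y)))" unfolding char_fun_def by (rule integral_norm_bound)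
  then show ?thesis by (simp add: prob_space)
qed

lemma char_fun_measurable:
  assumes "prob_space \<mu>" "sets \<mu> = sets borel" shows "char_fun \<mu> \<in> borel_measurable borel"
proof -
  interpret prob_space \<mu> by fact
  have [measurable_cong]: "sets \<mu> = sets borel" by fact
  show ?thesis unfolding char_fun_def[abs_def] by measurable
qed

text \<open>Inversion and dominated convergence make the smoothed densities converge at every point.
  All of them integrate to 1, so Scheffe's lemma yields convergence in mean, which bounds the total
  variation.\<close>

lemma gauss_smooth_tv_tendsto:
  fixes \<mu>s :: "nat \<Rightarrow> 'a::ordered_euclidean_space measure"
  assumes \<mu>s: "\<And>n. prob_space (\<mu>s n)" "\<And>n. sets (\<mu>s n) = sets borel" and \<mu>: "prob_space \<mu>" "sets \<mu> = sets borel" and e: "0 < e"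
    and lim: "AE s in lborel. (\<lambda>n. char_fun (\<mu>s n) s) \<longlonglongrightarrow> char_fun \<mu> s"
  shows "\<exists>\<delta>. \<delta> \<longlonglongrightarrow> 0 \<and> (\<forall>n. tv_le (\<mu>s n \<star> scaled_noise e gauss) (\<mu> \<star> scaled_noise e gauss) (\<delta> n))"
proof -
  interpret g: prob_space "gauss :: 'a measure" by (rule prob_space_gauss)
  have sg[measurable_cong]: "sets (gauss :: 'a measure) = sets borel" by (simp add: gauss_def)
  have [measurable]: "char_fun (\<mu>s n) \<in> borel_measurable borel" "char_fun \<mu> \<in> borel_measurable borel" for n
    using char_fun_measurable \<mu>s \<mu> by auto
  have ac: "AE s in gauss. P s" if "AE s in lborel. P s" for P :: "'a \<Rightarrow> bool"
    unfolding gauss_def using that by (subst AE_density) auto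
  have lim': "AE s in gauss. (\<lambda>n. char_fun (\<mu>s n) ((- 1 / e) *\<^sub>R s)) \<longlonglongrightarrow> char_fun \<mu> ((- 1 / e) *\<^sub>R s)"
    using e by (intro ac AE_lborel_scaleR[OF lim]) auto
  have pw: "(\<lambda>n. gauss_smooth e (\<mu>s n) x) \<longlonglongrightarrow> gauss_smooth e \<mu> x" for x
  proof -
    have "(\<lambda>n. CLINT s|gauss. iexp ((1 / e) *\<^sub>R x \<bullet> s) * char_fun (\<mu>s n) ((- 1 / e) *\<^sub>R s)) \<longlonglongrightarrow> (CLINT s|gauss. iexp ((1 / e) *\<^sub>R x \<bullet> s) * char_fun \<mu> ((- 1 / e) *\<^sub>R s))"
    proof (rule integral_dominated_convergence[where w="\<lambda>_. 1"])
      show "AE s in gauss. (\<lambda>n. iexp ((1 / e) *\<^sub>R x \<bullet> s) * char_fun (\<mu>s n) ((- 1 / e) *\<^sub>R s)) \<longlonglongrightarrow> iexp ((1 / e) *\<^sub>R x \<bullet> s) * char_fun \<mu> ((- 1 / e) *\<^sub>R s)"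
        using lim' by eventually_elim (rule tendsto_mult_left)
      show "AE s in gauss. norm (iexp ((1 / e) *\<^sub>R x \<bullet> s) * char_fun (\<mu>s n) ((- 1 / e) *\<^sub>R s)) \<le> 1" for n
        by (simp add: norm_mult char_fun_le_1 \<mu>s)
    qed auto
    then have "(\<lambda>n. complex_of_real (gauss_smooth e (\<mu>s n) x)) \<longlonglongrightarrow> complex_of_real (gauss_smooth e \<mu> x)"
      unfolding gauss_smooth_char_fun[OF \<mu>s e] gauss_smooth_char_fun[OF \<mu> e] by (rule tendsto_mult_left)
    then show ?thesis by (simp only: tendsto_of_real_iff)
  qed
  note d = gauss_smooth_density[OF \<mu>s e] and d0 = gauss_smooth_density[OF \<mu> e]
  have [measurable]: "gauss_smooth e (\<mu>s n) \<in> borel_measurable borel" "gauss_smooth e \<mu> \<in> borel_measurable borel" for n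
    by (rule d d0)+
  have G: "prob_space (scaled_noise e (gauss :: 'a measure))" "sets (scaled_noise e (gauss :: 'a measure)) = sets borel"
    using prob_finite_momentD[OF scaled_noise_moment(1)[OF gauss_moment[of 1], of e]] e by auto
  have one: "emeasure (\<nu> \<star> scaled_noise e gauss) UNIV = 1" if \<nu>: "prob_space \<nu>" "sets \<nu> = sets borel" for \<nu> :: "'a measure"
  proof -
    have "prob_space (\<nu> \<star> scaled_noise e gauss)"
      unfolding convolution_def using distr_pair_prob(4)[OF \<nu> G]
      by (intro prob_space.prob_space_distr[OF distr_pair_prob(3)[OF \<nu> G]]) (simp cong: measurable_cong_sets)
    then show ?thesis using prob_space.emeasure_space_1 by fastforce
  qed
  have I1: "(\<integral>\<^sup>+x. ennreal (gauss_smooth e (\<mu>s n) x) \<partial>lborel) = 1" for n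
    using d(3)[of UNIV n] one[OF \<mu>s] by simp
  have I0: "(\<integral>\<^sup>+x. ennreal (gauss_smooth e \<mu> x) \<partial>lborel) = 1"
    using d0(3)[of UNIV] one[OF \<mu>] by simp
  define \<delta> where "\<delta> n = (\<integral>\<^sup>+x. ennreal (norm (gauss_smooth e (\<mu>s n) x - gauss_smooth e \<mu> x)) \<partial>lborel)" for n
  have "\<delta> \<longlonglongrightarrow> 0"
    unfolding \<delta>_def
  proof (rule Scheffe_lemma2)
    show "integrable lborel (gauss_smooth e \<mu>)"
      using I0 d0(2) by (subst integrable_iff_bounded) auto
    show "AE x in lborel. (\<lambda>n. gauss_smooth e (\<mu>s n) x) \<longlonglongrightarrow> gauss_smooth e \<mu> x" using pw by simp
    show "(\<integral>\<^sup>+x. ennreal (norm (gauss_smooth e (\<mu>s n) x)) \<partial>lborel) \<le> (\<integral>\<^sup>+x. ennreal (norm (gauss_smooth e \<mu> x)) \<partial>lborel)" for n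
      using I1[of n] I0 d(2) d0(2) by simp
  qed measurable
  moreover have "tv_le (\<mu>s n \<star> scaled_noise e gauss) (\<mu> \<star> scaled_noise e gauss) (\<delta> n)" for n
    unfolding tv_le_def
  proof (intro ballI conjI)
    fix A :: "'a set" assume A[measurable]: "A \<in> sets borel"
    have le: "(\<integral>\<^sup>+x. ennreal (u x) * indicator A x \<partial>lborel) \<le> (\<integral>\<^sup>+x. ennreal (v x) * indicator A x \<partial>lborel) + (\<integral>\<^sup>+x. ennreal (norm (u x - v x)) \<partial>lborel)"
      if [measurable]: "u \<in> borel_measurable borel" "v \<in> borel_measurable borel" and v: "\<And>x. 0 \<le> v x" for u v :: "'a \<Rightarrow> real"
    proof -
      have "(\<integral>\<^sup>+x. ennreal (u x) * indicator A x \<partial>lborel) \<le> (\<integral>\<^sup>+x. ennreal (v x) * indicator A x + ennreal (norm (u x - v x)) \<partial>lborel)"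
      proof (rule nn_integral_mono)
        fix x
        have "ennreal (u x) \<le> ennreal (v x + norm (u x - v x))" by (rule ennreal_leI) (simp add: abs_if)
        then show "ennreal (u x) * indicator A x \<le> ennreal (v x) * indicator A x + ennreal (norm (u x - v x))"
          using v by (simp split: split_indicator)
      qed
      then show ?thesis by (subst (asm) nn_integral_add) auto
    qed
    show "emeasure (\<mu>s n \<star> scaled_noise e gauss) A \<le> emeasure (\<mu> \<star> scaled_noise e gauss) A + \<delta> n"
      unfolding d(3)[OF A] d0(3)[OF A] \<delta>_def by (rule le) (auto intro: d0)
    show "emeasure (\<mu> \<star> scaled_noise e gauss) A \<le> emeasure (\<mu>s n \<star> scaled_noise e gauss) A + \<delta> n"
      unfolding d(3)[OF A] d0(3)[OF A] \<delta>_def by (subst norm_minus_commute) (rule le, auto intro: d)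
  qed
  ultimately show ?thesis by blast
qed

section \<open>Deconvolution and the metric\<close>

lemma char_fun_convolution:
  fixes \<mu> \<zeta> :: "'a::ordered_euclidean_space measure"
  assumes \<mu>: "prob_space \<mu>" "sets \<mu> = sets borel" and \<zeta>: "prob_space \<zeta>" "sets \<zeta> = sets borel"
  shows "char_fun (\<mu> \<star> \<zeta>) t = char_fun \<mu> t * char_fun \<zeta> t"
proof -
  have [measurable_cong]: "sets \<mu> = sets borel" "sets \<zeta> = sets borel" by fact+
  interpret \<mu>: prob_space \<mu> by fact
  interpret \<zeta>: prob_space \<zeta> by fact
  interpret Q: pair_prob_space \<mu> \<zeta> ..
  have "char_fun (\<mu> \<star> \<zeta>) t = (CLINT q|\<mu> \<Otimes>\<^sub>M \<zeta>. iexp (t \<bullet> (fst q + snd q)))"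
    unfolding char_fun_def convolution_def by (subst integral_distr) (auto simp: split_beta')
  also have "\<dots> = (CLINT x|\<mu>. (CLINT y|\<zeta>. iexp (t \<bullet> (fst (x, y) + snd (x, y)))))"
    by (rule Q.integral_fst'[symmetric]) (rule integrable_iexp_inner[OF Q.P.prob_space_axioms], measurable)
  also have "\<dots> = (CLINT x|\<mu>. (CLINT y|\<zeta>. iexp (t \<bullet> x) * iexp (t \<bullet> y)))"
    by (simp add: inner_add_right exp_add distrib_left)
  finally show ?thesis by (simp add: char_fun_def)
qed

lemma ennreal_tendsto_0_le:
  fixes f g :: "nat \<Rightarrow> ennreal"
  assumes "g \<longlonglongrightarrow> 0" "\<And>n. f n \<le> g n"
  shows "f \<longlonglongrightarrow> 0"
  by (rule tendsto_sandwich[OF _ _ tendsto_const assms(1)]) (auto simp: assms(2))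

text \<open>The function \<open>iexp\<close> is 1-Lipschitz, so the two characteristic functions
  differ at \<open>t\<close> by at most \<open>norm t\<close> times the mean distance under the
  coupling.\<close>

lemma char_fun_tendsto:
  fixes \<pi> :: "nat \<Rightarrow> ('a::euclidean_space \<times> 'a) measure"
  assumes \<pi>: "\<And>n. \<pi> n \<in> couplings (\<mu>s n) \<mu>"
    and lim: "(\<lambda>n. \<integral>\<^sup>+q. ennreal (norm (fst q - snd q)) \<partial>\<pi> n) \<longlonglongrightarrow> 0"
  shows "(\<lambda>n. char_fun (\<mu>s n) t) \<longlonglongrightarrow> char_fun \<mu> t"
proof -
  have [measurable_cong]: "sets (\<pi> n) = sets (borel \<Otimes>\<^sub>M borel)" for n by (rule couplingsD[OF \<pi>])
  have ps: "prob_space (\<pi> n)" for n by (rule couplingsD[OF \<pi>])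
  have e: "char_fun (\<mu>s n) t = (CLINT q|\<pi> n. iexp (t \<bullet> fst q))" "char_fun \<mu> t = (CLINT q|\<pi> n. iexp (t \<bullet> snd q))" for n
    unfolding char_fun_def couplingsD(3)[OF \<pi>, of n, symmetric] couplingsD(4)[OF \<pi>, of n, symmetric]
    by (subst integral_distr; simp)+
  have ib: "cmod (iexp a - iexp b) \<le> \<bar>a - b\<bar>" for a b :: real
  proof -
    have "iexp a - iexp b = iexp b * (iexp (a - b) - 1)"
      by (simp add: algebra_simps exp_add[symmetric])
    then have "cmod (iexp a - iexp b) = cmod (iexp (a - b) - 1)" by (simp add: norm_mult)
    also have "\<dots> \<le> \<bar>a - b\<bar>" using iexp_approx1[of "a - b" 0] by simp
    finally show ?thesis .
  qed
  have le: "ennreal (cmod (char_fun (\<mu>s n) t - char_fun \<mu> t)) \<le> ennreal (norm t) * (\<integral>\<^sup>+q. ennreal (norm (fst q - snd q)) \<partial>\<pi> n)" for n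
  proof -
    have i: "integrable (\<pi> n) (\<lambda>q. iexp (t \<bullet> fst q))" "integrable (\<pi> n) (\<lambda>q. iexp (t \<bullet> snd q))"
      by (rule integrable_iexp_inner[OF ps], measurable)+
    have "char_fun (\<mu>s n) t - char_fun \<mu> t = (CLINT q|\<pi> n. iexp (t \<bullet> fst q) - iexp (t \<bullet> snd q))"
      unfolding e(1) e(2)[of n] using i by (rule Bochner_Integration.integral_diff[symmetric])
    then have "ennreal (cmod (char_fun (\<mu>s n) t - char_fun \<mu> t)) \<le> (\<integral>\<^sup>+q. ennreal (cmod (iexp (t \<bullet> fst q) - iexp (t \<bullet> snd q))) \<partial>\<pi> n)"
      using integral_norm_bound_ennreal[OF Bochner_Integration.integrable_diff[OF i]] by simp
    also have "\<dots> \<le> (\<integral>\<^sup>+q. ennreal (norm t) * ennreal (norm (fst q - snd q)) \<partial>\<pi> n)"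
    proof (rule nn_integral_mono)
      fix q :: "'a \<times> 'a"
      have "cmod (iexp (t \<bullet> fst q) - iexp (t \<bullet> snd q)) \<le> \<bar>t \<bullet> (fst q - snd q)\<bar>"
        using ib[of "t \<bullet> fst q" "t \<bullet> snd q"] by (simp only: inner_diff_right)
      also have "\<dots> \<le> norm t * norm (fst q - snd q)" by (rule Cauchy_Schwarz_ineq2)
      finally show "ennreal (cmod (iexp (t \<bullet> fst q) - iexp (t \<bullet> snd q))) \<le> ennreal (norm t) * ennreal (norm (fst q - snd q))"
        unfolding ennreal_mult[symmetric, OF norm_ge_zero norm_ge_zero] by (rule ennreal_leI)
    qed
    finally show ?thesis by (simp add: nn_integral_cmult)
  qed
  have "(\<lambda>n. ennreal (norm t) * (\<integral>\<^sup>+q. ennreal (norm (fst q - snd q)) \<partial>\<pi> n)) \<longlonglongrightarrow> ennreal (norm t) * 0"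
    by (intro ennreal_tendsto_cmult lim) simp
  then have "(\<lambda>n. ennreal (cmod (char_fun (\<mu>s n) t - char_fun \<mu> t))) \<longlonglongrightarrow> 0"
    by (intro ennreal_tendsto_0_le[OF _ le]) simp
  then have "(\<lambda>n. cmod (char_fun (\<mu>s n) t - char_fun \<mu> t)) \<longlonglongrightarrow> 0"
    by (subst (asm) tendsto_ennreal_iff[where x=0, simplified]) auto
  then show ?thesis using LIM_zero_iff tendsto_norm_zero_iff by blast
qed

text \<open>The Fourier transform pairs \<open>s\<close> with
  \<open>exp (- 2 * pi * i * (s \<bullet> x))\<close>, the characteristic function pairs
  \<open>t\<close> with \<open>exp (i * (t \<bullet> x))\<close>, and the noise is scaled by
  \<sigma>. Matching the exponents gives the frequency on the right.\<close>

lemma char_fun_scaled_noise: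
  fixes f :: "'a::euclidean_space \<Rightarrow> real"
  assumes f0: "\<And>x. 0 \<le> f x" and f[measurable]: "f \<in> borel_measurable borel" and \<xi>: "\<xi> = density lborel (\<lambda>x. ennreal (f x))"
  shows "char_fun (scaled_noise \<sigma> \<xi>) t = fourier_transform f ((- \<sigma> / (2 * pi)) *\<^sub>R t)"
proof -
  have "char_fun (scaled_noise \<sigma> \<xi>) t = (CLINT z|\<xi>. iexp (t \<bullet> (\<sigma> *\<^sub>R z)))"
    unfolding char_fun_def scaled_noise_def \<xi> by (subst integral_distr) auto
  also have "\<dots> = (CLINT z|lborel. f z *\<^sub>R iexp (t \<bullet> (\<sigma> *\<^sub>R z)))"
    unfolding \<xi> by (rule integral_density) (auto simp: f0)
  also have "\<dots> = fourier_transform f ((- \<sigma> / (2 * pi)) *\<^sub>R t)"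
    unfolding fourier_transform_def
  proof (rule Bochner_Integration.integral_cong[OF refl])
    fix x
    have "- 2 * of_real pi * \<i> * of_real ((- \<sigma> / (2 * pi)) *\<^sub>R t \<bullet> x) = \<i> * of_real (t \<bullet> (\<sigma> *\<^sub>R x))"
      by simp
    then show "f x *\<^sub>R iexp (t \<bullet> (\<sigma> *\<^sub>R x)) = exp (- 2 * of_real pi * \<i> * of_real ((- \<sigma> / (2 * pi)) *\<^sub>R t \<bullet> x)) * of_real (f x)"
      by (simp only: scaleR_conv_of_real mult.commute)
  qed
  finally show ?thesis .
qed

text \<open>If a set is open for one metric but not for the other, some point of it is approached in
  the second metric by points \<open>y n\<close> outside the set. They then converge in the first
  metric too, and must eventually enter the set.\<close>

lemma mtopology_eqI:
  assumes d1: "Metric_space M d1" and d2: "Metric_space M d2"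
    and eq: "\<And>xs x. (\<And>n::nat. xs n \<in> M) \<Longrightarrow> x \<in> M \<Longrightarrow> (\<lambda>n. d1 (xs n) x) \<longlonglongrightarrow> 0 \<longleftrightarrow> (\<lambda>n. d2 (xs n) x) \<longlonglongrightarrow> 0"
  shows "Metric_space.mtopology M d1 = Metric_space.mtopology M d2"
proof -
  have open_imp: "Metric_space.mopen M d' U"
    if m: "Metric_space M d" "Metric_space M d'" and U: "Metric_space.mopen M d U"
      and imp: "\<And>xs x. (\<And>n::nat. xs n \<in> M) \<Longrightarrow> x \<in> M \<Longrightarrow> (\<lambda>n. d' (xs n) x) \<longlonglongrightarrow> 0 \<Longrightarrow> (\<lambda>n. d (xs n) x) \<longlonglongrightarrow> 0" for d d' U
  proof -
    interpret A: Metric_space M d by fact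
    interpret B: Metric_space M d' by fact
    have UM: "U \<subseteq> M" using U by (simp add: A.mopen_def)
    have "\<exists>r>0. B.mball x r \<subseteq> U" if x: "x \<in> U" for x
    proof (rule ccontr)
      assume "\<not> ?thesis"
      then have "\<exists>y. y \<in> B.mball x (1 / Suc n) \<and> y \<notin> U" for n :: nat by (auto dest!: spec[of _ "1 / Suc n"])
      then have "\<exists>y. \<forall>n::nat. y n \<in> B.mball x (1 / Suc n) \<and> y n \<notin> U" by (intro choice allI)
      then obtain y where y: "\<And>n::nat. y n \<in> B.mball x (1 / Suc n)" "\<And>n. y n \<notin> U" by blast
      have lim: "(\<lambda>n. d' (y n) x) \<longlonglongrightarrow> 0"
      proof (rule tendsto_sandwich[OF _ _ tendsto_const LIMSEQ_Suc[OF lim_1_over_n]])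
        show "\<forall>\<^sub>F n in sequentially. d' (y n) x \<le> 1 / real (Suc n)"
          using y(1) by (intro always_eventually allI) (auto simp: B.commute less_imp_le)
      qed simp
      have "(\<lambda>n. d (y n) x) \<longlonglongrightarrow> 0" using y(1) UM x by (intro imp lim) auto
      moreover obtain r where r: "0 < r" "A.mball x r \<subseteq> U" using U x by (auto simp: A.mopen_def)
      ultimately have "\<forall>\<^sub>F n in sequentially. d (y n) x < r" by (intro order_tendstoD(2)) auto
      then obtain n where "d (y n) x < r" by (auto simp: eventually_sequentially)
      then have "y n \<in> A.mball x r" using y(1)[of n] UM x by (auto simp: A.commute)
      then show False using r y(2) by blast
    qed
    with UM show ?thesis by (auto simp: B.mopen_def)
  qed
  have "Metric_space.mopen M d1 = Metric_space.mopen M d2"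
    using open_imp[OF d1 d2] open_imp[OF d2 d1] eq by blast
  then show ?thesis unfolding Metric_space.mtopology_def[OF d1] Metric_space.mtopology_def[OF d2] by simp
qed

section \<open>The two distances as instances of \<open>transport\<close>, and their
  convergence\<close>

lemma transport_wasserstein: "1 \<le> p \<Longrightarrow> transport p {} {()} (\<lambda>_. norm :: 'a::euclidean_space \<Rightarrow> real)"
  by unfold_locales (auto simp: norm_triangle_ineq)

lemma D_wasserstein:
  assumes "1 \<le> p" shows "transport.D p {} {()} (\<lambda>_. norm) = wasserstein p"
proof -
  interpret transport p "{}" "{()}" "\<lambda>_. norm :: 'a \<Rightarrow> real" by (rule transport_wasserstein[OF assms])
  show ?thesis by (simp add: fun_eq_iff D_def wasserstein_def total_def cost_def bc_couplings_def split_beta')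
qed

lemma transport_adapted:
  "1 \<le> p \<Longrightarrow> transport p (histories :: (real^'d^'t::{finite,linorder}) measure set) UNIV (\<lambda>t x. norm (x $ t))"
proof unfold_locales
  show "norm x \<le> (\<Sum>t\<in>UNIV. norm (x $ t))" for x :: "real^'d^'t::{finite,linorder}"
    unfolding norm_vec_def by (rule L2_set_le_sum) simp
  show "(\<lambda>x::real^'d^'t::{finite,linorder}. norm (x $ i)) \<in> borel_measurable borel" for i
    by (intro borel_measurable_continuous_onI continuous_intros)
  show "norm (x $ i) \<le> norm x" for x :: "real^'d^'t::{finite,linorder}" and i by (rule Finite_Cartesian_Product.norm_nth_le)
qed (auto simp: histories_def subalgebra_history norm_triangle_ineq)

lemma D_adapted:
  assumes "1 \<le> p"
  shows "transport.D p (histories :: (real^'d^'t::{finite,linorder}) measure set) UNIV (\<lambda>t x. norm (x $ t)) = adapted_wasserstein p"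
proof -
  interpret transport p "histories :: (real^'d^'t::{finite,linorder}) measure set" UNIV "\<lambda>t x. norm (x $ t)"
    by (rule transport_adapted[OF assms])
  show ?thesis
    by (simp add: fun_eq_iff D_def adapted_wasserstein_def total_def cost_def bicausal_couplings_eq split_beta')
qed

lemma wasserstein_tendsto_iff:
  fixes \<mu> :: "'a::euclidean_space measure"
  assumes p: "1 \<le> p" and \<mu>s: "\<And>n::nat. \<mu>s n \<in> prob_finite_moment p" and \<mu>: "\<mu> \<in> prob_finite_moment p"
  shows "(\<lambda>n. wasserstein p (\<mu>s n) \<mu>) \<longlonglongrightarrow> 0 \<longleftrightarrow>
    (\<exists>\<pi>. (\<forall>n. \<pi> n \<in> couplings (\<mu>s n) \<mu>) \<and> (\<lambda>n. \<integral>\<^sup>+q. ennreal (norm (fst q - snd q) powr p) \<partial>\<pi> n) \<longlonglongrightarrow> 0)"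
proof -
  interpret transport p "{}" "{()}" "\<lambda>_. norm :: 'a \<Rightarrow> real" by (rule transport_wasserstein[OF p])
  show ?thesis
    using D_tendsto_0_iff[where \<mu>s=\<mu>s, OF \<mu>s \<mu>] by (simp add: D_wasserstein[OF p] total_def[abs_def] cost_def bc_couplings_def)
qed

text \<open>A bicausal coupling is in particular a coupling, and the sum over the times dominates
  the p-th power of the full norm up to a constant.\<close>

lemma adapted_imp_wasserstein_tendsto:
  fixes \<mu> :: "(real^'d^'t::{finite,linorder}) measure"
  assumes p: "1 \<le> p" and \<mu>s: "\<And>n::nat. \<mu>s n \<in> prob_finite_moment p" and \<mu>: "\<mu> \<in> prob_finite_moment p"
    and lim: "(\<lambda>n. adapted_wasserstein p (\<mu>s n) \<mu>) \<longlonglongrightarrow> 0"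
  shows "(\<lambda>n. wasserstein p (\<mu>s n) \<mu>) \<longlonglongrightarrow> 0"
proof -
  interpret transport p "histories :: (real^'d^'t::{finite,linorder}) measure set" UNIV "\<lambda>t x. norm (x $ t)"
    by (rule transport_adapted[OF p])
  obtain \<pi> where \<pi>: "\<And>n. \<pi> n \<in> bc_couplings histories (\<mu>s n) \<mu>" and tot: "(\<lambda>n. total (\<pi> n)) \<longlonglongrightarrow> 0"
    using lim D_tendsto_0_iff[where \<mu>s=\<mu>s, OF \<mu>s \<mu>] unfolding D_adapted[OF p] by blast
  have c: "\<pi> n \<in> couplings (\<mu>s n) \<mu>" for n by (rule bcD[OF \<pi>])
  have [measurable_cong]: "sets (\<pi> n) = sets (borel \<Otimes>\<^sub>M borel)" for n by (rule couplingsD[OF c])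
  define K where "K = real CARD('t) powr p"
  have K: "0 \<le> K" by (simp add: K_def)
  have le: "(\<integral>\<^sup>+q. ennreal (norm (fst q - snd q) powr p) \<partial>\<pi> n) \<le> ennreal K * total (\<pi> n)" for n
  proof -
    have "(\<integral>\<^sup>+q. ennreal (norm (fst q - snd q) powr p) \<partial>\<pi> n) \<le> (\<integral>\<^sup>+q. ennreal K * ennreal (cost (fst q) (snd q)) \<partial>\<pi> n)"
    proof (rule nn_integral_mono)
      fix q :: "(real^'d^'t::{finite,linorder}) \<times> (real^'d^'t::{finite,linorder})"
      show "ennreal (norm (fst q - snd q) powr p) \<le> ennreal K * ennreal (cost (fst q) (snd q))"
        unfolding ennreal_mult[symmetric, OF K cost_nonneg] unfolding K_def by (rule ennreal_leI[OF norm_le_cost])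
    qed
    then show ?thesis by (simp add: total_def nn_integral_cmult)
  qed
  have "(\<lambda>n. ennreal K * total (\<pi> n)) \<longlonglongrightarrow> ennreal K * 0" by (intro ennreal_tendsto_cmult tot) simp
  then have "(\<lambda>n. \<integral>\<^sup>+q. ennreal (norm (fst q - snd q) powr p) \<partial>\<pi> n) \<longlonglongrightarrow> 0"
    by (intro ennreal_tendsto_0_le[OF _ le]) simp
  then show ?thesis using c unfolding wasserstein_tendsto_iff[OF p \<mu>s \<mu>] by blast
qed

text \<open>The pasts of the first \<open>i\<close> time points lead from the trivial sigma-algebra
  to the Borel sets in \<open>CARD('t)\<close> steps, and every history of the definition of
  \<open>bicausal\<close> is among them.\<close>

lemma adapted_tendsto_if_tv:
  fixes \<mu> :: "(real^'d^'t::{finite,linorder}) measure"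
  assumes p: "1 \<le> p" and \<mu>s: "\<And>n::nat. \<mu>s n \<in> prob_finite_moment p" and \<mu>: "\<mu> \<in> prob_finite_moment p"
    and tv: "\<And>n. tv_le (\<mu>s n) \<mu> (\<delta> n)" and \<delta>: "\<delta> \<longlonglongrightarrow> 0" and ut: "uniform_tails p \<mu>s"
  shows "(\<lambda>n. adapted_wasserstein p (\<mu>s n) \<mu>) \<longlonglongrightarrow> 0"
proof -
  interpret transport p "histories :: (real^'d^'t::{finite,linorder}) measure set" UNIV "\<lambda>t x. norm (x $ t)"
    by (rule transport_adapted[OF p])
  have "(\<lambda>n. D (\<mu>s n) \<mu>) \<longlonglongrightarrow> 0"
  proof (rule D_tendsto_0_if_tv[OF \<mu>s \<mu> tv \<delta> ut, where H="\<lambda>i. history (past i)" and m="CARD('t)"])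
    show "subalgebra borel (history (past i :: 't set) :: (real^'d^'t::{finite,linorder}) measure)" for i by (rule subalgebra_history)
    show "subalgebra (history (past j :: 't set) :: (real^'d^'t::{finite,linorder}) measure) (history (past i))" if "i \<le> j" for i j
      by (rule history_mono[OF past_mono[OF that]])
    show "sets (history (past 0 :: 't set) :: (real^'d^'t::{finite,linorder}) measure) = {{}, UNIV}" by (simp add: past_0 history_empty)
    show "sets (history (past CARD('t) :: 't set) :: (real^'d^'t::{finite,linorder}) measure) = sets borel" by (simp add: past_card history_UNIV)
    show "histories \<subseteq> range (\<lambda>i. history (past i :: 't set) :: (real^'d^'t::{finite,linorder}) measure)" by (rule histories_subset)
  qed
  then show ?thesis by (simp add: D_adapted[OF p])
qed

text \<open>Adding the scaled noise to a point couples \<mu> with its smoothing at a cost that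
  depends on the noise alone. This is why one \<open>e\<close> works for all \<mu>.\<close>

lemma convolution_scaled_wasserstein_less:
  fixes \<zeta> :: "'a::ordered_euclidean_space measure"
  assumes p: "1 \<le> p" and \<zeta>: "\<zeta> \<in> prob_finite_moment p" and r: "0 < r"
  shows "\<exists>e>0. \<forall>\<mu>\<in>prob_finite_moment p. wasserstein p \<mu> (\<mu> \<star> scaled_noise e \<zeta>) < r"
proof -
  interpret transport p "{}" "{()}" "\<lambda>_. norm :: 'a \<Rightarrow> real" by (rule transport_wasserstein[OF p])
  obtain m where m: "(\<integral>\<^sup>+z. ennreal (norm z powr p) \<partial>\<zeta>) = ennreal m" "0 \<le> m"
    using prob_finite_momentD(3)[OF \<zeta>] by (cases "\<integral>\<^sup>+z. ennreal (norm z powr p) \<partial>\<zeta>") auto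
  \<comment> \<open>Chosen so that \<open>e powr p * m = r powr p * (m / (m + 1))\<close>, which is
    strictly below \<open>r powr p\<close> also when \<open>m = 0\<close>.\<close>
  define e where "e = r / (m + 1) powr (1 / p)"
  have e: "0 < e" using r m by (simp add: e_def)
  have "e powr p * m = r powr p * (m / (m + 1))"
    using r m p by (simp add: e_def powr_divide powr_powr)
  also have "\<dots> < r powr p * 1" using r m by (intro mult_strict_left_mono) auto
  finally have em: "e powr p * m < r powr p" by simp
  show ?thesis
  proof (intro exI[of _ e] conjI ballI e)
    fix \<mu> :: "'a measure" assume \<mu>: "\<mu> \<in> prob_finite_moment p"
    let ?\<gamma> = "scaled_noise e \<zeta>"
    have \<gamma>: "?\<gamma> \<in> prob_finite_moment p" using e by (intro scaled_noise_moment \<zeta>) simp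
    note d = distr_pair_prob[OF prob_finite_momentD(1,2)[OF \<mu>] prob_finite_momentD(1,2)[OF \<gamma>]]
    have [measurable_cong]: "sets (\<mu> \<Otimes>\<^sub>M ?\<gamma>) = sets (borel \<Otimes>\<^sub>M borel)" by (rule d)
    let ?\<pi> = "distr (\<mu> \<Otimes>\<^sub>M ?\<gamma>) (borel \<Otimes>\<^sub>M borel) (\<lambda>q. (fst q, fst q + snd q))"
    have [measurable_cong]: "sets ?\<gamma> = sets borel" by (rule prob_finite_momentD[OF \<gamma>])
    have "?\<pi> \<in> couplings \<mu> (\<mu> \<star> ?\<gamma>)"
      by (rule couplings_distrI) (use d in \<open>auto simp: convolution_def split_beta'\<close>)
    moreover have "total ?\<pi> < ennreal (r powr p)"
    proof -
      have "total ?\<pi> = (\<integral>\<^sup>+q. ennreal (norm (snd q) powr p) \<partial>(\<mu> \<Otimes>\<^sub>M ?\<gamma>))"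
        unfolding total_def cost_def by (subst nn_integral_distr) auto
      also have "\<dots> = (\<integral>\<^sup>+z. ennreal (norm z powr p) \<partial>distr (\<mu> \<Otimes>\<^sub>M ?\<gamma>) borel snd)"
        by (subst nn_integral_distr) auto
      also have "\<dots> = ennreal (e powr p) * ennreal m"
        using scaled_noise_moment(2)[OF \<zeta>, of e] e by (simp add: d m)
      also have "\<dots> = ennreal (e powr p * m)" by (rule ennreal_mult[symmetric]) (use m in auto)
      also have "\<dots> < ennreal (r powr p)" using em m by (intro ennreal_lessI) (use r in auto)
      finally show ?thesis .
    qed
    ultimately show "wasserstein p \<mu> (\<mu> \<star> ?\<gamma>) < r"
      using D_less_iff[OF \<mu> convolution_moment[OF _ \<mu> \<gamma>] r] p by (auto simp: D_wasserstein[OF p] bc_couplings_def)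
  qed
qed

text \<open>Characteristic functions control the bulk only; the moment tails are recovered
  separately from those of the smoothed laws. The Gaussian width is fixed before \<open>n\<close>,
  uniformly in the law, and the triangle inequality runs through both Gaussian smoothings with a
  third of \<open>r\<close> for each of the three distances.\<close>

lemma deconvolution:
  fixes \<mu> \<zeta> :: "(real^'d^'t::{finite,linorder}) measure"
  assumes p: "1 \<le> p" and \<zeta>: "\<zeta> \<in> prob_finite_moment p" and nz: "AE s in lborel. char_fun \<zeta> s \<noteq> 0"
    and \<mu>s: "\<And>n::nat. \<mu>s n \<in> prob_finite_moment p" and \<mu>: "\<mu> \<in> prob_finite_moment p"
    and lim: "(\<lambda>n. wasserstein p (\<mu>s n \<star> \<zeta>) (\<mu> \<star> \<zeta>)) \<longlonglongrightarrow> 0"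
  shows "(\<lambda>n. wasserstein p (\<mu>s n) \<mu>) \<longlonglongrightarrow> 0"
proof -
  interpret transport p "{}" "{()}" "\<lambda>_. norm :: real^'d^'t::{finite,linorder} \<Rightarrow> real" by (rule transport_wasserstein[OF p])
  have p0: "0 \<le> p" using p by simp
  note conv = convolution_moment[OF p0]
  have ms: "(\<mu>s n \<star> \<zeta>) \<in> prob_finite_moment p" for n by (rule conv[OF \<mu>s \<zeta>])
  have m: "(\<mu> \<star> \<zeta>) \<in> prob_finite_moment p" by (rule conv[OF \<mu> \<zeta>])
  obtain \<pi> where \<pi>: "\<And>n. \<pi> n \<in> couplings (\<mu>s n \<star> \<zeta>) (\<mu> \<star> \<zeta>)"
    and tot: "(\<lambda>n. \<integral>\<^sup>+q. ennreal (norm (fst q - snd q) powr p) \<partial>\<pi> n) \<longlonglongrightarrow> 0"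
    using lim unfolding wasserstein_tendsto_iff[OF p ms m] by blast
  have "(\<lambda>n. char_fun (\<mu>s n \<star> \<zeta>) s) \<longlonglongrightarrow> char_fun (\<mu> \<star> \<zeta>) s" for s
    by (rule char_fun_tendsto[OF \<pi> first_moment_tendsto_0[OF p couplingsD(1)[OF \<pi>] couplingsD(2)[OF \<pi>] tot]])
  then have prod: "(\<lambda>n. char_fun (\<mu>s n) s * char_fun \<zeta> s) \<longlonglongrightarrow> char_fun \<mu> s * char_fun \<zeta> s" for s
    using char_fun_convolution[OF prob_finite_momentD(1,2)[OF \<mu>s] prob_finite_momentD(1,2)[OF \<zeta>]]
      char_fun_convolution[OF prob_finite_momentD(1,2)[OF \<mu>] prob_finite_momentD(1,2)[OF \<zeta>]] by simp
  have ae: "AE s in lborel. (\<lambda>n. char_fun (\<mu>s n) s) \<longlonglongrightarrow> char_fun \<mu> s"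
    using nz
  proof eventually_elim
    case (elim s)
    have "(\<lambda>n. char_fun (\<mu>s n) s * char_fun \<zeta> s / char_fun \<zeta> s) \<longlonglongrightarrow> char_fun \<mu> s * char_fun \<zeta> s / char_fun \<zeta> s"
      by (intro tendsto_divide prod tendsto_const elim)
    then show ?case using elim by simp
  qed
  have "uniform_tails p (\<lambda>n. \<mu>s n \<star> \<zeta>)"
    by (rule uniform_tails_if_D[OF ms m]) (simp add: D_wasserstein[OF p] lim)
  then have ut: "uniform_tails p \<mu>s"
    by (rule uniform_tails_bound[OF _ uniform_tails_const[OF \<zeta>], of _ "2 powr p"])
      (auto intro!: tail_convolution(2) p0 prob_finite_momentD[OF \<mu>s] prob_finite_momentD[OF \<zeta>])
  show ?thesis
  proof (rule tendstoI)
    fix r :: real assume r: "0 < r"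
    obtain e where e: "0 < e" and er: "\<And>\<nu> :: (real^'d^'t::{finite,linorder}) measure. \<nu> \<in> prob_finite_moment p \<Longrightarrow> wasserstein p \<nu> (\<nu> \<star> scaled_noise e gauss) < r / 3"
      using convolution_scaled_wasserstein_less[OF p gauss_moment[OF p0], of "r / 3"] r by auto
    let ?\<gamma> = "scaled_noise e gauss :: (real^'d^'t::{finite,linorder}) measure"
    have \<gamma>: "?\<gamma> \<in> prob_finite_moment p" using e by (intro scaled_noise_moment gauss_moment p0) simp
    obtain \<delta> where \<delta>: "\<delta> \<longlonglongrightarrow> 0" "\<And>n. tv_le (\<mu>s n \<star> ?\<gamma>) (\<mu> \<star> ?\<gamma>) (\<delta> n)"
      using gauss_smooth_tv_tendsto[OF prob_finite_momentD(1,2)[OF \<mu>s] prob_finite_momentD(1,2)[OF \<mu>] e ae] by blast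
    have ut2: "uniform_tails p (\<lambda>n. \<mu>s n \<star> ?\<gamma>)"
      by (rule uniform_tails_bound[OF ut uniform_tails_const[OF \<gamma>], of "2 powr p"])
        (auto intro!: tail_convolution(1) p0 prob_finite_momentD[OF \<mu>s] prob_finite_momentD[OF \<gamma>])
    note sm = conv[OF \<mu>s \<gamma>] and sm0 = conv[OF \<mu> \<gamma>]
    \<comment> \<open>The passage from total variation to \<open>W_p\<close> goes through the
      adapted distance, for which it is already available and whose convergence is the stronger
      one.\<close>
    have "(\<lambda>n. wasserstein p (\<mu>s n \<star> ?\<gamma>) (\<mu> \<star> ?\<gamma>)) \<longlonglongrightarrow> 0"
      by (rule adapted_imp_wasserstein_tendsto[OF p sm sm0 adapted_tendsto_if_tv[OF p sm sm0 \<delta>(2) \<delta>(1) ut2]])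
    then have "\<forall>\<^sub>F n in sequentially. wasserstein p (\<mu>s n \<star> ?\<gamma>) (\<mu> \<star> ?\<gamma>) < r / 3"
      using r by (intro order_tendstoD(2)) auto
    then show "\<forall>\<^sub>F n in sequentially. dist (wasserstein p (\<mu>s n) \<mu>) 0 < r"
    proof eventually_elim
      case (elim n)
      have "wasserstein p (\<mu>s n) \<mu> \<le> wasserstein p (\<mu>s n) (\<mu>s n \<star> ?\<gamma>) + wasserstein p (\<mu>s n \<star> ?\<gamma>) \<mu>"
        using D_triangle[OF \<mu>s sm \<mu>] unfolding D_wasserstein[OF p] .
      also have "wasserstein p (\<mu>s n \<star> ?\<gamma>) \<mu> \<le> wasserstein p (\<mu>s n \<star> ?\<gamma>) (\<mu> \<star> ?\<gamma>) + wasserstein p (\<mu> \<star> ?\<gamma>) \<mu>"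
        using D_triangle[OF sm sm0 \<mu>] unfolding D_wasserstein[OF p] .
      also have "wasserstein p (\<mu> \<star> ?\<gamma>) \<mu> = wasserstein p \<mu> (\<mu> \<star> ?\<gamma>)"
        using D_sym unfolding D_wasserstein[OF p] .
      finally have "wasserstein p (\<mu>s n) \<mu> < r" using elim er[OF \<mu>s[of n]] er[OF \<mu>] by simp
      moreover have "0 \<le> wasserstein p (\<mu>s n) \<mu>" using D_nonneg unfolding D_wasserstein[OF p] .
      ultimately show ?case by simp
    qed
  qed
qed

theorem theorem35:
  fixes p \<sigma> :: real
    and \<xi> :: "(real ^ 'd ^ 't::{finite,linorder}) measure"
    and f :: "real ^ 'd ^ 't::{finite,linorder} \<Rightarrow> real"
    and grad_f :: "real ^ 'd ^ 't::{finite,linorder} \<Rightarrow> real ^ 'd ^ 't::{finite,linorder}"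
  assumes "1 \<le> p"
    and "\<xi> \<in> prob_finite_moment p"
    and "\<And>x. 0 \<le> f x"
    and "\<xi> = density lborel (\<lambda>x. ennreal (f x))"
    and "\<And>x. GDERIV f x :> grad_f x"
    and "continuous_on UNIV grad_f"
    and "integrable lborel grad_f"
    and "{s. fourier_transform f s = 0} \<in> null_sets lborel"
    and "0 < \<sigma>"
  shows "Metric_space (prob_finite_moment p) (smoothed_adapted_wasserstein \<xi> \<sigma> p) \<and>
    Metric_space.mtopology (prob_finite_moment p) (smoothed_adapted_wasserstein \<xi> \<sigma> p) =
    Metric_space.mtopology (prob_finite_moment p) (wasserstein p)"
proof -
  note p = assms(1) and \<sigma> = assms(9)
  have p0: "0 \<le> p" using p by simp
  interpret A: transport p "histories :: (real^'d^'t::{finite,linorder}) measure set" UNIV "\<lambda>t x. norm (x $ t)"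
    by (rule transport_adapted[OF p])
  interpret W: transport p "{}" "{()}" "\<lambda>_. norm :: real^'d^'t::{finite,linorder} \<Rightarrow> real" by (rule transport_wasserstein[OF p])
  let ?P = "prob_finite_moment p :: (real^'d^'t::{finite,linorder}) measure set"
  let ?\<zeta> = "scaled_noise \<sigma> \<xi>"
  let ?S = "smoothed_adapted_wasserstein \<xi> \<sigma> p"
  have S: "?S \<mu> \<nu> = A.D (\<mu> \<star> ?\<zeta>) (\<nu> \<star> ?\<zeta>)" for \<mu> \<nu>
    by (simp add: smoothed_adapted_wasserstein_def D_adapted[OF p])
  have \<zeta>: "?\<zeta> \<in> ?P" using \<sigma> by (intro scaled_noise_moment assms(2)) simp
  note conv = convolution_moment[OF p0 _ \<zeta>]
  have "continuous_on UNIV f"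
    using assms(5) by (auto simp: continuous_on_eq_continuous_at gderiv_def intro: has_derivative_continuous)
  then have fm: "f \<in> borel_measurable borel" by (rule borel_measurable_continuous_onI)
  have nz: "AE s in lborel. char_fun ?\<zeta> s \<noteq> 0"
  proof -
    have "AE s in lborel. fourier_transform f s \<noteq> 0" using assms(8) by (auto intro: AE_I')
    \<comment> \<open>Dilation by a nonzero factor preserves Lebesgue null sets, so rescaling the
      noise does not enlarge its zero set beyond a null set.\<close>
    then have "AE s in lborel. fourier_transform f ((- \<sigma> / (2 * pi)) *\<^sub>R s) \<noteq> 0"
      using \<sigma> by (intro AE_lborel_scaleR) auto
    then show ?thesis by (simp add: char_fun_scaled_noise[OF assms(3) fm assms(4)])
  qed
  define L where "L = (LINT w|lborel. norm (grad_f w)) / \<sigma>"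
  have L: "shift_lipschitz ?\<zeta> L" "0 \<le> L"
    using shift_lipschitz_scaled_noise[OF assms(3-7) \<sigma>] \<sigma> by (auto simp: L_def)
  \<comment> \<open>Adapted convergence of the smoothings implies their
    \<open>W_p\<close>-convergence, from which the noise can be removed.\<close>
  have SW: "(\<lambda>n. wasserstein p (\<mu>s n) \<mu>) \<longlonglongrightarrow> 0"
    if \<mu>s: "\<And>n::nat. \<mu>s n \<in> ?P" and \<mu>: "\<mu> \<in> ?P" and lim: "(\<lambda>n. ?S (\<mu>s n) \<mu>) \<longlonglongrightarrow> 0" for \<mu>s \<mu>
    by (rule deconvolution[OF p \<zeta> nz \<mu>s \<mu> adapted_imp_wasserstein_tendsto[OF p conv[OF \<mu>s] conv[OF \<mu>]]])
      (use lim in \<open>simp add: smoothed_adapted_wasserstein_def\<close>)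
  \<comment> \<open>Couplings of vanishing cost have vanishing mean distance, so the smoothings
    approach each other in total variation. Their tails are bounded by those of the unsmoothed laws
    and of the noise.\<close>
  have WS: "(\<lambda>n. ?S (\<mu>s n) \<mu>) \<longlonglongrightarrow> 0"
    if \<mu>s: "\<And>n::nat. \<mu>s n \<in> ?P" and \<mu>: "\<mu> \<in> ?P" and lim: "(\<lambda>n. wasserstein p (\<mu>s n) \<mu>) \<longlonglongrightarrow> 0" for \<mu>s \<mu>
  proof -
    obtain \<pi> where \<pi>: "\<And>n. \<pi> n \<in> couplings (\<mu>s n) \<mu>"
      and tot: "(\<lambda>n. \<integral>\<^sup>+q. ennreal (norm (fst q - snd q) powr p) \<partial>\<pi> n) \<longlonglongrightarrow> 0"
      using lim unfolding wasserstein_tendsto_iff[OF p \<mu>s \<mu>] by blast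
    have "(\<lambda>n. ennreal L * (\<integral>\<^sup>+q. ennreal (norm (fst q - snd q)) \<partial>\<pi> n)) \<longlonglongrightarrow> ennreal L * 0"
      by (intro ennreal_tendsto_cmult first_moment_tendsto_0[OF p couplingsD(1)[OF \<pi>] couplingsD(2)[OF \<pi>] tot]) simp
    then have \<delta>: "(\<lambda>n. ennreal L * (\<integral>\<^sup>+q. ennreal (norm (fst q - snd q)) \<partial>\<pi> n)) \<longlonglongrightarrow> 0" by simp
    have tv: "tv_le (\<mu>s n \<star> ?\<zeta>) (\<mu> \<star> ?\<zeta>) (ennreal L * (\<integral>\<^sup>+q. ennreal (norm (fst q - snd q)) \<partial>\<pi> n))" for n
      by (rule tv_le_convolution[OF \<pi> prob_finite_momentD(1,2)[OF \<zeta>] L])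
    have "uniform_tails p \<mu>s"
      by (rule W.uniform_tails_if_D[OF \<mu>s \<mu>]) (simp add: D_wasserstein[OF p] lim)
    then have ut: "uniform_tails p (\<lambda>n. \<mu>s n \<star> ?\<zeta>)"
      by (rule uniform_tails_bound[OF _ uniform_tails_const[OF \<zeta>], of _ "2 powr p"])
        (auto intro!: tail_convolution(1) p0 prob_finite_momentD[OF \<mu>s] prob_finite_momentD[OF \<zeta>])
    show ?thesis
      using adapted_tendsto_if_tv[OF p conv[OF \<mu>s] conv[OF \<mu>] tv \<delta> ut] by (simp add: smoothed_adapted_wasserstein_def)
  qed
  have MW: "Metric_space ?P (wasserstein p)" using W.Metric_space_D unfolding D_wasserstein[OF p] .
  \<comment> \<open>The other axioms are inherited from the adapted distance along convolution with
    the noise. Definiteness rests on the injectivity of that convolution, which is contained in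
    \<open>SW\<close>.\<close>
  have MS: "Metric_space ?P ?S"
  proof
    fix \<mu> \<nu> \<eta> :: "(real^'d^'t::{finite,linorder}) measure"
    show "0 \<le> ?S \<mu> \<nu>" unfolding S by (rule A.D_nonneg)
    show "?S \<mu> \<nu> = ?S \<nu> \<mu>" unfolding S by (rule A.D_sym)
    show "?S \<mu> \<nu> = 0 \<longleftrightarrow> \<mu> = \<nu>" if \<mu>: "\<mu> \<in> ?P" and \<nu>: "\<nu> \<in> ?P"
    proof
      assume "?S \<mu> \<nu> = 0"
      then have "(\<lambda>n::nat. wasserstein p \<mu> \<nu>) \<longlonglongrightarrow> 0" using SW[of "\<lambda>_. \<mu>" \<nu>] \<mu> \<nu> by simp
      then have "wasserstein p \<mu> \<nu> = 0" by (simp add: LIMSEQ_const_iff)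
      then show "\<mu> = \<nu>" using W.D_zero_imp_eq[OF \<mu> \<nu>] unfolding D_wasserstein[OF p] by blast
    next
      assume "\<mu> = \<nu>"
      then show "?S \<mu> \<nu> = 0" unfolding S using A.D_refl[OF conv[OF \<mu>]] by simp
    qed
    show "?S \<mu> \<eta> \<le> ?S \<mu> \<nu> + ?S \<nu> \<eta>" if "\<mu> \<in> ?P" "\<nu> \<in> ?P" "\<eta> \<in> ?P"
      unfolding S using that by (intro A.D_triangle conv)
  qed
  have "Metric_space.mtopology ?P ?S = Metric_space.mtopology ?P (wasserstein p)"
    by (rule mtopology_eqI[OF MS MW]) (use SW WS in blast)
  with MS show ?thesis ..
qed

end
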